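(* Let $(\mathfrak g,\diamond)$ be a Novikov algebra over $\mathbb K$. Then the cochain complex $\mathfrak C^\bullet_{\mathrm{pLie}}(\mathfrak g)$ of the underlying pre-Lie algebra $(\mathfrak g,\diamond)$ is isomorphic to a quotient of the cochain complex $\mathfrak C^\bullet_{\mathrm{Nov}}(\mathfrak g)$ of the Novikov algebra; namely, there is a short exact sequence of cochain complexes $$0\to\overline{\mathfrak C}^\bullet_{\mathrm{Nov}}(\mathfrak g)\xrightarrow{\ \iota\ }\mathfrak C^\bullet_{\mathrm{Nov}}(\mathfrak g)\xrightarrow{\ \pi\ }\mathfrak C^\bullet_{\mathrm{pLie}}(\mathfrak g)\to0,$$ where $\iota$ and $\pi$ are the natural inclusion and projection. Consequently there is a long exact sequence of cohomology groups $$\cdots\to\overline{\mathcal H}^n_{\mathrm{Nov}}(\mathfrak g;\mathfrak g)\xrightarrow{\mathcal H^n(\iota)}\mathcal H^n_{\mathrm{Nov}}(\mathfrak g;\mathfrak g)\xrightarrow{\mathcal H^n(\pi)}\mathcal H^n_{\mathrm{pLie}}(\mathfrak g;\mathfrak g)\xrightarrow{c^n}\overline{\mathcal H}^{n+1}_{\mathrm{Nov}}(\mathfrak g;\mathfrak g)\to\cdots,$$ whose connecting map is given, for $[f]\in\mathcal H^n_{\mathrm{pLie}}(\mathfrak g;\mathfrak g)$, by $c^1([f])=[0]$ and $c^n([f])=\big[d^{(0,\dots,0,n-1,1)}_{(0,\dots,0,1,n-2,2)}(f)\big]$ for $n\ge2$.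
   Context: $\mathbb K$ is a field of characteristic $0$; all vector spaces are over $\mathbb K$. A (left) Novikov algebra is a vector space $\mathfrak g$ with a bilinear operation $\diamond$ satisfying $(x\diamond y)\diamond z-x\diamond(y\diamond z)=(y\diamond x)\diamond z-y\diamond(x\diamond z)$ (the pre-Lie identity) and $(x\diamond y)\diamond z=(x\diamond z)\diamond y$. Write $\omega(x\otimes y)=x\diamond y$. Pre-Lie complex: $\mathfrak C^n_{\mathrm{pLie}}(\mathfrak g)=\mathrm{Hom}(\wedge^{n-1}\mathfrak g\otimes\mathfrak g,\mathfrak g)$, $n\ge1$, with $$\begin{aligned}(d^n_{\mathrm{pLie}}f)(x_1,\dots,x_n;x_{n+1})={}&\sum_{i=1}^n(-1)^{i+1}x_i\diamond f(x_1,\dots,\hat{x_i},\dots,x_n;x_{n+1})+\sum_{i=1}^n(-1)^{i+1}f(x_1,\dots,\hat{x_i},\dots,x_n;x_i)\diamond x_{n+1}\\&+\sum_{i=1}^n(-1)^if(x_1,\dots,\hat{x_i},\dots,x_n;x_i\diamond x_{n+1})\\&+\sum_{1\le i<j\le n}(-1)^{i+j}f(x_i\diamond x_j-x_j\diamond x_i,x_1,\dots,\hat{x_i},\dots,\hat{x_j},\dots,x_n;x_{n+1}),\end{aligned}$$ and cohomology $\mathcal H^n_{\mathrm{pLie}}(\mathfrak g;\mathfrak g)$. Conventions: $f^\sigma(x_1,\dots,x_n)=f(x_{\sigma^{-1}(1)},\dots,x_{\sigma^{-1}(n)})$ for $\sigma\in S_n$; $(-1)^\sigma$ is the sign. $\mathrm{Sh}^{-1}(i,j)$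 ($i+j=m$) is the set of $\sigma\in S_m$ with $\sigma^{-1}(1)<\dots<\sigma^{-1}(i)$ and $\sigma^{-1}(i+1)<\dots<\sigma^{-1}(m)$. $\mathrm{End}_{\mathfrak g}$ is the endomorphism operad. Operad $rNov$: let $ComDer$ be the operad generated by a unary $D$ and a symmetric binary $\mu$ with $\mu\circ(\mu,\mathrm{id})=\mu\circ(\mathrm{id},\mu)$, $D\circ\mu=\mu\circ(D,\mathrm{id})+\mu\circ(\mathrm{id},D)$; $\mu_n$ is the $n$-fold product. The operad $rNov$ of right Novikov algebras is identified with the suboperad of $ComDer$ for which $rNov(n)$ has basis $\mu_n\circ(D^{p_1},\dots,D^{p_n})$, $(p_1,\dots,p_n)\in P_n=\{p\in\mathbb N^n\mid\sum p_i=n-1\}$ ($\mathbb N=\{0,1,\dots\}$), with $\big(\mu_n\circ(D^{p_1},\dots,D^{p_n})\big)^\sigma=\mu_n\circ(D^{p_{\sigma(1)}},\dots,D^{p_{\sigma(n)}})$. Novikov complex: let $\mathcal O=rNov\otimes_{\mathrm H}\mathrm{End}_{\mathfrak g}$ (Hadamard product: $\mathcal O(n)=rNov(n)\otimes\mathrm{End}_{\mathfrak g}(n)$, diagonal action, componentwise composition), $\alpha(\nu)=\mu\circ(D,\mathrm{id})\otimes\omega-\mu\circ(\mathrm{id},D)\otimes\omega^{(1\,2)}$, $\mathrm{CE}^n(\mathcal O)=\{F\in\mathcal O(n)\mid F^\sigma=(-1)^\sigma F\ \forall\sigma\in S_n\}$, $$d^n_{\mathrm{CE}}(F)=\sum_{\sigma\in\mathrm{Sh}^{-1}(1,n)}(-1)^\sigma\big(\alpha(\nu)\circ(\mathrm{id},F)\big)^\sigma-\sum_{\sigma\in\mathrm{Sh}^{-1}(2,n-1)}(-1)^\sigma\big(F\circ(\alpha(\nu),\mathrm{id},\dots,\mathrm{id})\big)^\sigma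 .$$ Let $K_n=\{(k_{n-1},\dots,k_0)\in\mathbb N^n\mid\sum_ik_i=n,\ \sum_iik_i=n-1\}$; weakly decreasing $p\in P_n$ correspond bijectively to elements of $K_n$ via $k_j=|\{i\mid p_i=j\}|$. Put $\mathfrak C^n_{\mathrm{Nov}}(\mathfrak g)=\bigoplus_{(k_{n-1},\dots,k_0)\in K_n}\mathrm{Hom}(\wedge^{k_{n-1}}\mathfrak g\otimes\cdots\otimes\wedge^{k_0}\mathfrak g,\mathfrak g)$. The map sending $\sum_{P_n}\mu_n\circ(D^{p_1},\dots,D^{p_n})\otimes f^{(p_1,\dots,p_n)}$ to the collection of those $f^{(p_1,\dots,p_n)}$ with $p_1\ge\dots\ge p_n$ (each placed in the summand of the corresponding element of $K_n$) is a linear isomorphism $\mathrm{CE}^n(\mathcal O)\cong\mathfrak C^n_{\mathrm{Nov}}(\mathfrak g)$, and $d^n_{\mathrm{Nov}}$ is the transport of $d^n_{\mathrm{CE}}$ along it. $\mathcal H^n_{\mathrm{Nov}}(\mathfrak g;\mathfrak g)$ is the cohomology of $(\mathfrak C^\bullet_{\mathrm{Nov}}(\mathfrak g),d_{\mathrm{Nov}})$. For $k\in K_n$, $k'\in K_{n+1}$, $d^{k}_{k'}$ denotes the component of $d^n_{\mathrm{Nov}}$ from the summand indexed by $k$ to the summand indexed by $k'$ (for $n=2$, $(0,\dots,0,n-1,1)=(1,1)$ and $(0,\dots,0,1,n-2,2)=(1,0,2)$). Subcomplex: $\overline{\mathfrak C}^n_{\mathrm{Nov}}(\mathfrak g)=\bigoplus_{k\in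 K_n\setminus\{(0,\dots,0,n-1,1)\}}\mathrm{Hom}(\wedge^{k_{n-1}}\mathfrak g\otimes\cdots\otimes\wedge^{k_0}\mathfrak g,\mathfrak g)$ (for $n=1$ the removed element is $(1)$), with differential the restriction of $d_{\mathrm{Nov}}$ and cohomology $\overline{\mathcal H}^n_{\mathrm{Nov}}(\mathfrak g;\mathfrak g)$. $\pi$ is the projection onto the summand indexed by $(0,\dots,0,n-1,1)$. *)

theory Defs
  imports
    Complex_Main
    "HOL-Combinatorics.Permutations"
    "HOL-Library.Poly_Mapping"
    "HOL-Library.Function_Algebras"
    "HOL-Library.Set_Algebras"
begin

text \<open>
  Conventions.  A vector space is a type of class \<^class>\<open>ab_group_add\<close> with a scalar
  multiplication satisfying \<^locale>\<open>vector_space\<close>; an \<open>n\<close>-ary operation is a function on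
  lists that is \<open>0\<close> on lists of length other than \<open>n\<close>.  Permutations act on \<open>{1..n}\<close>
  and all positions in lists of arguments are counted from \<open>1\<close>.  Complexes live in degrees
  \<open>n \<ge> 1\<close>.
\<close>


section \<open>Cochain complexes of vector spaces, cohomology\<close>

definition linear_between ::
  "('k \<Rightarrow> 'a \<Rightarrow> 'a::ab_group_add) \<Rightarrow> ('k \<Rightarrow> 'b \<Rightarrow> 'b::ab_group_add) \<Rightarrow> 'a set \<Rightarrow> 'b set \<Rightarrow> ('a \<Rightarrow> 'b) \<Rightarrow> bool"
  where "linear_between s1 s2 A B f \<longleftrightarrow>
    f ` A \<subseteq> B \<and> (\<forall>x\<in>A. \<forall>y\<in>A. f (x + y) = f x + f y) \<and> (\<forall>c. \<forall>x\<in>A. f (s1 c x) = s2 c (f x))"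

record 'a cochains =
  cspace :: "nat \<Rightarrow> 'a set"
  cdiff :: "nat \<Rightarrow> 'a \<Rightarrow> 'a"

definition cochain_complex :: "('k::field \<Rightarrow> 'a \<Rightarrow> 'a::ab_group_add) \<Rightarrow> 'a cochains \<Rightarrow> bool"
  where "cochain_complex s X \<longleftrightarrow> (\<forall>n\<ge>1.
    module.subspace s (cspace X n) \<and>
    linear_between s s (cspace X n) (cspace X (Suc n)) (cdiff X n) \<and>
    (\<forall>x\<in>cspace X n. cdiff X (Suc n) (cdiff X n x) = 0))"

definition cochain_map ::
  "('k \<Rightarrow> 'a \<Rightarrow> 'a::ab_group_add) \<Rightarrow> 'a cochains \<Rightarrow> ('k \<Rightarrow> 'b \<Rightarrow> 'b::ab_group_add) \<Rightarrow> 'b cochains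
    \<Rightarrow> (nat \<Rightarrow> 'a \<Rightarrow> 'b) \<Rightarrow> bool"
  where "cochain_map s1 X s2 Y f \<longleftrightarrow> (\<forall>n\<ge>1.
    linear_between s1 s2 (cspace X n) (cspace Y n) (f n) \<and>
    (\<forall>x\<in>cspace X n. f (Suc n) (cdiff X n x) = cdiff Y n (f n x)))"

definition short_exact_sequence ::
  "('k::field \<Rightarrow> 'a \<Rightarrow> 'a::ab_group_add) \<Rightarrow> 'a cochains \<Rightarrow> (nat \<Rightarrow> 'a \<Rightarrow> 'b) \<Rightarrow>
   ('k \<Rightarrow> 'b \<Rightarrow> 'b::ab_group_add) \<Rightarrow> 'b cochains \<Rightarrow> (nat \<Rightarrow> 'b \<Rightarrow> 'c) \<Rightarrow>
   ('k \<Rightarrow> 'c \<Rightarrow> 'c::ab_group_add) \<Rightarrow> 'c cochains \<Rightarrow> bool"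
  where "short_exact_sequence s1 X i s2 Y p s3 Z \<longleftrightarrow>
    cochain_complex s1 X \<and> cochain_complex s2 Y \<and> cochain_complex s3 Z \<and>
    cochain_map s1 X s2 Y i \<and> cochain_map s2 Y s3 Z p \<and>
    (\<forall>n\<ge>1. inj_on (i n) (cspace X n) \<and>
           i n ` cspace X n = {y \<in> cspace Y n. p n y = 0} \<and>
           p n ` cspace Y n = cspace Z n)"

text \<open>
  The quotient of a subspace \<open>A\<close> by a subspace \<open>B\<close> is the set of cosets \<open>x +o B\<close>.
  Its addition is addition of sets, its zero is \<open>B\<close>, and its scalar multiplication is
  \<open>quot_scale\<close> (the summand \<open>B\<close> matters for the scalar \<open>0\<close>).
\<close>

definition quot :: "'a::ab_group_add set \<Rightarrow> 'a set \<Rightarrow> 'a set set"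
  where "quot A B = (\<lambda>x. x +o B) ` A"

definition quot_scale :: "('k \<Rightarrow> 'a \<Rightarrow> 'a::ab_group_add) \<Rightarrow> 'a set \<Rightarrow> 'k \<Rightarrow> 'a set \<Rightarrow> 'a set"
  where "quot_scale s B c U = s c ` U + B"

definition quot_linear ::
  "('k \<Rightarrow> 'a \<Rightarrow> 'a::ab_group_add) \<Rightarrow> 'a set \<Rightarrow> 'a set \<Rightarrow> ('k \<Rightarrow> 'b \<Rightarrow> 'b::ab_group_add) \<Rightarrow> 'b set \<Rightarrow> 'b set
    \<Rightarrow> ('a set \<Rightarrow> 'b set) \<Rightarrow> bool"
  where "quot_linear s1 A B s2 A' B' g \<longleftrightarrow>
    g ` quot A B \<subseteq> quot A' B' \<and>
    (\<forall>U\<in>quot A B. \<forall>V\<in>quot A B. g (U + V) = g U + g V) \<and>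
    (\<forall>c. \<forall>U\<in>quot A B. g (quot_scale s1 B c U) = quot_scale s2 B' c (g U))"

definition quot_map :: "('a \<Rightarrow> 'b::ab_group_add) \<Rightarrow> 'b set \<Rightarrow> 'a set \<Rightarrow> 'b set"
  where "quot_map f B' U = f ` U + B'"

text \<open>
  \<open>p\<close> induces an isomorphism of cochain complexes from the quotient complex \<open>Y / i(X)\<close>
  onto \<open>Z\<close>; a vector space \<open>V\<close> is treated as the quotient \<open>V / {0}\<close>.
\<close>

definition induces_quotient_iso ::
  "'a cochains \<Rightarrow> (nat \<Rightarrow> 'a \<Rightarrow> 'b) \<Rightarrow> ('k \<Rightarrow> 'b \<Rightarrow> 'b::ab_group_add) \<Rightarrow> 'b cochains \<Rightarrow>
   (nat \<Rightarrow> 'b \<Rightarrow> 'c) \<Rightarrow> ('k \<Rightarrow> 'c \<Rightarrow> 'c::ab_group_add) \<Rightarrow> 'c cochains \<Rightarrow> bool"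
  where "induces_quotient_iso X i s2 Y p s3 Z \<longleftrightarrow> (\<forall>n\<ge>1.
    bij_betw (quot_map (p n) {0}) (quot (cspace Y n) (i n ` cspace X n)) (quot (cspace Z n) {0}) \<and>
    quot_linear s2 (cspace Y n) (i n ` cspace X n) s3 (cspace Z n) {0} (quot_map (p n) {0}) \<and>
    (\<forall>U\<in>quot (cspace Y n) (i n ` cspace X n).
       quot_map (p (Suc n)) {0} (quot_map (cdiff Y n) (i (Suc n) ` cspace X (Suc n)) U) =
       quot_map (cdiff Z n) {0} (quot_map (p n) {0} U)))"

definition cocycles :: "'a::ab_group_add cochains \<Rightarrow> nat \<Rightarrow> 'a set"
  where "cocycles X n = {x \<in> cspace X n. cdiff X n x = 0}"

definition coboundaries :: "'a::ab_group_add cochains \<Rightarrow> nat \<Rightarrow> 'a set"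
  where "coboundaries X n = (if n \<le> 1 then {0} else cdiff X (n - 1) ` cspace X (n - 1))"

definition cohomology :: "'a::ab_group_add cochains \<Rightarrow> nat \<Rightarrow> 'a set set"
  where "cohomology X n = quot (cocycles X n) (coboundaries X n)"

definition cohomology_class :: "'a::ab_group_add cochains \<Rightarrow> nat \<Rightarrow> 'a \<Rightarrow> 'a set"
  where "cohomology_class X n x = x +o coboundaries X n"

definition cohomology_map :: "'b::ab_group_add cochains \<Rightarrow> (nat \<Rightarrow> 'a \<Rightarrow> 'b) \<Rightarrow> nat \<Rightarrow> 'a set \<Rightarrow> 'b set"
  where "cohomology_map Y f n = quot_map (f n) (coboundaries Y n)"

definition cohomology_linear ::
  "('k \<Rightarrow> 'a \<Rightarrow> 'a::ab_group_add) \<Rightarrow> 'a cochains \<Rightarrow> nat \<Rightarrow> ('k \<Rightarrow> 'b \<Rightarrow> 'b::ab_group_add) \<Rightarrow> 'b cochains \<Rightarrow> nat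
    \<Rightarrow> ('a set \<Rightarrow> 'b set) \<Rightarrow> bool"
  where "cohomology_linear s1 X n s2 Y m g \<longleftrightarrow>
    quot_linear s1 (cocycles X n) (coboundaries X n) s2 (cocycles Y m) (coboundaries Y m) g"

text \<open>
  The connecting map of the snake lemma for \<open>0 \<rightarrow> X \<rightarrow> Y \<rightarrow> Z \<rightarrow> 0\<close>: lift a
  representative along \<open>p\<close>, apply the differential of \<open>Y\<close>, pull back along \<open>i\<close>.
  Collecting the results of all choices yields a whole class modulo the coboundaries of \<open>X\<close>.
\<close>

definition connecting_map ::
  "'a cochains \<Rightarrow> (nat \<Rightarrow> 'a \<Rightarrow> 'b) \<Rightarrow> 'b cochains \<Rightarrow> (nat \<Rightarrow> 'b \<Rightarrow> 'c) \<Rightarrow> nat \<Rightarrow> 'c set \<Rightarrow> 'a set"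
  where "connecting_map X i Y p n U =
    {w \<in> cspace X (Suc n). \<exists>y\<in>cspace Y n. p n y \<in> U \<and> cdiff Y n y = i (Suc n) w}"

definition long_exact_sequence ::
  "('k \<Rightarrow> 'a \<Rightarrow> 'a::ab_group_add) \<Rightarrow> 'a cochains \<Rightarrow> (nat \<Rightarrow> 'a \<Rightarrow> 'b) \<Rightarrow>
   ('k \<Rightarrow> 'b \<Rightarrow> 'b::ab_group_add) \<Rightarrow> 'b cochains \<Rightarrow> (nat \<Rightarrow> 'b \<Rightarrow> 'c) \<Rightarrow>
   ('k \<Rightarrow> 'c \<Rightarrow> 'c::ab_group_add) \<Rightarrow> 'c cochains \<Rightarrow> (nat \<Rightarrow> 'c set \<Rightarrow> 'a set) \<Rightarrow> bool"
  where "long_exact_sequence s1 X i s2 Y p s3 Z \<delta> \<longleftrightarrow>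
    inj_on (cohomology_map Y i 1) (cohomology X 1) \<and>
    (\<forall>n\<ge>1.
      cohomology_linear s1 X n s2 Y n (cohomology_map Y i n) \<and>
      cohomology_linear s2 Y n s3 Z n (cohomology_map Z p n) \<and>
      cohomology_linear s3 Z n s1 X (Suc n) (\<delta> n) \<and>
      cohomology_map Y i n ` cohomology X n =
        {V \<in> cohomology Y n. cohomology_map Z p n V = coboundaries Z n} \<and>
      cohomology_map Z p n ` cohomology Y n =
        {W \<in> cohomology Z n. \<delta> n W = coboundaries X (Suc n)} \<and>
      \<delta> n ` cohomology Z n =
        {U \<in> cohomology X (Suc n). cohomology_map Y i (Suc n) U = coboundaries Y (Suc n)})"


section \<open>Novikov algebras and multilinear operations\<close>

locale novikov_algebra = vector_space scale
  for scale :: "'k::field_char_0 \<Rightarrow> 'v::ab_group_add \<Rightarrow> 'v" +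
  fixes nprod :: "'v \<Rightarrow> 'v \<Rightarrow> 'v" (infixl \<open>\<diamondop>\<close> 70)
  assumes linear_right: "Vector_Spaces.linear scale scale (\<lambda>y. x \<diamondop> y)"
    and linear_left: "Vector_Spaces.linear scale scale (\<lambda>x. x \<diamondop> y)"
    and pre_Lie: "(x \<diamondop> y) \<diamondop> z - x \<diamondop> (y \<diamondop> z) = (y \<diamondop> x) \<diamondop> z - y \<diamondop> (x \<diamondop> z)"
    and right_commutative: "(x \<diamondop> y) \<diamondop> z = (x \<diamondop> z) \<diamondop> y"

definition fun_scale :: "('k \<Rightarrow> 'b \<Rightarrow> 'b) \<Rightarrow> 'k \<Rightarrow> ('a \<Rightarrow> 'b) \<Rightarrow> 'a \<Rightarrow> 'b"
  where "fun_scale s c f = (\<lambda>x. s c (f x))"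

definition End_op :: "('k::field \<Rightarrow> 'v \<Rightarrow> 'v::ab_group_add) \<Rightarrow> nat \<Rightarrow> ('v list \<Rightarrow> 'v) set"
  where "End_op scale n = {f.
    (\<forall>xs. length xs \<noteq> n \<longrightarrow> f xs = 0) \<and>
    (\<forall>xs i. length xs = n \<longrightarrow> i < n \<longrightarrow> Vector_Spaces.linear scale scale (\<lambda>y. f (xs[i := y])))}"

definition perm_list :: "nat \<Rightarrow> (nat \<Rightarrow> nat) \<Rightarrow> 'a list \<Rightarrow> 'a list"
  where "perm_list n \<sigma> xs = map (\<lambda>i. xs ! (\<sigma> i - 1)) [1..<Suc n]"

definition End_act :: "nat \<Rightarrow> (nat \<Rightarrow> nat) \<Rightarrow> ('v list \<Rightarrow> 'v::zero) \<Rightarrow> 'v list \<Rightarrow> 'v"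
  where "End_act n \<sigma> f xs = (if length xs = n then f (perm_list n (inv \<sigma>) xs) else 0)"

text \<open>
  Partial composition \<open>f \<circ> (id, \<dots>, g, \<dots>, id)\<close> with \<open>g\<close> in position \<open>i\<close>;
  \<open>n\<close> and \<open>m\<close> are the arities of \<open>f\<close> and \<open>g\<close>.
\<close>

definition End_comp :: "nat \<Rightarrow> nat \<Rightarrow> nat \<Rightarrow> ('v list \<Rightarrow> 'v::zero) \<Rightarrow> ('v list \<Rightarrow> 'v) \<Rightarrow> 'v list \<Rightarrow> 'v"
  where "End_comp n i m f g xs =
    (if length xs = n + m - 1
     then f (take (i - 1) xs @ [g (take m (drop (i - 1) xs))] @ drop (i - 1 + m) xs)
     else 0)"

text \<open>
  \<open>Hom (\<Lambda>\<^bsup>k\<^sub>1\<^esup> \<otimes> \<dots> \<otimes> \<Lambda>\<^bsup>k\<^sub>r\<^esup>, \<gg>)\<close> for \<open>ks = [k\<^sub>1, \<dots>, k\<^sub>r]\<close>: multilinear maps that are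
  alternating in each of the consecutive blocks of \<open>k\<^sub>1, \<dots>, k\<^sub>r\<close> arguments.
\<close>

definition Hom_wedge :: "('k::field \<Rightarrow> 'v \<Rightarrow> 'v::ab_group_add) \<Rightarrow> nat list \<Rightarrow> ('v list \<Rightarrow> 'v) set"
  where "Hom_wedge scale ks = {f \<in> End_op scale (sum_list ks).
    \<forall>b < length ks. \<forall>i j. sum_list (take b ks) \<le> i \<longrightarrow> i < j \<longrightarrow> j < sum_list (take (Suc b) ks) \<longrightarrow>
      (\<forall>xs. length xs = sum_list ks \<longrightarrow> xs ! i = xs ! j \<longrightarrow> f xs = 0)}"


section \<open>The pre-Lie complex\<close>

definition omit :: "nat set \<Rightarrow> 'a list \<Rightarrow> 'a list"
  where "omit I xs = nths xs {l. Suc l \<notin> I}"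

definition pLie_diff ::
  "('k::field \<Rightarrow> 'v \<Rightarrow> 'v::ab_group_add) \<Rightarrow> ('v \<Rightarrow> 'v \<Rightarrow> 'v) \<Rightarrow> nat \<Rightarrow> ('v list \<Rightarrow> 'v) \<Rightarrow> 'v list \<Rightarrow> 'v"
  where "pLie_diff scale nprod n f xs =
    (if length xs = Suc n then
       let x = (\<lambda>i. xs ! (i - 1)); ys = take n xs; z = x (Suc n) in
         (\<Sum>i=1..n. scale ((-1) ^ (i + 1)) (nprod (x i) (f (omit {i} ys @ [z]))))
       + (\<Sum>i=1..n. scale ((-1) ^ (i + 1)) (nprod (f (omit {i} ys @ [x i])) z))
       + (\<Sum>i=1..n. scale ((-1) ^ i) (f (omit {i} ys @ [nprod (x i) z])))
       + (\<Sum>j=1..n. \<Sum>i=1..<j. scale ((-1) ^ (i + j))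
            (f ((nprod (x i) (x j) - nprod (x j) (x i)) # omit {i, j} ys @ [z])))
     else 0)"

definition pLie_complex ::
  "('k::field \<Rightarrow> 'v \<Rightarrow> 'v::ab_group_add) \<Rightarrow> ('v \<Rightarrow> 'v \<Rightarrow> 'v) \<Rightarrow> ('v list \<Rightarrow> 'v) cochains"
  where "pLie_complex scale nprod =
    \<lparr> cspace = (\<lambda>n. Hom_wedge scale [n - 1, 1]), cdiff = pLie_diff scale nprod \<rparr>"


section \<open>The operads ComDer and rNov\<close>

text \<open>
  Tree monomials in a unary \<open>D\<close> and a binary \<open>\<mu>\<close>.  Those whose leaves are labelled
  bijectively by \<open>{1..n}\<close> form a basis of the arity \<open>n\<close> part of the free operad on \<open>D\<close>
  and \<open>\<mu>\<close> (the symmetry of \<open>\<mu>\<close> is imposed below as a relation).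
\<close>

datatype 'l tree = Leaf 'l | Der "'l tree" | Mul "'l tree" "'l tree"

primrec leaves :: "'l tree \<Rightarrow> 'l list" where
  "leaves (Leaf l) = [l]"
| "leaves (Der t) = leaves t"
| "leaves (Mul t u) = leaves t @ leaves u"

definition trees :: "nat \<Rightarrow> nat tree set"
  where "trees n = {t. distinct (leaves t) \<and> set (leaves t) = {1..n}}"

definition free_op :: "nat \<Rightarrow> (nat tree \<Rightarrow>\<^sub>0 'k::zero) set"
  where "free_op n = {u. Poly_Mapping.keys u \<subseteq> trees n}"

text \<open>
  \<open>graft i m s t\<close> is \<open>t \<circ>\<^sub>i s\<close> for \<open>s\<close> of arity \<open>m\<close>: leaf \<open>i\<close> of \<open>t\<close> is replaced by
  \<open>s\<close>, and the leaves are renumbered.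
\<close>

primrec graft :: "nat \<Rightarrow> nat \<Rightarrow> nat tree \<Rightarrow> nat tree \<Rightarrow> nat tree" where
  "graft i m s (Leaf j) =
    (if j < i then Leaf j else if j = i then map_tree (\<lambda>l. l + i - 1) s else Leaf (j + m - 1))"
| "graft i m s (Der t) = Der (graft i m s t)"
| "graft i m s (Mul t u) = Mul (graft i m s t) (graft i m s u)"

definition free_comp ::
  "nat \<Rightarrow> nat \<Rightarrow> (nat tree \<Rightarrow>\<^sub>0 'k::comm_ring_1) \<Rightarrow> (nat tree \<Rightarrow>\<^sub>0 'k) \<Rightarrow> (nat tree \<Rightarrow>\<^sub>0 'k)"
  where "free_comp i m u v =
    (\<Sum>t\<in>Poly_Mapping.keys u. \<Sum>s\<in>Poly_Mapping.keys v.
      Poly_Mapping.single (graft i m s t) (Poly_Mapping.lookup u t * Poly_Mapping.lookup v s))"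

definition free_act :: "(nat \<Rightarrow> nat) \<Rightarrow> (nat tree \<Rightarrow>\<^sub>0 'k::comm_ring_1) \<Rightarrow> (nat tree \<Rightarrow>\<^sub>0 'k)"
  where "free_act \<sigma> u =
    (\<Sum>t\<in>Poly_Mapping.keys u. Poly_Mapping.single (map_tree (inv \<sigma>) t) (Poly_Mapping.lookup u t))"

abbreviation tree_elem :: "nat tree \<Rightarrow> (nat tree \<Rightarrow>\<^sub>0 'k::comm_ring_1)"
  where "tree_elem t \<equiv> Poly_Mapping.single t 1"

text \<open>
  The operadic ideal of relations: \<open>ComDer(n)\<close> is the quotient of \<open>free_op n\<close> by
  \<open>{u. ComDer_ideal n u}\<close>.
\<close>

inductive ComDer_ideal :: "nat \<Rightarrow> (nat tree \<Rightarrow>\<^sub>0 'k::field) \<Rightarrow> bool" where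
  commutative: "ComDer_ideal 2
    (tree_elem (Mul (Leaf 1) (Leaf 2)) - tree_elem (Mul (Leaf 2) (Leaf 1)))"
| associative: "ComDer_ideal 3
    (tree_elem (Mul (Mul (Leaf 1) (Leaf 2)) (Leaf 3)) - tree_elem (Mul (Leaf 1) (Mul (Leaf 2) (Leaf 3))))"
| Leibniz: "ComDer_ideal 2
    (tree_elem (Der (Mul (Leaf 1) (Leaf 2)))
      - (tree_elem (Mul (Der (Leaf 1)) (Leaf 2)) + tree_elem (Mul (Leaf 1) (Der (Leaf 2)))))"
| zero: "ComDer_ideal n 0"
| add: "ComDer_ideal n u \<Longrightarrow> ComDer_ideal n v \<Longrightarrow> ComDer_ideal n (u + v)"
| scale: "ComDer_ideal n u \<Longrightarrow> ComDer_ideal n (Poly_Mapping.map ((*) c) u)"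
| act: "ComDer_ideal n u \<Longrightarrow> \<sigma> permutes {1..n} \<Longrightarrow> ComDer_ideal n (free_act \<sigma> u)"
| comp_left: "ComDer_ideal n u \<Longrightarrow> v \<in> free_op m \<Longrightarrow> i \<in> {1..n} \<Longrightarrow>
    ComDer_ideal (n + m - 1) (free_comp i m u v)"
| comp_right: "ComDer_ideal m u \<Longrightarrow> v \<in> free_op n \<Longrightarrow> i \<in> {1..n} \<Longrightarrow>
    ComDer_ideal (n + m - 1) (free_comp i m v u)"

definition P_exps :: "nat \<Rightarrow> nat list set"
  where "P_exps n = {p. length p = n \<and> sum_list p + 1 = n}"

text \<open>
  \<open>dmon_tree [p\<^sub>1, \<dots>, p\<^sub>n]\<close> is \<open>\<mu>\<^sub>n \<circ> (D\<^bsup>p\<^sub>1\<^esup>, \<dots>, D\<^bsup>p\<^sub>n\<^esup>)\<close>, where \<open>\<mu>\<^sub>1 = id\<close> and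
  \<open>\<mu>\<^sub>n = \<mu> \<circ> (\<mu>\<^sub>n\<^sub>-\<^sub>1, id)\<close>.
\<close>

definition dmon_tree :: "nat list \<Rightarrow> nat tree"
  where "dmon_tree p =
    (let f = (\<lambda>i. (Der ^^ (p ! (i - 1))) (Leaf i))
     in foldl (\<lambda>t i. Mul t (f i)) (f 1) [2..<Suc (length p)])"

text \<open>
  Coordinates of (the class in \<open>ComDer(n)\<close> of) \<open>u\<close>, an element of the suboperad \<open>rNov\<close>,
  in the basis \<open>\<mu>\<^sub>n \<circ> (D\<^bsup>p\<^sub>1\<^esup>, \<dots>, D\<^bsup>p\<^sub>n\<^esup>)\<close>, \<open>p \<in> P_exps n\<close>, of \<open>rNov(n)\<close>.
\<close>

definition rNov_coord :: "nat \<Rightarrow> (nat tree \<Rightarrow>\<^sub>0 'k::field) \<Rightarrow> nat list \<Rightarrow> 'k"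
  where "rNov_coord n u = (THE c. (\<forall>p. p \<notin> P_exps n \<longrightarrow> c p = 0) \<and>
    ComDer_ideal n (u - (\<Sum>p\<in>P_exps n. Poly_Mapping.single (dmon_tree p) (c p))))"


section \<open>The Hadamard product of rNov and the endomorphism operad\<close>

text \<open>
  As \<open>rNov(n)\<close> has the basis \<open>\<mu>\<^sub>n \<circ> (D\<^bsup>p\<^sub>1\<^esup>, \<dots>, D\<^bsup>p\<^sub>n\<^esup>)\<close>, an element
  \<open>\<Sum>\<^sub>p \<mu>\<^sub>n \<circ> (D\<^bsup>p\<^sub>1\<^esup>, \<dots>, D\<^bsup>p\<^sub>n\<^esup>) \<otimes> f\<^bsup>p\<^esup>\<close> of the tensor product is given by the family
  \<open>p \<mapsto> f\<^bsup>p\<^esup>\<close>.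
\<close>

definition Had_op :: "('k::field \<Rightarrow> 'v \<Rightarrow> 'v::ab_group_add) \<Rightarrow> nat \<Rightarrow> (nat list \<Rightarrow> 'v list \<Rightarrow> 'v) set"
  where "Had_op scale n =
    {F. (\<forall>p. p \<notin> P_exps n \<longrightarrow> F p = 0) \<and> (\<forall>p\<in>P_exps n. F p \<in> End_op scale n)}"

text \<open>The sum collects the terms with \<open>(p\<^sub>\<sigma>\<^sub>(\<^sub>1\<^sub>), \<dots>, p\<^sub>\<sigma>\<^sub>(\<^sub>n\<^sub>)) = r\<close>.\<close>

definition Had_act ::
  "nat \<Rightarrow> (nat \<Rightarrow> nat) \<Rightarrow> (nat list \<Rightarrow> 'v list \<Rightarrow> 'v::ab_group_add) \<Rightarrow> nat list \<Rightarrow> 'v list \<Rightarrow> 'v"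
  where "Had_act n \<sigma> F r = (\<Sum>p\<in>{p \<in> P_exps n. perm_list n \<sigma> p = r}. End_act n \<sigma> (F p))"

definition Had_comp ::
  "('k::field \<Rightarrow> 'v \<Rightarrow> 'v::ab_group_add) \<Rightarrow> nat \<Rightarrow> nat \<Rightarrow> nat \<Rightarrow> (nat list \<Rightarrow> 'v list \<Rightarrow> 'v)
    \<Rightarrow> (nat list \<Rightarrow> 'v list \<Rightarrow> 'v) \<Rightarrow> nat list \<Rightarrow> 'v list \<Rightarrow> 'v"
  where "Had_comp scale n i m F G r =
    (\<Sum>p\<in>P_exps n. \<Sum>q\<in>P_exps m.
      fun_scale scale
        (rNov_coord (n + m - 1) (free_comp i m (tree_elem (dmon_tree p)) (tree_elem (dmon_tree q))) r)
        (End_comp n i m (F p) (G q)))"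

definition End_prod :: "('v \<Rightarrow> 'v \<Rightarrow> 'v::zero) \<Rightarrow> 'v list \<Rightarrow> 'v"
  where "End_prod nprod xs = (if length xs = 2 then nprod (xs ! 0) (xs ! 1) else 0)"

definition alpha_nu :: "('v \<Rightarrow> 'v \<Rightarrow> 'v::ab_group_add) \<Rightarrow> nat list \<Rightarrow> 'v list \<Rightarrow> 'v"
  where "alpha_nu nprod p =
    (if p = [1, 0] then End_prod nprod
     else if p = [0, 1] then - End_act 2 (transpose 1 2) (End_prod nprod)
     else 0)"


section \<open>The Novikov complex\<close>

definition CE :: "('k::field \<Rightarrow> 'v \<Rightarrow> 'v::ab_group_add) \<Rightarrow> nat \<Rightarrow> (nat list \<Rightarrow> 'v list \<Rightarrow> 'v) set"
  where "CE scale n = {F \<in> Had_op scale n. \<forall>\<sigma>. \<sigma> permutes {1..n} \<longrightarrow>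
    Had_act n \<sigma> F = fun_scale (fun_scale scale) (of_int (sign \<sigma>)) F}"

definition inv_shuffles :: "nat \<Rightarrow> nat \<Rightarrow> (nat \<Rightarrow> nat) set"
  where "inv_shuffles i j = {\<sigma>. \<sigma> permutes {1..i + j} \<and>
    strict_mono_on {1..i} (inv \<sigma>) \<and> strict_mono_on {i + 1..i + j} (inv \<sigma>)}"

definition CE_diff ::
  "('k::field \<Rightarrow> 'v \<Rightarrow> 'v::ab_group_add) \<Rightarrow> ('v \<Rightarrow> 'v \<Rightarrow> 'v) \<Rightarrow> nat
    \<Rightarrow> (nat list \<Rightarrow> 'v list \<Rightarrow> 'v) \<Rightarrow> nat list \<Rightarrow> 'v list \<Rightarrow> 'v"
  where "CE_diff scale nprod n F =
    (\<Sum>\<sigma>\<in>inv_shuffles 1 n. fun_scale (fun_scale scale) (of_int (sign \<sigma>))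
       (Had_act (n + 1) \<sigma> (Had_comp scale 2 2 n (alpha_nu nprod) F)))
  - (\<Sum>\<sigma>\<in>inv_shuffles 2 (n - 1). fun_scale (fun_scale scale) (of_int (sign \<sigma>))
       (Had_act (n + 1) \<sigma> (Had_comp scale n 1 2 F (alpha_nu nprod))))"

text \<open>
  Elements of \<open>K_types n\<close> are written \<open>[k\<^sub>n\<^sub>-\<^sub>1, \<dots>, k\<^sub>0]\<close>, so that \<open>k\<^sub>i = rev ks ! i\<close>.
\<close>

definition K_types :: "nat \<Rightarrow> nat list set"
  where "K_types n =
    {ks. length ks = n \<and> (\<Sum>i<n. rev ks ! i) = n \<and> (\<Sum>i<n. i * rev ks ! i) + 1 = n}"

definition exps_type :: "nat \<Rightarrow> nat list \<Rightarrow> nat list"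
  where "exps_type n p = map (\<lambda>j. card {i. i < n \<and> p ! i = j}) (rev [0..<n])"

definition Hom_sum :: "('k::field \<Rightarrow> 'v \<Rightarrow> 'v::ab_group_add) \<Rightarrow> nat list set \<Rightarrow> (nat list \<Rightarrow> 'v list \<Rightarrow> 'v) set"
  where "Hom_sum scale S = {c. (\<forall>k. k \<notin> S \<longrightarrow> c k = 0) \<and> (\<forall>k\<in>S. c k \<in> Hom_wedge scale k)}"

text \<open>
  The map from \<open>CE scale n\<close> to \<open>Hom_sum scale (K_types n)\<close>; for \<open>k\<close> in \<open>K_types n\<close> the
  sum has exactly one term.
\<close>

definition CE_to_Nov :: "nat \<Rightarrow> (nat list \<Rightarrow> 'v list \<Rightarrow> 'v::ab_group_add) \<Rightarrow> nat list \<Rightarrow> 'v list \<Rightarrow> 'v"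
  where "CE_to_Nov n F k =
    (\<Sum>p\<in>{p \<in> P_exps n. sorted_wrt (\<ge>) p \<and> exps_type n p = k}. F p)"

definition Nov_diff ::
  "('k::field \<Rightarrow> 'v \<Rightarrow> 'v::ab_group_add) \<Rightarrow> ('v \<Rightarrow> 'v \<Rightarrow> 'v) \<Rightarrow> nat
    \<Rightarrow> (nat list \<Rightarrow> 'v list \<Rightarrow> 'v) \<Rightarrow> nat list \<Rightarrow> 'v list \<Rightarrow> 'v"
  where "Nov_diff scale nprod n c =
    CE_to_Nov (n + 1) (CE_diff scale nprod n (inv_into (CE scale n) (CE_to_Nov n) c))"

definition Nov_complex ::
  "('k::field \<Rightarrow> 'v \<Rightarrow> 'v::ab_group_add) \<Rightarrow> ('v \<Rightarrow> 'v \<Rightarrow> 'v) \<Rightarrow> (nat list \<Rightarrow> 'v list \<Rightarrow> 'v) cochains"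
  where "Nov_complex scale nprod =
    \<lparr> cspace = (\<lambda>n. Hom_sum scale (K_types n)), cdiff = Nov_diff scale nprod \<rparr>"

definition summand_incl :: "nat list \<Rightarrow> ('v list \<Rightarrow> 'v::zero) \<Rightarrow> nat list \<Rightarrow> 'v list \<Rightarrow> 'v"
  where "summand_incl k f = (\<lambda>l. if l = k then f else 0)"

definition Nov_diff_component ::
  "('k::field \<Rightarrow> 'v \<Rightarrow> 'v::ab_group_add) \<Rightarrow> ('v \<Rightarrow> 'v \<Rightarrow> 'v) \<Rightarrow> nat \<Rightarrow> nat list \<Rightarrow> nat list
    \<Rightarrow> ('v list \<Rightarrow> 'v) \<Rightarrow> 'v list \<Rightarrow> 'v"
  where "Nov_diff_component scale nprod n k k' f = Nov_diff scale nprod n (summand_incl k f) k'"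

text \<open>The index \<open>(0, \<dots>, 0, n - 1, 1)\<close>, which for \<open>n = 1\<close> reads \<open>(1)\<close>.\<close>

definition pLie_type :: "nat \<Rightarrow> nat list"
  where "pLie_type n = (if n = 1 then [1] else replicate (n - 2) 0 @ [n - 1, 1])"

text \<open>The index \<open>(0, \<dots>, 0, 1, n - 2, 2)\<close> in \<open>K_types (n + 1)\<close>, for \<open>n \<ge> 2\<close>.\<close>

definition conn_type :: "nat \<Rightarrow> nat list"
  where "conn_type n = replicate (n - 2) 0 @ [1, n - 2, 2]"

definition Nov_bar_complex ::
  "('k::field \<Rightarrow> 'v \<Rightarrow> 'v::ab_group_add) \<Rightarrow> ('v \<Rightarrow> 'v \<Rightarrow> 'v) \<Rightarrow> (nat list \<Rightarrow> 'v list \<Rightarrow> 'v) cochains"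
  where "Nov_bar_complex scale nprod =
    \<lparr> cspace = (\<lambda>n. Hom_sum scale (K_types n - {pLie_type n})), cdiff = Nov_diff scale nprod \<rparr>"

text \<open>Families vanish outside their index set, so extension by zero is the identity function.\<close>

definition Nov_incl :: "nat \<Rightarrow> (nat list \<Rightarrow> 'v list \<Rightarrow> 'v) \<Rightarrow> nat list \<Rightarrow> 'v list \<Rightarrow> 'v"
  where "Nov_incl n c = c"

definition Nov_proj :: "nat \<Rightarrow> (nat list \<Rightarrow> 'v list \<Rightarrow> 'v) \<Rightarrow> 'v list \<Rightarrow> 'v"
  where "Nov_proj n c = c (pLie_type n)"

end

theory Submission
  imports Defs
begin

text \<open>
  Acting on products of exponentials \<open>e\<^bsup>l\<^sub>it\<^esup>\<close>, an element of \<open>ComDer(n)\<close> is multiplication by a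
  polynomial in \<open>l\<^sub>1, \<dots>, l\<^sub>n\<close>, and \<open>\<mu>\<^sub>n \<circ> (D\<^bsup>p\<^sub>1\<^esup>, \<dots>, D\<^bsup>p\<^sub>n\<^esup>)\<close> is the monomial with exponents
  \<open>p\<close>.  So a family in \<open>rNov \<otimes> End\<close> is the same thing as a polynomial cochain on the Lie algebra
  of pairs \<open>(a, x)\<close>, with bracket \<open>[(a, x), (b, y)] = (a + b, a x \<diamondop> y - b y \<diamondop> x)\<close>, and the
  differential of the Novikov complex is its Chevalley--Eilenberg differential; this squares to \<open>0\<close>
  by Cartan's formulas.  The coefficient of \<open>l\<^sub>1 \<cdots> l\<^sub>n\<close> in the differential of a cochain only
  involves its coefficient of \<open>l\<^sub>1 \<cdots> l\<^sub>n\<^sub>-\<^sub>1\<close> and is the pre-Lie differential of the latter; hence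
  \<open>\<pi>\<close> is a cochain map.  The connecting map is computed from the lift of a pre-Lie cocycle by
  zeros, whose differential has a single non-zero component.
\<close>

section \<open>Quotients of vector spaces\<close>

text \<open>\<open>rNov\<close> is given by generators and an inductively generated ideal, its
  coordinates by \<open>THE\<close>, and every composition in the complex passes through them. Hence
  both halves of a basis theorem are required: rewriting of trees reaches the monomials, and
  evaluation, invariant under the ideal, separates them. The second half treats polynomials as
  functions, which characteristic 0 permits; structure constants then enter only through their
  generating polynomial. Taking Cartan's formula as the definition of the differential turns
  \<open>d d = 0\<close> into inductions on the list of arguments, free of double sums over omitted
  indices. Fixing an argument removes it from the list but not its weight, which the bracket with a
  value still needs: this is the reason for the parameter \<open>w\<close>. Polynomials do not
  display single components, so the two halves of the differential are also written in coordinates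
  and checked against their polynomials. Characteristic 0 is used again when a family with
  prescribed components on decreasing exponents is alternated: each component is overcounted by the
  order of a stabilizer.\<close>

lemma subspace_coset_eq_iff:
  assumes "vector_space s" "module.subspace s B"
  shows "x +o B = y +o B \<longleftrightarrow> x - y \<in> B"
proof -
  interpret vector_space s by fact
  show ?thesis
  proof
    assume "x +o B = y +o B"
    moreover have "x \<in> x +o B"
      using assms(2) subspace_0 by (force simp: elt_set_plus_def)
    ultimately show "x - y \<in> B"
      by (simp add: set_minus_plus)
  next
    assume xy: "x - y \<in> B"
    have "x +o B \<subseteq> y +o B" if "x - y \<in> B" for x y
    proof
      fix z assume "z \<in> x +o B"
      then have "z - x \<in> B" by (simp add: set_minus_plus)
      then have "(z - x) + (x - y) \<in> B" using that assms(2) subspace_add by blast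
      then show "z \<in> y +o B" by (simp add: set_minus_plus [symmetric])
    qed
    moreover have "y - x \<in> B"
      using xy assms(2) subspace_neg by fastforce
    ultimately show "x +o B = y +o B" using xy by blast
  qed
qed

lemma subspace_coset_eq_self_iff:
  assumes "vector_space s" "module.subspace s B"
  shows "x +o B = B \<longleftrightarrow> x \<in> B"
  using subspace_coset_eq_iff [OF assms, of x 0] by simp

lemma subspace_plus_self:
  assumes "vector_space s" "module.subspace s B"
  shows "B + B = B"
proof -
  interpret vector_space s by fact
  show ?thesis
  proof
    show "B + B \<subseteq> B"
      using assms(2) subspace_add by (auto simp: set_plus_def)
    show "B \<subseteq> B + B"
      using assms(2) subspace_0 by (intro set_zero_plus2)
  qed
qed

text \<open>For \<open>c = 0\<close> the image of the coset under \<open>s c\<close> is a single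
  point; the summand \<open>B\<close> restores a full coset, so no scalar has to be
  inverted.\<close>

lemma quot_scale_coset:
  assumes "vector_space s" "module.subspace s B"
  shows "quot_scale s B c (x +o B) = s c x +o B"
proof -
  interpret vector_space s by fact
  have "s c ` (x +o B) + B \<subseteq> s c x +o B"
    using assms(2) subspace_scale subspace_add
    by (auto simp: elt_set_plus_def set_plus_def scale_right_distrib add.assoc)
  moreover have "s c x +o B \<subseteq> s c ` (x +o B) + B"
    using assms(2) subspace_0
    by (fastforce simp: elt_set_plus_def set_plus_def image_iff)
  ultimately show ?thesis by (simp add: quot_scale_def)
qed

lemma linear_between_add: "linear_between s1 s2 A B f \<Longrightarrow> x \<in> A \<Longrightarrow> y \<in> A \<Longrightarrow> f (x + y) = f x + f y"
  and linear_between_scale: "linear_between s1 s2 A B f \<Longrightarrow> x \<in> A \<Longrightarrow> f (s1 c x) = s2 c (f x)"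
  and linear_between_in: "linear_between s1 s2 A B f \<Longrightarrow> x \<in> A \<Longrightarrow> f x \<in> B"
  by (auto simp: linear_between_def)

lemma linear_between_diff:
  assumes "vector_space s1" "vector_space s2" "module.subspace s1 A" "linear_between s1 s2 A B f"
    "x \<in> A" "y \<in> A"
  shows "f (x - y) = f x - f y"
proof -
  interpret V1: vector_space s1 by fact
  interpret V2: vector_space s2 by fact
  \<comment> \<open>\<open>linear_between\<close> controls sums and multiples on \<open>A\<close>
    only, so a difference is taken as a sum with the multiple by -1.\<close>
  have "s1 (-1) y \<in> A" using assms V1.subspace_scale by blast
  then have "f (x + s1 (-1) y) = f x + s2 (-1) (f y)"
    using assms by (metis linear_between_add linear_between_scale)
  then show ?thesis by simp
qed

lemma linear_between_0:
  assumes "vector_space s1" "vector_space s2" "module.subspace s1 A" "linear_between s1 s2 A B f"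
  shows "f 0 = 0"
proof -
  interpret V1: vector_space s1 by fact
  have "0 \<in> A" using assms V1.subspace_0 by blast
  then show ?thesis using linear_between_diff [OF assms, of 0 0] by simp
qed

text \<open>\<open>f\<close> is known to be additive on \<open>A\<close> only;
  \<open>B \<subseteq> A\<close> keeps the coset inside \<open>A\<close>, and the values of
  \<open>f\<close> on \<open>B\<close> are absorbed by \<open>B'\<close>.\<close>

lemma quot_map_coset:
  assumes "vector_space s1" "vector_space s2" "module.subspace s1 A" "module.subspace s1 B"
    "B \<subseteq> A" "module.subspace s2 B'" "linear_between s1 s2 A A' f" "f ` B \<subseteq> B'" "x \<in> A"
  shows "quot_map f B' (x +o B) = f x +o B'"
proof -
  interpret V1: vector_space s1 by fact
  interpret V2: vector_space s2 by fact
  have fxb: "f (x + b) = f x + f b" if "b \<in> B" for b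
    using that assms by (meson linear_between_add subsetD)
  have "f ` (x +o B) + B' \<subseteq> f x +o B'"
  proof
    fix z assume "z \<in> f ` (x +o B) + B'"
    then obtain b b' where "b \<in> B" "b' \<in> B'" "z = f (x + b) + b'"
      by (auto simp: elt_set_plus_def set_plus_def)
    then have "z = f x + (f b + b')" "f b + b' \<in> B'"
      using assms fxb V2.subspace_add by (auto simp: add.assoc)
    then show "z \<in> f x +o B'" by (auto simp: elt_set_plus_def)
  qed
  moreover have "f x +o B' \<subseteq> f ` (x +o B) + B'"
  proof
    fix z assume "z \<in> f x +o B'"
    then obtain b' where "b' \<in> B'" "z = f x + b'" by (auto simp: elt_set_plus_def)
    moreover have "x \<in> x +o B"
      using assms V1.subspace_0 by (force simp: elt_set_plus_def)
    ultimately show "z \<in> f ` (x +o B) + B'" by (auto simp: set_plus_def)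
  qed
  ultimately show ?thesis by (simp add: quot_map_def)
qed

text \<open>It is enough that \<open>f\<close> is linear modulo \<open>B'\<close>. This generality
  serves the connecting map, whose representatives come from arbitrary choices.\<close>

lemma quot_linear_coset_map:
  assumes "vector_space s1" "vector_space s2" "module.subspace s1 A" "module.subspace s1 B"
    "module.subspace s2 B'"
    and g: "\<And>x. x \<in> A \<Longrightarrow> g (x +o B) = f x +o B'"
    and f: "\<And>x. x \<in> A \<Longrightarrow> f x \<in> A'"
    "\<And>x y. x \<in> A \<Longrightarrow> y \<in> A \<Longrightarrow> f (x + y) - (f x + f y) \<in> B'"
    "\<And>c x. x \<in> A \<Longrightarrow> f (s1 c x) - s2 c (f x) \<in> B'"
  shows "quot_linear s1 A B s2 A' B' g"
proof -
  interpret V1: vector_space s1 by fact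
  interpret V2: vector_space s2 by fact
  have add: "g ((x +o B) + (y +o B)) = g (x +o B) + g (y +o B)" if "x \<in> A" "y \<in> A" for x y
  proof -
    have "g ((x +o B) + (y +o B)) = f (x + y) +o B'"
      using that assms(3) V1.subspace_add g subspace_plus_self [OF assms(1) assms(4)]
      by (simp add: set_plus_rearrange)
    also have "\<dots> = (f x + f y) +o B'"
      using f(2) that subspace_coset_eq_iff [OF assms(2) assms(5)] by blast
    finally show ?thesis
      using that g subspace_plus_self [OF assms(2) assms(5)] by (simp add: set_plus_rearrange)
  qed
  have scale: "g (quot_scale s1 B c (x +o B)) = quot_scale s2 B' c (g (x +o B))" if "x \<in> A" for x c
    using that g f(3) assms(3) V1.subspace_scale subspace_coset_eq_iff [OF assms(2) assms(5)]
    by (simp add: quot_scale_coset assms)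
  show ?thesis
    unfolding quot_linear_def quot_def using add scale g f(1) by auto
qed

lemma quot_linear_quot_map:
  assumes "vector_space s1" "vector_space s2" "module.subspace s1 A" "module.subspace s1 B"
    "B \<subseteq> A" "module.subspace s2 B'" "linear_between s1 s2 A A' f" "f ` B \<subseteq> B'"
  shows "quot_linear s1 A B s2 A' B' (quot_map f B')"
proof -
  interpret V2: vector_space s2 by fact
  have "0 \<in> B'" using assms V2.subspace_0 by blast
  then show ?thesis
    using assms
    by (intro quot_linear_coset_map [where f = f])
      (auto simp: quot_map_coset [OF assms] linear_between_add linear_between_scale linear_between_in)
qed

section \<open>The long exact sequence\<close>

lemma linear_between_subset:
  assumes "linear_between s1 s2 A A' f" "B \<subseteq> A" "f ` B \<subseteq> B'"
  shows "linear_between s1 s2 B B' f"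
  using assms by (auto simp: linear_between_def subset_iff)

lemma cocycles_subspace:
  assumes "vector_space s" "cochain_complex s X" "n \<ge> 1"
  shows "module.subspace s (cocycles X n)"
proof -
  interpret vector_space s by fact
  have X: "subspace (cspace X n)" and d: "linear_between s s (cspace X n) (cspace X (Suc n)) (cdiff X n)"
    using assms by (auto simp: cochain_complex_def)
  show ?thesis
    using X d linear_between_0 [OF assms(1,1) X d]
    by (auto simp: subspace_def cocycles_def linear_between_add linear_between_scale)
qed

lemma coboundaries_subset:
  assumes "vector_space s" "cochain_complex s X" "n \<ge> 1"
  shows "coboundaries X n \<subseteq> cocycles X n"
proof (cases "n = 1")
  case True
  interpret vector_space s by fact
  show ?thesis
    using subspace_0 [OF cocycles_subspace [OF assms]] True by (auto simp: coboundaries_def)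
next
  case False
  then have "n - 1 \<ge> 1" "Suc (n - 1) = n" using assms by auto
  then have d: "linear_between s s (cspace X (n - 1)) (cspace X n) (cdiff X (n - 1))"
      and dd: "\<forall>x\<in>cspace X (n - 1). cdiff X n (cdiff X (n - 1) x) = 0"
    using assms(2) unfolding cochain_complex_def by metis+
  then show ?thesis
    using False assms(3) by (auto simp: coboundaries_def cocycles_def linear_between_in [OF d [unfolded One_nat_def]])
qed

lemma coboundaries_subspace:
  assumes "vector_space s" "cochain_complex s X" "n \<ge> 1"
  shows "module.subspace s (coboundaries X n)"
proof (cases "n = 1")
  case True
  interpret vector_space s by fact
  show ?thesis using True by (auto simp: coboundaries_def)
next
  case False
  interpret vector_space s by fact
  have "n - 1 \<ge> 1" using False assms by auto
  then have X: "subspace (cspace X (n - 1))"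
    and d: "linear_between s s (cspace X (n - 1)) (cspace X (Suc (n - 1))) (cdiff X (n - 1))"
    using assms by (auto simp: cochain_complex_def)
  show ?thesis
    unfolding subspace_def
  proof (intro conjI ballI allI)
    show "0 \<in> coboundaries X n"
      using linear_between_0 [OF assms(1,1) X d] subspace_0 [OF X] False assms(3)
      by (auto simp: coboundaries_def intro!: image_eqI [of _ _ 0])
    fix x y assume "x \<in> coboundaries X n" "y \<in> coboundaries X n"
    then obtain a b where "a \<in> cspace X (n - 1)" "b \<in> cspace X (n - 1)"
        "x = cdiff X (n - 1) a" "y = cdiff X (n - 1) b"
      using False assms(3) by (auto simp: coboundaries_def)
    then show "x + y \<in> coboundaries X n"
      using False assms(3) subspace_add [OF X] linear_between_add [OF d, of a b]
      by (auto simp: coboundaries_def intro!: image_eqI [of _ _ "a + b"])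
  next
    fix c x assume "x \<in> coboundaries X n"
    then obtain a where "a \<in> cspace X (n - 1)" "x = cdiff X (n - 1) a"
      using False assms(3) by (auto simp: coboundaries_def)
    then show "s c x \<in> coboundaries X n"
      using False assms(3) subspace_scale [OF X] linear_between_scale [OF d, of a c]
      by (auto simp: coboundaries_def intro!: image_eqI [of _ _ "s c a"])
  qed
qed

section \<open>The snake lemma for an arbitrary short exact sequence of cochain complexes\<close>

locale cochain_ses =
  V1: vector_space s1 + V2: vector_space s2 + V3: vector_space s3
  for s1 :: "'k::field \<Rightarrow> 'a \<Rightarrow> 'a::ab_group_add"
    and s2 :: "'k \<Rightarrow> 'b \<Rightarrow> 'b::ab_group_add"
    and s3 :: "'k \<Rightarrow> 'c \<Rightarrow> 'c::ab_group_add" +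
  fixes X i Y p Z
  assumes ses: "short_exact_sequence s1 X i s2 Y p s3 Z"
begin

lemma vs: "vector_space s1" "vector_space s2" "vector_space s3"
  by unfold_locales

lemma complexes: "cochain_complex s1 X" "cochain_complex s2 Y" "cochain_complex s3 Z"
  using ses by (auto simp: short_exact_sequence_def)

lemma spaces:
  "n \<ge> 1 \<Longrightarrow> V1.subspace (cspace X n)" "n \<ge> 1 \<Longrightarrow> V2.subspace (cspace Y n)"
  "n \<ge> 1 \<Longrightarrow> V3.subspace (cspace Z n)"
  using complexes by (auto simp: cochain_complex_def)

lemma diffs:
  "n \<ge> 1 \<Longrightarrow> linear_between s1 s1 (cspace X n) (cspace X (Suc n)) (cdiff X n)"
  "n \<ge> 1 \<Longrightarrow> linear_between s2 s2 (cspace Y n) (cspace Y (Suc n)) (cdiff Y n)"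
  "n \<ge> 1 \<Longrightarrow> linear_between s3 s3 (cspace Z n) (cspace Z (Suc n)) (cdiff Z n)"
  using complexes by (auto simp: cochain_complex_def)

lemma diff_diff:
  "n \<ge> 1 \<Longrightarrow> x \<in> cspace X n \<Longrightarrow> cdiff X (Suc n) (cdiff X n x) = 0"
  "n \<ge> 1 \<Longrightarrow> y \<in> cspace Y n \<Longrightarrow> cdiff Y (Suc n) (cdiff Y n y) = 0"
  "n \<ge> 1 \<Longrightarrow> z \<in> cspace Z n \<Longrightarrow> cdiff Z (Suc n) (cdiff Z n z) = 0"
  using complexes by (auto simp: cochain_complex_def)

lemma i_linear: "n \<ge> 1 \<Longrightarrow> linear_between s1 s2 (cspace X n) (cspace Y n) (i n)"
  and i_diff: "n \<ge> 1 \<Longrightarrow> x \<in> cspace X n \<Longrightarrow> i (Suc n) (cdiff X n x) = cdiff Y n (i n x)"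
  and p_linear: "n \<ge> 1 \<Longrightarrow> linear_between s2 s3 (cspace Y n) (cspace Z n) (p n)"
  and p_diff: "n \<ge> 1 \<Longrightarrow> y \<in> cspace Y n \<Longrightarrow> p (Suc n) (cdiff Y n y) = cdiff Z n (p n y)"
  and i_inj: "n \<ge> 1 \<Longrightarrow> inj_on (i n) (cspace X n)"
  and i_image: "n \<ge> 1 \<Longrightarrow> i n ` cspace X n = {y \<in> cspace Y n. p n y = 0}"
  and p_image: "n \<ge> 1 \<Longrightarrow> p n ` cspace Y n = cspace Z n"
  using ses by (auto simp: short_exact_sequence_def cochain_map_def)

lemmas cocycles_sub =
  cocycles_subspace [OF vs(1) complexes(1)] cocycles_subspace [OF vs(2) complexes(2)]
  cocycles_subspace [OF vs(3) complexes(3)]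

lemmas coboundaries_sub =
  coboundaries_subspace [OF vs(1) complexes(1)] coboundaries_subspace [OF vs(2) complexes(2)]
  coboundaries_subspace [OF vs(3) complexes(3)]

lemmas coboundaries_le =
  coboundaries_subset [OF vs(1) complexes(1)] coboundaries_subset [OF vs(2) complexes(2)]
  coboundaries_subset [OF vs(3) complexes(3)]

lemma i_0: "n \<ge> 1 \<Longrightarrow> i n 0 = 0"
  by (rule linear_between_0 [OF vs(1,2) spaces(1) i_linear])

lemma p_0: "n \<ge> 1 \<Longrightarrow> p n 0 = 0"
  by (rule linear_between_0 [OF vs(2,3) spaces(2) p_linear])

lemma i_in: "n \<ge> 1 \<Longrightarrow> x \<in> cspace X n \<Longrightarrow> i n x \<in> cspace Y n"
  and p_in: "n \<ge> 1 \<Longrightarrow> y \<in> cspace Y n \<Longrightarrow> p n y \<in> cspace Z n"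
  and diff_in: "n \<ge> 1 \<Longrightarrow> x \<in> cspace X n \<Longrightarrow> cdiff X n x \<in> cspace X (Suc n)"
    "n \<ge> 1 \<Longrightarrow> y \<in> cspace Y n \<Longrightarrow> cdiff Y n y \<in> cspace Y (Suc n)"
    "n \<ge> 1 \<Longrightarrow> z \<in> cspace Z n \<Longrightarrow> cdiff Z n z \<in> cspace Z (Suc n)"
  using i_linear p_linear diffs by (blast intro: linear_between_in)+

lemma i_cocycles: "n \<ge> 1 \<Longrightarrow> x \<in> cocycles X n \<Longrightarrow> i n x \<in> cocycles Y n"
  using i_linear i_diff [symmetric] i_0 by (auto simp: cocycles_def i_in p_in diff_in)

lemma p_cocycles: "n \<ge> 1 \<Longrightarrow> y \<in> cocycles Y n \<Longrightarrow> p n y \<in> cocycles Z n"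
  using p_linear p_diff [symmetric] p_0 by (auto simp: cocycles_def i_in p_in diff_in)

lemma coboundaries_Suc: "n \<ge> 1 \<Longrightarrow> coboundaries W (Suc n) = cdiff W n ` cspace W n"
  by (simp add: coboundaries_def)

lemma i_coboundaries:
  assumes "n \<ge> 1" "x \<in> coboundaries X n" shows "i n x \<in> coboundaries Y n"
proof (cases "n = 1")
  case True
  then show ?thesis using assms i_0 by (simp add: coboundaries_def)
next
  case False
  then obtain m where "n = Suc m" "m \<ge> 1" using assms(1) by (cases n) auto
  then show ?thesis
    using assms i_diff i_linear by (auto simp: coboundaries_Suc i_in p_in diff_in intro!: image_eqI)
qed

lemma p_coboundaries:
  assumes "n \<ge> 1" "y \<in> coboundaries Y n" shows "p n y \<in> coboundaries Z n"
proof (cases "n = 1")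
  case True
  then show ?thesis using assms p_0 by (simp add: coboundaries_def)
next
  case False
  then obtain m where "n = Suc m" "m \<ge> 1" using assms(1) by (cases n) auto
  then show ?thesis
    using assms p_diff p_linear by (auto simp: coboundaries_Suc i_in p_in diff_in intro!: image_eqI)
qed

lemma lift_p:
  assumes "n \<ge> 1" "z \<in> cspace Z n" obtains y where "y \<in> cspace Y n" "p n y = z"
  using p_image [OF assms(1)] assms(2) that by (metis imageE)

lemma lift_i:
  assumes "n \<ge> 1" "y \<in> cspace Y n" "p n y = 0" obtains x where "x \<in> cspace X n" "i n x = y"
proof -
  have "y \<in> i n ` cspace X n" using i_image [OF assms(1)] assms by simp
  then show ?thesis using that by auto
qed

text \<open>Above degree 1 a primitive is lifted and differentiated. The lift is itself a
  coboundary, so subtracting it leaves cohomology classes unchanged.\<close>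

lemma lift_p_coboundary:
  assumes "n \<ge> 1" "z \<in> coboundaries Z n" obtains y where "y \<in> coboundaries Y n" "p n y = z"
proof (cases "n = 1")
  case True
  then show ?thesis using assms p_0 that [of 0] by (simp add: coboundaries_def)
next
  case False
  then obtain m where m: "n = Suc m" "m \<ge> 1" using assms(1) by (cases n) auto
  then obtain a where "a \<in> cspace Z m" "z = cdiff Z m a" using assms by (auto simp: coboundaries_Suc)
  then obtain b where "b \<in> cspace Y m" "p m b = a" using lift_p m by metis
  then show ?thesis
    using that [of "cdiff Y m b"] m p_diff \<open>z = _\<close> by (auto simp: coboundaries_Suc)
qed

lemma i_map: "n \<ge> 1 \<Longrightarrow> x \<in> cocycles X n \<Longrightarrow>
    cohomology_map Y i n (x +o coboundaries X n) = i n x +o coboundaries Y n"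
  unfolding cohomology_map_def
  by (rule quot_map_coset [OF vs(1,2) cocycles_sub(1) coboundaries_sub(1) coboundaries_le(1)
        coboundaries_sub(2) linear_between_subset [OF i_linear]])
    (use i_cocycles i_coboundaries in \<open>auto simp: cocycles_def\<close>)

lemma p_map: "n \<ge> 1 \<Longrightarrow> y \<in> cocycles Y n \<Longrightarrow>
    cohomology_map Z p n (y +o coboundaries Y n) = p n y +o coboundaries Z n"
  unfolding cohomology_map_def
  by (rule quot_map_coset [OF vs(2,3) cocycles_sub(2) coboundaries_sub(2) coboundaries_le(2)
        coboundaries_sub(3) linear_between_subset [OF p_linear]])
    (use p_cocycles p_coboundaries in \<open>auto simp: cocycles_def\<close>)

lemma i_map_linear: "n \<ge> 1 \<Longrightarrow> cohomology_linear s1 X n s2 Y n (cohomology_map Y i n)"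
  unfolding cohomology_linear_def cohomology_map_def
  by (rule quot_linear_quot_map [OF vs(1,2) cocycles_sub(1) coboundaries_sub(1) coboundaries_le(1)
        coboundaries_sub(2) linear_between_subset [OF i_linear]])
    (use i_cocycles i_coboundaries in \<open>auto simp: cocycles_def\<close>)

lemma p_map_linear: "n \<ge> 1 \<Longrightarrow> cohomology_linear s2 Y n s3 Z n (cohomology_map Z p n)"
  unfolding cohomology_linear_def cohomology_map_def
  by (rule quot_linear_quot_map [OF vs(2,3) cocycles_sub(2) coboundaries_sub(2) coboundaries_le(2)
        coboundaries_sub(3) linear_between_subset [OF p_linear]])
    (use p_cocycles p_coboundaries in \<open>auto simp: cocycles_def\<close>)

abbreviation "\<delta> \<equiv> connecting_map X i Y p"

text \<open>Since \<open>p\<close> commutes with the differentials, it sends the differential of a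
  lift of the cocycle \<open>z\<close> to 0; exactness pulls that differential back to
  \<open>X\<close>.\<close>

lemma snake_lift:
  assumes n: "n \<ge> 1" and z: "z \<in> cocycles Z n"
  obtains y w where "y \<in> cspace Y n" "p n y = z" "w \<in> cspace X (Suc n)" "i (Suc n) w = cdiff Y n y"
proof -
  obtain y where y: "y \<in> cspace Y n" "p n y = z"
    using z n lift_p by (auto simp: cocycles_def)
  have "cdiff Y n y \<in> cspace Y (Suc n)" "p (Suc n) (cdiff Y n y) = 0"
    using n y z diffs(2) by (auto simp: p_diff cocycles_def i_in p_in diff_in)
  then show ?thesis using that y n lift_i by (metis Suc_eq_plus1 le_add2)
qed

text \<open>The injective map \<open>i\<close> sends the differential of \<open>w\<close> to the
  second differential of \<open>y\<close>, which is 0.\<close>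

lemma snake_cocycle:
  assumes n: "n \<ge> 1" and "y \<in> cspace Y n" "w \<in> cspace X (Suc n)" "i (Suc n) w = cdiff Y n y"
  shows "w \<in> cocycles X (Suc n)"
proof -
  have "i (Suc (Suc n)) (cdiff X (Suc n) w) = i (Suc (Suc n)) 0"
    using assms by (simp add: i_diff i_0 diff_diff)
  moreover have "cdiff X (Suc n) w \<in> cspace X (Suc (Suc n))" "0 \<in> cspace X (Suc (Suc n))"
    using assms diffs(1) [of "Suc n"] spaces(1) [of "Suc (Suc n)"] V1.subspace_0
    by (auto simp: i_in p_in diff_in)
  ultimately show ?thesis
    using assms i_inj [of "Suc (Suc n)"] by (auto simp: inj_on_def cocycles_def)
qed

text \<open>One choice of lift already determines the set of all results: two lifts of cohomologous
  cocycles differ by a coboundary of \<open>Y\<close> and an element \<open>i n x\<close>, and only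
  the latter changes \<open>w\<close>, by the differential of \<open>x\<close>.\<close>

lemma connecting_map_eq:
  assumes n: "n \<ge> 1" and y: "y \<in> cspace Y n" and z: "p n y = z" "z \<in> cocycles Z n"
    and w: "w \<in> cspace X (Suc n)" "i (Suc n) w = cdiff Y n y"
  shows "\<delta> n (z +o coboundaries Z n) = w +o coboundaries X (Suc n)"
proof (intro equalityI subsetI)
  fix v assume "v \<in> \<delta> n (z +o coboundaries Z n)"
  then obtain y' where v: "v \<in> cspace X (Suc n)" and y': "y' \<in> cspace Y n"
      "p n y' \<in> z +o coboundaries Z n" "cdiff Y n y' = i (Suc n) v"
    by (auto simp: connecting_map_def)
  then have "p n y' - z \<in> coboundaries Z n" by (simp add: set_minus_plus)
  then obtain b where b: "b \<in> coboundaries Y n" "p n b = p n y' - z"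
    using lift_p_coboundary n by metis
  then have b': "b \<in> cocycles Y n" using coboundaries_le(2) n by blast
  have mem: "y' - y \<in> cspace Y n" "y' - y - b \<in> cspace Y n"
    using b' y y' n spaces(2) V2.subspace_diff by (auto simp: cocycles_def)
  \<comment> \<open>The coboundary \<open>b\<close> accounts for the change of representative in the
    class of \<open>z\<close>; what is left lies in the kernel of \<open>p\<close>.\<close>
  have "p n (y' - y - b) = 0"
    using linear_between_diff [OF vs(2,3) spaces(2) p_linear] mem y y' z b b' n
    by (simp add: cocycles_def)
  then obtain x where x: "x \<in> cspace X n" "i n x = y' - y - b"
    using lift_i mem n by metis
  have "i (Suc n) (cdiff X n x) = cdiff Y n (y' - y - b)"
    using x n by (simp add: i_diff)
  also have "\<dots> = i (Suc n) v - i (Suc n) w"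
    using linear_between_diff [OF vs(2,2) spaces(2) diffs(2)] mem y y' w b' n
    by (simp add: cocycles_def)
  also have "\<dots> = i (Suc n) (v - w)"
    using linear_between_diff [OF vs(1,2) spaces(1) i_linear] v w by simp
  finally have "cdiff X n x = v - w"
    using i_inj [of "Suc n"] spaces(1) [of "Suc n"] v w x n diffs(1) [of n] V1.subspace_diff
    by (auto simp: inj_on_def i_in p_in diff_in)
  then show "v \<in> w +o coboundaries X (Suc n)"
    using x n by (auto simp: set_minus_plus [symmetric] coboundaries_Suc intro!: image_eqI)
next
  fix v assume "v \<in> w +o coboundaries X (Suc n)"
  then have "v - w \<in> coboundaries X (Suc n)" by (simp add: set_minus_plus)
  then obtain x where x: "x \<in> cspace X n" "v - w = cdiff X n x"
    using n by (auto simp: coboundaries_Suc)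
  have ix: "i n x \<in> cspace Y n" "p n (i n x) = 0"
    using i_image [OF n] x by auto
  have "cdiff X n x \<in> cspace X (Suc n)" using x n diffs(1) by (auto simp: i_in p_in diff_in)
  then have v: "v \<in> cspace X (Suc n)"
    using x w V1.subspace_add [OF spaces(1) [of "Suc n"]] by (metis diff_add_cancel le_Suc_eq n)
  \<comment> \<open>Every element of the coset is reached: the lift \<open>y + i n x\<close> of
    \<open>z\<close> realizes \<open>v\<close>.\<close>
  have "cdiff Y n (y + i n x) = i (Suc n) w + i (Suc n) (v - w)"
    using x w y ix n by (simp add: linear_between_add [OF diffs(2)] i_diff)
  also have "\<dots> = i (Suc n) v"
    using v w linear_between_diff [OF vs(1,2) spaces(1) i_linear] by simp
  finally have "cdiff Y n (y + i n x) = i (Suc n) v" .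
  moreover have "p n (y + i n x) = z"
    using ix y z n linear_between_add [OF p_linear] by simp
  moreover have "y + i n x \<in> cspace Y n"
    using ix y n spaces(2) V2.subspace_add by blast
  moreover have "z \<in> z +o coboundaries Z n"
    using V3.subspace_0 [OF coboundaries_sub(3) [OF n]] by (force simp: elt_set_plus_def)
  ultimately show "v \<in> \<delta> n (z +o coboundaries Z n)"
    using v by (auto simp: connecting_map_def)
qed

text \<open>A choice of lift and of its result for each cocycle; the choice need not be linear in
  \<open>z\<close>.\<close>

definition snake :: "nat \<Rightarrow> 'c \<Rightarrow> 'b \<times> 'a"
  where "snake n z = (SOME (y, w). y \<in> cspace Y n \<and> p n y = z \<and> w \<in> cspace X (Suc n) \<and>
    i (Suc n) w = cdiff Y n y)"

lemma snake:
  assumes "n \<ge> 1" "z \<in> cocycles Z n"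
  shows "fst (snake n z) \<in> cspace Y n" "p n (fst (snake n z)) = z"
    "snd (snake n z) \<in> cspace X (Suc n)" "i (Suc n) (snd (snake n z)) = cdiff Y n (fst (snake n z))"
proof -
  have "\<exists>q. case q of (y, w) \<Rightarrow> y \<in> cspace Y n \<and> p n y = z \<and> w \<in> cspace X (Suc n) \<and>
    i (Suc n) w = cdiff Y n y"
    using snake_lift [OF assms] by blast
  from someI_ex [OF this] show "fst (snake n z) \<in> cspace Y n" "p n (fst (snake n z)) = z"
    "snd (snake n z) \<in> cspace X (Suc n)" "i (Suc n) (snd (snake n z)) = cdiff Y n (fst (snake n z))"
    unfolding snake_def [symmetric] by (auto split: prod.splits)
qed

lemma connecting_snake:
  assumes "n \<ge> 1" "z \<in> cocycles Z n"
  shows "\<delta> n (z +o coboundaries Z n) = snd (snake n z) +o coboundaries X (Suc n)"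
    and "snd (snake n z) \<in> cocycles X (Suc n)"
  using snake [OF assms] connecting_map_eq assms snake_cocycle by blast+

text \<open>Sums and multiples of chosen lifts are admissible lifts of the sums and multiples. By
  \<open>connecting_map_eq\<close> they yield the same classes as the lifts chosen for these, so
  linearity holds modulo coboundaries.\<close>

lemma connecting_linear:
  assumes n: "n \<ge> 1" shows "cohomology_linear s3 Z n s1 X (Suc n) (\<delta> n)"
  unfolding cohomology_linear_def
proof (rule quot_linear_coset_map [where f = "\<lambda>z. snd (snake n z)"])
  have n': "Suc n \<ge> 1" by simp
  fix z assume z: "z \<in> cocycles Z n"
  note sz = snake [OF n z]
  {
    fix z' assume z': "z' \<in> cocycles Z n"
    note sz' = snake [OF n z']
    have zz: "z + z' \<in> cocycles Z n" using z z' cocycles_sub(3) n V3.subspace_add by blast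
    have "\<delta> n ((z + z') +o coboundaries Z n) =
        (snd (snake n z) + snd (snake n z')) +o coboundaries X (Suc n)"
    proof (rule connecting_map_eq [OF n, where y = "fst (snake n z) + fst (snake n z')"])
      show "fst (snake n z) + fst (snake n z') \<in> cspace Y n"
        using sz sz' n spaces(2) V2.subspace_add by blast
      show "p n (fst (snake n z) + fst (snake n z')) = z + z'"
        using sz sz' n linear_between_add [OF p_linear] by simp
      show "snd (snake n z) + snd (snake n z') \<in> cspace X (Suc n)"
        using sz sz' n' spaces(1) V1.subspace_add by blast
      show "i (Suc n) (snd (snake n z) + snd (snake n z')) = cdiff Y n (fst (snake n z) + fst (snake n z'))"
        using sz sz' n linear_between_add [OF i_linear] linear_between_add [OF diffs(2)] by simp
    qed (fact zz)
    then show "snd (snake n (z + z')) - (snd (snake n z) + snd (snake n z')) \<in> coboundaries X (Suc n)"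
      using connecting_snake(1) [OF n zz] subspace_coset_eq_iff [OF vs(1) coboundaries_sub(1) [OF n']]
      by simp
  next
    fix c
    have zz: "s3 c z \<in> cocycles Z n" using z cocycles_sub(3) n V3.subspace_scale by blast
    have "\<delta> n (s3 c z +o coboundaries Z n) = s1 c (snd (snake n z)) +o coboundaries X (Suc n)"
    proof (rule connecting_map_eq [OF n, where y = "s2 c (fst (snake n z))"])
      show "s2 c (fst (snake n z)) \<in> cspace Y n"
        using sz n spaces(2) V2.subspace_scale by blast
      show "p n (s2 c (fst (snake n z))) = s3 c z"
        using sz n linear_between_scale [OF p_linear] by simp
      show "s1 c (snd (snake n z)) \<in> cspace X (Suc n)"
        using sz n' spaces(1) V1.subspace_scale by blast
      show "i (Suc n) (s1 c (snd (snake n z))) = cdiff Y n (s2 c (fst (snake n z)))"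
        using sz n linear_between_scale [OF i_linear] linear_between_scale [OF diffs(2)] by simp
    qed (fact zz)
    then show "snd (snake n (s3 c z)) - s1 c (snd (snake n z)) \<in> coboundaries X (Suc n)"
      using connecting_snake(1) [OF n zz] subspace_coset_eq_iff [OF vs(1) coboundaries_sub(1) [OF n']]
      by simp
  }
qed (use n vs cocycles_sub(3) coboundaries_sub(1,3) connecting_snake in auto)

lemma exact_Y:
  assumes n: "n \<ge> 1"
  shows "cohomology_map Y i n ` cohomology X n =
    {V \<in> cohomology Y n. cohomology_map Z p n V = coboundaries Z n}"
proof (intro equalityI subsetI)
  fix V assume "V \<in> cohomology_map Y i n ` cohomology X n"
  then obtain x where x: "x \<in> cocycles X n" "V = i n x +o coboundaries Y n"
    using n by (auto simp: cohomology_def quot_def i_map)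
  have "p n (i n x) = 0" using i_image [OF n] x by (auto simp: cocycles_def)
  then show "V \<in> {V \<in> cohomology Y n. cohomology_map Z p n V = coboundaries Z n}"
    using x n i_cocycles by (auto simp: cohomology_def quot_def p_map)
next
  fix V assume "V \<in> {V \<in> cohomology Y n. cohomology_map Z p n V = coboundaries Z n}"
  then obtain y where y: "y \<in> cocycles Y n" "V = y +o coboundaries Y n"
      "p n y +o coboundaries Z n = 0 +o coboundaries Z n"
    using n by (auto simp: cohomology_def quot_def p_map)
  then have "p n y \<in> coboundaries Z n"
    using subspace_coset_eq_self_iff [OF vs(3) coboundaries_sub(3) [OF n]] by simp
  \<comment> \<open>Passing from \<open>y\<close> to \<open>y - b\<close> keeps the class and moves
    the representative into the kernel of \<open>p\<close>.\<close>
  then obtain b where b: "b \<in> coboundaries Y n" "p n b = p n y"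
    using lift_p_coboundary n by metis
  then have b': "b \<in> cocycles Y n" using coboundaries_le(2) n by blast
  have yb: "y - b \<in> cocycles Y n" using y b' n cocycles_sub(2) V2.subspace_diff by blast
  have "p n (y - b) = 0"
    using linear_between_diff [OF vs(2,3) spaces(2) p_linear] y b b' n by (simp add: cocycles_def)
  then obtain x where x: "x \<in> cspace X n" "i n x = y - b"
    using lift_i yb n by (metis (no_types, lifting) cocycles_def mem_Collect_eq)
  have "i (Suc n) (cdiff X n x) = i (Suc n) 0"
    using x yb n i_0 by (simp add: i_diff cocycles_def)
  then have "x \<in> cocycles X n"
    using i_inj [of "Suc n"] x n diffs(1) [of n] spaces(1) [of "Suc n"] V1.subspace_0
    by (auto simp: inj_on_def cocycles_def i_in p_in diff_in)
  moreover have "V = i n x +o coboundaries Y n"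
    using subspace_coset_eq_iff [OF vs(2) coboundaries_sub(2) [OF n]] y x b by simp
  ultimately show "V \<in> cohomology_map Y i n ` cohomology X n"
    using n by (auto simp: cohomology_def quot_def i_map intro!: image_eqI)
qed

lemma exact_Z:
  assumes n: "n \<ge> 1"
  shows "cohomology_map Z p n ` cohomology Y n =
    {W \<in> cohomology Z n. \<delta> n W = coboundaries X (Suc n)}"
proof (intro equalityI subsetI)
  fix W assume "W \<in> cohomology_map Z p n ` cohomology Y n"
  then obtain y where y: "y \<in> cocycles Y n" "W = p n y +o coboundaries Z n"
    using n by (auto simp: cohomology_def quot_def p_map)
  \<comment> \<open>The cocycle \<open>y\<close> is itself a lift, with vanishing differential, so 0
    is an admissible result.\<close>
  have "\<delta> n W = 0 +o coboundaries X (Suc n)"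
    unfolding y(2) using y n i_0 [of "Suc n"] V1.subspace_0 [OF spaces(1) [of "Suc n"]]
    by (intro connecting_map_eq [where y = y]) (auto simp: cocycles_def p_cocycles p_diff [symmetric] p_0
         intro: p_in)
  then show "W \<in> {W \<in> cohomology Z n. \<delta> n W = coboundaries X (Suc n)}"
    using y n p_cocycles by (auto simp: cohomology_def quot_def)
next
  fix W assume "W \<in> {W \<in> cohomology Z n. \<delta> n W = coboundaries X (Suc n)}"
  then obtain z where z: "z \<in> cocycles Z n" "W = z +o coboundaries Z n"
      "\<delta> n (z +o coboundaries Z n) = 0 +o coboundaries X (Suc n)"
    by (auto simp: cohomology_def quot_def)
  obtain y w where yw: "y \<in> cspace Y n" "p n y = z" "w \<in> cspace X (Suc n)" "i (Suc n) w = cdiff Y n y"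
    using snake_lift [OF n z(1)] by blast
  have "w +o coboundaries X (Suc n) = 0 +o coboundaries X (Suc n)"
    using connecting_map_eq [OF n yw(1,2) z(1) yw(3,4)] z by simp
  then have "w \<in> coboundaries X (Suc n)"
    using subspace_coset_eq_self_iff [OF vs(1) coboundaries_sub(1) [of "Suc n"]] by simp
  then obtain x where x: "x \<in> cspace X n" "w = cdiff X n x" using n by (auto simp: coboundaries_Suc)
  have ix: "i n x \<in> cspace Y n" "p n (i n x) = 0"
    using i_image [OF n] x by auto
  \<comment> \<open>As \<open>w\<close> is the differential of \<open>x\<close>, subtracting
    \<open>i n x\<close> turns the lift of \<open>z\<close> into a cocycle without changing its
    image under \<open>p\<close>.\<close>
  have "cdiff Y n (y - i n x) = 0"
    using linear_between_diff [OF vs(2,2) spaces(2) diffs(2)] yw x ix n by (simp add: i_diff [symmetric])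
  then have "y - i n x \<in> cocycles Y n"
    using ix yw n spaces(2) V2.subspace_diff by (auto simp: cocycles_def)
  moreover have "p n (y - i n x) = z"
    using linear_between_diff [OF vs(2,3) spaces(2) p_linear] yw x ix n by simp
  ultimately show "W \<in> cohomology_map Z p n ` cohomology Y n"
    using n z by (force simp: cohomology_def quot_def p_map)
qed

lemma exact_X:
  assumes n: "n \<ge> 1"
  shows "\<delta> n ` cohomology Z n =
    {U \<in> cohomology X (Suc n). cohomology_map Y i (Suc n) U = coboundaries Y (Suc n)}"
proof (intro equalityI subsetI)
  fix U assume "U \<in> \<delta> n ` cohomology Z n"
  then obtain z where z: "z \<in> cocycles Z n" "U = \<delta> n (z +o coboundaries Z n)"
    by (auto simp: cohomology_def quot_def)
  note s = snake [OF n z(1)] connecting_snake [OF n z(1)]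
  have "i (Suc n) (snd (snake n z)) \<in> coboundaries Y (Suc n)"
    using s n by (auto simp: coboundaries_Suc)
  then have "i (Suc n) (snd (snake n z)) +o coboundaries Y (Suc n) = 0 +o coboundaries Y (Suc n)"
    using subspace_coset_eq_self_iff [OF vs(2) coboundaries_sub(2) [of "Suc n"]] by simp
  then show "U \<in> {U \<in> cohomology X (Suc n). cohomology_map Y i (Suc n) U = coboundaries Y (Suc n)}"
    using s z by (auto simp: cohomology_def quot_def i_map)
next
  fix U assume "U \<in> {U \<in> cohomology X (Suc n). cohomology_map Y i (Suc n) U = coboundaries Y (Suc n)}"
  then obtain w where w: "w \<in> cocycles X (Suc n)" "U = w +o coboundaries X (Suc n)"
      "i (Suc n) w +o coboundaries Y (Suc n) = 0 +o coboundaries Y (Suc n)"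
    by (auto simp: cohomology_def quot_def i_map)
  then have "i (Suc n) w \<in> coboundaries Y (Suc n)"
    using subspace_coset_eq_self_iff [OF vs(2) coboundaries_sub(2) [of "Suc n"]] by simp
  then obtain y where y: "y \<in> cspace Y n" "i (Suc n) w = cdiff Y n y"
    using n by (auto simp: coboundaries_Suc)
  \<comment> \<open>The image of \<open>y\<close> in \<open>Z\<close> is a cocycle, and
    \<open>y\<close> itself is a lift of it with result \<open>w\<close>.\<close>
  have "p (Suc n) (i (Suc n) w) = 0" using i_image [of "Suc n"] w by (auto simp: cocycles_def)
  then have z: "p n y \<in> cocycles Z n"
    using y n p_diff p_linear by (auto simp: cocycles_def i_in p_in diff_in)
  then have "\<delta> n (p n y +o coboundaries Z n) = U"
    using connecting_map_eq [OF n y(1) refl z] w y by (simp add: cocycles_def)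
  then show "U \<in> \<delta> n ` cohomology Z n"
    using z by (auto simp: cohomology_def quot_def)
qed

theorem long_exact: "long_exact_sequence s1 X i s2 Y p s3 Z \<delta>"
proof -
  \<comment> \<open>In degree 1 the only coboundary is 0, so classes are single cocycles and
    injectivity is inherited from \<open>i\<close>.\<close>
  have "inj_on (cohomology_map Y i 1) (cohomology X 1)"
  proof (rule inj_onI)
    fix U V assume "U \<in> cohomology X 1" "V \<in> cohomology X 1"
      and eq: "cohomology_map Y i 1 U = cohomology_map Y i 1 V"
    then obtain x y where xy: "x \<in> cocycles X 1" "y \<in> cocycles X 1"
        "U = x +o coboundaries X 1" "V = y +o coboundaries X 1"
      by (auto simp: cohomology_def quot_def)
    then have "i 1 x = i 1 y"
      using eq i_map [of 1] subspace_coset_eq_iff [OF vs(2) coboundaries_sub(2) [of 1]]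
      by (simp add: coboundaries_def)
    then show "U = V" using xy i_inj [of 1] by (auto simp: inj_on_def cocycles_def)
  qed
  then show ?thesis
    unfolding long_exact_sequence_def
    by (intro conjI allI impI i_map_linear p_map_linear connecting_linear exact_Y exact_Z exact_X)
qed

theorem quotient_iso: "induces_quotient_iso X i s2 Y p s3 Z"
  unfolding induces_quotient_iso_def
proof (intro allI impI)
  \<comment> \<open>By exactness this image is the kernel of \<open>p\<close>.\<close>
  have I: "V2.subspace (i n ` cspace X n)" if n: "n \<ge> 1" for n
    using spaces(2) [OF n] p_linear [OF n] linear_between_0 [OF vs(2,3) spaces(2) p_linear] n
    by (auto simp: i_image V2.subspace_def linear_between_add linear_between_scale)
  have map: "quot_map (p n) {0} (y +o i n ` cspace X n) = p n y +o {0}"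
    if "n \<ge> 1" "y \<in> cspace Y n" for n y
    using that i_image p_0
    by (intro quot_map_coset [OF vs(2,3) spaces(2) I _ _ p_linear]) auto
  have mapZ: "quot_map (cdiff Z n) {0} (z +o {0}) = cdiff Z n z +o {0}"
    if "n \<ge> 1" "z \<in> cspace Z n" for n z
    using that linear_between_0 [OF vs(3,3) spaces(3) diffs(3)] V3.subspace_0 [OF spaces(3)]
    by (intro quot_map_coset [OF vs(3,3) spaces(3) _ _ _ diffs(3)]) auto
  have mapY: "quot_map (cdiff Y n) (i (Suc n) ` cspace X (Suc n)) (y +o i n ` cspace X n) =
      cdiff Y n y +o i (Suc n) ` cspace X (Suc n)"
    if "n \<ge> 1" "y \<in> cspace Y n" for n y
  proof (rule quot_map_coset [OF vs(2,2) spaces(2) I _ I diffs(2)])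
    show "i n ` cspace X n \<subseteq> cspace Y n" using that i_in by auto
    show "cdiff Y n ` i n ` cspace X n \<subseteq> i (Suc n) ` cspace X (Suc n)"
      using that i_diff [symmetric] diff_in(1) by auto
  qed (use that in auto)
  fix n :: nat assume n: "1 \<le> n"
  have "bij_betw (quot_map (p n) {0}) (quot (cspace Y n) (i n ` cspace X n)) (quot (cspace Z n) {0})"
  proof (rule bij_betw_imageI)
    show "inj_on (quot_map (p n) {0}) (quot (cspace Y n) (i n ` cspace X n))"
    proof (rule inj_onI)
      fix U V assume "U \<in> quot (cspace Y n) (i n ` cspace X n)" "V \<in> quot (cspace Y n) (i n ` cspace X n)"
        and eq: "quot_map (p n) {0} U = quot_map (p n) {0} V"
      then obtain x y where xy: "x \<in> cspace Y n" "y \<in> cspace Y n"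
          "U = x +o i n ` cspace X n" "V = y +o i n ` cspace X n"
        by (auto simp: quot_def)
      then have "p n x = p n y"
        using eq map n by (simp add: elt_set_plus_def)
      then have "x - y \<in> i n ` cspace X n"
        using xy n spaces(2) V2.subspace_diff linear_between_diff [OF vs(2,3) spaces(2) p_linear]
        by (simp add: i_image)
      then show "U = V" using xy subspace_coset_eq_iff [OF vs(2) I [OF n]] by simp
    qed
    have "quot_map (p n) {0} ` quot (cspace Y n) (i n ` cspace X n) = (\<lambda>z. z +o {0}) ` p n ` cspace Y n"
      unfolding quot_def image_image using map n by (auto intro!: image_cong)
    then show "quot_map (p n) {0} ` quot (cspace Y n) (i n ` cspace X n) = quot (cspace Z n) {0}"
      using p_image [OF n] by (simp add: quot_def)
  qed
  moreover have "quot_linear s2 (cspace Y n) (i n ` cspace X n) s3 (cspace Z n) {0} (quot_map (p n) {0})"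
    using n i_image by (intro quot_linear_quot_map [OF vs(2,3) spaces(2) I _ _ p_linear]) auto
  moreover have "quot_map (p (Suc n)) {0} (quot_map (cdiff Y n) (i (Suc n) ` cspace X (Suc n)) U) =
       quot_map (cdiff Z n) {0} (quot_map (p n) {0} U)"
    if U: "U \<in> quot (cspace Y n) (i n ` cspace X n)" for U
  proof -
    obtain y where y: "y \<in> cspace Y n" "U = y +o i n ` cspace X n" using U by (auto simp: quot_def)
    then show ?thesis
      using n linear_between_in [OF diffs(2) [OF n]] linear_between_in [OF p_linear [OF n]]
      by (simp add: mapY map mapZ p_diff)
  qed
  ultimately show "bij_betw (quot_map (p n) {0}) (quot (cspace Y n) (i n ` cspace X n)) (quot (cspace Z n) {0}) \<and>
    quot_linear s2 (cspace Y n) (i n ` cspace X n) s3 (cspace Z n) {0} (quot_map (p n) {0}) \<and>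
    (\<forall>U\<in>quot (cspace Y n) (i n ` cspace X n).
       quot_map (p (Suc n)) {0} (quot_map (cdiff Y n) (i (Suc n) ` cspace X (Suc n)) U) =
       quot_map (cdiff Z n) {0} (quot_map (p n) {0} U))"
    by blast
qed

end

text \<open>Only \<open>Y\<close> has to be known as a complex: the kernel of \<open>p\<close> is
  stable under its differential, and surjectivity of \<open>p\<close> transfers linearity and
  \<open>d d = 0\<close> to \<open>Z\<close>. For the pre-Lie complex this replaces a computation
  with the square of its differential.\<close>

lemma short_exact_sequence_kernel:
  assumes vs: "vector_space s2" "vector_space s3" and Y: "cochain_complex s2 Y"
    and Z: "\<And>n. n \<ge> 1 \<Longrightarrow> module.subspace s3 (cspace Z n)"
    and p: "cochain_map s2 Y s3 Z p" "\<And>n. n \<ge> 1 \<Longrightarrow> p n ` cspace Y n = cspace Z n"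
    and X: "\<And>n. n \<ge> 1 \<Longrightarrow> cspace X n = {y \<in> cspace Y n. p n y = 0}" "cdiff X = cdiff Y"
    and i: "\<And>n x. i n x = x"
  shows "short_exact_sequence s2 X i s2 Y p s3 Z"
proof -
  interpret V2: vector_space s2 by fact
  interpret V3: vector_space s3 by fact
  have Ysp: "V2.subspace (cspace Y n)"
    and Yd: "linear_between s2 s2 (cspace Y n) (cspace Y (Suc n)) (cdiff Y n)"
    and Ydd: "\<forall>x\<in>cspace Y n. cdiff Y (Suc n) (cdiff Y n x) = 0" if "n \<ge> 1" for n
    using Y that by (auto simp: cochain_complex_def)
  have pl: "linear_between s2 s3 (cspace Y n) (cspace Z n) (p n)"
    and pd: "\<forall>y\<in>cspace Y n. p (Suc n) (cdiff Y n y) = cdiff Z n (p n y)" if "n \<ge> 1" for n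
    using p(1) that by (auto simp: cochain_map_def)
  have Zd0: "cdiff Z n 0 = 0" if n: "n \<ge> 1" for n
  proof -
    have "cdiff Z n (p n 0) = p (Suc n) (cdiff Y n 0)" using pd [OF n] Ysp [OF n] V2.subspace_0 by auto
    then show ?thesis
      using linear_between_0 [OF vs Ysp pl] linear_between_0 [OF vs(1,1) Ysp Yd] n by simp
  qed
  have "cochain_complex s2 X"
    unfolding cochain_complex_def
  proof (intro allI impI conjI)
    fix n :: nat assume n: "1 \<le> n"
    show "V2.subspace (cspace X n)"
      using Ysp [OF n] pl [OF n] linear_between_0 [OF vs Ysp pl] n
      by (auto simp: X V2.subspace_def linear_between_add linear_between_scale)
    show "linear_between s2 s2 (cspace X n) (cspace X (Suc n)) (cdiff X n)"
      using Yd [OF n] pd [OF n] Zd0 [OF n] n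
      by (auto simp: X linear_between_def)
    show "\<forall>x\<in>cspace X n. cdiff X (Suc n) (cdiff X n x) = 0"
      using Ydd n by (simp add: X)
  qed
  moreover have "cochain_complex s3 Z"
    unfolding cochain_complex_def
  proof (intro allI impI conjI ballI)
    fix n :: nat assume n: "1 \<le> n"
    show "V3.subspace (cspace Z n)" by (rule Z [OF n])
    have lift: "\<exists>y\<in>cspace Y n. p n y = z" if "z \<in> cspace Z n" for z using p(2) [OF n] that by (metis imageE)
    have pdY: "cdiff Z n (p n y) = p (Suc n) (cdiff Y n y)" if "y \<in> cspace Y n" for y
      using pd [OF n] that by auto
    show "linear_between s3 s3 (cspace Z n) (cspace Z (Suc n)) (cdiff Z n)"
      unfolding linear_between_def
    proof (intro conjI ballI allI)
      show "cdiff Z n ` cspace Z n \<subseteq> cspace Z (Suc n)"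
      proof
        fix v assume "v \<in> cdiff Z n ` cspace Z n"
        then obtain y where "y \<in> cspace Y n" "v = p (Suc n) (cdiff Y n y)"
          using lift pdY by auto
        then show "v \<in> cspace Z (Suc n)"
          using linear_between_in [OF pl [of "Suc n"]] linear_between_in [OF Yd [OF n]] by simp
      qed
    next
      fix x y assume "x \<in> cspace Z n" "y \<in> cspace Z n"
      then obtain a b where ab: "a \<in> cspace Y n" "b \<in> cspace Y n" "x = p n a" "y = p n b"
        using lift by metis
      then have "cdiff Z n (p n (a + b)) = p (Suc n) (cdiff Y n a + cdiff Y n b)"
        using pdY V2.subspace_add [OF Ysp [OF n]] linear_between_add [OF Yd [OF n]] by simp
      then show "cdiff Z n (x + y) = cdiff Z n x + cdiff Z n y"
        using ab pdY linear_between_add [OF pl [OF n]] linear_between_add [OF pl [of "Suc n"]]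
          linear_between_in [OF Yd [OF n]] by simp
    next
      fix c x assume "x \<in> cspace Z n"
      then obtain a where ab: "a \<in> cspace Y n" "x = p n a" using lift by metis
      then have "cdiff Z n (p n (s2 c a)) = p (Suc n) (s2 c (cdiff Y n a))"
        using pdY V2.subspace_scale [OF Ysp [OF n]] linear_between_scale [OF Yd [OF n]] by simp
      then show "cdiff Z n (s3 c x) = s3 c (cdiff Z n x)"
        using ab pdY linear_between_scale [OF pl [OF n]] linear_between_scale [OF pl [of "Suc n"]]
          linear_between_in [OF Yd [OF n]] by simp
    qed
    fix x assume "x \<in> cspace Z n"
    then obtain a where ab: "a \<in> cspace Y n" "x = p n a" using lift by metis
    have "cdiff Z (Suc n) (cdiff Z n x) = p (Suc (Suc n)) (cdiff Y (Suc n) (cdiff Y n a))"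
      using ab pdY pd [of "Suc n"] linear_between_in [OF Yd [OF n]] by simp
    then show "cdiff Z (Suc n) (cdiff Z n x) = 0"
      using Ydd [OF n] ab linear_between_0 [OF vs Ysp pl, of "Suc (Suc n)"] by simp
  qed
  moreover have "cochain_map s2 X s2 Y i"
    by (auto simp: cochain_map_def linear_between_def X i)
  ultimately show ?thesis
    unfolding short_exact_sequence_def using Y p X i by (auto simp: inj_on_def)
qed

section \<open>The operad ComDer\<close>

text \<open>Linear extension of a map between basis elements. The symmetric action and composition
  with a single tree on either side are instances, so that one set of rules covers them.\<close>

definition tmap :: "('a \<Rightarrow> 'b) \<Rightarrow> ('a \<Rightarrow>\<^sub>0 'k::comm_ring_1) \<Rightarrow> ('b \<Rightarrow>\<^sub>0 'k)"
  where "tmap f u = (\<Sum>t\<in>Poly_Mapping.keys u. Poly_Mapping.single (f t) (Poly_Mapping.lookup u t))"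

abbreviation smul :: "'k::comm_ring_1 \<Rightarrow> ('a \<Rightarrow>\<^sub>0 'k) \<Rightarrow> ('a \<Rightarrow>\<^sub>0 'k)"
  where "smul c u \<equiv> Poly_Mapping.map ((*) c) u"

lemma lookup_smul [simp]: "Poly_Mapping.lookup (smul c u) t = c * Poly_Mapping.lookup u t"
  by (simp add: Poly_Mapping.map.rep_eq when_def)

lemma tmap_0 [simp]: "tmap f 0 = 0"
  by (simp add: tmap_def)

lemma tmap_add: "tmap f (u + v) = tmap f u + tmap f v"
  unfolding tmap_def by (rule setsum_keys_plus_distrib) (simp_all add: single_add)

lemma tmap_diff: "tmap f (u - v) = tmap f u - tmap f v"
  using tmap_add [of f "u - v" v] by (simp add: eq_diff_eq)

lemma tmap_single [simp]: "tmap f (Poly_Mapping.single t c) = Poly_Mapping.single (f t) c"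
  by (simp add: tmap_def)

lemma tmap_sum: "tmap f (\<Sum>x\<in>S. u x) = (\<Sum>x\<in>S. tmap f (u x))"
  by (induction S rule: infinite_finite_induct) (simp_all add: tmap_add)

lemma tmap_tmap: "tmap f (tmap g u) = tmap (\<lambda>t. f (g t)) u"
  by (simp add: tmap_def [of g] tmap_sum) (simp add: tmap_def)

lemma tmap_cong: "(\<And>t. t \<in> Poly_Mapping.keys u \<Longrightarrow> f t = g t) \<Longrightarrow> tmap f u = tmap g u"
  unfolding tmap_def by (intro sum.cong) simp_all

lemma lookup_tmap:
  "Poly_Mapping.lookup (tmap f u) s =
    (\<Sum>t\<in>Poly_Mapping.keys u. if f t = s then Poly_Mapping.lookup u t else 0)"
  by (auto simp: tmap_def lookup_sum lookup_single when_def intro!: sum.cong)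

lemma keys_tmap: "Poly_Mapping.keys (tmap f u) \<subseteq> f ` Poly_Mapping.keys u"
proof
  fix s assume "s \<in> Poly_Mapping.keys (tmap f u)"
  then have "(\<Sum>t\<in>Poly_Mapping.keys u. if f t = s then Poly_Mapping.lookup u t else 0) \<noteq> 0"
    by (simp add: in_keys_iff lookup_tmap)
  then obtain t where "t \<in> Poly_Mapping.keys u" "(if f t = s then Poly_Mapping.lookup u t else 0) \<noteq> 0"
    using sum.not_neutral_contains_not_neutral by blast
  then show "s \<in> f ` Poly_Mapping.keys u" by (auto split: if_splits)
qed

lemma tmap_ident: "tmap (\<lambda>t. t) u = u"
  by (rule poly_mapping_eqI) (simp add: lookup_tmap sum.delta in_keys_iff)

lemma smul_tmap: "smul c (tmap f u) = tmap f (smul c u)"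
proof (rule poly_mapping_eqI)
  fix s
  have "Poly_Mapping.lookup (tmap f (smul c u)) s =
      (\<Sum>t\<in>Poly_Mapping.keys u. if f t = s then Poly_Mapping.lookup (smul c u) t else 0)"
    unfolding lookup_tmap by (rule sum.mono_neutral_left) (auto simp: in_keys_iff)
  also have "\<dots> = Poly_Mapping.lookup (smul c (tmap f u)) s"
    by (auto simp: lookup_tmap sum_distrib_left intro!: sum.cong)
  finally show "Poly_Mapping.lookup (smul c (tmap f u)) s = Poly_Mapping.lookup (tmap f (smul c u)) s" ..
qed

lemma free_act_eq_tmap: "free_act \<sigma> u = tmap (map_tree (inv \<sigma>)) u"
  by (simp add: free_act_def tmap_def)

lemma free_comp_tree_right: "free_comp i m u (tree_elem s) = tmap (graft i m s) u"
  by (simp add: free_comp_def tmap_def)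

lemma free_comp_tree_left: "free_comp i m (tree_elem t) v = tmap (\<lambda>s. graft i m s t) v"
  by (simp add: free_comp_def tmap_def)

text \<open>\<open>ComDer(n)\<close> acts as the polynomial ring in \<open>n\<close> variables: \<open>D\<close> multiplies by the sum of
  the variables at the leaves below it (\<open>D\<close> is \<open>d/dt\<close> acting on products of exponentials \<open>e\<^bsup>l\<^sub>it\<^esup>\<close>).\<close>

primrec tree_eval :: "('l \<Rightarrow> 'k::comm_ring_1) \<Rightarrow> 'l tree \<Rightarrow> 'k" where
  "tree_eval l (Leaf j) = 1"
| "tree_eval l (Der t) = sum_list (map l (leaves t)) * tree_eval l t"
| "tree_eval l (Mul t u) = tree_eval l t * tree_eval l u"

definition free_eval :: "('l \<Rightarrow> 'k::comm_ring_1) \<Rightarrow> ('l tree \<Rightarrow>\<^sub>0 'k) \<Rightarrow> 'k"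
  where "free_eval l u = (\<Sum>t\<in>Poly_Mapping.keys u. Poly_Mapping.lookup u t * tree_eval l t)"

lemma leaves_map_tree [simp]: "leaves (map_tree f t) = map f (leaves t)"
  by (induction t) auto

lemma set_tree_eq: "set_tree t = set (leaves t)"
  by (induction t) auto

lemma leaves_nonempty [simp]: "leaves t \<noteq> []"
  by (induction t) auto

lemma tree_eval_map_tree: "tree_eval l (map_tree f t) = tree_eval (\<lambda>j. l (f j)) t"
  by (induction t) (auto simp: comp_def)

lemma free_eval_0 [simp]: "free_eval l 0 = 0"
  by (simp add: free_eval_def)

lemma free_eval_add: "free_eval l (u + v) = free_eval l u + free_eval l v"
  unfolding free_eval_def by (rule setsum_keys_plus_distrib) (simp_all add: distrib_right)

lemma free_eval_diff: "free_eval l (u - v) = free_eval l u - free_eval l v"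
  using free_eval_add [of l "u - v" v] by (simp add: eq_diff_eq)

lemma free_eval_sum: "free_eval l (\<Sum>x\<in>S. u x) = (\<Sum>x\<in>S. free_eval l (u x))"
  by (induction S rule: infinite_finite_induct) (simp_all add: free_eval_add)

lemma free_eval_single [simp]: "free_eval l (Poly_Mapping.single t c) = c * tree_eval l t"
  by (simp add: free_eval_def)

lemma free_eval_smul: "free_eval l (smul c u) = c * free_eval l u"
proof -
  have "free_eval l (smul c u) = (\<Sum>t\<in>Poly_Mapping.keys u. Poly_Mapping.lookup (smul c u) t * tree_eval l t)"
    unfolding free_eval_def by (rule sum.mono_neutral_left) (auto simp: in_keys_iff)
  then show ?thesis by (simp add: free_eval_def sum_distrib_left mult.assoc)
qed

lemma free_eval_tmap:
  "free_eval l (tmap f u) = (\<Sum>t\<in>Poly_Mapping.keys u. Poly_Mapping.lookup u t * tree_eval l (f t))"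
  by (simp add: tmap_def free_eval_sum)

text \<open>The weights seen by the outer tree of a graft: a \<open>D\<close> above leaf
  \<open>i\<close> counts that leaf with the total weight of the \<open>m\<close> leaves that
  replace it.\<close>

definition graft_point :: "nat \<Rightarrow> nat \<Rightarrow> (nat \<Rightarrow> 'k::comm_ring_1) \<Rightarrow> nat \<Rightarrow> 'k"
  where "graft_point i m l j =
    (if j < i then l j else if j = i then (\<Sum>k=1..m. l (k + i - 1)) else l (j + m - 1))"

lemma sum_list_distinct_leaves:
  assumes "s \<in> trees m"
  shows "sum_list (map l (leaves s)) = (\<Sum>k=1..m. l k)"
  using assms by (simp add: trees_def sum_list_distinct_conv_sum_set)

lemma sum_leaves_graft:
  assumes "s \<in> trees m"
  shows "sum_list (map l (leaves (graft i m s t))) = sum_list (map (graft_point i m l) (leaves t))"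
  using sum_list_distinct_leaves [OF assms, of "\<lambda>k. l (k + i - 1)"]
  by (induction t) (auto simp: graft_point_def comp_def)

text \<open>The exponent counts the copies of \<open>s\<close> in the graft. It is 1 for
  \<open>t\<close> in \<open>trees n\<close> with \<open>i\<close> between 1 and \<open>n\<close>,
  but the induction passes through subtrees that may lack the leaf \<open>i\<close>.\<close>

lemma tree_eval_graft:
  assumes "s \<in> trees m"
  shows "tree_eval l (graft i m s t) =
    tree_eval (graft_point i m l) t * tree_eval (\<lambda>k. l (k + i - 1)) s ^ count_list (leaves t) i"
  by (induction t) (auto simp: sum_leaves_graft [OF assms] tree_eval_map_tree power_add)

lemma count_leaves: "t \<in> trees n \<Longrightarrow> i \<in> {1..n} \<Longrightarrow> count_list (leaves t) i = 1"
proof -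
  have "count_list xs i = 1" if "distinct xs" "i \<in> set xs" for xs
    using that by (induction xs) (auto simp: count_list_0_iff)
  then show "t \<in> trees n \<Longrightarrow> i \<in> {1..n} \<Longrightarrow> count_list (leaves t) i = 1"
    by (simp add: trees_def)
qed

lemma free_eval_comp:
  assumes "u \<in> free_op n" "v \<in> free_op m" "i \<in> {1..n}"
  shows "free_eval l (free_comp i m u v) =
    free_eval (graft_point i m l) u * free_eval (\<lambda>k. l (k + i - 1)) v"
proof -
  have "tree_eval l (graft i m s t) = tree_eval (graft_point i m l) t * tree_eval (\<lambda>k. l (k + i - 1)) s"
    if "t \<in> Poly_Mapping.keys u" "s \<in> Poly_Mapping.keys v" for s t
    using assms that tree_eval_graft [of s m l i t] count_leaves [of t n i]
    by (simp add: free_op_def subset_iff)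
  then show ?thesis
    unfolding free_comp_def free_eval_sum free_eval_def [of _ u] free_eval_def [of _ v] sum_product
    by (intro sum.cong refl) (simp add: mult_ac)
qed

lemma leaves_graft_trees:
  assumes s: "s \<in> trees m" and i: "1 \<le> i"
  shows "set (leaves (graft i m s t)) = 
    (\<Union>j\<in>set (leaves t). if j < i then {j} else if j = i then {i..<i+m} else {j + m - 1})"
proof (induction t)
  case (Leaf j)
  have "(\<lambda>l. l + i - 1) ` {1..m} = {i..<i+m}"
  proof
    show "{i..<i+m} \<subseteq> (\<lambda>l. l + i - 1) ` {1..m}"
    proof
      fix k assume "k \<in> {i..<i+m}"
      then have "k = (k - i + 1) + i - 1" "k - i + 1 \<in> {1..m}" by auto
      then show "k \<in> (\<lambda>l. l + i - 1) ` {1..m}" by blast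
    qed
  qed (use i in auto)
  then show ?case using s by (auto simp: trees_def)
qed auto

lemma distinct_leaves_graft:
  assumes s: "s \<in> trees m" and i: "1 \<le> i" and "distinct (leaves t)"
  shows "distinct (leaves (graft i m s t))"
proof -
  have m: "m \<ge> 1"
    using s leaves_nonempty [of s] by (cases m) (auto simp: trees_def)
  \<comment> \<open>The labels of the graft that come from leaf \<open>j\<close>; they are disjoint
    for distinct leaves.\<close>
  define S where "S j = (if j < i then {j} else if j = i then {i..<i+m} else {j + m - 1})" for j
  have disj: "S j \<inter> S k = {}" if "j \<noteq> k" for j k
    using that m i by (auto simp: S_def split: if_splits)
  show ?thesis
    using assms(3)
  proof (induction t)
    case (Leaf j)
    have "inj_on (\<lambda>l. l + i - 1) {1..m}" using i by (auto simp: inj_on_def)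
    then show ?case using s by (simp add: trees_def distinct_map)
  next
    case (Mul t u)
    have "set (leaves (graft i m s t)) \<inter> set (leaves (graft i m s u)) = {}"
      unfolding leaves_graft_trees [OF s i] S_def [symmetric]
    proof (rule equals0I)
      fix x assume "x \<in> (\<Union>j\<in>set (leaves t). S j) \<inter> (\<Union>j\<in>set (leaves u). S j)"
      then obtain j k where "j \<in> set (leaves t)" "k \<in> set (leaves u)" "x \<in> S j \<inter> S k" by blast
      moreover have "j \<noteq> k" using Mul.prems calculation by auto
      ultimately show False using disj by blast
    qed
    then show ?case using Mul by simp
  qed simp
qed

lemma graft_trees:
  assumes "t \<in> trees n" "s \<in> trees m" "i \<in> {1..n}"
  shows "graft i m s t \<in> trees (n + m - 1)"
proof -
  have m: "m \<ge> 1"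
    using assms(2) leaves_nonempty [of s] by (cases m) (auto simp: trees_def)
  have "set (leaves (graft i m s t)) = {1..n + m - 1}"
  proof -
    have "j \<in> (\<Union>j\<in>{1..n}. if j < i then {j} else if j = i then {i..<i+m} else {j + m - 1})"
      if j: "j \<in> {1..n + m - 1}" for j
    proof -
      \<comment> \<open>A label lies before, inside or after the inserted block; in the last case it
        is the old label \<open>j + 1 - m\<close> shifted by \<open>m - 1\<close>.\<close>
      consider "j < i" | "i \<le> j" "j < i + m" | "j \<ge> i + m" by linarith
      then show ?thesis
      proof cases
        case 1
        then show ?thesis using j assms(3) by (intro UN_I [of j]) auto
      next
        case 2
        then show ?thesis using assms(3) by (intro UN_I [of i]) auto
      next
        case 3
        then show ?thesis using j m assms(3) by (intro UN_I [of "j + 1 - m"]) auto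
      qed
    qed
    then have "{1..n + m - 1} \<subseteq> (\<Union>j\<in>{1..n}. if j < i then {j} else if j = i then {i..<i+m} else {j + m - 1})"
      by blast
    moreover have "(if j < i then {j} else if j = i then {i..<i+m} else {j + m - 1}) \<subseteq> {1..n + m - 1}"
      if "j \<in> {1..n}" for j
      using that assms(3) m by auto
    moreover have "set (leaves t) = {1..n}" using assms by (simp add: trees_def)
    moreover have "1 \<le> i" using assms(3) by simp
    note leaves_graft_trees [OF assms(2) this, of t]
    ultimately show ?thesis
      by (intro subset_antisym) (simp_all only: UN_subset_iff, blast)
  qed
  then show ?thesis
    using distinct_leaves_graft [OF assms(2), of i t] assms(1,3) by (simp add: trees_def)
qed

lemma free_op_comp:
  assumes "u \<in> free_op n" "v \<in> free_op m" "i \<in> {1..n}"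
  shows "free_comp i m u v \<in> free_op (n + m - 1)"
proof -
  have "Poly_Mapping.keys (free_comp i m u v) \<subseteq>
    (\<Union>t\<in>Poly_Mapping.keys u. \<Union>s\<in>Poly_Mapping.keys v. {graft i m s t})"
    unfolding free_comp_def
    by (intro order.trans [OF keys_sum] UN_mono order.refl) (auto simp: keys_single)
  then show ?thesis
    using assms graft_trees unfolding free_op_def by blast
qed

lemma permutes_trees:
  assumes "\<sigma> permutes {1..n}" "t \<in> trees n"
  shows "map_tree \<sigma> t \<in> trees n"
  using assms permutes_image [OF assms(1)] permutes_inj [OF assms(1)]
  by (auto simp: trees_def distinct_map intro: inj_on_subset)

text \<open>Commutativity and associativity hold in the coefficient ring, Leibniz holds because the
  weight of a product is the sum of the weights, and actions and compositions merely change the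
  point of evaluation or add a factor. Membership in \<open>free_op\<close> is carried along, as
  evaluating a composite needs every leaf exactly once.\<close>

theorem ComDer_ideal_eval:
  "ComDer_ideal n u \<Longrightarrow> u \<in> free_op n \<and> (\<forall>l. free_eval l u = 0)"
proof (induction rule: ComDer_ideal.induct)
  case commutative
  show ?case
    by (auto simp: free_op_def trees_def free_eval_diff dest!: subsetD [OF keys_diff])
next
  case associative
  show ?case
    by (auto simp: free_op_def trees_def free_eval_diff dest!: subsetD [OF keys_diff])
next
  case Leibniz
  show ?case
    by (auto simp: free_op_def trees_def free_eval_diff free_eval_add
        dest!: subsetD [OF keys_diff] subsetD [OF Poly_Mapping.keys_add])
next
  case (zero n)
  show ?case by (simp add: free_op_def)
next
  case (add n u v)
  then show ?case
    using Poly_Mapping.keys_add [of u v] by (auto simp: free_op_def free_eval_add)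
next
  case (scale n u c)
  have "Poly_Mapping.keys (smul c u) \<subseteq> Poly_Mapping.keys u" by (auto simp: in_keys_iff)
  then show ?case using scale by (auto simp: free_op_def free_eval_smul)
next
  case (act n u \<sigma>)
  then show ?case
    using keys_tmap [of "map_tree (inv \<sigma>)" u] permutes_trees [OF permutes_inv [OF act(2)]]
    unfolding free_act_eq_tmap free_eval_tmap tree_eval_map_tree free_op_def
    by (auto simp: free_eval_def)
next
  case (comp_left n u v m i)
  then show ?case using free_op_comp [of u n v m i] free_eval_comp [of u n v m i] by simp
next
  case (comp_right m u v n i)
  then show ?case using free_op_comp [of v n u m i] free_eval_comp [of v n u m i] by simp
qed

subsection \<open>Relations between trees with arbitrary labels\<close>

definition tree_on :: "'l set \<Rightarrow> 'l tree \<Rightarrow> bool"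
  where "tree_on A t \<longleftrightarrow> distinct (leaves t) \<and> set (leaves t) = A"

definition combs_on :: "'l set \<Rightarrow> ('l tree \<Rightarrow>\<^sub>0 'k::zero) \<Rightarrow> bool"
  where "combs_on A u \<longleftrightarrow> (\<forall>t\<in>Poly_Mapping.keys u. tree_on A t)"

text \<open>The ideal transported to arbitrary finite label sets, independently of a numbering.
  Subtrees then keep their labels, and products with disjoint labels can be formed without shifting
  indices.\<close>

definition relation :: "'l set \<Rightarrow> ('l tree \<Rightarrow>\<^sub>0 'k::field) \<Rightarrow> bool"
  where "relation A u \<longleftrightarrow> finite A \<and> combs_on A u \<and>
    (\<forall>n \<beta>. bij_betw \<beta> A {1..n} \<longrightarrow> ComDer_ideal n (tmap (map_tree \<beta>) u))"

primrec subst :: "'l \<Rightarrow> 'l tree \<Rightarrow> 'l tree \<Rightarrow> 'l tree" where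
  "subst a s (Leaf j) = (if j = a then s else Leaf j)"
| "subst a s (Der t) = Der (subst a s t)"
| "subst a s (Mul t u) = Mul (subst a s t) (subst a s u)"

lemma trees_tree_on: "trees n = {t. tree_on {1..n} t}"
  by (simp add: trees_def tree_on_def)

lemma tree_on_map_tree: "tree_on A t \<Longrightarrow> bij_betw \<beta> A B \<Longrightarrow> tree_on B (map_tree \<beta> t)"
  by (auto simp: tree_on_def distinct_map bij_betw_def)

lemma tree_on_finite: "tree_on A t \<Longrightarrow> finite A"
  by (auto simp: tree_on_def)

lemma map_tree_cong_on: "tree_on A t \<Longrightarrow> (\<And>x. x \<in> A \<Longrightarrow> f x = g x) \<Longrightarrow> map_tree f t = map_tree g t"
  by (rule tree.map_cong0) (auto simp: tree_on_def set_tree_eq)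

lemma combs_on_add: "combs_on A u \<Longrightarrow> combs_on A v \<Longrightarrow> combs_on A (u + v)"
  using Poly_Mapping.keys_add [of u v] by (auto simp: combs_on_def)

lemma combs_on_diff: "combs_on A u \<Longrightarrow> combs_on A v \<Longrightarrow> combs_on A (u - v :: _ \<Rightarrow>\<^sub>0 'k::ab_group_add)"
  by (auto simp: combs_on_def in_keys_iff lookup_minus)

lemma combs_on_smul: "combs_on A u \<Longrightarrow> combs_on A (smul c u)"
  by (auto simp: combs_on_def in_keys_iff)

lemma combs_on_single: "tree_on A t \<Longrightarrow> combs_on A (Poly_Mapping.single t c)"
  by (auto simp: combs_on_def)

lemma combs_on_tmap: "combs_on A u \<Longrightarrow> (\<And>t. tree_on A t \<Longrightarrow> tree_on B (f t)) \<Longrightarrow> combs_on B (tmap f u)"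
  using keys_tmap [of f u] by (auto simp: combs_on_def)

text \<open>One numbering suffices: any other differs from it by a permutation, and the ideal is
  stable under permutations.\<close>

lemma relationI:
  assumes \<beta>: "bij_betw \<beta> A {1..n}" and u: "ComDer_ideal n (tmap (map_tree \<beta>) u)" "combs_on A u"
  shows "relation A u"
  unfolding relation_def
proof (intro conjI allI impI)
  show "finite A" using \<beta> bij_betw_finite by blast
  fix n' :: nat and \<beta>' assume \<beta>': "bij_betw \<beta>' A {1..n'}"
  then have n': "n' = n" using bij_betw_same_card [OF \<beta>] bij_betw_same_card [OF \<beta>'] by simp
  define \<sigma> where "\<sigma> x = (if x \<in> {1..n} then \<beta>' (inv_into A \<beta> x) else x)" for x
  have "bij_betw (\<beta>' \<circ> inv_into A \<beta>) {1..n} {1..n}"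
    using \<beta> \<beta>' n' by (intro bij_betw_trans [OF bij_betw_inv_into]) auto
  then have "bij_betw \<sigma> {1..n} {1..n}"
    by (rule bij_betw_cong [THEN iffD1, rotated]) (auto simp: \<sigma>_def)
  then have \<sigma>: "\<sigma> permutes {1..n}"
    by (rule bij_imp_permutes) (auto simp: \<sigma>_def)
  \<comment> \<open>\<open>free_act\<close> relabels by the inverse permutation, so acting with
    \<open>inv \<sigma>\<close> relabels by \<open>\<sigma>\<close>.\<close>
  have "ComDer_ideal n (free_act (inv \<sigma>) (tmap (map_tree \<beta>) u))"
    using u \<sigma> permutes_inv by (intro ComDer_ideal.act)
  also have "free_act (inv \<sigma>) (tmap (map_tree \<beta>) u) = tmap (\<lambda>t. map_tree \<sigma> (map_tree \<beta> t)) u"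
    using \<sigma> by (simp add: free_act_eq_tmap tmap_tmap permutes_inv_inv)
  also have "\<dots> = tmap (map_tree \<beta>') u"
  proof (rule tmap_cong)
    fix t assume "t \<in> Poly_Mapping.keys u"
    then have "tree_on A t" using u(2) by (auto simp: combs_on_def)
    then show "map_tree \<sigma> (map_tree \<beta> t) = map_tree \<beta>' t"
      using \<beta> by (auto simp: tree.map_comp \<sigma>_def bij_betw_def intro!: map_tree_cong_on)
  qed
  finally show "ComDer_ideal n' (tmap (map_tree \<beta>') u)" using n' by simp
qed (use u in auto)

lemma relation_0: "finite A \<Longrightarrow> relation A 0"
  by (simp add: relation_def combs_on_def ComDer_ideal.zero)

lemma relation_add: "relation A u \<Longrightarrow> relation A v \<Longrightarrow> relation A (u + v)"
  by (simp add: relation_def combs_on_add tmap_add ComDer_ideal.add)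

lemma relation_smul: "relation A u \<Longrightarrow> relation A (smul c u)"
  by (simp add: relation_def combs_on_smul smul_tmap [symmetric] ComDer_ideal.scale)

lemma smul_minus_one: "smul (-1) u = - u"
  by (rule poly_mapping_eqI) simp

lemma relation_diff: "relation A u \<Longrightarrow> relation A v \<Longrightarrow> relation A (u - v)"
  using relation_add [of A u "smul (-1) v"] relation_smul [of A v "-1"] by (simp add: smul_minus_one)

lemma finite_bij_nat: "finite A \<Longrightarrow> \<exists>\<beta>. bij_betw \<beta> A {1..card A}"
  using ex_bij_betw_nat_finite_1 bij_betw_inv_into by blast

text \<open>The label \<open>a\<close> is sent to \<open>1\<close>, so that substitution becomes \<open>\<circ>\<^sub>1\<close>.\<close>

lemma subst_relabel:
  fixes A B :: "'l set"
  assumes A: "finite A" "a \<in> A" and B: "finite B" and disj: "B \<inter> (A - {a}) = {}"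
  obtains \<beta> \<gamma> \<theta> :: "'l \<Rightarrow> nat" and n m :: nat where "bij_betw \<beta> A {1..n}" "bij_betw \<gamma> B {1..m}"
    "bij_betw \<theta> ((A - {a}) \<union> B) {1..n + m - 1}" "1 \<in> {1..n}"
    "\<And>t s. tree_on A t \<Longrightarrow> tree_on B s \<Longrightarrow>
      map_tree \<theta> (subst a s t) = graft 1 m (map_tree \<gamma> s) (map_tree \<beta> t)"
proof -
  define k where "k = card (A - {a})"
  define m where "m = card B"
  obtain \<epsilon> where \<epsilon>: "bij_betw \<epsilon> (A - {a}) {1..k}"
    using finite_bij_nat [of "A - {a}"] A k_def by blast
  obtain \<gamma> where \<gamma>: "bij_betw \<gamma> B {1..m}"
    using finite_bij_nat [of B] B m_def by blast
  define \<beta> where "\<beta> x = (if x = a then 1 else \<epsilon> x + 1)" for x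
  \<comment> \<open>In a graft at 1 the leaves of \<open>s\<close> come first, and a leaf
    \<open>\<epsilon> x + 1\<close> of the outer tree moves to
    \<open>\<epsilon> x + m\<close>.\<close>
  define \<theta> where "\<theta> x = (if x \<in> B then \<gamma> x else \<epsilon> x + m)" for x
  have "bij_betw (\<lambda>x. x + 1) {1..k} {2..k+1}"
    by (rule bij_betwI [where g = "\<lambda>x. x - 1"]) auto
  from bij_betw_trans [OF \<epsilon> this] have "bij_betw \<beta> (A - {a}) {2..k+1}"
    by (rule bij_betw_cong [THEN iffD1, rotated]) (auto simp: \<beta>_def)
  moreover have "bij_betw \<beta> {a} {1}" by (simp add: \<beta>_def)
  ultimately have "bij_betw \<beta> ({a} \<union> (A - {a})) ({1} \<union> {2..k+1})"
    by (rule_tac bij_betw_combine) auto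
  moreover have "{a} \<union> (A - {a}) = A" "{1} \<union> {2..k+1} = {1..k+1}" using A by auto
  ultimately have \<beta>: "bij_betw \<beta> A {1..k+1}" by simp
  have "bij_betw (\<lambda>x. x + m) {1..k} {m+1..k+m}"
    by (rule bij_betwI [where g = "\<lambda>x. x - m"]) auto
  from bij_betw_trans [OF \<epsilon> this] have "bij_betw \<theta> (A - {a}) {m+1..k+m}"
    by (rule bij_betw_cong [THEN iffD1, rotated]) (use disj in \<open>auto simp: \<theta>_def\<close>)
  moreover have "bij_betw \<theta> B {1..m}"
    by (rule bij_betw_cong [THEN iffD1, rotated, OF \<gamma>]) (auto simp: \<theta>_def)
  ultimately have "bij_betw \<theta> ((A - {a}) \<union> B) ({m+1..k+m} \<union> {1..m})"
    by (rule_tac bij_betw_combine) auto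
  moreover have "{m+1..k+m} \<union> {1..m} = {1..k + 1 + m - 1}" by auto
  ultimately have \<theta>: "bij_betw \<theta> ((A - {a}) \<union> B) {1..k + 1 + m - 1}" by simp
  have "map_tree \<theta> (subst a s t) = graft 1 m (map_tree \<gamma> s) (map_tree \<beta> t)"
    if "set (leaves t) \<subseteq> A" "tree_on B s" for t s
    using that(1)
  proof (induction t)
    case (Leaf j)
    show ?case
    proof (cases "j = a")
      case True
      have "map_tree \<theta> s = map_tree \<gamma> s"
        using that(2) by (rule map_tree_cong_on) (auto simp: \<theta>_def)
      then show ?thesis using True by (simp add: \<beta>_def tree.map_ident)
    next
      case False
      then have "\<epsilon> j \<ge> 1" using Leaf \<epsilon> by (auto simp: bij_betw_def)
      then show ?thesis using Leaf False disj by (auto simp: \<beta>_def \<theta>_def)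
    qed
  qed auto
  then show ?thesis
    using \<beta> \<gamma> \<theta> by (intro that [of \<beta> "k + 1" \<gamma> m \<theta>]) (auto simp: tree_on_def)
qed

lemma leaves_subst: "set (leaves (subst a s t)) =
    (set (leaves t) - {a}) \<union> (if a \<in> set (leaves t) then set (leaves s) else {})"
  by (induction t) auto

lemma tree_on_subst:
  assumes "tree_on A t" "tree_on B s" "a \<in> A" "B \<inter> (A - {a}) = {}"
  shows "tree_on ((A - {a}) \<union> B) (subst a s t)"
proof -
  have "distinct (leaves (subst a s t))" if "distinct (leaves t)" "set (leaves t) \<subseteq> A" for t
    using that
  proof (induction t)
    case (Mul t u)
    have "x \<notin> set (leaves (subst a s u))" if x: "x \<in> set (leaves (subst a s t))" for x
    proof
      assume "x \<in> set (leaves (subst a s u))"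
      moreover have "set (leaves s) = B" using assms by (simp add: tree_on_def)
      moreover have "x \<notin> B" if "x \<in> A" "x \<noteq> a" using assms(4) that by blast
      ultimately show False
        using x Mul.prems unfolding leaves_subst
        by (cases "x = a") (auto split: if_splits)
    qed
    then have "set (leaves (subst a s t)) \<inter> set (leaves (subst a s u)) = {}" by blast
    then show ?case using Mul by simp
  qed (use assms in \<open>auto simp: tree_on_def\<close>)
  then show ?thesis using assms by (auto simp: tree_on_def leaves_subst)
qed

lemma relation_subst_left:
  assumes u: "relation A u" and s: "tree_on B s" and a: "a \<in> A" and disj: "B \<inter> (A - {a}) = {}"
  shows "relation ((A - {a}) \<union> B) (tmap (subst a s) u)"
proof -
  have "finite A" "combs_on A u" using u by (auto simp: relation_def)
  obtain \<beta> n \<gamma> m \<theta> where m: "bij_betw \<beta> A {1..n}" "bij_betw \<gamma> B {1..m}"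
    "bij_betw \<theta> ((A - {a}) \<union> B) {1..n + m - 1}" "1 \<in> {1..n}"
    "\<And>t s. tree_on A t \<Longrightarrow> tree_on B s \<Longrightarrow>
      map_tree \<theta> (subst a s t) = graft 1 m (map_tree \<gamma> s) (map_tree \<beta> t)"
    by (rule subst_relabel [OF \<open>finite A\<close> a tree_on_finite [OF s] disj]) (rule that)
  have "ComDer_ideal n (tmap (map_tree \<beta>) u)" using u m(1) by (simp add: relation_def)
  moreover have "tree_elem (map_tree \<gamma> s) \<in> free_op m"
    using tree_on_map_tree [OF s m(2)] by (simp add: free_op_def trees_tree_on)
  ultimately have "ComDer_ideal (n + m - 1) (free_comp 1 m (tmap (map_tree \<beta>) u) (tree_elem (map_tree \<gamma> s)))"
    using m(4) by (rule ComDer_ideal.comp_left)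
  also have "free_comp 1 m (tmap (map_tree \<beta>) u) (tree_elem (map_tree \<gamma> s)) =
      tmap (map_tree \<theta>) (tmap (subst a s) u)"
    unfolding free_comp_tree_right tmap_tmap
    using \<open>combs_on A u\<close> s m(5) by (intro tmap_cong) (auto simp: combs_on_def)
  finally show ?thesis
    using m(3) \<open>combs_on A u\<close> tree_on_subst [OF _ s a disj]
    by (intro relationI combs_on_tmap [where A = A])
qed

lemma relation_subst_right:
  assumes u: "relation B u" and t: "tree_on A t" and a: "a \<in> A" and disj: "B \<inter> (A - {a}) = {}"
  shows "relation ((A - {a}) \<union> B) (tmap (\<lambda>s. subst a s t) u)"
proof -
  have "finite B" "combs_on B u" using u by (auto simp: relation_def)
  obtain \<beta> n \<gamma> m \<theta> where m: "bij_betw \<beta> A {1..n}" "bij_betw \<gamma> B {1..m}"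
    "bij_betw \<theta> ((A - {a}) \<union> B) {1..n + m - 1}" "1 \<in> {1..n}"
    "\<And>t s. tree_on A t \<Longrightarrow> tree_on B s \<Longrightarrow>
      map_tree \<theta> (subst a s t) = graft 1 m (map_tree \<gamma> s) (map_tree \<beta> t)"
    by (rule subst_relabel [OF tree_on_finite [OF t] a \<open>finite B\<close> disj]) (rule that)
  have "ComDer_ideal m (tmap (map_tree \<gamma>) u)" using u m(2) by (simp add: relation_def)
  moreover have "tree_elem (map_tree \<beta> t) \<in> free_op n"
    using tree_on_map_tree [OF t m(1)] by (simp add: free_op_def trees_tree_on)
  ultimately have "ComDer_ideal (n + m - 1) (free_comp 1 m (tree_elem (map_tree \<beta> t)) (tmap (map_tree \<gamma>) u))"
    using m(4) by (rule ComDer_ideal.comp_right)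
  also have "free_comp 1 m (tree_elem (map_tree \<beta> t)) (tmap (map_tree \<gamma>) u) =
      tmap (map_tree \<theta>) (tmap (\<lambda>s. subst a s t) u)"
    unfolding free_comp_tree_left tmap_tmap
    using \<open>combs_on B u\<close> t m(5) by (intro tmap_cong) (auto simp: combs_on_def)
  finally show ?thesis
    using m(3) \<open>combs_on B u\<close> tree_on_subst [OF t _ a disj]
    by (intro relationI combs_on_tmap [where A = B])
qed

lemma subst_id: "a \<notin> set (leaves t) \<Longrightarrow> subst a s t = t"
  by (induction t) auto

lemma tree_on_Mul: "tree_on A t \<Longrightarrow> tree_on B s \<Longrightarrow> A \<inter> B = {} \<Longrightarrow> tree_on (A \<union> B) (Mul t s)"
  by (auto simp: tree_on_def)

text \<open>The relation is substituted into the tree \<open>Der (Leaf a)\<close> with a single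
  leaf.\<close>

lemma relation_Der:
  assumes "relation A u"
  shows "relation A (tmap Der u)"
  using relation_subst_right [OF assms, where A = "{a}" and a = a and t = "Der (Leaf a)" for a]
  by (simp add: tree_on_def)

text \<open>The relation is substituted for a fresh leaf \<open>a\<close> multiplied by
  \<open>s\<close>; natural numbers as labels guarantee that a fresh one exists.\<close>

lemma
  fixes u :: "nat tree \<Rightarrow>\<^sub>0 'k::field"
  assumes u: "relation A u" and s: "tree_on B s" and disj: "A \<inter> B = {}"
  shows relation_Mul1: "relation (A \<union> B) (tmap (\<lambda>t. Mul t s) u)"
    and relation_Mul2: "relation (A \<union> B) (tmap (\<lambda>t. Mul s t) u)"
proof -
  have "finite (A \<union> B)" using u s tree_on_finite by (auto simp: relation_def)
  then obtain a where a: "a \<notin> A \<union> B" using ex_new_if_finite infinite_UNIV_nat by blast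
  then have "subst a t s = s" for t using s by (intro subst_id) (auto simp: tree_on_def)
  moreover have "tree_on (insert a B) (Mul (Leaf a) s)" "tree_on (insert a B) (Mul s (Leaf a))"
    using a s by (auto simp: tree_on_def)
  moreover have "insert a B - {a} \<union> A = A \<union> B" using a by auto
  ultimately show "relation (A \<union> B) (tmap (\<lambda>t. Mul t s) u)" "relation (A \<union> B) (tmap (\<lambda>t. Mul s t) u)"
    using relation_subst_right [OF u, of "insert a B" "Mul (Leaf a) s" a]
      relation_subst_right [OF u, of "insert a B" "Mul s (Leaf a)" a] a disj by auto
qed

text \<open>A relation in two leaves is specialized to trees. The placeholders \<open>x\<close> and
  \<open>y\<close> occur neither in \<open>t\<close> nor in \<open>s\<close>, so the second
  substitution leaves the inserted \<open>t\<close> alone.\<close>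

lemma relation_subst2:
  fixes u :: "nat tree \<Rightarrow>\<^sub>0 'k::field"
  assumes u: "relation {x, y} u" "x \<noteq> y" and t: "tree_on A t" and s: "tree_on B s"
    and disj: "A \<inter> B = {}" "{x, y} \<inter> (A \<union> B) = {}"
  shows "relation (A \<union> B) (tmap (\<lambda>p. subst y s (subst x t p)) u)"
proof -
  have "relation ({y} \<union> A) (tmap (subst x t) u)"
    using relation_subst_left [OF u(1) t, of x] u(2) disj by (simp add: insert_Diff_if)
  moreover have "({y} \<union> A) - {y} \<union> B = A \<union> B" using disj by auto
  ultimately show ?thesis
    using relation_subst_left [OF _ s, of "{y} \<union> A" "tmap (subst x t) u" y] disj
    by (auto simp: tmap_tmap)
qed

lemma ex_fresh2: "finite (A :: nat set) \<Longrightarrow> \<exists>x y. x \<notin> A \<and> y \<notin> A \<and> x \<noteq> y"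
  by (metis ex_new_if_finite finite_insert infinite_UNIV_nat insertCI)

lemma bij_betw_pair: "x \<noteq> y \<Longrightarrow> bij_betw (\<lambda>z. if z = x then 1 else 2::nat) {x, y} {1..2}"
  by (auto simp: bij_betw_def inj_on_def)

lemma relation_comm:
  assumes t: "tree_on A t" and s: "tree_on B s" and disj: "A \<inter> B = {}"
  shows "relation (A \<union> B) (tree_elem (Mul t s) - tree_elem (Mul s t) :: nat tree \<Rightarrow>\<^sub>0 'k::field)"
proof -
  obtain x y where xy: "x \<notin> A \<union> B" "y \<notin> A \<union> B" "x \<noteq> y"
    using ex_fresh2 [of "A \<union> B"] tree_on_finite [OF t] tree_on_finite [OF s] by auto
  have sub: "subst y s t = t" using t xy by (intro subst_id) (auto simp: tree_on_def)
  have "relation {x, y} (tree_elem (Mul (Leaf x) (Leaf y)) - tree_elem (Mul (Leaf y) (Leaf x))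
      :: nat tree \<Rightarrow>\<^sub>0 'k::field)"
    using xy ComDer_ideal.commutative
    by (intro relationI [OF bij_betw_pair] combs_on_diff combs_on_single) (auto simp: tmap_diff tree_on_def)
  from relation_subst2 [OF this _ t s] show ?thesis
    using xy disj sub by (auto simp: tmap_diff)
qed

lemma relation_Leibniz:
  assumes t: "tree_on A t" and s: "tree_on B s" and disj: "A \<inter> B = {}"
  shows "relation (A \<union> B) (tree_elem (Der (Mul t s)) - 
    (tree_elem (Mul (Der t) s) + tree_elem (Mul t (Der s))) :: nat tree \<Rightarrow>\<^sub>0 'k::field)"
proof -
  obtain x y where xy: "x \<notin> A \<union> B" "y \<notin> A \<union> B" "x \<noteq> y"
    using ex_fresh2 [of "A \<union> B"] tree_on_finite [OF t] tree_on_finite [OF s] by auto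
  have sub: "subst y s t = t" using t xy by (intro subst_id) (auto simp: tree_on_def)
  have "relation {x, y} (tree_elem (Der (Mul (Leaf x) (Leaf y))) -
      (tree_elem (Mul (Der (Leaf x)) (Leaf y)) + tree_elem (Mul (Leaf x) (Der (Leaf y))))
      :: nat tree \<Rightarrow>\<^sub>0 'k::field)"
    using xy ComDer_ideal.Leibniz
    by (intro relationI [OF bij_betw_pair] combs_on_diff combs_on_add combs_on_single)
      (auto simp: tmap_diff tmap_add tree_on_def)
  from relation_subst2 [OF this _ t s] show ?thesis
    using xy disj sub by (auto simp: tmap_diff tmap_add)
qed

lemma relation_assoc:
  assumes t: "tree_on A t" and s: "tree_on B s" and r: "tree_on C r"
    and disj: "A \<inter> B = {}" "A \<inter> C = {}" "B \<inter> C = {}"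
  shows "relation (A \<union> B \<union> C) (tree_elem (Mul (Mul t s) r) - tree_elem (Mul t (Mul s r))
    :: nat tree \<Rightarrow>\<^sub>0 'k::field)"
proof -
  let ?S = "A \<union> B \<union> C"
  have fin: "finite ?S" using tree_on_finite t s r by auto
  obtain x y where xy: "x \<notin> ?S" "y \<notin> ?S" "x \<noteq> y"
    using ex_fresh2 [OF fin] by blast
  obtain z where z: "z \<notin> ?S \<union> {x, y}"
    using ex_new_if_finite [of "?S \<union> {x, y}"] fin infinite_UNIV_nat by auto
  have sub: "subst y s t = t" "subst z r t = t" "subst z r s = s" 
    using t s xy z by (auto intro!: subst_id simp: tree_on_def)
  have "relation {x, y, z} (tree_elem (Mul (Mul (Leaf x) (Leaf y)) (Leaf z)) -
      tree_elem (Mul (Leaf x) (Mul (Leaf y) (Leaf z))) :: nat tree \<Rightarrow>\<^sub>0 'k::field)"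
  proof (rule relationI [where n = 3])
    show "bij_betw (\<lambda>w. if w = x then 1 else if w = y then 2 else 3::nat) {x, y, z} {1..3}"
      using xy z by (auto simp: bij_betw_def inj_on_def)
    show "ComDer_ideal 3 (tmap (map_tree (\<lambda>w. if w = x then 1 else if w = y then 2 else 3::nat))
      (tree_elem (Mul (Mul (Leaf x) (Leaf y)) (Leaf z)) -
      tree_elem (Mul (Leaf x) (Mul (Leaf y) (Leaf z))) :: nat tree \<Rightarrow>\<^sub>0 'k::field))"
      using xy z ComDer_ideal.associative by (auto simp: tmap_diff)
  qed (use xy z in \<open>auto intro!: combs_on_diff combs_on_single simp: tree_on_def\<close>)
  from relation_subst_left [OF this t, of x]
  have "relation ({y, z} \<union> A) (tree_elem (Mul (Mul t (Leaf y)) (Leaf z)) -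
      tree_elem (Mul t (Mul (Leaf y) (Leaf z))) :: nat tree \<Rightarrow>\<^sub>0 'k::field)"
    using xy z by (auto simp: tmap_diff insert_Diff_if Int_insert_right Un_commute)
  from relation_subst_left [OF this s, of y]
  have "relation ({z} \<union> (A \<union> B)) (tree_elem (Mul (Mul t s) (Leaf z)) -
      tree_elem (Mul t (Mul s (Leaf z))) :: nat tree \<Rightarrow>\<^sub>0 'k::field)"
    using xy z sub disj by (auto simp: tmap_diff insert_Diff_if Int_Un_distrib Int_commute)
  from relation_subst_left [OF this r, of z]
  show ?thesis
    using xy z sub disj by (auto simp: tmap_diff insert_Diff_if Int_Un_distrib Int_commute)
qed

subsection \<open>Reduction to monomials\<close>

text \<open>Trees do not mention the field whereas the ideal depends on it; the type argument
  records it.\<close>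

definition tree_equiv :: "'k::field itself \<Rightarrow> nat set \<Rightarrow> nat tree \<Rightarrow> nat tree \<Rightarrow> bool"
  where "tree_equiv _ A t s \<longleftrightarrow> tree_on A t \<and> tree_on A s \<and>
    relation A (tree_elem t - tree_elem s :: nat tree \<Rightarrow>\<^sub>0 'k)"

lemma tree_equiv_refl: "tree_on A t \<Longrightarrow> tree_equiv TYPE('k::field) A t t"
  by (simp add: tree_equiv_def relation_0 tree_on_finite)

lemma tree_equiv_sym: "tree_equiv TYPE('k::field) A t s \<Longrightarrow> tree_equiv TYPE('k) A s t"
  using relation_diff [of A 0 "tree_elem t - tree_elem s :: nat tree \<Rightarrow>\<^sub>0 'k"]
  by (auto simp: tree_equiv_def relation_0 tree_on_finite)

lemma tree_equiv_trans [trans]: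
  "tree_equiv TYPE('k::field) A t s \<Longrightarrow> tree_equiv TYPE('k) A s r \<Longrightarrow> tree_equiv TYPE('k) A t r"
  using relation_add [of A "tree_elem t - tree_elem s :: nat tree \<Rightarrow>\<^sub>0 'k" "tree_elem s - tree_elem r"]
  by (auto simp: tree_equiv_def)

lemma tree_equiv_Mul1:
  assumes "tree_equiv TYPE('k::field) A t t'" "tree_on B s" "A \<inter> B = {}"
  shows "tree_equiv TYPE('k) (A \<union> B) (Mul t s) (Mul t' s)"
  using assms relation_Mul1 [OF _ assms(2,3), of "tree_elem t - tree_elem t' :: nat tree \<Rightarrow>\<^sub>0 'k"]
  by (auto simp: tree_equiv_def tree_on_Mul tmap_diff)

lemma tree_equiv_Mul2:
  assumes "tree_equiv TYPE('k::field) B s s'" "tree_on A t" "A \<inter> B = {}"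
  shows "tree_equiv TYPE('k) (A \<union> B) (Mul t s) (Mul t s')"
  using assms relation_Mul2 [OF _ assms(2), of B "tree_elem s - tree_elem s' :: nat tree \<Rightarrow>\<^sub>0 'k"]
  by (auto simp: tree_equiv_def tree_on_Mul tmap_diff Un_commute Int_commute)

lemma tree_equiv_comm:
  assumes "tree_on A t" "tree_on B s" "A \<inter> B = {}"
  shows "tree_equiv TYPE('k::field) (A \<union> B) (Mul t s) (Mul s t)"
  using assms relation_comm [OF assms] tree_on_Mul [of B s A t]
  by (auto simp: tree_equiv_def tree_on_Mul Un_commute Int_commute)

lemma tree_equiv_assoc:
  assumes "tree_on A t" "tree_on B s" "tree_on C r" "A \<inter> B = {}" "A \<inter> C = {}" "B \<inter> C = {}"
  shows "tree_equiv TYPE('k::field) (A \<union> (B \<union> C)) (Mul (Mul t s) r) (Mul t (Mul s r))"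
  using relation_assoc [OF assms] tree_on_Mul [OF tree_on_Mul [OF assms(1,2,4)] assms(3)]
    tree_on_Mul [OF assms(1) tree_on_Mul [OF assms(2,3,6)]] assms
  by (auto simp: tree_equiv_def Un_assoc)

text \<open>Nested to the left to agree with the shape of \<open>dmon_tree\<close>, which serves as
  normal form.\<close>

definition left_prod :: "'l tree list \<Rightarrow> 'l tree"
  where "left_prod ts = foldl Mul (hd ts) (tl ts)"

lemma left_prod_single [simp]: "left_prod [t] = t"
  by (simp add: left_prod_def)

lemma left_prod_snoc: "ts \<noteq> [] \<Longrightarrow> left_prod (ts @ [t]) = Mul (left_prod ts) t"
  by (simp add: left_prod_def)

lemma leaves_left_prod: "ts \<noteq> [] \<Longrightarrow> leaves (left_prod ts) = concat (map leaves ts)"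
  by (induction ts rule: rev_nonempty_induct) (auto simp: left_prod_snoc)

definition labels :: "'l tree list \<Rightarrow> 'l list"
  where "labels ts = concat (map leaves ts)"

lemma labels_simps [simp]: "labels [] = []" "labels (t # ts) = leaves t @ labels ts"
  "labels (ts @ us) = labels ts @ labels us"
  by (simp_all add: labels_def)

lemma tree_on_left_prod: "ts \<noteq> [] \<Longrightarrow> distinct (labels ts) \<Longrightarrow> tree_on (set (labels ts)) (left_prod ts)"
  by (simp add: tree_on_def leaves_left_prod labels_def)

lemma tree_on_leaves: "distinct (leaves t) \<Longrightarrow> tree_on (set (leaves t)) t"
  by (simp add: tree_on_def)

text \<open>Associativity detaches the last factor of the second product, and the induction
  hypothesis joins the rest.\<close>

lemma left_prod_append:
  assumes "us \<noteq> []" "ts \<noteq> []" "distinct (labels (ts @ us))"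
  shows "tree_equiv TYPE('k::field) (set (labels (ts @ us))) (Mul (left_prod ts) (left_prod us)) (left_prod (ts @ us))"
  using assms
proof (induction us rule: rev_nonempty_induct)
  case (single u)
  then show ?case
    using tree_on_left_prod [of "ts @ [u]"] by (auto simp: left_prod_snoc intro: tree_equiv_refl)
next
  case (snoc u us)
  have on: "tree_on (set (labels ts)) (left_prod ts)" "tree_on (set (labels us)) (left_prod us)"
    "tree_on (set (leaves u)) u"
    using snoc tree_on_left_prod tree_on_leaves by auto
  have "tree_equiv TYPE('k) (set (labels ts) \<union> (set (labels us) \<union> set (leaves u)))
     (Mul (Mul (left_prod ts) (left_prod us)) u) (Mul (left_prod ts) (Mul (left_prod us) u))"
    using snoc.prems by (intro tree_equiv_assoc on) auto
  note tree_equiv_sym [OF this]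
  also have "tree_equiv TYPE('k) (set (labels ts) \<union> (set (labels us) \<union> set (leaves u)))
     (Mul (Mul (left_prod ts) (left_prod us)) u) (Mul (left_prod (ts @ us)) u)"
    using tree_equiv_Mul1 [OF snoc.IH on(3)] snoc.prems by (auto simp: Un_assoc Int_Un_distrib2)
  finally show ?case
    using snoc by (simp add: left_prod_snoc Un_assoc flip: append_assoc)
qed

text \<open>The factor \<open>x\<close> is exchanged with the block \<open>bs\<close> as a whole:
  regroup, commute, regroup.\<close>

lemma left_prod_move:
  assumes "ts \<noteq> []" "distinct (labels (as @ x # bs))" "ts = as @ bs"
  shows "tree_equiv TYPE('k::field) (set (labels (as @ x # bs))) (left_prod (as @ x # bs)) (left_prod (ts @ [x]))"
proof -
  let ?A = "set (labels as)" and ?B = "set (labels bs)" and ?X = "set (leaves x)"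
  have x: "tree_on ?X x" using assms tree_on_leaves by auto
  consider "bs = []" | "as = []" "bs \<noteq> []" | "as \<noteq> []" "bs \<noteq> []" by blast
  then show ?thesis
  proof cases
    case 1
    then show ?thesis using assms tree_on_left_prod [of "as @ [x]"] by (auto intro!: tree_equiv_refl)
  next
    case 2
    have b: "tree_on ?B (left_prod bs)" using 2 assms tree_on_left_prod by auto
    have "tree_equiv TYPE('k) (?X \<union> ?B) (left_prod ([x] @ bs)) (Mul (left_prod [x]) (left_prod bs))"
      using left_prod_append [of bs "[x]", where 'k = 'k] 2 assms by (auto intro: tree_equiv_sym)
    also have "tree_equiv TYPE('k) (?X \<union> ?B) (Mul (left_prod [x]) (left_prod bs)) (Mul (left_prod bs) x)"
      using tree_equiv_comm [OF x b] assms by auto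
    finally show ?thesis using 2 assms by (simp add: left_prod_snoc)
  next
    case 3
    have a: "tree_on ?A (left_prod as)" and b: "tree_on ?B (left_prod bs)"
      using 3 assms tree_on_left_prod by auto
    have disj: "?A \<inter> ?X = {}" "?A \<inter> ?B = {}" "?X \<inter> ?B = {}" using assms by auto
    have "tree_equiv TYPE('k) (?A \<union> (?X \<union> ?B)) (left_prod ((as @ [x]) @ bs)) (Mul (left_prod (as @ [x])) (left_prod bs))"
      using left_prod_append [of bs "as @ [x]", where 'k = 'k] 3 assms
      by (auto intro: tree_equiv_sym simp: Un_assoc)
    also have "left_prod (as @ [x]) = Mul (left_prod as) x" using 3 by (simp add: left_prod_snoc)
    also have "tree_equiv TYPE('k) (?A \<union> (?X \<union> ?B)) (Mul (Mul (left_prod as) x) (left_prod bs))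
       (Mul (left_prod as) (Mul x (left_prod bs)))"
      using disj by (intro tree_equiv_assoc a b x) auto
    also have "tree_equiv TYPE('k) (?A \<union> (?X \<union> ?B)) (Mul (left_prod as) (Mul x (left_prod bs)))
       (Mul (left_prod as) (Mul (left_prod bs) x))"
      using disj by (intro tree_equiv_Mul2 tree_equiv_comm a b x) auto
    also have "tree_equiv TYPE('k) (?A \<union> (?X \<union> ?B)) (Mul (left_prod as) (Mul (left_prod bs) x))
        (Mul (Mul (left_prod as) (left_prod bs)) x)"
      using tree_equiv_sym [OF tree_equiv_assoc [OF a b x, where 'k = 'k]] disj by (auto simp: Un_ac)
    also have "tree_equiv TYPE('k) (?A \<union> (?X \<union> ?B)) (Mul (Mul (left_prod as) (left_prod bs)) x)
        (Mul (left_prod (as @ bs)) x)"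
      using tree_equiv_Mul1 [OF left_prod_append [of bs as, where 'k = 'k] x] 3 assms disj
      by (auto simp: Un_ac Int_Un_distrib2 Int_commute)
    finally show ?thesis using 3 assms left_prod_snoc [of "as @ bs" x] by (simp add: Un_assoc)
  qed
qed

text \<open>Induction on the target order: its last factor is moved to the end of \<open>ts\<close>,
  and the remaining factors are rearranged by hypothesis.\<close>

lemma left_prod_mset:
  assumes "us \<noteq> []" "mset ts = mset us" "distinct (labels us)"
  shows "tree_equiv TYPE('k::field) (set (labels us)) (left_prod ts) (left_prod us)"
  using assms
proof (induction us arbitrary: ts rule: rev_nonempty_induct)
  case (single u)
  then show ?case by (auto intro!: tree_equiv_refl tree_on_leaves)
next
  case (snoc u us)
  have "u \<in> set ts" using snoc.prems(1) by (metis in_set_conv_decomp mset_eq_setD)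
  then obtain as bs where ts: "ts = as @ u # bs" by (auto simp: in_set_conv_decomp)
  then have m: "mset (as @ bs) = mset us" using snoc.prems(1) by simp
  have "mset (labels ts) = (\<Sum>t\<in>#mset ts. mset (leaves t))" for ts :: "nat tree list"
    by (induction ts) auto
  then have mm: "mset (labels ts) = mset (labels vs)" if "mset ts = mset vs" for ts vs :: "nat tree list"
    using that by simp
  have d: "distinct (labels ts)" "set (labels ts) = set (labels (us @ [u]))"
    using mm [OF snoc.prems(1)] snoc.prems(2) by (metis mset_eq_imp_distinct_iff, metis mset_eq_setD)
  have ne: "as @ bs \<noteq> []" using m snoc.hyps by auto
  have "tree_equiv TYPE('k) (set (labels ts)) (left_prod ts) (left_prod ((as @ bs) @ [u]))"
    using left_prod_move [OF ne] d(1) ts by blast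
  also have "tree_equiv TYPE('k) (set (labels ts)) (left_prod ((as @ bs) @ [u])) (left_prod (us @ [u]))"
  proof -
    have "tree_equiv TYPE('k) (set (labels us) \<union> set (leaves u)) (Mul (left_prod (as @ bs)) u) (Mul (left_prod us) u)"
      using snoc.prems by (intro tree_equiv_Mul1 snoc.IH m tree_on_leaves) auto
    then show ?thesis using d(2) ne snoc.hyps by (simp add: left_prod_snoc del: append_assoc)
  qed
  finally show ?case using d(2) by simp
qed

definition reducible :: "nat set \<Rightarrow> nat tree set \<Rightarrow> (nat tree \<Rightarrow>\<^sub>0 'k::field) \<Rightarrow> bool"
  where "reducible A M u \<longleftrightarrow> (\<exists>w. Poly_Mapping.keys w \<subseteq> M \<and> relation A (u - w))"

lemma reducible_add: "reducible A M u \<Longrightarrow> reducible A M v \<Longrightarrow> reducible A M (u + v)"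
proof -
  assume "reducible A M u" "reducible A M v"
  then obtain a b where "Poly_Mapping.keys a \<subseteq> M" "relation A (u - a)" "Poly_Mapping.keys b \<subseteq> M" "relation A (v - b)"
    by (auto simp: reducible_def)
  then show "reducible A M (u + v)"
    using relation_add [of A "u - a" "v - b"] Poly_Mapping.keys_add [of a b]
    by (auto simp: reducible_def algebra_simps intro!: exI [of _ "a + b"])
qed

lemma smul_diff: "smul c (u - v) = smul c u - smul c v"
  by (rule poly_mapping_eqI) (simp add: lookup_minus algebra_simps)

lemma reducible_smul: "reducible A M u \<Longrightarrow> reducible A M (smul c u)"
proof -
  assume "reducible A M u"
  then obtain a where "Poly_Mapping.keys a \<subseteq> M" "relation A (u - a)" by (auto simp: reducible_def)
  then show "reducible A M (smul c u)"
    using relation_smul [of A "u - a" c]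
    by (auto simp: reducible_def smul_diff in_keys_iff subset_iff intro!: exI [of _ "smul c a"])
qed

lemma reducible_relation: "relation A (u - v) \<Longrightarrow> reducible A M v \<Longrightarrow> reducible A M u"
proof -
  assume u: "relation A (u - v)" and "reducible A M v"
  then obtain a where "Poly_Mapping.keys a \<subseteq> M" "relation A (v - a)" by (auto simp: reducible_def)
  then show "reducible A M u"
    using relation_add [OF u, of "v - a"] by (auto simp: reducible_def intro!: exI [of _ a])
qed

lemma reducible_self: "finite A \<Longrightarrow> t \<in> M \<Longrightarrow> reducible A M (Poly_Mapping.single t c)"
  by (auto simp: reducible_def relation_0 intro!: exI [of _ "Poly_Mapping.single t c"] split: if_splits)

lemma smul_single: "smul c (tree_elem t) = Poly_Mapping.single t c"
  by (simp add: map_single)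

lemma reducible_tmap:
  assumes "finite A" "\<And>t. t \<in> Poly_Mapping.keys u \<Longrightarrow> reducible A M (tree_elem (f t) :: nat tree \<Rightarrow>\<^sub>0 'k::field)"
  shows "reducible A M (tmap f u :: nat tree \<Rightarrow>\<^sub>0 'k)"
proof -
  have "reducible A M (\<Sum>t\<in>S. Poly_Mapping.single (f t) (Poly_Mapping.lookup u t))"
    if "S \<subseteq> Poly_Mapping.keys u" for S
    using finite_subset [OF that finite_keys] that
  proof (induction S rule: finite_induct)
    case empty
    then show ?case using assms(1) by (auto simp: reducible_def relation_0 intro!: exI [of _ 0])
  next
    case (insert t S)
    then show ?case
      using assms(2) reducible_smul [of A M "tree_elem (f t)" "Poly_Mapping.lookup u t"]
      by (auto simp: smul_single intro!: reducible_add)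
  qed
  then show ?thesis by (simp add: tmap_def)
qed

lemma reducible_mono: "reducible A M u \<Longrightarrow> M \<subseteq> M' \<Longrightarrow> reducible A M' u"
  by (auto simp: reducible_def)

text \<open>Reduction inside a context \<open>f\<close>: as \<open>f\<close> preserves relations,
  \<open>t\<close> may be replaced under \<open>f\<close> by a combination of normal forms, each of
  which is then reduced further.\<close>

lemma reducible_context:
  assumes ctx: "\<And>u :: nat tree \<Rightarrow>\<^sub>0 'k. relation A u \<Longrightarrow> relation A' (tmap f u)"
    and t: "reducible A M (tree_elem t :: nat tree \<Rightarrow>\<^sub>0 'k::field)"
    and M: "finite A'" "\<And>m. m \<in> M \<Longrightarrow> reducible A' M' (tree_elem (f m) :: nat tree \<Rightarrow>\<^sub>0 'k)"
  shows "reducible A' M' (tree_elem (f t) :: nat tree \<Rightarrow>\<^sub>0 'k)"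
proof -
  obtain w where w: "Poly_Mapping.keys w \<subseteq> M" "relation A (tree_elem t - w :: nat tree \<Rightarrow>\<^sub>0 'k)"
    using t by (auto simp: reducible_def)
  have "relation A' (tree_elem (f t) - tmap f w :: nat tree \<Rightarrow>\<^sub>0 'k)"
    using ctx [OF w(2)] by (simp add: tmap_diff)
  moreover have "reducible A' M' (tmap f w :: nat tree \<Rightarrow>\<^sub>0 'k)"
    using w M by (intro reducible_tmap) auto
  ultimately show ?thesis by (rule reducible_relation)
qed

lemma reducible_equiv:
  "tree_equiv TYPE('k::field) A t s \<Longrightarrow> s \<in> M \<Longrightarrow> reducible A M (tree_elem t :: nat tree \<Rightarrow>\<^sub>0 'k)"
  by (rule reducible_relation [OF _ reducible_self])
    (auto simp: tree_equiv_def dest: tree_on_finite)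

text \<open>The general Leibniz rule: splitting off the last factor leaves the derivative of a
  shorter product and a term in which the last factor is differentiated.\<close>

lemma reducible_Der_left_prod:
  assumes "ts \<noteq> []" "distinct (labels ts)"
  shows "reducible (set (labels ts)) ((\<lambda>k. left_prod (ts[k := Der (ts ! k)])) ` {..<length ts})
    (tree_elem (Der (left_prod ts)) :: nat tree \<Rightarrow>\<^sub>0 'k::field)"
  using assms
proof (induction ts rule: rev_nonempty_induct)
  case (single t)
  then show ?case by (auto intro!: reducible_self)
next
  case (snoc t ts)
  let ?M = "(\<lambda>k. left_prod ((ts @ [t])[k := Der ((ts @ [t]) ! k)])) ` {..<length (ts @ [t])}"
  let ?A = "set (labels ts) \<union> set (leaves t)"
  have on: "tree_on (set (labels ts)) (left_prod ts)" "tree_on (set (leaves t)) t"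
    "set (labels ts) \<inter> set (leaves t) = {}"
    using snoc tree_on_left_prod tree_on_leaves by auto
  have "left_prod ((ts @ [t])[length ts := Der ((ts @ [t]) ! length ts)]) \<in> ?M"
    by (rule imageI) simp
  then have "Mul (left_prod ts) (Der t) \<in> ?M"
    using snoc.hyps by (simp add: left_prod_snoc)
  then have r2: "reducible ?A ?M (tree_elem (Mul (left_prod ts) (Der t)) :: nat tree \<Rightarrow>\<^sub>0 'k)"
    by (intro reducible_self) auto
  have r1: "reducible ?A ?M (tree_elem (Mul (Der (left_prod ts)) t) :: nat tree \<Rightarrow>\<^sub>0 'k)"
  proof (rule reducible_context [where f = "\<lambda>s. Mul s t"])
    show "reducible (set (labels ts)) ((\<lambda>k. left_prod (ts[k := Der (ts ! k)])) ` {..<length ts})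
      (tree_elem (Der (left_prod ts)) :: nat tree \<Rightarrow>\<^sub>0 'k)"
      using snoc by auto
    fix m assume "m \<in> (\<lambda>k. left_prod (ts[k := Der (ts ! k)])) ` {..<length ts}"
    then obtain k where "k < length ts" "m = left_prod (ts[k := Der (ts ! k)])" by auto
    then have "Mul m t = left_prod ((ts @ [t])[k := Der ((ts @ [t]) ! k)])"
      by (simp add: left_prod_snoc nth_append list_update_append snoc.hyps)
    then have "Mul m t \<in> ?M" using \<open>k < length ts\<close> by auto
    then show "reducible ?A ?M (tree_elem (Mul m t) :: nat tree \<Rightarrow>\<^sub>0 'k)"
      by (intro reducible_self) auto
  qed (use relation_Mul1 [OF _ on(2,3)] in auto)
  have "reducible ?A ?M (tree_elem (Der (Mul (left_prod ts) t)) :: nat tree \<Rightarrow>\<^sub>0 'k)"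
    by (rule reducible_relation [OF relation_Leibniz [OF on] reducible_add [OF r1 r2]])
  then show ?case using snoc.hyps by (simp add: left_prod_snoc)
qed

section \<open>Reduction of arbitrary trees to monomials in their leaves\<close>

primrec derivs :: "'l tree \<Rightarrow> nat" where
  "derivs (Leaf l) = 0"
| "derivs (Der t) = Suc (derivs t)"
| "derivs (Mul t u) = derivs t + derivs u"

abbreviation dleaf :: "('l \<Rightarrow> nat) \<Rightarrow> 'l \<Rightarrow> 'l tree"
  where "dleaf e l \<equiv> (Der ^^ e l) (Leaf l)"

lemma leaves_funpow_Der [simp]: "leaves ((Der ^^ k) t) = leaves t"
  by (induction k) auto

lemma labels_dleaf [simp]: "labels (map (dleaf e) ls) = ls"
  by (induction ls) auto

text \<open>The factors keep the order in which the leaves occur in the tree; sorting them is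
  postponed to \<open>ComDer_reduction\<close>.\<close>

definition monomials :: "nat list \<Rightarrow> nat \<Rightarrow> nat tree set"
  where "monomials ls d = {left_prod (map (dleaf e) ls) | e. sum e (set ls) = d}"

lemma monomials_tree_on: "m \<in> monomials ls d \<Longrightarrow> ls \<noteq> [] \<Longrightarrow> distinct ls \<Longrightarrow> tree_on (set ls) m"
  using tree_on_left_prod [of "map (dleaf e) ls" for e] by (auto simp: monomials_def)

lemma reducible_monomials:
  "distinct (leaves t) \<Longrightarrow>
    reducible (set (leaves t)) (monomials (leaves t) (derivs t)) (tree_elem t :: nat tree \<Rightarrow>\<^sub>0 'k::field)"
proof (induction t)
  case (Leaf l)
  have "Leaf l \<in> monomials [l] 0" by (auto simp: monomials_def intro!: exI [of _ "\<lambda>_. 0"])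
  then show ?case by (auto intro!: reducible_self)
next
  case (Der t)
  have "reducible (set (leaves t)) (monomials (leaves t) (Suc (derivs t))) (tree_elem (Der t) :: nat tree \<Rightarrow>\<^sub>0 'k)"
  proof (rule reducible_context [where f = Der])
    show "reducible (set (leaves t)) (monomials (leaves t) (derivs t)) (tree_elem t :: nat tree \<Rightarrow>\<^sub>0 'k)"
      using Der by simp
    fix m assume "m \<in> monomials (leaves t) (derivs t)"
    then obtain e where e: "sum e (set (leaves t)) = derivs t" "m = left_prod (map (dleaf e) (leaves t))"
      by (auto simp: monomials_def)
    have "(\<lambda>k. left_prod ((map (dleaf e) (leaves t))[k := Der (map (dleaf e) (leaves t) ! k)])) ` {..<length (leaves t)}
      \<subseteq> monomials (leaves t) (Suc (derivs t))"
    proof clarsimp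
      fix k assume k: "k < length (leaves t)"
      \<comment> \<open>The Leibniz rule raises the exponent of the \<open>k\<close>-th leaf by
        one.\<close>
      define e' where "e' = e(leaves t ! k := Suc (e (leaves t ! k)))"
      have "(map (dleaf e) (leaves t))[k := Der (dleaf e (leaves t ! k))] = map (dleaf e') (leaves t)"
        using k Der.prems by (auto simp: list_eq_iff_nth_eq nth_list_update e'_def nth_eq_iff_index_eq)
      moreover have "sum e' (set (leaves t)) = Suc (derivs t)"
        using k e(1) sum.remove [of "set (leaves t)" "leaves t ! k" e] sum.remove [of "set (leaves t)" "leaves t ! k" e']
        by (simp add: e'_def cong: sum.cong_simp)
      ultimately show "left_prod ((map (dleaf e) (leaves t))[k := Der (dleaf e (leaves t ! k))])
          \<in> monomials (leaves t) (Suc (derivs t))"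
        by (auto simp: monomials_def)
    qed
    then show "reducible (set (leaves t)) (monomials (leaves t) (Suc (derivs t))) (tree_elem (Der m) :: nat tree \<Rightarrow>\<^sub>0 'k)"
      using reducible_mono [OF reducible_Der_left_prod [of "map (dleaf e) (leaves t)"]] Der.prems e(2) by simp
  qed (use relation_Der in auto)
  then show ?case by simp
next
  case (Mul t u)
  let ?A = "set (leaves t)" and ?B = "set (leaves u)"
  let ?M = "monomials (leaves t @ leaves u) (derivs t + derivs u)"
  have disj: "?A \<inter> ?B = {}" using Mul.prems by simp
  have "reducible (?A \<union> ?B) ?M (tree_elem (Mul t u) :: nat tree \<Rightarrow>\<^sub>0 'k)"
  proof (rule reducible_context [where f = "\<lambda>t. Mul t u"])
    show "reducible ?A (monomials (leaves t) (derivs t)) (tree_elem t :: nat tree \<Rightarrow>\<^sub>0 'k)"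
      using Mul by simp
    show "relation (?A \<union> ?B) (tmap (\<lambda>t. Mul t u) w)" if "relation ?A w" for w :: "nat tree \<Rightarrow>\<^sub>0 'k"
      using relation_Mul1 [OF that _ disj] tree_on_leaves Mul.prems by auto
    fix m assume m: "m \<in> monomials (leaves t) (derivs t)"
    have mon: "tree_on ?A m" using monomials_tree_on [OF m] Mul.prems by simp
    show "reducible (?A \<union> ?B) ?M (tree_elem (Mul m u) :: nat tree \<Rightarrow>\<^sub>0 'k)"
    proof (rule reducible_context [where f = "Mul m"])
      show "reducible ?B (monomials (leaves u) (derivs u)) (tree_elem u :: nat tree \<Rightarrow>\<^sub>0 'k)"
        using Mul by simp
      show "relation (?A \<union> ?B) (tmap (Mul m) w)" if "relation ?B w" for w :: "nat tree \<Rightarrow>\<^sub>0 'k"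
        using relation_Mul2 [OF that mon] disj by (auto simp: Un_commute)
      fix m' assume m': "m' \<in> monomials (leaves u) (derivs u)"
      obtain e e' where e: "sum e ?A = derivs t" "m = left_prod (map (dleaf e) (leaves t))"
          and e': "sum e' ?B = derivs u" "m' = left_prod (map (dleaf e') (leaves u))"
        using m m' by (auto simp: monomials_def)
      \<comment> \<open>The exponents of both factors are glued, which is consistent since their
        leaves are disjoint.\<close>
      define f where "f l = (if l \<in> ?A then e l else e' l)" for l
      have f: "map (dleaf f) (leaves t) = map (dleaf e) (leaves t)"
          "map (dleaf f) (leaves u) = map (dleaf e') (leaves u)"
        using disj by (auto simp: f_def)
      have "sum f ?A = sum e ?A" "sum f ?B = sum e' ?B"
        using disj by (auto simp: f_def intro!: sum.cong)
      then have "sum f (?A \<union> ?B) = derivs t + derivs u"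
        using e(1) e'(1) disj by (simp add: sum.union_disjoint)
      then have "left_prod (map (dleaf f) (leaves t @ leaves u)) \<in> ?M"
        unfolding monomials_def by (intro CollectI exI [of _ f]) simp
      moreover have "tree_equiv TYPE('k) (?A \<union> ?B) (Mul m m') (left_prod (map (dleaf f) (leaves t @ leaves u)))"
        using left_prod_append [of "map (dleaf e') (leaves u)" "map (dleaf e) (leaves t)", where 'k = 'k]
          Mul.prems unfolding e(2) e'(2) map_append f by simp
      ultimately show "reducible (?A \<union> ?B) ?M (tree_elem (Mul m m') :: nat tree \<Rightarrow>\<^sub>0 'k)"
        using reducible_equiv by blast
    qed auto
  qed auto
  then show ?case by simp
qed

lemma dmon_tree_eq: "p \<noteq> [] \<Longrightarrow> dmon_tree p = left_prod (map (\<lambda>i. (Der ^^ (p ! (i - 1))) (Leaf i)) [1..<Suc (length p)])"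
proof -
  assume "p \<noteq> []"
  then have u: "[1..<Suc (length p)] = 1 # [2..<Suc (length p)]"
    using upt_conv_Cons [of 1 "Suc (length p)"] by (simp add: numeral_2_eq_2 del: upt_Suc)
  show ?thesis
    unfolding dmon_tree_def left_prod_def u by (simp add: foldl_map del: upt_Suc)
qed

text \<open>Existence of coordinates. The reduction keeps the number of derivations, so
  \<open>n - 1\<close> of them give exponents in \<open>P_exps n\<close>; the factors are finally
  put in the order 1, ..., \<open>n\<close>.\<close>

theorem ComDer_reduction:
  assumes t: "t \<in> trees n" and n: "derivs t + 1 = n"
  shows "\<exists>w. Poly_Mapping.keys w \<subseteq> dmon_tree ` P_exps n \<and> ComDer_ideal n (tree_elem t - w :: nat tree \<Rightarrow>\<^sub>0 'k::field)"
proof -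
  have lt: "set (leaves t) = {1..n}" "distinct (leaves t)" using t by (auto simp: trees_def)
  have "reducible {1..n} (dmon_tree ` P_exps n) (tree_elem t :: nat tree \<Rightarrow>\<^sub>0 'k)"
  proof (rule reducible_context [where f = "\<lambda>t. t"])
    show "reducible {1..n} (monomials (leaves t) (derivs t)) (tree_elem t :: nat tree \<Rightarrow>\<^sub>0 'k)"
      using reducible_monomials [of t] lt by simp
    fix m assume "m \<in> monomials (leaves t) (derivs t)"
    then obtain e where e: "sum e {1..n} = derivs t" "m = left_prod (map (dleaf e) (leaves t))"
      using lt by (auto simp: monomials_def)
    define p where "p = map e [1..<Suc n]"
    have "sum_list p = derivs t"
      using e(1) by (simp add: p_def interv_sum_list_conv_sum_set_nat atLeastLessThanSuc_atLeastAtMost del: upt_Suc)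
    then have p: "p \<in> P_exps n" using n by (simp add: P_exps_def p_def del: upt_Suc)
    have ms: "mset (leaves t) = mset [1..<Suc n]"
      using lt by (metis atLeastLessThanSuc_atLeastAtMost distinct_upt set_eq_iff_mset_eq_distinct set_upt)
    have "tree_equiv TYPE('k) (set (labels (map (dleaf e) [1..<Suc n]))) (left_prod (map (dleaf e) (leaves t)))
        (left_prod (map (dleaf e) [1..<Suc n]))"
      using n by (intro left_prod_mset) (simp_all only: mset_map ms labels_dleaf distinct_upt, simp)
    moreover have "left_prod (map (dleaf e) [1..<Suc n]) = dmon_tree p"
    proof -
      have "map (dleaf e) [1..<Suc n] = map (\<lambda>i. (Der ^^ (p ! (i - 1))) (Leaf i)) [1..<Suc (length p)]"
        by (auto simp: p_def simp del: upt_Suc)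
      moreover have "p \<noteq> []" using n by (auto simp: p_def simp del: upt_Suc)
      ultimately show ?thesis using dmon_tree_eq [of p] by presburger
    qed
    ultimately show "reducible {1..n} (dmon_tree ` P_exps n) (tree_elem m :: nat tree \<Rightarrow>\<^sub>0 'k)"
      using reducible_equiv [of "{1..n}" m "dmon_tree p" "dmon_tree ` P_exps n", where 'k = 'k] e(2) p
      by (simp add: atLeastLessThanSuc_atLeastAtMost del: upt_Suc)
  qed (auto simp: tmap_ident)
  then obtain w where w: "Poly_Mapping.keys w \<subseteq> dmon_tree ` P_exps n" "relation {1..n} (tree_elem t - w :: nat tree \<Rightarrow>\<^sub>0 'k)"
    by (auto simp: reducible_def)
  have "ComDer_ideal n (tmap (map_tree (\<lambda>x. x)) (tree_elem t - w :: nat tree \<Rightarrow>\<^sub>0 'k))"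
    using w(2) unfolding relation_def by (auto simp: bij_betw_def)
  moreover have "map_tree (\<lambda>x. x) = (\<lambda>t :: nat tree. t)" by (simp add: fun_eq_iff tree.map_ident)
  ultimately have "ComDer_ideal n (tree_elem t - w :: nat tree \<Rightarrow>\<^sub>0 'k)" by (simp add: tmap_ident)
  then show ?thesis using w(1) by blast
qed

subsection \<open>Coordinates in the monomial basis\<close>

definition monom_eval :: "'k::comm_ring_1 list \<Rightarrow> nat list \<Rightarrow> 'k"
  where "monom_eval ls p = prod_list (map2 (^) ls p)"

lemma monom_eval_simps [simp]:
  "monom_eval [] p = 1" "monom_eval ls [] = 1"
  "monom_eval (a # ls) (k # p) = a ^ k * monom_eval ls p"
  by (simp_all add: monom_eval_def)

lemma tree_eval_left_prod: "ts \<noteq> [] \<Longrightarrow> tree_eval l (left_prod ts) = prod_list (map (tree_eval l) ts)"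
  by (induction ts rule: rev_nonempty_induct) (auto simp: left_prod_snoc)

lemma tree_eval_funpow_Der: "tree_eval l ((Der ^^ k) t) = sum_list (map l (leaves t)) ^ k * tree_eval l t"
  by (induction k) (auto simp: mult.assoc)

lemma tree_eval_dmon_tree:
  assumes "p \<noteq> []"
  shows "tree_eval l (dmon_tree p) = monom_eval (map l [1..<Suc (length p)]) p"
proof -
  have "map (tree_eval l \<circ> (\<lambda>i. (Der ^^ (p ! (i - 1))) (Leaf i))) [1..<Suc (length p)] =
      map2 (^) (map l [1..<Suc (length p)]) p"
    by (rule nth_equalityI) (auto simp: tree_eval_funpow_Der simp del: upt_Suc)
  then show ?thesis
    using assms by (simp add: dmon_tree_eq tree_eval_left_prod monom_eval_def del: upt_Suc)
qed

lemma dmon_tree_trees: "p \<noteq> [] \<Longrightarrow> dmon_tree p \<in> trees (length p)"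
proof -
  have "concat (map (leaves \<circ> (\<lambda>i. (Der ^^ f i) (Leaf i))) xs) = xs" for xs :: "nat list" and f
    by (induction xs) auto
  then show "p \<noteq> [] \<Longrightarrow> dmon_tree p \<in> trees (length p)"
    by (auto simp: dmon_tree_eq trees_def leaves_left_prod simp del: upt_Suc)
qed

lemma derivs_funpow_Der [simp]: "derivs ((Der ^^ k) t) = k + derivs t"
  by (induction k) auto

lemma derivs_dmon_tree: "p \<noteq> [] \<Longrightarrow> derivs (dmon_tree p) = sum_list p"
proof -
  have "derivs (left_prod ts) = sum_list (map derivs ts)" if "ts \<noteq> []" for ts :: "nat tree list"
    using that by (induction ts rule: rev_nonempty_induct) (auto simp: left_prod_snoc)
  moreover have "map (derivs \<circ> (\<lambda>i. (Der ^^ (p ! (i - 1))) (Leaf i))) [1..<Suc (length p)] = p"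
    by (rule nth_equalityI) (auto simp del: upt_Suc)
  ultimately show "p \<noteq> [] \<Longrightarrow> derivs (dmon_tree p) = sum_list p"
    by (simp add: dmon_tree_eq del: upt_Suc)
qed

lemma finite_P_exps [simp]: "finite (P_exps n)"
proof (rule finite_subset)
  show "P_exps n \<subseteq> {p. set p \<subseteq> {..n} \<and> length p = n}"
    using member_le_sum_list by (fastforce simp: P_exps_def)
qed (simp add: finite_lists_length_eq)

lemma P_exps_nonempty: "p \<in> P_exps n \<Longrightarrow> p \<noteq> []"
  by (auto simp: P_exps_def)

text \<open>Comparing \<open>P(2a)\<close> with \<open>2\<^sup>d P(a)\<close> lowers the degree.\<close>

lemma vector_poly_eq_0:
  fixes scale :: "'k::field_char_0 \<Rightarrow> 'v::ab_group_add \<Rightarrow> 'v"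
  assumes "vector_space scale" and "\<And>a. (\<Sum>k\<le>d. scale (a ^ k) (v k)) = 0" "k \<le> d"
  shows "v k = 0"
  using assms(2,3)
proof (induction d arbitrary: v k)
  interpret vector_space scale by fact
  {
    case 0
    then show ?case by auto
  next
    case (Suc d)
    have "scale (2 ^ k - 2 ^ Suc d) (v k) = 0" if "k \<le> d" for k
    proof (rule Suc.IH [OF _ that])
      fix a :: 'k
      have "(\<Sum>k\<le>Suc d. scale ((2 * a) ^ k) (v k)) - scale (2 ^ Suc d) (\<Sum>k\<le>Suc d. scale (a ^ k) (v k)) = 0"
        by (simp only: Suc.prems(1) scale_zero_right diff_0_right)
      then have "(\<Sum>k\<le>Suc d. scale ((2 * a) ^ k - 2 ^ Suc d * a ^ k) (v k)) = 0"
        by (simp add: scale_sum_right sum_subtractf scale_left_diff_distrib del: sum.atMost_Suc power_Suc)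
      then show "(\<Sum>k\<le>d. scale (a ^ k) (scale (2 ^ k - 2 ^ Suc d) (v k))) = 0"
        by (simp add: power_mult_distrib algebra_simps)
    qed
    \<comment> \<open>Characteristic 0 keeps distinct powers of 2 distinct in the field.\<close>
    moreover have "(2::'k) ^ k - 2 ^ Suc d \<noteq> 0" if "k \<le> d" for k
    proof -
      have "(2::nat) ^ k \<noteq> 2 ^ Suc d"
        using that power_inject_exp [of "2::nat" k "Suc d"] by auto
      then have "of_nat (2 ^ k) \<noteq> (of_nat (2 ^ Suc d) :: 'k)" by (simp only: of_nat_eq_iff) simp
      then show ?thesis by simp
    qed
    ultimately have v: "v k = 0" if "k \<le> d" for k
      using that by (metis scale_eq_0_iff)
    moreover have "v (Suc d) = 0" using Suc.prems(1) [of 1] v by simp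
    ultimately show ?case using Suc.prems(2) by (cases "k = Suc d") auto
  }
qed

text \<open>Induction on the number of variables: terms are grouped by the exponent of the first
  variable, and \<open>vector_poly_eq_0\<close> isolates each group. Vector coefficients are allowed
  because the values of a family take this place in \<open>Phi_inj\<close>.\<close>

lemma monom_eval_independent:
  fixes scale :: "'k::field_char_0 \<Rightarrow> 'v::ab_group_add \<Rightarrow> 'v"
  assumes vs: "vector_space scale" and S: "finite S" "\<And>p. p \<in> S \<Longrightarrow> length p = n"
    and z: "\<And>ls. length ls = n \<Longrightarrow> (\<Sum>p\<in>S. scale (monom_eval ls p) (v p)) = 0" and p: "p \<in> S"
  shows "v p = 0"
  using S z p
proof (induction n arbitrary: S v p)
  interpret vector_space scale by fact
  {
    case 0
    then have "S = {[]}" by auto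
    then show ?case using 0 by auto
  next
    case (Suc n)
    define d where "d = Max (hd ` S)"
    define T where "T k = {q. k # q \<in> S}" for k
    have finT: "finite (T k)" for k
      unfolding T_def using Suc.prems(1)
      by (rule finite_subset [of _ "tl ` S", rotated, OF finite_imageI]) force
    have hd: "hd ` S \<subseteq> {..d}" using Suc.prems(1) by (auto simp: d_def)
    have "(\<Sum>q\<in>T k. scale (monom_eval ls q) (v (k # q))) = 0" if ls: "length ls = n" and k: "k \<le> d" for ls k
    proof (rule vector_poly_eq_0 [OF vs _ k, of "\<lambda>k. \<Sum>q\<in>T k. scale (monom_eval ls q) (v (k # q))"])
      fix a :: 'k
      have eq: "{p \<in> S. hd p = j} = (#) j ` T j" for j
      proof (intro equalityI subsetI)
        fix p assume "p \<in> {p \<in> S. hd p = j}"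
        then show "p \<in> (#) j ` T j"
          using Suc.prems(2) [of p] by (cases p) (auto simp: T_def)
      qed (auto simp: T_def)
      have "0 = (\<Sum>p\<in>S. scale (monom_eval (a # ls) p) (v p))"
        using Suc.prems(3) [of "a # ls"] ls by simp
      also have "\<dots> = (\<Sum>j\<le>d. \<Sum>p\<in>{p \<in> S. hd p = j}. scale (monom_eval (a # ls) p) (v p))"
        using sum.group [OF Suc.prems(1) finite_atMost hd, symmetric] .
      also have "\<dots> = (\<Sum>j\<le>d. \<Sum>q\<in>T j. scale (a ^ j) (scale (monom_eval ls q) (v (j # q))))"
        unfolding eq by (rule sum.cong [OF refl]) (simp add: sum.reindex)
      finally show "(\<Sum>j\<le>d. scale (a ^ j) (\<Sum>q\<in>T j. scale (monom_eval ls q) (v (j # q)))) = 0"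
        by (simp add: scale_sum_right)
    qed
    then have "v (k # q) = 0" if "k # q \<in> S" for k q
      using Suc.IH [of "T k" "\<lambda>q. v (k # q)" q] finT that hd Suc.prems(2) by (fastforce simp: T_def)
    then show ?case using Suc.prems(2) [OF Suc.prems(4)] Suc.prems(4) by (cases p) auto
  }
qed

lemma vector_space_mult: "vector_space ((*) :: 'k::field \<Rightarrow> 'k \<Rightarrow> 'k)"
  by unfold_locales (simp_all add: algebra_simps)

lemma ex_map_upt: "length ls = n \<Longrightarrow> \<exists>l. map l [1..<Suc n] = ls"
  by (intro exI [of _ "\<lambda>i. ls ! (i - 1)"] nth_equalityI) (auto simp del: upt_Suc)

lemma coords_unique:
  fixes c c' :: "nat list \<Rightarrow> 'k::field_char_0"
  assumes "\<And>p. p \<notin> P_exps n \<Longrightarrow> c p = 0" "\<And>p. p \<notin> P_exps n \<Longrightarrow> c' p = 0"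
    and eq: "\<And>l. (\<Sum>p\<in>P_exps n. c p * monom_eval (map l [1..<Suc n]) p) =
      (\<Sum>p\<in>P_exps n. c' p * monom_eval (map l [1..<Suc n]) p)"
  shows "c = c'"
proof
  fix p
  have "c p - c' p = 0" if "p \<in> P_exps n"
  proof (rule monom_eval_independent [OF vector_space_mult finite_P_exps _ _ that, of n "\<lambda>p. c p - c' p"])
    fix ls :: "'k list" assume "length ls = n"
    then obtain l where "map l [1..<Suc n] = ls" using ex_map_upt by blast
    then show "(\<Sum>p\<in>P_exps n. monom_eval ls p * (c p - c' p)) = 0"
      using eq [of l] by (simp add: right_diff_distrib sum_subtractf mult.commute)
  qed (auto simp: P_exps_def)
  then show "c p = c' p" using assms(1,2) [of p] by (cases "p \<in> P_exps n") auto
qed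

text \<open>Equal trees have equal evaluations, so the indicator functions of \<open>p\<close> and
  \<open>q\<close> represent the same polynomial over the rationals; uniqueness of coefficients
  gives \<open>p = q\<close>.\<close>

lemma dmon_tree_inj: "inj_on dmon_tree (P_exps n)"
proof (rule inj_onI)
  fix p q assume pq: "p \<in> P_exps n" "q \<in> P_exps n" "dmon_tree p = dmon_tree q"
  have "(\<lambda>r. if r = p then 1 else 0 :: rat) = (\<lambda>r. if r = q then 1 else 0)"
  proof (rule coords_unique)
    fix l :: "nat \<Rightarrow> rat"
    have "p \<noteq> []" "q \<noteq> []" "length p = n" "length q = n"
      using pq P_exps_nonempty by (auto simp: P_exps_def)
    then have "monom_eval (map l [1..<Suc n]) p = monom_eval (map l [1..<Suc n]) q"
      using tree_eval_dmon_tree [of p l] tree_eval_dmon_tree [of q l] pq(3) by simp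
    then show "(\<Sum>r\<in>P_exps n. (if r = p then 1 else 0) * monom_eval (map l [1..<Suc n]) r) =
        (\<Sum>r\<in>P_exps n. (if r = q then 1 else 0) * monom_eval (map l [1..<Suc n]) r)"
      using pq by (simp add: if_distrib [of "\<lambda>x. x * _"] sum.delta del: upt_Suc cong: if_cong)
  qed (use pq in auto)
  then show "p = q" by (metis zero_neq_one)
qed

text \<open>Justifies the description operator in \<open>rNov_coord\<close>: reduction to monomials
  gives existence, evaluation gives uniqueness. The second claim ties any admissible coordinates to
  the evaluation polynomial.\<close>

lemma rNov_coord_property:
  fixes c :: "nat list \<Rightarrow> 'k::field_char_0"
  assumes t: "t \<in> trees n" "derivs t + 1 = n"
  shows "\<exists>!c :: nat list \<Rightarrow> 'k. (\<forall>p. p \<notin> P_exps n \<longrightarrow> c p = 0) \<and>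
      ComDer_ideal n (tree_elem t - (\<Sum>p\<in>P_exps n. Poly_Mapping.single (dmon_tree p) (c p)))"
    and "(\<forall>p. p \<notin> P_exps n \<longrightarrow> c p = 0) \<and>
        ComDer_ideal n (tree_elem t - (\<Sum>p\<in>P_exps n. Poly_Mapping.single (dmon_tree p) (c p))) \<Longrightarrow>
      tree_eval l t = (\<Sum>p\<in>P_exps n. c p * monom_eval (map l [1..<Suc n]) p)" (is "?Q c \<Longrightarrow> _")
proof -
  have ev: "tree_eval l t = (\<Sum>p\<in>P_exps n. c p * monom_eval (map l [1..<Suc n]) p)"
    if "?Q c" for c and l :: "nat \<Rightarrow> 'k"
  proof -
    have "free_eval l (tree_elem t - (\<Sum>p\<in>P_exps n. Poly_Mapping.single (dmon_tree p) (c p))) = 0"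
      using that ComDer_ideal_eval by blast
    then have "tree_eval l t = (\<Sum>p\<in>P_exps n. c p * tree_eval l (dmon_tree p))"
      by (simp add: free_eval_diff free_eval_sum)
    also have "\<dots> = (\<Sum>p\<in>P_exps n. c p * monom_eval (map l [1..<Suc n]) p)"
      using tree_eval_dmon_tree P_exps_nonempty by (intro sum.cong) (auto simp: P_exps_def simp del: upt_Suc)
    finally show ?thesis .
  qed
  then show "?Q c \<Longrightarrow> tree_eval l t = (\<Sum>p\<in>P_exps n. c p * monom_eval (map l [1..<Suc n]) p)" .
  obtain w where w: "Poly_Mapping.keys w \<subseteq> dmon_tree ` P_exps n" "ComDer_ideal n (tree_elem t - w :: nat tree \<Rightarrow>\<^sub>0 'k)"
    using ComDer_reduction [OF t] by blast
  define c where "c p = (if p \<in> P_exps n then Poly_Mapping.lookup w (dmon_tree p) else 0)" for p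
  have "w = (\<Sum>s\<in>dmon_tree ` P_exps n. Poly_Mapping.single s (Poly_Mapping.lookup w s))"
    using w(1) by (intro poly_mapping_eqI)
      (auto simp: lookup_sum lookup_single when_def sum.delta in_keys_iff subset_iff)
  also have "\<dots> = (\<Sum>p\<in>P_exps n. Poly_Mapping.single (dmon_tree p) (c p))"
    using dmon_tree_inj by (simp add: sum.reindex c_def)
  finally have "?Q c" using w(2) by (simp add: c_def)
  moreover have "c' = c" if c': "?Q c'" for c'
  proof (rule coords_unique)
    show "(\<Sum>p\<in>P_exps n. c' p * monom_eval (map l [1..<Suc n]) p) =
      (\<Sum>p\<in>P_exps n. c p * monom_eval (map l [1..<Suc n]) p)" for l
      using ev [OF c', of l] ev [OF \<open>?Q c\<close>, of l] by (rule trans [OF sym])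
  qed (use c' \<open>?Q c\<close> in auto)
  ultimately show "\<exists>!c. ?Q c" by (rule ex1I)
qed

lemma rNov_coord_outside: "t \<in> trees n \<Longrightarrow> derivs t + 1 = n \<Longrightarrow> p \<notin> P_exps n \<Longrightarrow>
    rNov_coord n (tree_elem t) p = (0 :: 'k::field_char_0)"
  using theI' [OF rNov_coord_property(1) [of t n, where 'k = 'k]] by (simp add: rNov_coord_def)

lemma rNov_coord_eval: "t \<in> trees n \<Longrightarrow> derivs t + 1 = n \<Longrightarrow>
    tree_eval l t = (\<Sum>p\<in>P_exps n. rNov_coord n (tree_elem t) p * monom_eval (map l [1..<Suc n]) p)"
  for l :: "nat \<Rightarrow> 'k::field_char_0"
  unfolding rNov_coord_def by (rule rNov_coord_property(2) [OF _ _ theI' [OF rNov_coord_property(1)]])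

lemma derivs_graft: "derivs (graft i m s t) = derivs t + count_list (leaves t) i * derivs s"
proof -
  have "derivs (map_tree f s) = derivs s" for f :: "nat \<Rightarrow> nat"
    by (induction s) auto
  then show ?thesis by (induction t) (auto simp: algebra_simps)
qed

text \<open>One list operation for all levels of a composition: with \<open>sum_list\<close> it acts
  on weights, with an operation on vectors, and in \<open>Phi_comp\<close> on pairs of both.\<close>

definition comp_args :: "nat \<Rightarrow> nat \<Rightarrow> ('a list \<Rightarrow> 'a) \<Rightarrow> 'a list \<Rightarrow> 'a list"
  where "comp_args i m g xs = take (i - 1) xs @ [g (take m (drop (i - 1) xs))] @ drop (i - 1 + m) xs"

lemma map_graft_point:
  assumes "i \<in> {1..n}" "m \<ge> 1"
  shows "map (graft_point i m l) [1..<Suc n] = comp_args i m sum_list (map l [1..<Suc (n + m - 1)])"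
    and "map (\<lambda>k. l (k + i - 1)) [1..<Suc m] = take m (drop (i - 1) (map l [1..<Suc (n + m - 1)]))"
proof -
  show sub: "map (\<lambda>k. l (k + i - 1)) [1..<Suc m] = take m (drop (i - 1) (map l [1..<Suc (n + m - 1)]))"
    using assms by (intro nth_equalityI) (auto simp del: upt_Suc simp: add.commute)
  have "(\<Sum>k=1..m. l (k + i - 1)) = sum_list (take m (drop (i - 1) (map l [1..<Suc (n + m - 1)])))"
    unfolding sub [symmetric]
    by (simp add: interv_sum_list_conv_sum_set_nat atLeastLessThanSuc_atLeastAtMost del: upt_Suc)
  then show "map (graft_point i m l) [1..<Suc n] = comp_args i m sum_list (map l [1..<Suc (n + m - 1)])"
    using assms unfolding comp_args_def
    by (intro nth_equalityI) (auto simp: graft_point_def nth_append nth_Cons' add.commute simp del: upt_Suc)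
qed

text \<open>The derivations add up to \<open>(n - 1) + (m - 1)\<close>, which is what arity
  \<open>n + m - 1\<close> requires, so the composite stays in \<open>rNov\<close>.\<close>

lemma graft_dmon_tree:
  assumes "p \<in> P_exps n" "q \<in> P_exps m" "i \<in> {1..n}"
  defines "t \<equiv> graft i m (dmon_tree q) (dmon_tree p)"
  shows "t \<in> trees (n + m - 1)" "derivs t + 1 = n + m - 1"
    "tree_eval l t = monom_eval (comp_args i m sum_list (map l [1..<Suc (n + m - 1)])) p *
      monom_eval (take m (drop (i - 1) (map l [1..<Suc (n + m - 1)]))) q"
    "free_comp i m (tree_elem (dmon_tree p)) (tree_elem (dmon_tree q)) = (tree_elem t :: nat tree \<Rightarrow>\<^sub>0 'k::comm_ring_1)"
proof -
  have p: "p \<noteq> []" "length p = n" "sum_list p + 1 = n" and q: "q \<noteq> []" "length q = m" "sum_list q + 1 = m"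
    using assms P_exps_nonempty by (auto simp: P_exps_def)
  have tr: "dmon_tree p \<in> trees n" "dmon_tree q \<in> trees m"
    using dmon_tree_trees [OF p(1)] dmon_tree_trees [OF q(1)] p q by simp_all
  show "t \<in> trees (n + m - 1)" unfolding t_def by (rule graft_trees [OF tr assms(3)])
  show "derivs t + 1 = n + m - 1"
    using p q count_leaves [OF tr(1) assms(3)] by (simp add: t_def derivs_graft derivs_dmon_tree)
  have m: "m \<ge> 1" using q by simp
  show "tree_eval l t = monom_eval (comp_args i m sum_list (map l [1..<Suc (n + m - 1)])) p *
      monom_eval (take m (drop (i - 1) (map l [1..<Suc (n + m - 1)]))) q"
    unfolding t_def tree_eval_graft [OF tr(2)] count_leaves [OF tr(1) assms(3)]
      map_graft_point [OF assms(3) m, symmetric] tree_eval_dmon_tree [OF p(1)] tree_eval_dmon_tree [OF q(1)] p(2) q(2)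
    by simp
qed (simp add: t_def free_comp_tree_right)

text \<open>The generating polynomial of the structure constants of a composition. Together with
  their vanishing outside \<open>P_exps\<close>, this is all that later arguments need of these
  constants.\<close>

lemma coord_comp_eval:
  fixes ls :: "'k::field_char_0 list"
  assumes "p \<in> P_exps n" "q \<in> P_exps m" "i \<in> {1..n}" "length ls = n + m - 1"
  shows "(\<Sum>r\<in>P_exps (n + m - 1).
      rNov_coord (n + m - 1) (free_comp i m (tree_elem (dmon_tree p)) (tree_elem (dmon_tree q))) r * monom_eval ls r) =
    monom_eval (comp_args i m sum_list ls) p * monom_eval (take m (drop (i - 1) ls)) q"
proof -
  obtain l where l: "map l [1..<Suc (n + m - 1)] = ls" using ex_map_upt [OF assms(4)] by blast
  show ?thesis
    using rNov_coord_eval [OF graft_dmon_tree(1,2) [OF assms(1-3)], of l]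
    unfolding graft_dmon_tree(3,4) [OF assms(1-3)] l by simp
qed

lemma coord_comp_outside:
  assumes "p \<in> P_exps n" "q \<in> P_exps m" "i \<in> {1..n}" "r \<notin> P_exps (n + m - 1)"
  shows "rNov_coord (n + m - 1) (free_comp i m (tree_elem (dmon_tree p)) (tree_elem (dmon_tree q))) r = (0::'k::field_char_0)"
  unfolding graft_dmon_tree(4) [OF assms(1-3)]
  by (rule rNov_coord_outside [OF graft_dmon_tree(1,2) [OF assms(1-3)] assms(4)])

section \<open>The graded Lie bracket and the Loday differential\<close>

definition delete :: "nat \<Rightarrow> 'a list \<Rightarrow> 'a list"
  where "delete i xs = take i xs @ drop (Suc i) xs"

lemma delete_simps [simp]: "delete 0 (x # xs) = xs" "delete (Suc i) (x # xs) = x # delete i xs"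
  by (simp_all add: delete_def)

lemma length_delete: "i < length xs \<Longrightarrow> length (delete i xs) = length xs - 1"
  by (simp add: delete_def)

text \<open>A pair \<open>(a, x)\<close> stands for \<open>e\<^bsup>at\<^esup> \<otimes> x\<close> in the Lie algebra \<open>A \<otimes> \<gg>\<close>, where \<open>A\<close> is a commutative
  differential algebra; a cochain is evaluated on lists of such pairs.  The argument \<open>w\<close> is the
  weight of the value of \<open>\<phi>\<close> on the empty list.\<close>

context novikov_algebra
begin

lemma prod_left:
  "(x + y) \<diamondop> z = x \<diamondop> z + y \<diamondop> z" "(x - y) \<diamondop> z = x \<diamondop> z - y \<diamondop> z" "scale c x \<diamondop> z = scale c (x \<diamondop> z)"
  "0 \<diamondop> z = 0"
proof -
  interpret l: Vector_Spaces.linear scale scale "\<lambda>x. x \<diamondop> z" by (rule linear_left)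
  show "(x + y) \<diamondop> z = x \<diamondop> z + y \<diamondop> z" "(x - y) \<diamondop> z = x \<diamondop> z - y \<diamondop> z" "scale c x \<diamondop> z = scale c (x \<diamondop> z)"
    "0 \<diamondop> z = 0"
    by (rule l.add l.diff l.scale l.zero)+
qed

lemma prod_right:
  "z \<diamondop> (x + y) = z \<diamondop> x + z \<diamondop> y" "z \<diamondop> (x - y) = z \<diamondop> x - z \<diamondop> y" "z \<diamondop> scale c x = scale c (z \<diamondop> x)"
  "z \<diamondop> 0 = 0"
proof -
  interpret l: Vector_Spaces.linear scale scale "\<lambda>x. z \<diamondop> x" by (rule linear_right)
  show "z \<diamondop> (x + y) = z \<diamondop> x + z \<diamondop> y" "z \<diamondop> (x - y) = z \<diamondop> x - z \<diamondop> y" "z \<diamondop> scale c x = scale c (z \<diamondop> x)"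
    "z \<diamondop> 0 = 0"
    by (rule l.add l.diff l.scale l.zero)+
qed

text \<open>The second component of the bracket of \<open>z\<close> with \<open>(w, v)\<close>, with
  \<open>w\<close> and \<open>v\<close> as separate arguments because values of cochains are vectors
  whose weight is tracked apart.\<close>

definition act :: "'k \<times> 'v \<Rightarrow> 'k \<Rightarrow> 'v \<Rightarrow> 'v"
  where "act z w v = scale (fst z) (snd z \<diamondop> v) - scale w (v \<diamondop> snd z)"

definition brk :: "'k \<times> 'v \<Rightarrow> 'k \<times> 'v \<Rightarrow> 'k \<times> 'v"
  where "brk z y = (fst z + fst y, act z (fst y) (snd y))"

lemma fst_brk [simp]: "fst (brk z y) = fst z + fst y"
  by (simp add: brk_def)

lemma act_0 [simp]: "act z w 0 = 0"
  by (simp add: act_def prod_left prod_right)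

lemma act_diff: "act z w (u - v) = act z w u - act z w v"
  by (simp add: act_def prod_left prod_right scale_right_diff_distrib)

lemmas scale_distribs =
  scale_right_distrib scale_left_distrib scale_right_diff_distrib scale_left_diff_distrib

text \<open>The Jacobi identity of the bracket on pairs. The pre-Lie identity and right
  commutativity serve as rewriting rules \<open>1\<close> to \<open>4\<close>, which leave few
  enough products for a comparison of coefficients.\<close>

lemma act_brk: "act x (w + fst y) (act y w v) - act y (w + fst x) (act x w v) = act (brk x y) w v"
proof -
  obtain a x' where x: "x = (a, x')" by (cases x)
  obtain b y' where y: "y = (b, y')" by (cases y)
  have 1: "x' \<diamondop> (y' \<diamondop> v) = (x' \<diamondop> y') \<diamondop> v - (y' \<diamondop> x') \<diamondop> v + y' \<diamondop> (x' \<diamondop> v)"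
    using pre_Lie [of x' y' v] by (simp add: algebra_simps)
  have 2: "x' \<diamondop> (v \<diamondop> y') = (x' \<diamondop> y') \<diamondop> v - (v \<diamondop> x') \<diamondop> y' + v \<diamondop> (x' \<diamondop> y')"
    using pre_Lie [of x' v y'] right_commutative [of x' v y'] by (simp add: algebra_simps)
  have 3: "y' \<diamondop> (v \<diamondop> x') = (y' \<diamondop> x') \<diamondop> v - (v \<diamondop> x') \<diamondop> y' + v \<diamondop> (y' \<diamondop> x')"
    using pre_Lie [of y' v x'] right_commutative [of y' v x'] right_commutative [of v x' y']
    by (simp add: algebra_simps)
  have 4: "(v \<diamondop> y') \<diamondop> x' = (v \<diamondop> x') \<diamondop> y'" "(y' \<diamondop> v) \<diamondop> x' = (y' \<diamondop> x') \<diamondop> v"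
      "(x' \<diamondop> v) \<diamondop> y' = (x' \<diamondop> y') \<diamondop> v"
    by (rule right_commutative)+
  show ?thesis
    unfolding x y act_def brk_def fst_conv snd_conv prod_left prod_right 1 2 3 4
    by (simp add: scale_distribs algebra_simps)
qed

lemma brk_jacobi: "snd (brk x (brk y z)) - snd (brk y (brk x z)) = snd (brk (brk x y) z)"
  using act_brk [of x "fst z" y "snd z"] by (simp add: brk_def add.commute)

lemma brk_antisym: "brk y x = (fst (brk x y), 0 - snd (brk x y))"
  by (simp add: brk_def act_def)

text \<open>The Lie derivative: \<open>z\<close> acts on the value, and the insertions of a bracket
  into each slot are subtracted. Fixing the argument \<open>y\<close> passes its weight to
  \<open>w\<close>, so that at the empty list \<open>w\<close> is the weight of the whole
  value.\<close>

fun lie_der :: "'k \<times> 'v \<Rightarrow> (('k \<times> 'v) list \<Rightarrow> 'v) \<Rightarrow> 'k \<Rightarrow> ('k \<times> 'v) list \<Rightarrow> 'v" where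
  "lie_der z \<phi> w [] = act z w (\<phi> [])"
| "lie_der z \<phi> w (y # ys) = lie_der z (\<lambda>us. \<phi> (y # us)) (w + fst y) ys - \<phi> (brk z y # ys)"

text \<open>The Cartan formula \<open>\<iota>\<^sub>z d = L\<^sub>z - d \<iota>\<^sub>z\<close> taken as a definition.\<close>

fun loday :: "(('k \<times> 'v) list \<Rightarrow> 'v) \<Rightarrow> 'k \<Rightarrow> ('k \<times> 'v) list \<Rightarrow> 'v" where
  "loday \<phi> w [] = 0"
| "loday \<phi> w (z # zs) = lie_der z \<phi> w zs - loday (\<lambda>us. \<phi> (z # us)) (w + fst z) zs"

text \<open>The part of multilinearity that the Lie algebra identities call for: the Jacobi identity
  and antisymmetry are both phrased with differences.\<close>

definition subtractive :: "(('k \<times> 'v) list \<Rightarrow> 'v) \<Rightarrow> bool"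
  where "subtractive \<phi> \<longleftrightarrow>
    (\<forall>as bs a x y. \<phi> (as @ (a, x - y) # bs) = \<phi> (as @ (a, x) # bs) - \<phi> (as @ (a, y) # bs))"

definition swap_alternating :: "(('k \<times> 'v) list \<Rightarrow> 'v) \<Rightarrow> bool"
  where "swap_alternating \<phi> \<longleftrightarrow> (\<forall>as x y bs. \<phi> (as @ x # y # bs) = - \<phi> (as @ y # x # bs))"

lemma subtractive_Cons: "subtractive \<phi> \<Longrightarrow> subtractive (\<lambda>us. \<phi> (z # us))"
  unfolding subtractive_def by (metis append_Cons)

lemma subtractive_hd: "subtractive \<phi> \<Longrightarrow> \<phi> ((a, x - y) # bs) = \<phi> ((a, x) # bs) - \<phi> ((a, y) # bs)"
  unfolding subtractive_def by (metis append_Nil)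

lemma swap_alternating_Cons: "swap_alternating \<phi> \<Longrightarrow> swap_alternating (\<lambda>us. \<phi> (z # us))"
  unfolding swap_alternating_def by (metis append_Cons)

lemma swap_alternating_hd: "swap_alternating \<phi> \<Longrightarrow> \<phi> (x # y # bs) = - \<phi> (y # x # bs)"
  unfolding swap_alternating_def by (metis append_Nil)

lemma lie_der_diff: "lie_der z (\<lambda>us. \<phi> us - \<psi> us) w zs = lie_der z \<phi> w zs - lie_der z \<psi> w zs"
  by (induction zs arbitrary: \<phi> \<psi> w) (simp_all add: act_diff)

lemma loday_diff: "loday (\<lambda>us. \<phi> us - \<psi> us) w zs = loday \<phi> w zs - loday \<psi> w zs"
  by (induction zs arbitrary: \<phi> \<psi> w) (simp_all add: lie_der_diff)

lemma lie_der_zero: "lie_der z (\<lambda>us. 0) w zs = 0"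
  using lie_der_diff [of z "\<lambda>us. 0" "\<lambda>us. 0"] by simp

lemma loday_zero: "loday (\<lambda>us. 0) w zs = 0"
  using loday_diff [of "\<lambda>us. 0" "\<lambda>us. 0"] by simp

lemma lie_der_uminus: "lie_der z (\<lambda>us. - \<phi> us) w zs = - lie_der z \<phi> w zs"
  using lie_der_diff [of z "\<lambda>us. 0" \<phi>] by (simp add: lie_der_zero)

lemma loday_uminus: "loday (\<lambda>us. - \<phi> us) w zs = - loday \<phi> w zs"
  using loday_diff [of "\<lambda>us. 0" \<phi>] by (simp add: loday_zero)

lemma lie_der_cong: "(\<And>us. length us = length zs \<Longrightarrow> \<phi> us = \<psi> us) \<Longrightarrow> lie_der z \<phi> w zs = lie_der z \<psi> w zs"
proof (induction zs arbitrary: \<phi> \<psi> w)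
  case (Cons y ys)
  have "lie_der z (\<lambda>us. \<phi> (y # us)) (w + fst y) ys = lie_der z (\<lambda>us. \<psi> (y # us)) (w + fst y) ys"
    using Cons.prems by (intro Cons.IH) simp
  then show ?case using Cons.prems by simp
qed simp

lemma loday_cong: "(\<And>us. Suc (length us) = length zs \<Longrightarrow> \<phi> us = \<psi> us) \<Longrightarrow> loday \<phi> w zs = loday \<psi> w zs"
proof (induction zs arbitrary: \<phi> \<psi> w)
  case (Cons y ys)
  have "loday (\<lambda>us. \<phi> (y # us)) (w + fst y) ys = loday (\<lambda>us. \<psi> (y # us)) (w + fst y) ys"
    using Cons.prems by (intro Cons.IH) simp
  moreover have "lie_der y \<phi> w ys = lie_der y \<psi> w ys"
    using Cons.prems by (intro lie_der_cong) simp
  ultimately show ?case by simp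
qed simp

text \<open>Lie derivatives represent the bracket. The weights differ because a value of
  \<open>lie_der y \<phi>\<close> is heavier than one of \<open>\<phi>\<close> by the weight of
  \<open>y\<close>.\<close>

lemma lie_der_commutator:
  assumes "subtractive \<phi>"
  shows "lie_der x (lie_der y \<phi> w) (w + fst y) zs - lie_der y (lie_der x \<phi> w) (w + fst x) zs =
    lie_der (brk x y) \<phi> w zs"
  using assms
proof (induction zs arbitrary: \<phi> w)
  case Nil
  show ?case by (simp add: act_brk)
next
  case (Cons z zs)
  have j: "\<phi> (brk x (brk y z) # zs) - \<phi> (brk y (brk x z) # zs) = \<phi> (brk (brk x y) z # zs)"
  proof -
    have "brk (brk x y) z = (fst x + fst y + fst z, snd (brk x (brk y z)) - snd (brk y (brk x z)))"
      by (simp add: brk_jacobi prod_eq_iff)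
    moreover have "(fst x + fst y + fst z, snd (brk x (brk y z))) = brk x (brk y z)"
        "(fst x + fst y + fst z, snd (brk y (brk x z))) = brk y (brk x z)"
      by (simp_all add: prod_eq_iff)
    ultimately show ?thesis using subtractive_hd [OF Cons.prems] by metis
  qed
  \<comment> \<open>The two middle terms are exchanged when \<open>x\<close> and \<open>y\<close>
    are, so they cancel in the commutator; the last term feeds the Jacobi identity
    \<open>j\<close>.\<close>
  have e: "lie_der x (lie_der y \<phi> w) (w + fst y) (z # zs) =
      lie_der x (lie_der y (\<lambda>us. \<phi> (z # us)) (w + fst z)) (w + fst z + fst y) zs
      - lie_der x (\<lambda>us. \<phi> (brk y z # us)) (w + (fst y + fst z)) zs
      - lie_der y (\<lambda>us. \<phi> (brk x z # us)) (w + (fst x + fst z)) zs + \<phi> (brk y (brk x z) # zs)" for x y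
    by (simp add: lie_der_diff algebra_simps)
  show ?case
    unfolding e using Cons.IH [OF subtractive_Cons [OF Cons.prems], of z "w + fst z"] j
    by (simp add: algebra_simps)
qed

text \<open>Expanding both sides at the first argument \<open>z\<close>, the difference reduces to
  the commutator rule and the induction hypothesis for \<open>\<phi>\<close> with \<open>z\<close>
  inserted.\<close>

lemma lie_der_loday:
  assumes "subtractive \<phi>"
  shows "lie_der x (loday \<phi> w) w zs = loday (lie_der x \<phi> w) (w + fst x) zs"
  using assms
proof (induction zs arbitrary: \<phi> w)
  case (Cons z zs)
  have "lie_der x (loday \<phi> w) w (z # zs) =
      lie_der x (lie_der z \<phi> w) (w + fst z) zs - lie_der x (loday (\<lambda>us. \<phi> (z # us)) (w + fst z)) (w + fst z) zs
      - lie_der (brk x z) \<phi> w zs + loday (\<lambda>us. \<phi> (brk x z # us)) (w + (fst x + fst z)) zs"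
    by (simp add: lie_der_diff algebra_simps)
  moreover have "loday (lie_der x \<phi> w) (w + fst x) (z # zs) =
      lie_der z (lie_der x \<phi> w) (w + fst x) zs - loday (lie_der x (\<lambda>us. \<phi> (z # us)) (w + fst z)) (w + fst z + fst x) zs
      + loday (\<lambda>us. \<phi> (brk x z # us)) (w + (fst x + fst z)) zs"
    by (simp add: loday_diff algebra_simps)
  ultimately show ?case
    using Cons.IH [OF subtractive_Cons [OF Cons.prems], of z "w + fst z"]
      lie_der_commutator [OF Cons.prems, of x z w zs]
    by (simp add: algebra_simps)
qed simp

text \<open>After inserting \<open>z\<close>, Cartan's recursion leaves \<open>L_z d - d L_z\<close>
  plus \<open>d d\<close> of the contracted cochain; the former vanishes by
  \<open>lie_der_loday\<close>, the latter by induction.\<close>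

theorem loday_loday:
  assumes "subtractive \<phi>"
  shows "loday (loday \<phi> w) w zs = 0"
  using assms
proof (induction zs arbitrary: \<phi> w)
  case (Cons z zs)
  then show ?case
    using Cons.IH [OF subtractive_Cons [OF Cons.prems], of z "w + fst z"]
      lie_der_loday [OF Cons.prems, of z w zs]
    by (simp add: loday_diff)
qed simp

lemma lie_der_alternating:
  assumes "swap_alternating \<phi>"
  shows "swap_alternating (lie_der z \<phi> w)"
proof -
  have "lie_der z \<phi> w (as @ x # y # bs) = - lie_der z \<phi> w (as @ y # x # bs)"
    if "swap_alternating \<phi>" for \<phi> w as x y bs
    using that
  proof (induction as arbitrary: \<phi> w)
    case Nil
    have "(\<lambda>us. \<phi> (x # y # us)) = (\<lambda>us. - \<phi> (y # x # us))"
      by (rule ext) (rule swap_alternating_hd [OF Nil])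
    then show ?case
      using swap_alternating_hd [OF Nil, of x "brk z y" bs] swap_alternating_hd [OF Nil, of "brk z x" y bs]
      by (simp add: lie_der_uminus algebra_simps)
  next
    case (Cons a as)
    have "\<phi> (brk z a # as @ x # y # bs) = - \<phi> (brk z a # as @ y # x # bs)"
      using Cons.prems unfolding swap_alternating_def by (metis append_Cons)
    moreover have "lie_der z (\<lambda>us. \<phi> (a # us)) (w + fst a) (as @ x # y # bs) =
        - lie_der z (\<lambda>us. \<phi> (a # us)) (w + fst a) (as @ y # x # bs)"
      by (rule Cons.IH [OF swap_alternating_Cons [OF Cons.prems]])
    ultimately show ?case by (simp only: append_Cons lie_der.simps minus_diff_eq) simp
  qed
  from this [OF assms] show ?thesis unfolding swap_alternating_def by blast
qed

text \<open>Work is needed for a swap of the first two arguments: expanding twice, the two Lie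
  derivatives change places with opposite signs, and the leftover bracket is antisymmetric.\<close>

theorem loday_alternating:
  assumes "swap_alternating \<phi>" "subtractive \<phi>"
  shows "swap_alternating (loday \<phi> w)"
proof -
  have "loday \<phi> w (as @ x # y # bs) = - loday \<phi> w (as @ y # x # bs)"
    if "swap_alternating \<phi>" "subtractive \<phi>" for \<phi> w as x y bs
    using that
  proof (induction as arbitrary: \<phi> w)
    case Nil
    have "(\<lambda>us. \<phi> (x # y # us)) = (\<lambda>us. - \<phi> (y # x # us))"
      by (rule ext) (rule swap_alternating_hd [OF Nil(1)])
    \<comment> \<open>A slot filled with 0 gives 0, as \<open>0 = 0 - 0\<close>; a slot with
      \<open>0 - v\<close> therefore changes sign.\<close>
    moreover have "\<phi> (brk y x # bs) = - \<phi> (brk x y # bs)"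
      using subtractive_hd [OF Nil(2), of "fst (brk x y)" 0 "snd (brk x y)" bs]
        subtractive_hd [OF Nil(2), of "fst (brk x y)" 0 0 bs]
      unfolding brk_antisym [of y x] by (simp only: prod.collapse) simp
    ultimately show ?case
      by (simp add: loday_uminus algebra_simps)
  next
    case (Cons a as)
    have "lie_der a \<phi> w (as @ x # y # bs) = - lie_der a \<phi> w (as @ y # x # bs)"
      using lie_der_alternating [OF Cons.prems(1), of a w] unfolding swap_alternating_def by blast
    then show ?case
      using Cons.IH [OF swap_alternating_Cons [OF Cons.prems(1)] subtractive_Cons [OF Cons.prems(2)],
          of a "w + fst a"]
      by simp
  qed
  from this [OF assms] show ?thesis unfolding swap_alternating_def by blast
qed

section \<open>Comparison of the recursive differential with the Chevalley-Eilenberg sums\<close>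

lemma lie_der_explicit:
  "lie_der z \<phi> w zs = act z (w + sum_list (map fst zs)) (\<phi> zs) - (\<Sum>j<length zs. \<phi> (zs[j := brk z (zs ! j)]))"
proof (induction zs arbitrary: \<phi> w)
  case (Cons y ys)
  show ?case
    unfolding list.size add_Suc_right sum.lessThan_Suc_shift
    by (simp add: Cons.IH algebra_simps)
qed simp

lemma swap_alternating_move:
  "swap_alternating \<phi> \<Longrightarrow> \<phi> (as @ b # bs) = scale ((-1) ^ length as) (\<phi> (b # as @ bs))"
proof (induction as arbitrary: \<phi>)
  case (Cons a as)
  then show ?case
    using Cons.IH [OF swap_alternating_Cons [OF Cons.prems], of a] swap_alternating_hd [OF Cons.prems, of a b "as @ bs"]
    by simp
qed simp

lemma swap_alternating_update:
  assumes "swap_alternating \<phi>" "j < length zs"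
  shows "\<phi> (zs[j := b]) = scale ((-1) ^ j) (\<phi> (b # delete j zs))"
  using swap_alternating_move [OF assms(1), of "take j zs" b "drop (Suc j) zs"] assms(2)
  by (simp add: upd_conv_take_nth_drop delete_def)

text \<open>Positions are counted from 0, so \<open>(-1) ^ i\<close> is the usual sign for the
  argument number \<open>i + 1\<close>; in the sum over pairs below the parity of
  \<open>i + j\<close> is the same under both countings.\<close>

definition ce_action :: "(('k \<times> 'v) list \<Rightarrow> 'v) \<Rightarrow> 'k \<Rightarrow> ('k \<times> 'v) list \<Rightarrow> 'v"
  where "ce_action \<phi> w zs = (\<Sum>i<length zs. scale ((-1) ^ i)
    (act (zs ! i) (w + sum_list (map fst (delete i zs))) (\<phi> (delete i zs))))"

definition ce_bracket :: "(('k \<times> 'v) list \<Rightarrow> 'v) \<Rightarrow> ('k \<times> 'v) list \<Rightarrow> 'v"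
  where "ce_bracket \<phi> zs = (\<Sum>j<length zs. \<Sum>i<j. scale ((-1) ^ (i + j))
    (\<phi> (brk (zs ! i) (zs ! j) # delete i (delete j zs))))"

lemma ce_action_Cons: "ce_action \<phi> w (z # zs) =
    act z (w + sum_list (map fst zs)) (\<phi> zs) - ce_action (\<lambda>us. \<phi> (z # us)) (w + fst z) zs"
  unfolding ce_action_def list.size add_Suc_right sum.lessThan_Suc_shift add_0_right
  by (simp add: sum_negf algebra_simps)

text \<open>Pairs containing the new argument \<open>z\<close> give the brackets that the Lie
  derivative inserts in place; in all other pairs the bracket is moved past \<open>z\<close> at the
  cost of a sign.\<close>

lemma ce_bracket_Cons:
  assumes "swap_alternating \<phi>"
  shows "ce_bracket \<phi> (z # zs) =
    - (\<Sum>j<length zs. \<phi> (zs[j := brk z (zs ! j)])) - ce_bracket (\<lambda>us. \<phi> (z # us)) zs"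
proof -
  have "ce_bracket \<phi> (z # zs) = (\<Sum>j<length zs. scale ((-1) ^ Suc j) (\<phi> (brk z (zs ! j) # delete j zs)) +
     (\<Sum>i<j. scale ((-1) ^ (i + j)) (\<phi> (brk (zs ! i) (zs ! j) # z # delete i (delete j zs)))))"
    unfolding ce_bracket_def list.size add_Suc_right add_0_right sum.lessThan_Suc_shift
    by simp
  also have "\<dots> = (\<Sum>j<length zs. - \<phi> (zs[j := brk z (zs ! j)]) -
     (\<Sum>i<j. scale ((-1) ^ (i + j)) (\<phi> (z # brk (zs ! i) (zs ! j) # delete i (delete j zs)))))"
  proof (rule sum.cong [OF refl])
    fix j assume "j \<in> {..<length zs}"
    then have "scale ((-1) ^ Suc j) (\<phi> (brk z (zs ! j) # delete j zs)) = - \<phi> (zs[j := brk z (zs ! j)])"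
      using swap_alternating_update [OF assms, of j zs] by simp
    moreover have "(\<Sum>i<j. scale ((-1) ^ (i + j)) (\<phi> (brk (zs ! i) (zs ! j) # z # delete i (delete j zs)))) =
        - (\<Sum>i<j. scale ((-1) ^ (i + j)) (\<phi> (z # brk (zs ! i) (zs ! j) # delete i (delete j zs))))"
      unfolding sum_negf [symmetric]
      by (rule sum.cong [OF refl]) (subst swap_alternating_hd [OF assms], simp)
    ultimately show "scale ((-1) ^ Suc j) (\<phi> (brk z (zs ! j) # delete j zs)) +
        (\<Sum>i<j. scale ((-1) ^ (i + j)) (\<phi> (brk (zs ! i) (zs ! j) # z # delete i (delete j zs)))) =
      - \<phi> (zs[j := brk z (zs ! j)]) -
        (\<Sum>i<j. scale ((-1) ^ (i + j)) (\<phi> (z # brk (zs ! i) (zs ! j) # delete i (delete j zs))))"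
      by (simp only: diff_conv_add_uminus)
  qed
  finally show ?thesis by (simp add: ce_bracket_def sum_subtractf sum_negf)
qed

text \<open>The bridge from the recursion, suited to \<open>d d = 0\<close>, to the sums over
  omitted arguments that the shuffles of \<open>CE_diff\<close> produce.\<close>

theorem loday_eq_ce:
  "swap_alternating \<phi> \<Longrightarrow> loday \<phi> w zs = ce_action \<phi> w zs + ce_bracket \<phi> zs"
proof (induction zs arbitrary: \<phi> w)
  case Nil
  show ?case by (simp add: ce_action_def ce_bracket_def)
next
  case (Cons z zs)
  then show ?case
    using Cons.IH [OF swap_alternating_Cons [OF Cons.prems]]
    by (simp add: ce_action_Cons ce_bracket_Cons lie_der_explicit)
qed

end

section \<open>Permuting lists\<close>

lemma sum_fun_apply: "(\<Sum>x\<in>S. f x) y = (\<Sum>x\<in>S. f x y)"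
  by (induction S rule: infinite_finite_induct) simp_all

lemma length_perm_list [simp]: "length (perm_list n \<sigma> xs) = n"
  by (simp add: perm_list_def del: upt_Suc)

lemma perm_list_nth: "k < n \<Longrightarrow> perm_list n \<sigma> xs ! k = xs ! (\<sigma> (Suc k) - 1)"
  by (simp add: perm_list_def nth_append del: upt_Suc)

lemma permutes_in_range: "\<sigma> permutes {1..n} \<Longrightarrow> k < n \<Longrightarrow> \<sigma> (Suc k) - 1 < n \<and> Suc (\<sigma> (Suc k) - 1) = \<sigma> (Suc k)"
  using permutes_in_image [of \<sigma> "{1..n}" "Suc k"] by auto

text \<open>Reindexing is contravariant, which is why the action on arguments uses the inverse
  permutation.\<close>

lemma perm_list_comp: "\<sigma> permutes {1..n} \<Longrightarrow> perm_list n \<sigma> (perm_list n \<tau> xs) = perm_list n (\<tau> \<circ> \<sigma>) xs"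
  using permutes_in_range [of \<sigma> n] by (intro nth_equalityI) (simp_all add: perm_list_nth)

lemma perm_list_id [simp]: "length xs = n \<Longrightarrow> perm_list n id xs = xs"
  by (intro nth_equalityI) (simp_all add: perm_list_nth)

lemma perm_list_inv:
  assumes "\<sigma> permutes {1..n}" "length xs = n"
  shows "perm_list n \<sigma> (perm_list n (inv \<sigma>) xs) = xs" "perm_list n (inv \<sigma>) (perm_list n \<sigma> xs) = xs"
  using assms permutes_inv [OF assms(1)] permutes_inv_o [OF assms(1)] by (simp_all add: perm_list_comp)

lemma map_perm_list: "\<sigma> permutes {1..n} \<Longrightarrow> length xs = n \<Longrightarrow> map f (perm_list n \<sigma> xs) = perm_list n \<sigma> (map f xs)"
  using permutes_in_range [of \<sigma> n] by (intro nth_equalityI) (simp_all add: perm_list_nth)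

lemma mset_perm_list:
  assumes "\<sigma> permutes {1..n}" "length xs = n"
  shows "mset (perm_list n \<sigma> xs) = mset xs"
proof -
  have "mset (perm_list n \<sigma> xs) = image_mset (\<lambda>i. xs ! (i - 1)) (image_mset \<sigma> (mset_set {1..n}))"
    by (simp add: perm_list_def multiset.map_comp comp_def atLeastLessThanSuc_atLeastAtMost del: upt_Suc)
  also have "\<dots> = image_mset (\<lambda>i. xs ! (i - 1)) (mset_set {1..n})"
    by (simp only: permutes_image_mset [OF assms(1)])
  also have "\<dots> = mset (perm_list n id xs)"
    by (simp add: perm_list_def atLeastLessThanSuc_atLeastAtMost del: upt_Suc)
  finally show ?thesis using assms by simp
qed

lemma perm_list_P_exps: "\<sigma> permutes {1..n} \<Longrightarrow> p \<in> P_exps n \<Longrightarrow> perm_list n \<sigma> p \<in> P_exps n"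
  using mset_perm_list [of \<sigma> n p] by (auto simp: P_exps_def simp flip: sum_mset_sum_list)

lemma perm_list_eq_iff:
  assumes "\<sigma> permutes {1..n}" "length p = n" "length r = n"
  shows "perm_list n \<sigma> p = r \<longleftrightarrow> p = perm_list n (inv \<sigma>) r"
  using perm_list_inv(1) [OF assms(1,3)] perm_list_inv(2) [OF assms(1,2)] by auto

text \<open>Slot \<open>i\<close> of a list, counted from 0, is position \<open>Suc i\<close> for
  the permutation; \<open>perm_list\<close> with the inverse carries it to position
  \<open>\<sigma> (Suc i)\<close>.\<close>

lemma perm_list_update:
  assumes "\<sigma> permutes {1..n}" "i < n" "length xs = n"
  shows "perm_list n (inv \<sigma>) (xs[i := y]) = (perm_list n (inv \<sigma>) xs)[\<sigma> (Suc i) - 1 := y]"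
proof (rule nth_equalityI)
  fix k assume "k < length (perm_list n (inv \<sigma>) (xs[i := y]))"
  then have k: "k < n" by simp
  have inv: "inv \<sigma> permutes {1..n}" using assms by (intro permutes_inv)
  have "inv \<sigma> (Suc k) - 1 = i \<longleftrightarrow> inv \<sigma> (Suc k) = Suc i"
    using permutes_in_range [OF inv k] by auto
  also have "\<dots> \<longleftrightarrow> Suc k = \<sigma> (Suc i)" using permutes_inv_eq [OF assms(1)] by metis
  also have "\<dots> \<longleftrightarrow> k = \<sigma> (Suc i) - 1"
    using permutes_in_range [OF assms(1,2)] by auto
  finally show "perm_list n (inv \<sigma>) (xs[i := y]) ! k = (perm_list n (inv \<sigma>) xs)[\<sigma> (Suc i) - 1 := y] ! k"
    using k permutes_in_range [OF inv k] assms by (auto simp: perm_list_nth nth_list_update)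
qed simp

lemma prod_list_perm: "\<sigma> permutes {1..n} \<Longrightarrow> length xs = n \<Longrightarrow> prod_list (perm_list n \<sigma> xs) = prod_list (xs :: 'a::comm_monoid_mult list)"
  using mset_perm_list [of \<sigma> n xs] by (metis prod_mset_prod_list)

text \<open>A monomial is a product over matched pairs of weight and exponent, so permuting the
  exponents amounts to permuting the weights backwards.\<close>

lemma monom_eval_perm:
  assumes "\<sigma> permutes {1..n}" "length ls = n" "length p = n"
  shows "monom_eval ls (perm_list n \<sigma> p) = monom_eval (perm_list n (inv \<sigma>) ls) p"
proof -
  have "map2 (^) ls (perm_list n \<sigma> p) = perm_list n \<sigma> (map2 (^) (perm_list n (inv \<sigma>) ls) p)"
  proof (rule nth_equalityI)
    fix k assume "k < length (map2 (^) ls (perm_list n \<sigma> p))"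
    then have k: "k < n" by simp
    have "perm_list n \<sigma> (perm_list n (inv \<sigma>) ls) ! k = ls ! k" by (simp only: perm_list_inv(1) [OF assms(1,2)])
    then show "map2 (^) ls (perm_list n \<sigma> p) ! k = perm_list n \<sigma> (map2 (^) (perm_list n (inv \<sigma>) ls) p) ! k"
      using k permutes_in_range [OF assms(1) k] assms by (simp add: perm_list_nth)
  qed (use assms in simp)
  then show ?thesis
    using prod_list_perm [OF assms(1), of "map2 (^) (perm_list n (inv \<sigma>) ls) p"] assms(2,3)
    by (simp add: monom_eval_def)
qed

section \<open>Multilinear operations and the Hadamard product\<close>

context novikov_algebra
begin

lemma linear_iff_additive: "Vector_Spaces.linear scale scale f \<longleftrightarrow>
    (\<forall>x y. f (x + y) = f x + f y) \<and> (\<forall>c x. f (scale c x) = scale c (f x))"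
proof -
  have "module scale" by unfold_locales
  then show ?thesis
    unfolding module_hom_iff_linear [symmetric] module_hom_def module_hom_axioms_def by auto
qed

lemma End_op_iff: "f \<in> End_op scale n \<longleftrightarrow> (\<forall>xs. length xs \<noteq> n \<longrightarrow> f xs = 0) \<and>
    (\<forall>xs i x y. length xs = n \<longrightarrow> i < n \<longrightarrow> f (xs[i := x + y]) = f (xs[i := x]) + f (xs[i := y])) \<and>
    (\<forall>xs i c x. length xs = n \<longrightarrow> i < n \<longrightarrow> f (xs[i := scale c x]) = scale c (f (xs[i := x])))"
  by (auto simp: End_op_def linear_iff_additive)

lemma End_op_length: "f \<in> End_op scale n \<Longrightarrow> length xs \<noteq> n \<Longrightarrow> f xs = 0"
  by (simp add: End_op_iff)

lemma End_op_update: "f \<in> End_op scale n \<Longrightarrow> length xs = n \<Longrightarrow> i < n \<Longrightarrow> Vector_Spaces.linear scale scale (\<lambda>y. f (xs[i := y]))"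
  by (simp add: End_op_def)

text \<open>If the total length is not \<open>n\<close>, the map is constantly 0 and hence still
  linear; this spares side conditions later.\<close>

lemma End_op_slot:
  assumes "f \<in> End_op scale n"
  shows "Vector_Spaces.linear scale scale (\<lambda>y. f (as @ y # bs))"
proof (cases "length as + Suc (length bs) = n")
  case True
  have "as @ y # bs = (as @ 0 # bs)[length as := y]" for y by simp
  then show ?thesis using End_op_update [OF assms, of "as @ 0 # bs" "length as"] True by simp
next
  case False
  then show ?thesis using End_op_length [OF assms] by (simp add: linear_iff_additive)
qed

lemma End_op_0: "0 \<in> End_op scale n"
  by (simp add: End_op_iff)

lemma End_op_add: "f \<in> End_op scale n \<Longrightarrow> g \<in> End_op scale n \<Longrightarrow> f + g \<in> End_op scale n"
  by (simp add: End_op_iff algebra_simps scale_right_distrib)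

lemma End_op_scale: "f \<in> End_op scale n \<Longrightarrow> fun_scale scale c f \<in> End_op scale n"
  by (simp add: End_op_iff fun_scale_def scale_right_distrib mult.commute)

lemma fun_scale_minus_one: "fun_scale scale (-1) f = - f"
  by (simp add: fun_scale_def fun_eq_iff)

lemma End_op_uminus: "f \<in> End_op scale n \<Longrightarrow> - f \<in> End_op scale n"
  using End_op_scale [of f n "-1"] by (simp add: fun_scale_minus_one)

lemma End_op_sum: "(\<And>x. x \<in> S \<Longrightarrow> f x \<in> End_op scale n) \<Longrightarrow> (\<Sum>x\<in>S. f x) \<in> End_op scale n"
  by (induction S rule: infinite_finite_induct) (simp_all add: End_op_0 End_op_add)

lemma End_op_act:
  assumes "f \<in> End_op scale n" "\<sigma> permutes {1..n}"
  shows "End_act n \<sigma> f \<in> End_op scale n"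
  unfolding End_op_def
proof (intro CollectI conjI allI impI)
  fix xs :: "'v list" and i assume "length xs = n" "i < n"
  then show "Vector_Spaces.linear scale scale (\<lambda>y. End_act n \<sigma> f (xs[i := y]))"
    using End_op_update [OF assms(1), of "perm_list n (inv \<sigma>) xs" "\<sigma> (Suc i) - 1"] permutes_in_range [OF assms(2)]
    by (simp add: End_act_def perm_list_update [OF assms(2)])
qed (simp add: End_act_def)

lemma End_comp_eq: "End_comp n i m f g xs = (if length xs = n + m - 1 then f (comp_args i m g xs) else 0)"
  by (simp add: End_comp_def comp_args_def)

lemma linear_compose: "Vector_Spaces.linear scale scale f \<Longrightarrow> Vector_Spaces.linear scale scale g \<Longrightarrow>
    Vector_Spaces.linear scale scale (\<lambda>x. f (g x))"
  by (simp add: linear_iff_additive)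

lemma End_op_comp:
  assumes f: "f \<in> End_op scale n" and g: "g \<in> End_op scale m" and i: "i \<in> {1..n}"
  shows "End_comp n i m f g \<in> End_op scale (n + m - 1)"
  unfolding End_op_def
proof (intro CollectI conjI allI impI)
  fix xs :: "'v list" and j assume xs: "length xs = n + m - 1" and j: "j < n + m - 1"
  let ?C = "comp_args i m g"
  have len: "length (?C xs) = n" using xs i by (auto simp: comp_args_def)
  consider (left) "j < i - 1" | (mid) "i - 1 \<le> j" "j < i - 1 + m" | (right) "j \<ge> i - 1 + m" by linarith
  then have "Vector_Spaces.linear scale scale (\<lambda>y. f (?C (xs[j := y])))"
  proof cases
    case left
    have "?C (xs[j := y]) = (?C xs)[j := y]" for y
      using left xs i j by (simp add: comp_args_def take_update_swap list_update_append)
    then show ?thesis using End_op_update [OF f len, of j] left i by auto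
  next
    case mid
    have "?C (xs[j := y]) = take (i - 1) xs @ g ((take m (drop (i - 1) xs))[j - (i - 1) := y]) # drop (i - 1 + m) xs" for y
      using mid xs i by (simp add: comp_args_def drop_update_swap take_update_swap list_update_beyond)
    moreover have "Vector_Spaces.linear scale scale (\<lambda>y. g ((take m (drop (i - 1) xs))[j - (i - 1) := y]))"
      using mid xs i by (intro End_op_update [OF g]) auto
    ultimately show ?thesis
      using linear_compose [OF End_op_slot [OF f]] by simp
  next
    case right
    \<comment> \<open>The block of \<open>m\<close> arguments has become one entry, so later
      positions drop by \<open>m - 1\<close>.\<close>
    have "?C (xs[j := y]) = (?C xs)[j + 1 - m := y]" for y
    proof -
      have "take m (drop (i - 1) (xs[j := y])) = take m (drop (i - 1) xs)"
          "take (i - 1) (xs[j := y]) = take (i - 1) xs"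
          "drop (i - 1 + m) (xs[j := y]) = (drop (i - 1 + m) xs)[j - (i - 1 + m) := y]"
        using right i by (simp_all add: drop_update_swap)
      moreover have "j + 1 - m - length (take (i - 1) xs @ [g (take m (drop (i - 1) xs))]) = j - (i - 1 + m)"
          "\<not> j + 1 - m < length (take (i - 1) xs @ [g (take m (drop (i - 1) xs))])"
        using right xs i by auto
      ultimately show ?thesis
        unfolding comp_args_def append_assoc [symmetric] by (simp only: list_update_append if_False)
    qed
    then show ?thesis using End_op_update [OF f len, of "j + 1 - m"] right i j by simp
  qed
  then show "Vector_Spaces.linear scale scale (\<lambda>y. End_comp n i m f g (xs[j := y]))"
    using xs by (simp add: End_comp_eq)
qed (simp add: End_comp_eq)

lemma Had_opD: "F \<in> Had_op scale n \<Longrightarrow> F p \<in> End_op scale n"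
  by (cases "p \<in> P_exps n") (auto simp: Had_op_def End_op_0)

lemma Had_op_outside: "F \<in> Had_op scale n \<Longrightarrow> p \<notin> P_exps n \<Longrightarrow> F p = 0"
  by (simp add: Had_op_def)

lemma Had_opI: "(\<And>p. p \<notin> P_exps n \<Longrightarrow> F p = 0) \<Longrightarrow> (\<And>p. p \<in> P_exps n \<Longrightarrow> F p \<in> End_op scale n) \<Longrightarrow> F \<in> Had_op scale n"
  by (simp add: Had_op_def)

abbreviation "scale2 \<equiv> fun_scale (fun_scale scale)"

lemma scale2_apply [simp]: "scale2 c F p xs = scale c (F p xs)"
  by (simp add: fun_scale_def)

lemma scale2_apply1: "scale2 c F p = fun_scale scale c (F p)"
  by (simp add: fun_scale_def)

lemma Had_op_0: "0 \<in> Had_op scale n"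
  by (simp add: Had_op_def End_op_0)

lemma Had_op_add: "F \<in> Had_op scale n \<Longrightarrow> G \<in> Had_op scale n \<Longrightarrow> F + G \<in> Had_op scale n"
  by (simp add: Had_op_def End_op_add)

lemma Had_op_scale: "F \<in> Had_op scale n \<Longrightarrow> scale2 c F \<in> Had_op scale n"
  by (simp add: Had_op_def scale2_apply1 End_op_scale) (simp add: fun_scale_def fun_eq_iff)

lemma Had_op_diff: "F \<in> Had_op scale n \<Longrightarrow> G \<in> Had_op scale n \<Longrightarrow> F - G \<in> Had_op scale n"
  using Had_op_add [of F n "scale2 (-1) G"] Had_op_scale [of G n "-1"]
  by (simp add: fun_scale_def fun_eq_iff fun_diff_def plus_fun_def)

lemma Had_op_sum: "(\<And>x. x \<in> S \<Longrightarrow> f x \<in> Had_op scale n) \<Longrightarrow> (\<Sum>x\<in>S. f x) \<in> Had_op scale n"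
  by (induction S rule: infinite_finite_induct) (simp_all add: Had_op_0 Had_op_add)

text \<open>At most one exponent list is carried to \<open>r\<close>; if that list lies outside
  \<open>P_exps n\<close>, the sum is empty and \<open>F\<close> vanishes there too.\<close>

lemma Had_act_apply:
  assumes "F \<in> Had_op scale n" "\<sigma> permutes {1..n}" "length r = n"
  shows "Had_act n \<sigma> F r = End_act n \<sigma> (F (perm_list n (inv \<sigma>) r))"
proof -
  let ?p = "perm_list n (inv \<sigma>) r"
  have eq: "{p \<in> P_exps n. perm_list n \<sigma> p = r} = (if ?p \<in> P_exps n then {?p} else {})"
    using perm_list_eq_iff [OF assms(2) _ assms(3)] by (auto simp: P_exps_def)
  have "End_act n \<sigma> 0 = (0 :: 'v list \<Rightarrow> 'v)" by (simp add: End_act_def fun_eq_iff)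
  then show ?thesis
    unfolding Had_act_def eq using Had_op_outside [OF assms(1), of ?p] by simp
qed

lemma Had_op_act:
  assumes "F \<in> Had_op scale n" "\<sigma> permutes {1..n}"
  shows "Had_act n \<sigma> F \<in> Had_op scale n"
proof (rule Had_opI)
  fix p assume "p \<notin> P_exps n"
  then have e: "{q \<in> P_exps n. perm_list n \<sigma> q = p} = {}" using perm_list_P_exps [OF assms(2)] by auto
  show "Had_act n \<sigma> F p = 0" unfolding Had_act_def e by simp
next
  fix p assume "p \<in> P_exps n"
  then show "Had_act n \<sigma> F p \<in> End_op scale n"
    using assms by (simp add: Had_act_apply P_exps_def End_op_act Had_opD)
qed

lemma Had_op_comp:
  assumes "F \<in> Had_op scale n" "G \<in> Had_op scale m" "i \<in> {1..n}"
  shows "Had_comp scale n i m F G \<in> Had_op scale (n + m - 1)"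
proof (rule Had_opI)
  fix p assume p: "p \<notin> P_exps (n + m - 1)"
  have "fun_scale scale 0 f = 0" for f :: "'v list \<Rightarrow> 'v" by (simp add: fun_scale_def fun_eq_iff)
  then show "Had_comp scale n i m F G p = 0"
    unfolding Had_comp_def
    by (intro sum.neutral ballI) (simp only: coord_comp_outside [OF _ _ assms(3) p])
next
  fix p assume "p \<in> P_exps (n + m - 1)"
  show "Had_comp scale n i m F G p \<in> End_op scale (n + m - 1)"
    unfolding Had_comp_def
    by (intro End_op_sum End_op_scale End_op_comp Had_opD [OF assms(1)] Had_opD [OF assms(2)] assms(3))
qed

text \<open>The cochain on \<open>A \<otimes> \<gg>\<close> defined by a family: \<open>\<mu>\<^sub>n \<circ> (D\<^bsup>p\<^sub>1\<^esup>, \<dots>, D\<^bsup>p\<^sub>n\<^esup>)\<close> multiplies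
  a product of exponentials by the monomial with exponents \<open>p\<close>.\<close>

definition Phi :: "(nat list \<Rightarrow> 'v list \<Rightarrow> 'v) \<Rightarrow> ('k \<times> 'v) list \<Rightarrow> 'v"
  where "Phi F zs = (\<Sum>p\<in>P_exps (length zs). scale (monom_eval (map fst zs) p) (F p (map snd zs)))"

lemma Phi_length: "F \<in> Had_op scale n \<Longrightarrow> length zs \<noteq> n \<Longrightarrow> Phi F zs = 0"
  unfolding Phi_def by (rule sum.neutral) (auto simp: End_op_length [OF Had_opD])

lemma Phi_add: "Phi (F + G) zs = Phi F zs + Phi G zs"
  by (simp add: Phi_def scale_right_distrib sum.distrib)

lemma Phi_diff: "Phi (F - G) zs = Phi F zs - Phi G zs"
  by (simp add: Phi_def scale_right_diff_distrib sum_subtractf)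

lemma Phi_scale: "Phi (scale2 c F) zs = scale c (Phi F zs)"
  by (simp add: Phi_def scale_sum_right mult.commute)

lemma Phi_sum: "Phi (\<Sum>x\<in>S. F x) zs = (\<Sum>x\<in>S. Phi (F x) zs)"
proof (induction S rule: infinite_finite_induct)
  case (insert x S)
  then show ?case by (simp only: sum.insert [OF insert.hyps] Phi_add)
qed (simp_all add: Phi_def)

text \<open>For fixed vectors, independence of monomials recovers every component from the values at
  all weights. Identities between families can therefore be checked on cochains.\<close>

lemma Phi_inj:
  assumes "F \<in> Had_op scale n" "G \<in> Had_op scale n" "\<And>zs. length zs = n \<Longrightarrow> Phi F zs = Phi G zs"
  shows "F = G"
proof (intro ext)
  fix p and xs :: "'v list"
  consider "p \<notin> P_exps n" | "length xs \<noteq> n" | "p \<in> P_exps n" "length xs = n" by blast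
  then show "F p xs = G p xs"
  proof cases
    case 1
    then show ?thesis using assms(1,2) by (simp add: Had_op_outside)
  next
    case 2
    then show ?thesis using assms(1,2) by (simp add: End_op_length [OF Had_opD])
  next
    case 3
    have "F p xs - G p xs = 0"
    proof (rule monom_eval_independent [OF vector_space_axioms finite_P_exps _ _ 3(1), of n "\<lambda>p. F p xs - G p xs"])
      fix ls :: "'k list" assume "length ls = n"
      then have "map fst (zip ls xs) = ls" "map snd (zip ls xs) = xs" "length (zip ls xs) = n" using 3 by simp_all
      then show "(\<Sum>p\<in>P_exps n. scale (monom_eval ls p) (F p xs - G p xs)) = 0"
        using assms(3) [of "zip ls xs"] by (simp add: Phi_def scale_right_diff_distrib sum_subtractf)
    qed (auto simp: P_exps_def)
    then show ?thesis by simp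
  qed
qed

lemma Phi_act:
  assumes "F \<in> Had_op scale n" "\<sigma> permutes {1..n}" "length zs = n"
  shows "Phi (Had_act n \<sigma> F) zs = Phi F (perm_list n (inv \<sigma>) zs)"
proof -
  have inv: "inv \<sigma> permutes {1..n}" using assms by (intro permutes_inv)
  have bij: "bij_betw (perm_list n \<sigma>) (P_exps n) (P_exps n)"
    using perm_list_inv [OF assms(2)] perm_list_P_exps [OF assms(2)] perm_list_P_exps [OF inv]
    by (intro bij_betwI [where g = "perm_list n (inv \<sigma>)"]) (auto simp: P_exps_def)
  have "Phi (Had_act n \<sigma> F) zs =
      (\<Sum>p\<in>P_exps n. scale (monom_eval (map fst zs) (perm_list n \<sigma> p)) (Had_act n \<sigma> F (perm_list n \<sigma> p) (map snd zs)))"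
    unfolding Phi_def assms(3) by (rule sum.reindex_bij_betw [OF bij, symmetric])
  also have "\<dots> = Phi F (perm_list n (inv \<sigma>) zs)"
    unfolding Phi_def length_perm_list
  proof (rule sum.cong [OF refl])
    fix p assume "p \<in> P_exps n"
    then have p: "length p = n" by (simp add: P_exps_def)
    show "scale (monom_eval (map fst zs) (perm_list n \<sigma> p)) (Had_act n \<sigma> F (perm_list n \<sigma> p) (map snd zs)) =
      scale (monom_eval (map fst (perm_list n (inv \<sigma>) zs)) p) (F p (map snd (perm_list n (inv \<sigma>) zs)))"
      using assms p by (simp add: Had_act_apply perm_list_inv map_perm_list [OF inv] monom_eval_perm End_act_def)
  qed
  finally show ?thesis .
qed

text \<open>Composition becomes substitution of the pair formed by total weight and value. The sum
  over \<open>r\<close> collapses by \<open>coord_comp_eval\<close>, the sum over \<open>q\<close>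
  by linearity of \<open>F p\<close> in the slot.\<close>

lemma Phi_comp:
  assumes F: "F \<in> Had_op scale n" and G: "G \<in> Had_op scale m" and i: "i \<in> {1..n}" and zs: "length zs = n + m - 1"
  shows "Phi (Had_comp scale n i m F G) zs = Phi F (comp_args i m (\<lambda>us. (sum_list (map fst us), Phi G us)) zs)"
proof (cases "m = 0")
  case True
  \<comment> \<open>\<open>P_exps 0\<close> is empty, since a sum of exponents plus 1 is never
    0.\<close>
  have "G = 0" using True Had_op_outside [OF G] by (simp add: fun_eq_iff P_exps_def)
  then have "Phi G us = 0" for us by (simp add: Phi_def)
  moreover have "F p (as @ 0 # bs) = 0" for p as bs
  proof -
    interpret l: Vector_Spaces.linear scale scale "\<lambda>y. F p (as @ y # bs)"
      by (rule End_op_slot [OF Had_opD [OF F]])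
    show ?thesis by (rule l.zero)
  qed
  moreover have "Had_comp scale n i m F G r = 0" for r
    using True by (simp add: Had_comp_def P_exps_def)
  ultimately show ?thesis by (simp add: Phi_def comp_args_def)
next
  case False
  define ls where "ls = map fst zs"
  define xs where "xs = map snd zs"
  have ls: "length ls = n + m - 1" and xs: "length xs = n + m - 1" using zs by (simp_all add: ls_def xs_def)
  define mid where "mid = take m (drop (i - 1) zs)"
  have mid: "length mid = m" "map fst mid = take m (drop (i - 1) ls)" "map snd mid = take m (drop (i - 1) xs)"
    using zs i False by (auto simp: mid_def ls_def xs_def take_map drop_map)
  let ?c = "\<lambda>p q. rNov_coord (n + m - 1) (free_comp i m (tree_elem (dmon_tree p)) (tree_elem (dmon_tree q))) :: nat list \<Rightarrow> 'k"
  let ?E = "\<lambda>p q. F p (comp_args i m (G q) xs)"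
  have "Phi (Had_comp scale n i m F G) zs = (\<Sum>r\<in>P_exps (n + m - 1). \<Sum>p\<in>P_exps n. \<Sum>q\<in>P_exps m.
      scale (?c p q r * monom_eval ls r) (?E p q))"
    unfolding Phi_def zs Had_comp_def ls_def [symmetric] xs_def [symmetric]
    using xs by (simp add: sum_fun_apply scale_sum_right fun_scale_def End_comp_eq mult.commute)
  also have "\<dots> = (\<Sum>p\<in>P_exps n. \<Sum>q\<in>P_exps m. \<Sum>r\<in>P_exps (n + m - 1). scale (?c p q r * monom_eval ls r) (?E p q))"
    by (subst sum.swap, rule sum.cong [OF refl], rule sum.swap)
  also have "\<dots> = (\<Sum>p\<in>P_exps n. \<Sum>q\<in>P_exps m. scale (monom_eval (comp_args i m sum_list ls) p *
      monom_eval (take m (drop (i - 1) ls)) q) (?E p q))"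
    using coord_comp_eval [OF _ _ i ls]
    by (intro sum.cong refl) (simp flip: scale_sum_left)
  also have "\<dots> = (\<Sum>p\<in>P_exps n. scale (monom_eval (comp_args i m sum_list ls) p) (F p (comp_args i m (\<lambda>_. Phi G mid) xs)))"
  proof (rule sum.cong [OF refl])
    fix p
    interpret l: Vector_Spaces.linear scale scale "\<lambda>y. F p (take (i - 1) xs @ y # drop (i - 1 + m) xs)"
      by (rule End_op_slot [OF Had_opD [OF F]])
    show "(\<Sum>q\<in>P_exps m. scale (monom_eval (comp_args i m sum_list ls) p * monom_eval (take m (drop (i - 1) ls)) q) (?E p q)) =
      scale (monom_eval (comp_args i m sum_list ls) p) (F p (comp_args i m (\<lambda>_. Phi G mid) xs))"
    proof -
      have "F p (take (i - 1) xs @ Phi G mid # drop (i - 1 + m) xs) =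
          (\<Sum>q\<in>P_exps m. scale (monom_eval (take m (drop (i - 1) ls)) q)
            (F p (take (i - 1) xs @ G q (take m (drop (i - 1) xs)) # drop (i - 1 + m) xs)))"
        unfolding Phi_def mid by (simp only: l.sum l.scale)
      then show ?thesis by (simp add: comp_args_def scale_sum_right)
    qed
  qed
  also have "\<dots> = Phi F (comp_args i m (\<lambda>us. (sum_list (map fst us), Phi G us)) zs)"
  proof -
    have "length (comp_args i m (\<lambda>us. (sum_list (map fst us), Phi G us)) zs) = n"
      using zs i by (auto simp: comp_args_def)
    moreover have "map fst (comp_args i m (\<lambda>us. (sum_list (map fst us), Phi G us)) zs) = comp_args i m sum_list ls"
      using mid by (simp add: comp_args_def ls_def take_map drop_map)
    moreover have "map snd (comp_args i m (\<lambda>us. (sum_list (map fst us), Phi G us)) zs) = comp_args i m (\<lambda>_. Phi G mid) xs"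
      by (simp add: comp_args_def xs_def take_map drop_map mid_def)
    ultimately show ?thesis by (simp add: Phi_def)
  qed
  finally show ?thesis .
qed

lemma Phi_subtractive:
  assumes "F \<in> Had_op scale n" shows "subtractive (Phi F)"
  unfolding subtractive_def
proof (intro allI)
  fix as bs :: "('k \<times> 'v) list" and a x y
  have "F p (map snd as @ (x - y) # map snd bs) = F p (map snd as @ x # map snd bs) - F p (map snd as @ y # map snd bs)" for p
  proof -
    interpret l: Vector_Spaces.linear scale scale "\<lambda>y. F p (map snd as @ y # map snd bs)"
      by (rule End_op_slot [OF Had_opD [OF assms]])
    show ?thesis by (rule l.diff)
  qed
  then show "Phi F (as @ (a, x - y) # bs) = Phi F (as @ (a, x) # bs) - Phi F (as @ (a, y) # bs)"
    by (simp add: Phi_def scale_right_diff_distrib sum_subtractf)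
qed

section \<open>Alternation and shuffles\<close>

lemma swap_alternating_prefix: "swap_alternating \<phi> \<Longrightarrow> swap_alternating (\<lambda>us. \<phi> (as @ us))"
  unfolding swap_alternating_def by (metis append_assoc)

text \<open>On both sides the two entries are brought together in front of \<open>cs\<close>; the
  same sign arises each time, so a single adjacent swap remains.\<close>

lemma swap_alternating_swap:
  assumes "swap_alternating \<phi>"
  shows "\<phi> (as @ x # cs @ y # bs) = - \<phi> (as @ y # cs @ x # bs)"
proof -
  have "\<phi> (as @ x # cs @ y # bs) = scale ((-1) ^ Suc (length cs)) (\<phi> (as @ y # x # cs @ bs))" for x y
    using swap_alternating_move [OF swap_alternating_prefix [OF assms], of as "x # cs" y bs] by simp
  then show ?thesis
    using swap_alternating_hd [OF swap_alternating_prefix [OF assms], of as x y "cs @ bs"] by simp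
qed

lemma perm_list_transpose:
  assumes "a \<in> {1..n}" "b \<in> {1..n}" "a < b" "length zs = n"
  obtains as x cs y bs where "zs = as @ x # cs @ y # bs" "perm_list n (transpose a b) zs = as @ y # cs @ x # bs"
proof -
  let ?as = "take (a - 1) zs" and ?cs = "take (b - a - 1) (drop a zs)" and ?bs = "drop b zs"
  have "zs = ?as @ zs ! (a - 1) # drop a zs"
    using assms id_take_nth_drop [of "a - 1" zs] by simp
  moreover have "drop a zs = ?cs @ zs ! (b - 1) # ?bs"
    using assms id_take_nth_drop [of "b - a - 1" "drop a zs"] by (simp add: add.commute)
  ultimately have "zs = ?as @ zs ! (a - 1) # ?cs @ zs ! (b - 1) # ?bs" by metis
  moreover have "perm_list n (transpose a b) zs = ?as @ zs ! (b - 1) # ?cs @ zs ! (a - 1) # ?bs"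
  proof (rule nth_equalityI)
    fix k assume "k < length (perm_list n (transpose a b) zs)"
    then have k: "k < n" by simp
    consider "k < a - 1" | "k = a - 1" | "a - 1 < k" "k < b - 1" | "k = b - 1" | "b - 1 < k" by linarith
    then show "perm_list n (transpose a b) zs ! k = (?as @ zs ! (b - 1) # ?cs @ zs ! (a - 1) # ?bs) ! k"
      using assms k by cases (auto simp: perm_list_nth transpose_def nth_append nth_Cons')
  qed (use assms in simp)
  ultimately show ?thesis using that by blast
qed

lemma swap_alternating_transpose:
  assumes "swap_alternating \<phi>" "a \<in> {1..n}" "b \<in> {1..n}" "a \<noteq> b" "length zs = n"
  shows "\<phi> (perm_list n (transpose a b) zs) = - \<phi> zs"
proof -
  have *: "\<phi> (perm_list n (transpose a b) zs) = - \<phi> zs"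
    if ab: "a \<in> {1..n}" "b \<in> {1..n}" "a < b" for a b
  proof -
    obtain as x cs y bs where "zs = as @ x # cs @ y # bs" "perm_list n (transpose a b) zs = as @ y # cs @ x # bs"
      using perm_list_transpose [OF ab assms(5)] .
    then show ?thesis using swap_alternating_swap [OF assms(1)] by metis
  qed
  show ?thesis
  proof (cases "a < b")
    case True
    then show ?thesis using * assms by blast
  next
    case False
    then show ?thesis using * [of b a] assms by (subst transpose_commute) auto
  qed
qed

lemma swap_alternating_perm:
  assumes "swap_alternating \<phi>" "\<sigma> permutes {1..n}" "length zs = n"
  shows "\<phi> (perm_list n \<sigma> zs) = scale (of_int (sign \<sigma>)) (\<phi> zs)"
  using assms(2) finite_atLeastAtMost assms(3)
proof (induction \<sigma> arbitrary: zs rule: permutes_induct)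
  case id
  then show ?case by (simp add: perm_list_id [unfolded id_def] id_def)
next
  case (swap a b p)
  have "\<phi> (perm_list n (transpose a b \<circ> p) zs) = \<phi> (perm_list n p (perm_list n (transpose a b) zs))"
    using swap.hyps by (simp add: perm_list_comp)
  also have "\<dots> = scale (of_int (sign p)) (- \<phi> zs)"
    using swap.IH [of "perm_list n (transpose a b) zs"] swap_alternating_transpose [OF assms(1) swap.hyps(1,2,3) swap.prems]
    by simp
  also have "sign (transpose a b \<circ> p) = - sign p"
    using swap.hyps permutes_imp_permutation [OF finite_atLeastAtMost swap.hyps(4)]
    by (subst sign_compose) (auto simp: sign_swap_id permutation_swap_id)
  then have "scale (of_int (sign p)) (- \<phi> zs) = scale (of_int (sign (transpose a b \<circ> p))) (\<phi> zs)" by simp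
  finally show ?case .
qed

lemma sign_inv_perm: "\<sigma> permutes {1..n::nat} \<Longrightarrow> sign (inv \<sigma>) = sign \<sigma>"
  by (metis finite_atLeastAtMost permutes_imp_permutation sign_inverse)

text \<open>Exponents travel with arguments: permuting pairs of weight and vector is the diagonal
  action. Adjacent transpositions give one direction, the sign rule for general permutations the
  other.\<close>

lemma CE_iff: "F \<in> CE scale n \<longleftrightarrow> F \<in> Had_op scale n \<and> swap_alternating (Phi F)"
proof (intro iffI conjI)
  assume F: "F \<in> CE scale n"
  then show H: "F \<in> Had_op scale n" by (simp add: CE_def)
  have "Phi F (as @ x # y # bs) = - Phi F (as @ y # x # bs)" for as x y bs
  proof (cases "length as + length bs + 2 = n")
    case True
    let ?zs = "as @ y # x # bs"
    define \<sigma> where "\<sigma> = transpose (Suc (length as)) (Suc (Suc (length as)))"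
    have \<sigma>: "\<sigma> permutes {1..n}" unfolding \<sigma>_def using True by (intro permutes_swap_id) auto
    have "perm_list n (inv \<sigma>) ?zs = as @ x # y # bs"
    proof (rule nth_equalityI)
      fix k assume "k < length (perm_list n (inv \<sigma>) ?zs)"
      then show "perm_list n (inv \<sigma>) ?zs ! k = (as @ x # y # bs) ! k"
        by (auto simp: \<sigma>_def perm_list_nth transpose_def nth_append nth_Cons')
    qed (use True in simp)
    then have "Phi F (as @ x # y # bs) = Phi (Had_act n \<sigma> F) ?zs"
      using Phi_act [OF H \<sigma>, of ?zs] True by simp
    also have "Had_act n \<sigma> F = scale2 (of_int (sign \<sigma>)) F" using F \<sigma> by (simp add: CE_def)
    also have "Phi (scale2 (of_int (sign \<sigma>)) F) ?zs = scale (of_int (sign \<sigma>)) (Phi F ?zs)"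
      by (rule Phi_scale)
    finally show ?thesis by (simp add: \<sigma>_def sign_swap_id)
  next
    case False
    then show ?thesis using Phi_length [OF H] by simp
  qed
  then show "swap_alternating (Phi F)" unfolding swap_alternating_def by blast
next
  assume F: "F \<in> Had_op scale n \<and> swap_alternating (Phi F)"
  have "Had_act n \<sigma> F = scale2 (of_int (sign \<sigma>)) F" if \<sigma>: "\<sigma> permutes {1..n}" for \<sigma>
  proof (rule Phi_inj)
    fix zs :: "('k \<times> 'v) list" assume zs: "length zs = n"
    show "Phi (Had_act n \<sigma> F) zs = Phi (scale2 (of_int (sign \<sigma>)) F) zs"
      using F \<sigma> zs permutes_inv [OF \<sigma>] sign_inv_perm [OF \<sigma>]
      by (simp add: Phi_act Phi_scale swap_alternating_perm)
  qed (use F \<sigma> in \<open>auto simp: Had_op_act Had_op_scale\<close>)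
  then show "F \<in> CE scale n" using F by (simp add: CE_def)
qed

end

text \<open>The cycle whose action on a list moves entry \<open>i\<close>, counted from 0, to the
  front. Its inverse is the shuffle that singles out one argument.\<close>

definition cyc :: "nat \<Rightarrow> nat \<Rightarrow> nat"
  where "cyc i k = (if k = 1 then i + 1 else if 2 \<le> k \<and> k \<le> i + 1 then k - 1 else k)"

lemma cyc_0: "cyc 0 = id"
  by (auto simp: cyc_def fun_eq_iff)

lemma cyc_Suc: "cyc (Suc i) = transpose (i + 1) (i + 2) \<circ> cyc i"
  by (auto simp: cyc_def fun_eq_iff transpose_def)

lemma cyc_permutes: "i < n \<Longrightarrow> cyc i permutes {1..n}"
proof (induction i)
  case (Suc i)
  then show ?case unfolding cyc_Suc by (intro permutes_compose permutes_swap_id) auto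
qed (simp only: cyc_0 permutes_id)

lemma sign_cyc: "sign (cyc i) = (-1) ^ i"
proof (induction i)
  case (Suc i)
  have "permutation (cyc i)"
    using cyc_permutes [of i "Suc i"] permutes_imp_permutation by blast
  then show ?case unfolding cyc_Suc using Suc
    by (subst sign_compose) (auto simp: sign_swap_id permutation_swap_id)
qed (simp add: cyc_0)

lemma perm_list_cyc: "i < n \<Longrightarrow> length xs = n \<Longrightarrow> perm_list n (cyc i) xs = xs ! i # delete i xs"
proof (rule nth_equalityI)
  fix k assume "i < n" "length xs = n" "k < length (perm_list n (cyc i) xs)"
  then show "perm_list n (cyc i) xs ! k = (xs ! i # delete i xs) ! k"
    by (cases k) (auto simp: perm_list_nth cyc_def delete_def nth_append)
qed (simp add: length_delete)

text \<open>The increasing enumeration of a finite set is unique: both maps list the same image in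
  sorted order.\<close>

lemma strict_mono_on_same_image:
  fixes f g :: "nat \<Rightarrow> nat"
  assumes "strict_mono_on A f" "strict_mono_on A g" "f ` A = g ` A" "finite A" "x \<in> A"
  shows "f x = g x"
proof -
  let ?l = "sorted_list_of_set A"
  have s: "sorted_wrt (<) ?l" by (simp add: strict_sorted_list_of_set)
  have "sorted_wrt (<) (map h ?l)" if "strict_mono_on A h" for h :: "nat \<Rightarrow> nat"
    using s that assms(4) unfolding sorted_wrt_map
    by (rule_tac sorted_wrt_mono_rel [OF _ s]) (auto simp: strict_mono_on_def)
  then have "map f ?l = map g ?l"
    using assms by (intro strict_sorted_equal) auto
  then show ?thesis using assms(4,5) by simp
qed

text \<open>The image of the first block determines that of the second as its complement, and
  monotonicity determines the map on each block.\<close>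

lemma inv_shuffles_inj:
  assumes "\<sigma> \<in> inv_shuffles a b" "\<tau> \<in> inv_shuffles a b" "inv \<sigma> ` {1..a} = inv \<tau> ` {1..a}"
  shows "\<sigma> = \<tau>"
proof -
  have \<sigma>: "\<sigma> permutes {1..a + b}" "strict_mono_on {1..a} (inv \<sigma>)" "strict_mono_on {a + 1..a + b} (inv \<sigma>)"
    and \<tau>: "\<tau> permutes {1..a + b}" "strict_mono_on {1..a} (inv \<tau>)" "strict_mono_on {a + 1..a + b} (inv \<tau>)"
    using assms by (auto simp: inv_shuffles_def)
  have U: "{1..a + b} - {1..a} = {a + 1..a + b}" by auto
  have im: "inv \<rho> ` {a + 1..a + b} = {1..a + b} - inv \<rho> ` {1..a}" if "\<rho> permutes {1..a + b}" for \<rho>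
    using permutes_inv [OF that] permutes_inj permutes_image unfolding U [symmetric]
    by (metis image_set_diff)
  have "inv \<sigma> x = inv \<tau> x" for x
  proof -
    consider "x \<in> {1..a}" | "x \<in> {a + 1..a + b}" | "x \<notin> {1..a + b}" by force
    then show ?thesis
    proof cases
      case 1
      then show ?thesis using strict_mono_on_same_image [OF \<sigma>(2) \<tau>(2) assms(3)] by simp
    next
      case 2
      have "inv \<sigma> ` {a + 1..a + b} = inv \<tau> ` {a + 1..a + b}"
        unfolding im [OF \<sigma>(1)] im [OF \<tau>(1)] assms(3) ..
      then show ?thesis
        using strict_mono_on_same_image [OF \<sigma>(3) \<tau>(3) _ finite_atLeastAtMost 2] by blast
    next
      case 3
      then show ?thesis
        using permutes_not_in [OF permutes_inv [OF \<sigma>(1)]] permutes_not_in [OF permutes_inv [OF \<tau>(1)]] by simp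
    qed
  qed
  then have "inv (inv \<sigma>) = inv (inv \<tau>)" by presburger
  then show ?thesis using permutes_inv_inv \<sigma>(1) \<tau>(1) by metis
qed

lemma inv_shuffles_1: "bij_betw (\<lambda>i. inv (cyc i)) {..n} (inv_shuffles 1 n)"
proof -
  have mem: "inv (cyc i) \<in> inv_shuffles 1 n" and img: "inv (inv (cyc i)) ` {1..1} = {i + 1}" if "i \<le> n" for i
  proof -
    have p: "cyc i permutes {1..Suc n}" using that by (intro cyc_permutes) simp
    have "strict_mono_on {2..Suc n} (cyc i)" "strict_mono_on {Suc 0} (cyc i)"
      by (auto simp: strict_mono_on_def cyc_def)
    then show "inv (cyc i) \<in> inv_shuffles 1 n"
      using p permutes_inv [OF p] by (simp add: inv_shuffles_def permutes_inv_inv numeral_2_eq_2)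
    show "inv (inv (cyc i)) ` {1..1} = {i + 1}" using p by (simp add: permutes_inv_inv cyc_def)
  qed
  show ?thesis
  proof (rule bij_betw_imageI)
    show "inj_on (\<lambda>i. inv (cyc i)) {..n}"
    proof (rule inj_onI)
      fix i j assume "i \<in> {..n}" "j \<in> {..n}" "inv (cyc i) = inv (cyc j)"
      then show "i = j" using img [of i] img [of j] by simp
    qed
    show "(\<lambda>i. inv (cyc i)) ` {..n} = inv_shuffles 1 n"
    proof (intro equalityI subsetI)
      fix \<sigma> assume \<sigma>: "\<sigma> \<in> inv_shuffles 1 n"
      then have "inv \<sigma> 1 \<in> {1..1 + n}"
        by (subst permutes_in_image [OF permutes_inv]) (auto simp: inv_shuffles_def)
      then obtain i where i: "inv \<sigma> 1 = i + 1" "i \<le> n" by (metis add.commute add_le_cancel_left atLeastAtMost_iff le_Suc_ex)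
      then have "\<sigma> = inv (cyc i)"
        using img [of i] by (intro inv_shuffles_inj [OF \<sigma> mem]) simp_all
      then show "\<sigma> \<in> (\<lambda>i. inv (cyc i)) ` {..n}" using i by auto
    qed (use mem in auto)
  qed
qed

text \<open>Entry \<open>j\<close> is moved to the front, which shifts entry \<open>i < j\<close> by
  one; hence \<open>Suc i\<close> in the second move. This shift is the origin of the extra minus in
  \<open>sign_cyc2\<close>.\<close>

definition cyc2 :: "nat \<Rightarrow> nat \<Rightarrow> nat \<Rightarrow> nat"
  where "cyc2 j i = cyc j \<circ> cyc (Suc i)"

lemma cyc2_permutes: "i < j \<Longrightarrow> j < n \<Longrightarrow> cyc2 j i permutes {1..n}"
  unfolding cyc2_def by (intro permutes_compose cyc_permutes) auto

lemma sign_cyc2: "sign (cyc2 j i) = - ((-1) ^ (i + j))"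
proof -
  have "permutation (cyc i)" for i
    using cyc_permutes [of i "Suc i"] permutes_imp_permutation by blast
  then show ?thesis unfolding cyc2_def by (subst sign_compose) (auto simp: sign_cyc power_add)
qed

lemma perm_list_cyc2:
  assumes "i < j" "j < n" "length xs = n"
  shows "perm_list n (cyc2 j i) xs = xs ! i # xs ! j # delete i (delete j xs)"
proof -
  have "perm_list n (cyc2 j i) xs = perm_list n (cyc (Suc i)) (perm_list n (cyc j) xs)"
    unfolding cyc2_def using assms by (intro perm_list_comp [symmetric] cyc_permutes) simp
  also have "\<dots> = delete j xs ! i # xs ! j # delete i (delete j xs)"
    using assms by (simp add: perm_list_cyc length_delete)
  also have "delete j xs ! i = xs ! i" using assms by (simp add: delete_def nth_append)
  finally show ?thesis .
qed

lemma inv_shuffles_2: "bij_betw (\<lambda>(j, i). inv (cyc2 j i)) (SIGMA j:{..Suc n}. {..<j}) (inv_shuffles 2 n)"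
proof -
  have mem: "inv (cyc2 j i) \<in> inv_shuffles 2 n" and img: "inv (inv (cyc2 j i)) ` {1..2} = {i + 1, j + 1}"
    if "i < j" "j \<le> Suc n" for i j
  proof -
    have p: "cyc2 j i permutes {1..2 + n}" using that by (intro cyc2_permutes) simp_all
    have 1: "cyc2 j i 1 = i + 1" "cyc2 j i 2 = j + 1" using that by (auto simp: cyc2_def cyc_def)
    have U: "{1..2} = {1, 2::nat}" by auto
    have "strict_mono_on {1..2} (cyc2 j i)" using 1 that unfolding U by (auto simp: strict_mono_on_def)
    moreover have "strict_mono_on {3..2 + n} (cyc2 j i)"
    proof -
      have "cyc k r < cyc k s" if "2 \<le> r" "r < s" for k r s using that by (auto simp: cyc_def)
      moreover have "2 \<le> cyc k r" if "3 \<le> r" for k r using that by (auto simp: cyc_def)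
      ultimately show ?thesis by (simp add: strict_mono_on_def cyc2_def)
    qed
    ultimately show "inv (cyc2 j i) \<in> inv_shuffles 2 n"
      using p permutes_inv [OF p] by (simp add: inv_shuffles_def permutes_inv_inv)
    show "inv (inv (cyc2 j i)) ` {1..2} = {i + 1, j + 1}" using p 1 unfolding U by (simp add: permutes_inv_inv)
  qed
  show ?thesis
  proof (rule bij_betw_imageI)
    show "inj_on (\<lambda>(j, i). inv (cyc2 j i)) (SIGMA j:{..Suc n}. {..<j})"
    proof (rule inj_onI, clarify)
      fix j i j' i' assume a: "j \<le> Suc n" "i < j" "j' \<le> Suc n" "i' < j'" "inv (cyc2 j i) = inv (cyc2 j' i')"
      then have "{i + 1, j + 1} = {i' + 1, j' + 1}" using img [of i j] img [of i' j'] by simp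
      then show "j = j' \<and> i = i'" using a by (auto simp: doubleton_eq_iff)
    qed
    show "(\<lambda>(j, i). inv (cyc2 j i)) ` (SIGMA j:{..Suc n}. {..<j}) = inv_shuffles 2 n"
    proof (intro equalityI subsetI)
      fix \<sigma> assume \<sigma>: "\<sigma> \<in> inv_shuffles 2 n"
      then have inv: "inv \<sigma> permutes {1..2 + n}" "strict_mono_on {1..2} (inv \<sigma>)"
        by (auto simp: inv_shuffles_def intro: permutes_inv)
      have "inv \<sigma> 1 \<in> {1..2 + n}" "inv \<sigma> 2 \<in> {1..2 + n}"
        by (subst permutes_in_image [OF inv(1)], simp)+
      moreover have "inv \<sigma> 1 < inv \<sigma> 2" using inv(2) by (auto simp: strict_mono_on_def)
      ultimately have ij: "inv \<sigma> 1 - 1 < inv \<sigma> 2 - 1" "inv \<sigma> 2 - 1 \<le> Suc n"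
          "inv \<sigma> 1 = (inv \<sigma> 1 - 1) + 1" "inv \<sigma> 2 = (inv \<sigma> 2 - 1) + 1"
        by auto
      define i j where "i = inv \<sigma> 1 - 1" and "j = inv \<sigma> 2 - 1"
      have U: "{1..2} = {1, 2::nat}" by auto
      have "inv \<sigma> ` {1..2} = inv (inv (cyc2 j i)) ` {1..2}"
        unfolding img [OF ij(1,2), folded i_def j_def] using ij(3,4) unfolding U by (simp add: i_def j_def)
      then have "\<sigma> = inv (cyc2 j i)"
        using ij by (intro inv_shuffles_inj [OF \<sigma> mem]) (simp_all add: i_def j_def)
      then show "\<sigma> \<in> (\<lambda>(j, i). inv (cyc2 j i)) ` (SIGMA j:{..Suc n}. {..<j})"
        using ij by (intro image_eqI [of _ _ "(j, i)"]) (auto simp: i_def j_def)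
    qed (use mem in auto)
  qed
qed

section \<open>The Chevalley--Eilenberg differential\<close>

lemma P_exps_2: "P_exps 2 = {[1, 0], [0, 1]}"
proof -
  have "p \<in> P_exps 2 \<Longrightarrow> p = [1, 0] \<or> p = [0, 1]" for p
    by (auto simp: P_exps_def length_Suc_conv numeral_2_eq_2 add_is_1)
  then show ?thesis by (auto simp: P_exps_def)
qed

context novikov_algebra
begin

abbreviation "\<alpha> \<equiv> alpha_nu nprod"

lemma End_prod_in: "End_prod nprod \<in> End_op scale 2"
proof -
  have "End_prod nprod (xs[i := x + y]) = End_prod nprod (xs[i := x]) + End_prod nprod (xs[i := y])"
    "End_prod nprod (xs[i := scale c x]) = scale c (End_prod nprod (xs[i := x]))"
    if "length xs = 2" "i < 2" for xs i x y c
    using that by (auto simp: End_prod_def prod_left prod_right less_2_cases_iff)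
  then show ?thesis by (simp add: End_op_iff) (simp add: End_prod_def)
qed

lemma alpha_Had: "\<alpha> \<in> Had_op scale 2"
  by (rule Had_opI)
    (auto simp: P_exps_2 alpha_nu_def End_prod_in intro!: End_op_uminus End_op_act permutes_swap_id)

text \<open>The cochain of \<open>\<alpha>\<close> is the bracket on pairs, so composing with
  \<open>\<alpha>\<close> inserts brackets or lets an argument act on a value.\<close>

lemma Phi_alpha: "Phi \<alpha> [x, y] = act x (fst y) (snd y)"
proof -
  have "End_act 2 (transpose 1 2) (End_prod nprod) [u, v] = v \<diamondop> u" for u v
    by (simp add: End_act_def End_prod_def perm_list_nth transpose_def numeral_2_eq_2)
  then show ?thesis
    by (simp add: Phi_def P_exps_2 [unfolded numeral_2_eq_2] alpha_nu_def End_prod_def act_def)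
qed

lemma CE_diff_Had:
  assumes "F \<in> Had_op scale n" "n \<ge> 1"
  shows "CE_diff scale nprod n F \<in> Had_op scale (n + 1)"
proof -
  have 1: "Had_comp scale 2 2 n \<alpha> F \<in> Had_op scale (n + 1)"
    using Had_op_comp [OF alpha_Had assms(1), of 2] by simp
  have 2: "Had_comp scale n 1 2 F \<alpha> \<in> Had_op scale (n + 1)"
    using Had_op_comp [OF assms(1) alpha_Had, of 1] assms(2) by simp
  have "Had_act (n + 1) \<sigma> (Had_comp scale 2 2 n \<alpha> F) \<in> Had_op scale (n + 1)" if "\<sigma> \<in> inv_shuffles 1 n" for \<sigma>
    using that by (intro Had_op_act 1) (auto simp: inv_shuffles_def)
  moreover have "Had_act (n + 1) \<sigma> (Had_comp scale n 1 2 F \<alpha>) \<in> Had_op scale (n + 1)" if "\<sigma> \<in> inv_shuffles 2 (n - 1)" for \<sigma>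
    using that assms(2) by (intro Had_op_act 2) (auto simp: inv_shuffles_def)
  ultimately show ?thesis
    unfolding CE_diff_def by (intro Had_op_diff Had_op_sum Had_op_scale)
qed

lemma sum_shuffles_1:
  fixes g :: "(nat \<Rightarrow> nat) \<Rightarrow> 'a::comm_monoid_add"
  shows "(\<Sum>\<sigma>\<in>inv_shuffles 1 n. g \<sigma>) = (\<Sum>i\<le>n. g (inv (cyc i)))"
  by (rule sum.reindex_bij_betw [OF inv_shuffles_1, symmetric])

lemma sum_shuffles_2:
  fixes g :: "(nat \<Rightarrow> nat) \<Rightarrow> 'a::comm_monoid_add"
  assumes "n \<ge> 1"
  shows "(\<Sum>\<sigma>\<in>inv_shuffles 2 (n - 1). g \<sigma>) = (\<Sum>j\<le>n. \<Sum>i<j. g (inv (cyc2 j i)))"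
proof -
  have "(\<Sum>\<sigma>\<in>inv_shuffles 2 (n - 1). g \<sigma>) = (\<Sum>(j, i)\<in>(SIGMA j:{..Suc (n - 1)}. {..<j}). g (inv (cyc2 j i)))"
    by (subst sum.reindex_bij_betw [OF inv_shuffles_2, symmetric]) (simp add: case_prod_unfold)
  then show ?thesis using assms by (simp add: sum.Sigma)
qed

lemma inv_cyc:
  assumes "i \<le> n"
  shows "inv (cyc i) permutes {1..n + 1}" "inv (inv (cyc i)) = cyc i" "sign (inv (cyc i)) = (-1) ^ i"
  using cyc_permutes [of i "n + 1"] assms
  by (auto simp: permutes_inv permutes_inv_inv sign_inv_perm sign_cyc)

lemma inv_cyc2:
  assumes "i < j" "j \<le> n"
  shows "inv (cyc2 j i) permutes {1..n + 1}" "inv (inv (cyc2 j i)) = cyc2 j i"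
    "sign (inv (cyc2 j i)) = - ((-1) ^ (i + j))"
  using cyc2_permutes [of i j "n + 1"] assms
  by (auto simp: permutes_inv permutes_inv_inv sign_inv_perm sign_cyc2)

text \<open>The base weight is 0, since the weight of a value is exactly the sum of the weights of
  its arguments. The two sums over shuffles become the action and the bracket terms.\<close>

theorem Phi_CE_diff:
  assumes F: "F \<in> CE scale n" and n: "n \<ge> 1"
  shows "Phi (CE_diff scale nprod n F) zs = loday (Phi F) 0 zs"
proof (cases "length zs = n + 1")
  case True
  have H: "F \<in> Had_op scale n" and alt: "swap_alternating (Phi F)" using F by (auto simp: CE_iff)
  let ?H = "Had_comp scale 2 2 n \<alpha> F" and ?K = "Had_comp scale n 1 2 F \<alpha>"
  have HH: "?H \<in> Had_op scale (n + 1)" using Had_op_comp [OF alpha_Had H, of 2] by simp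
  have KH: "?K \<in> Had_op scale (n + 1)" using Had_op_comp [OF H alpha_Had, of 1] n by simp
  have PH: "Phi ?H (z # us) = act z (sum_list (map fst us)) (Phi F us)" if "length us = n" for z us
    using Phi_comp [OF alpha_Had H, of 2 "z # us"] that by (simp add: comp_args_def Phi_alpha)
  have PK: "Phi ?K (x # y # us) = Phi F (brk x y # us)" if "length us = n - 1" for x y us
    using Phi_comp [OF H alpha_Had, of 1 "x # y # us"] that n
    by (simp add: comp_args_def Phi_alpha brk_def)
  have "(\<Sum>\<sigma>\<in>inv_shuffles 1 n. Phi (scale2 (of_int (sign \<sigma>)) (Had_act (n + 1) \<sigma> ?H)) zs) =
     (\<Sum>i\<le>n. scale ((-1) ^ i) (act (zs ! i) (sum_list (map fst (delete i zs))) (Phi F (delete i zs))))"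
    unfolding sum_shuffles_1
  proof (rule sum.cong [OF refl])
    fix i assume i: "i \<in> {..n}"
    show "Phi (scale2 (of_int (sign (inv (cyc i)))) (Had_act (n + 1) (inv (cyc i)) ?H)) zs =
       scale ((-1) ^ i) (act (zs ! i) (sum_list (map fst (delete i zs))) (Phi F (delete i zs)))"
      using i True by (simp add: Phi_scale Phi_act [OF HH] inv_cyc perm_list_cyc PH length_delete del: One_nat_def)
  qed
  \<comment> \<open>The sign of \<open>cyc2\<close> carries an extra minus, which cancels the
    subtraction in \<open>CE_diff\<close>.\<close>
  moreover have "(\<Sum>\<sigma>\<in>inv_shuffles 2 (n - 1). Phi (scale2 (of_int (sign \<sigma>)) (Had_act (n + 1) \<sigma> ?K)) zs) =
     - (\<Sum>j\<le>n. \<Sum>i<j. scale ((-1) ^ (i + j)) (Phi F (brk (zs ! i) (zs ! j) # delete i (delete j zs))))"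
    unfolding sum_shuffles_2 [OF n] sum_negf [symmetric]
  proof (intro sum.cong refl)
    fix i j assume ij: "j \<in> {..n}" "i \<in> {..<j}"
    show "Phi (scale2 (of_int (sign (inv (cyc2 j i)))) (Had_act (n + 1) (inv (cyc2 j i)) ?K)) zs =
       - scale ((-1) ^ (i + j)) (Phi F (brk (zs ! i) (zs ! j) # delete i (delete j zs)))"
      using ij True by (simp add: Phi_scale Phi_act [OF KH] inv_cyc2 perm_list_cyc2 PK length_delete del: One_nat_def)
  qed
  ultimately have "Phi (CE_diff scale nprod n F) zs = ce_action (Phi F) 0 zs + ce_bracket (Phi F) zs"
    unfolding CE_diff_def Phi_diff Phi_sum ce_action_def ce_bracket_def True
    by (simp add: lessThan_Suc_atMost)
  then show ?thesis using loday_eq_ce [OF alt] by simp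
next
  case False
  have H: "F \<in> Had_op scale n" using F by (auto simp: CE_iff)
  have "loday (Phi F) 0 zs = loday (\<lambda>us. 0) 0 zs"
    using False by (intro loday_cong Phi_length [OF H]) auto
  then show ?thesis
    using Phi_length [OF CE_diff_Had [OF H n] False] by (simp add: loday_zero)
qed

theorem CE_diff_CE:
  assumes F: "F \<in> CE scale n" and n: "n \<ge> 1"
  shows "CE_diff scale nprod n F \<in> CE scale (n + 1)"
proof -
  have H: "F \<in> Had_op scale n" and alt: "swap_alternating (Phi F)" using F by (auto simp: CE_iff)
  have "Phi (CE_diff scale nprod n F) = loday (Phi F) 0" using Phi_CE_diff [OF assms] by (simp add: fun_eq_iff)
  then show ?thesis
    using CE_diff_Had [OF H n] loday_alternating [OF alt Phi_subtractive [OF H]] by (simp add: CE_iff)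
qed

theorem CE_diff_CE_diff:
  assumes F: "F \<in> CE scale n" and n: "n \<ge> 1"
  shows "CE_diff scale nprod (n + 1) (CE_diff scale nprod n F) = 0"
proof (rule Phi_inj)
  have dF: "CE_diff scale nprod n F \<in> CE scale (n + 1)" by (rule CE_diff_CE [OF assms])
  then show "CE_diff scale nprod (n + 1) (CE_diff scale nprod n F) \<in> Had_op scale (n + 1 + 1)"
    by (intro CE_diff_Had [of "CE_diff scale nprod n F" "n + 1"]) (simp_all add: CE_iff)
  fix zs
  have "Phi (CE_diff scale nprod n F) = loday (Phi F) 0" using Phi_CE_diff [OF assms] by (simp add: fun_eq_iff)
  then show "Phi (CE_diff scale nprod (n + 1) (CE_diff scale nprod n F)) zs = Phi 0 zs"
    using Phi_CE_diff [OF dF] loday_loday [OF Phi_subtractive, of F n] F by (simp add: CE_iff Phi_def)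
qed (rule Had_op_0)

section \<open>Linearity of the differential and of the space of alternating families\<close>

lemma CE_diff_add:
  assumes "F \<in> CE scale n" "G \<in> CE scale n" "F + G \<in> CE scale n" "n \<ge> 1"
  shows "CE_diff scale nprod n (F + G) = CE_diff scale nprod n F + CE_diff scale nprod n G"
proof (rule Phi_inj)
  show "Phi (CE_diff scale nprod n (F + G)) zs = Phi (CE_diff scale nprod n F + CE_diff scale nprod n G) zs" for zs
    using assms loday_diff [of "\<lambda>us. Phi F us + Phi G us" "Phi G" 0 zs]
    by (simp add: Phi_CE_diff Phi_add) (simp add: Phi_add [abs_def] eq_diff_eq)
  show "CE_diff scale nprod n F + CE_diff scale nprod n G \<in> Had_op scale (n + 1)"
    using assms by (intro Had_op_add CE_diff_Had) (auto simp: CE_iff)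
  show "CE_diff scale nprod n (F + G) \<in> Had_op scale (n + 1)"
    using assms by (intro CE_diff_Had) (auto simp: CE_iff)
qed

lemma lie_der_scale: "lie_der z (\<lambda>us. scale c (\<phi> us)) w zs = scale c (lie_der z \<phi> w zs)"
  by (induction zs arbitrary: \<phi> w) (simp_all add: act_def prod_left prod_right scale_distribs mult.commute)

lemma loday_scale: "loday (\<lambda>us. scale c (\<phi> us)) w zs = scale c (loday \<phi> w zs)"
  by (induction zs arbitrary: \<phi> w) (simp_all add: lie_der_scale scale_distribs)

lemma CE_diff_scale:
  assumes "F \<in> CE scale n" "scale2 c F \<in> CE scale n" "n \<ge> 1"
  shows "CE_diff scale nprod n (scale2 c F) = scale2 c (CE_diff scale nprod n F)"
proof (rule Phi_inj)
  show "Phi (CE_diff scale nprod n (scale2 c F)) zs = Phi (scale2 c (CE_diff scale nprod n F)) zs" for zs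
    unfolding Phi_scale Phi_CE_diff [OF assms(1,3)] Phi_CE_diff [OF assms(2,3)]
    by (simp add: Phi_scale [abs_def] loday_scale)
  show "scale2 c (CE_diff scale nprod n F) \<in> Had_op scale (n + 1)"
    using assms by (intro Had_op_scale CE_diff_Had) (auto simp: CE_iff)
  show "CE_diff scale nprod n (scale2 c F) \<in> Had_op scale (n + 1)"
    using assms by (intro CE_diff_Had) (auto simp: CE_iff)
qed

lemma CE_add: "F \<in> CE scale n \<Longrightarrow> G \<in> CE scale n \<Longrightarrow> F + G \<in> CE scale n"
  unfolding CE_iff swap_alternating_def Phi_add by (metis Had_op_add minus_add_distrib)

lemma CE_scale: "F \<in> CE scale n \<Longrightarrow> scale2 c F \<in> CE scale n"
  unfolding CE_iff swap_alternating_def Phi_scale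
  by (metis Had_op_scale scale_minus_right)

lemma CE_0: "0 \<in> CE scale n"
  by (simp add: CE_iff Had_op_0 swap_alternating_def Phi_def)

end

section \<open>Exponents sorted in decreasing order\<close>

text \<open>Representatives of the orbits of permutations on \<open>P_exps n\<close>.\<close>

definition dec_exps :: "nat \<Rightarrow> nat list set"
  where "dec_exps n = {p \<in> P_exps n. sorted_wrt (\<ge>) p}"

lemma P_exps_less: "p \<in> P_exps n \<Longrightarrow> i < n \<Longrightarrow> p ! i < n"
  using member_le_sum_list [of "p ! i" p] by (auto simp: P_exps_def)

lemma count_mset_nth: "count (mset p) j = card {i. i < length p \<and> p ! i = j}"
proof -
  have "count (mset p) j = length (filter (\<lambda>x. x = j) p)"
    by (induction p) auto
  then show ?thesis by (simp only: length_filter_conv_card)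
qed

lemma rev_exps_type_nth: "j < n \<Longrightarrow> rev (exps_type n p) ! j = card {i. i < n \<and> p ! i = j}"
  by (simp add: exps_type_def rev_map)

lemma length_exps_type [simp]: "length (exps_type n p) = n"
  by (simp add: exps_type_def)

lemma sum_card_fibers:
  fixes f :: "nat \<Rightarrow> nat"
  assumes "J \<subseteq> {..<n}"
  shows "(\<Sum>j\<in>J. f j * card {i. i < n \<and> p ! i = j}) = (\<Sum>i | i < n \<and> p ! i \<in> J. f (p ! i))"
proof -
  have "(\<Sum>j\<in>J. f j * card {i. i < n \<and> p ! i = j}) = (\<Sum>j\<in>J. \<Sum>i | i \<in> {i. i < n \<and> p ! i \<in> J} \<and> p ! i = j. f (p ! i))"
    by (rule sum.cong [OF refl]) (auto intro!: arg_cong [of _ _ card])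
  also have "\<dots> = (\<Sum>i | i < n \<and> p ! i \<in> J. f (p ! i))"
    using assms finite_subset by (intro sum.group) auto
  finally show ?thesis .
qed

lemma exps_type_K_types:
  assumes "p \<in> P_exps n" shows "exps_type n p \<in> K_types n"
proof -
  have *: "{i. i < n \<and> p ! i < n} = {..<n}" using P_exps_less [OF assms] by auto
  have "(\<Sum>j<n. rev (exps_type n p) ! j) = n"
    using sum_card_fibers [of "{..<n}" n "\<lambda>_. 1" p] * by (simp add: rev_exps_type_nth)
  moreover have "(\<Sum>j<n. j * rev (exps_type n p) ! j) = sum_list p"
    using sum_card_fibers [of "{..<n}" n "\<lambda>j. j" p] * assms
    by (simp add: rev_exps_type_nth sum_list_sum_nth P_exps_def atLeast0LessThan)
  ultimately show ?thesis using assms by (simp add: K_types_def P_exps_def)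
qed

lemma dec_exps_mset_eq:
  assumes "p \<in> dec_exps n" "q \<in> dec_exps n" "mset p = mset q" shows "p = q"
proof -
  have "sorted (rev p)" "sorted (rev q)" using assms by (auto simp: dec_exps_def sorted_wrt_rev)
  then have "rev p = rev q" using assms(3) by (metis mset_rev properties_for_sort)
  then show ?thesis by simp
qed

text \<open>The type lists the multiplicities of the values below \<open>n\<close>, and the entries
  of a list in \<open>P_exps n\<close> take no others.\<close>

lemma exps_type_eq_iff_mset:
  assumes "p \<in> P_exps n" "q \<in> P_exps n"
  shows "exps_type n p = exps_type n q \<longleftrightarrow> mset p = mset q"
proof
  assume eq: "exps_type n p = exps_type n q"
  have "count (mset p) j = count (mset q) j" for j
  proof (cases "j < n")
    case True
    then show ?thesis
      using arg_cong [OF eq, of "\<lambda>k. rev k ! j"] assms by (simp add: rev_exps_type_nth count_mset_nth P_exps_def)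
  next
    case False
    then have e: "{i. i < n \<and> p ! i = j} = {}" "{i. i < n \<and> q ! i = j} = {}"
      using P_exps_less assms by fastforce+
    have l: "length p = n" "length q = n" using assms by (auto simp: P_exps_def)
    show ?thesis unfolding count_mset_nth l e ..
  qed
  then show "mset p = mset q" by (simp add: multiset_eq_iff)
next
  assume "mset p = mset q"
  then have "card {i. i < n \<and> p ! i = j} = card {i. i < n \<and> q ! i = j}" for j
    using assms count_mset_nth [of p j] count_mset_nth [of q j] by (simp add: P_exps_def)
  then show "exps_type n p = exps_type n q" by (simp add: exps_type_def)
qed

lemma exps_type_inj: "inj_on (exps_type n) (dec_exps n)"
  using dec_exps_mset_eq exps_type_eq_iff_mset by (auto simp: inj_on_def dec_exps_def)

lemma exps_type_dec_exps: "exps_type n ` dec_exps n = K_types n"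
proof (intro equalityI subsetI)
  fix k assume "k \<in> exps_type n ` dec_exps n"
  then show "k \<in> K_types n" using exps_type_K_types by (auto simp: dec_exps_def)
next
  fix k assume k: "k \<in> K_types n"
  \<comment> \<open>The multiset with the prescribed multiplicities; its decreasing arrangement is
    the preimage.\<close>
  define M where "M = (\<Sum>j<n. replicate_mset (rev k ! j) j)"
  define p where "p = rev (sorted_list_of_multiset M)"
  have cM: "count M j = (if j < n then rev k ! j else 0)" for j
    by (simp add: M_def count_sum sum.delta)
  have mp: "mset p = M" by (simp add: p_def)
  have "size M = n" using k by (simp add: M_def K_types_def size_multiset_sum [symmetric] flip: size_mset)
  moreover have "sum_mset M = (\<Sum>j<n. j * rev k ! j)"
  proof -
    have "sum_mset (\<Sum>j\<in>J. replicate_mset (rev k ! j) j) = (\<Sum>j\<in>J. j * rev k ! j)" for J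
      by (induction J rule: infinite_finite_induct) (simp_all add: mult.commute)
    then show ?thesis by (simp add: M_def)
  qed
  ultimately have p: "length p = n" "sum_list p + 1 = n"
    using k mp by (metis size_mset, simp add: K_types_def flip: sum_mset_sum_list)
  then have "p \<in> dec_exps n"
    by (auto simp: dec_exps_def P_exps_def p_def sorted_wrt_rev)
  moreover have "exps_type n p = k"
  proof -
    have "rev (exps_type n p) = rev k"
    proof (rule nth_equalityI)
      show "length (rev (exps_type n p)) = length (rev k)" using k by (simp add: K_types_def)
      fix j assume "j < length (rev (exps_type n p))"
      then show "rev (exps_type n p) ! j = rev k ! j"
        using count_mset_nth [of p j] cM [of j] mp p by (simp add: rev_exps_type_nth)
    qed
    then show ?thesis by simp
  qed
  ultimately show "k \<in> exps_type n ` dec_exps n" by blast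
qed

lemma K_types_cases:
  assumes "k \<in> K_types n" obtains p where "p \<in> dec_exps n" "k = exps_type n p"
proof -
  have "k \<in> exps_type n ` dec_exps n" using assms by (simp only: exps_type_dec_exps)
  then show ?thesis using that by auto
qed

text \<open>A type starts with the multiplicity of the largest value, so its first \<open>b\<close>
  entries cover the values \<open>n - b\<close> to \<open>n - 1\<close>. These sums are the block
  boundaries in \<open>Hom_wedge\<close>.\<close>

lemma sum_list_take_exps_type:
  assumes "p \<in> P_exps n" "b \<le> n"
  shows "sum_list (take b (exps_type n p)) = card {i. i < n \<and> n - b \<le> p ! i}"
proof -
  have "take b (rev [0..<n]) = rev [n - b..<n]" using assms by (simp add: rev_take take_rev drop_upt)
  then have "sum_list (take b (exps_type n p)) = (\<Sum>j\<in>{n - b..<n}. card {i. i < n \<and> p ! i = j})"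
    unfolding exps_type_def take_map
    by (simp only: rev_map [symmetric] sum_list_rev interv_sum_list_conv_sum_set_nat)
      (simp add: atLeastLessThan_def)
  also have "\<dots> = card {i. i < n \<and> p ! i \<in> {n - b..<n}}"
  proof -
    have "{n - b..<n} \<subseteq> {..<n}" by auto
    from sum_card_fibers [OF this, of "\<lambda>_. 1" p] show ?thesis by simp
  qed
  also have "{i. i < n \<and> p ! i \<in> {n - b..<n}} = {i. i < n \<and> n - b \<le> p ! i}"
    using P_exps_less [OF assms(1)] by auto
  finally show ?thesis .
qed

text \<open>Translates the block condition of \<open>Hom_wedge\<close> into equality of exponents,
  the form in which permutations can be applied.\<close>

lemma same_block_iff:
  assumes p: "p \<in> dec_exps n" and ij: "i < j" "j < n"
  shows "(\<exists>b<n. sum_list (take b (exps_type n p)) \<le> i \<and> j < sum_list (take (Suc b) (exps_type n p))) \<longleftrightarrow>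
    p ! i = p ! j"
proof -
  have P: "p \<in> P_exps n" using p by (simp add: dec_exps_def)
  have dec: "p ! s \<le> p ! r" if "r \<le> s" "s < n" for r s
    using p that by (cases "r = s") (auto simp: dec_exps_def P_exps_def sorted_wrt_iff_nth_less)
  \<comment> \<open>In a decreasing list the entries that are at least \<open>v\<close> form an
    initial segment, and the cardinality is its length.\<close>
  have le: "card {k. k < n \<and> v \<le> p ! k} \<le> r \<longleftrightarrow> p ! r < v" if "r < n" for v r
  proof
    assume c: "card {k. k < n \<and> v \<le> p ! k} \<le> r"
    show "p ! r < v"
    proof (rule ccontr)
      assume "\<not> p ! r < v"
      then have "k < n \<and> v \<le> p ! k" if "k \<le> r" for k
        using dec [OF that \<open>r < n\<close>] that \<open>r < n\<close> by auto
      then have "{..r} \<subseteq> {k. k < n \<and> v \<le> p ! k}" by auto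
      then have "card {..r} \<le> card {k. k < n \<and> v \<le> p ! k}" by (intro card_mono) auto
      then show False using c by simp
    qed
  next
    assume "p ! r < v"
    then have "k < r" if "k < n" "v \<le> p ! k" for k
      using dec [of r k] that by (force simp: not_less)
    then have "{k. k < n \<and> v \<le> p ! k} \<subseteq> {..<r}" by auto
    then have "card {k. k < n \<and> v \<le> p ! k} \<le> card {..<r}" by (intro card_mono) auto
    then show "card {k. k < n \<and> v \<le> p ! k} \<le> r" by simp
  qed
  have "sum_list (take b (exps_type n p)) \<le> i \<and> j < sum_list (take (Suc b) (exps_type n p)) \<longleftrightarrow>
      p ! i < n - b \<and> n - Suc b \<le> p ! j" if "b < n" for b
    using le [of i "n - b"] le [of j "n - Suc b"] that ij
    by (simp add: sum_list_take_exps_type [OF P] not_less flip: not_le)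
  moreover have "(\<exists>b<n. p ! i < n - b \<and> n - Suc b \<le> p ! j) \<longleftrightarrow> p ! i = p ! j"
  proof
    assume "\<exists>b<n. p ! i < n - b \<and> n - Suc b \<le> p ! j"
    then show "p ! i = p ! j" using dec [of i j] ij by force
  next
    assume "p ! i = p ! j"
    then show "\<exists>b<n. p ! i < n - b \<and> n - Suc b \<le> p ! j"
      using P_exps_less [OF P ij(2)] by (intro exI [of _ "n - Suc (p ! j)"]) auto
  qed
  ultimately show ?thesis by blast
qed

text \<open>Transports a permutation of positions counted from 0 to the convention of positions
  counted from 1.\<close>

lemma mset_eq_perm_list:
  assumes "mset xs = mset ys" "length ys = n"
  obtains \<sigma> where "\<sigma> permutes {1..n}" "perm_list n \<sigma> ys = xs"
proof -
  obtain f where f: "f permutes {..<length ys}" "permute_list f ys = xs"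
    using mset_eq_permutation [OF assms(1)] by blast
  define \<sigma> where "\<sigma> i = (if i \<in> {1..n} then Suc (f (i - 1)) else i)" for i
  have fn: "f k < n \<longleftrightarrow> k < n" for k using permutes_in_image [OF f(1), of k] assms(2) by simp
  have "bij_betw \<sigma> {1..n} {1..n}"
  proof (rule bij_betwI [where g = "\<lambda>i. Suc (inv f (i - 1))"])
    have inv: "inv f k < n \<longleftrightarrow> k < n" for k
      using permutes_in_image [OF permutes_inv [OF f(1)], of k] assms(2) by simp
    have r: "i - 1 < n" if "i \<in> {1..n}" for i using that by auto
    show "\<sigma> \<in> {1..n} \<rightarrow> {1..n}"
    proof
      fix i assume i: "i \<in> {1..n}"
      have "f (i - 1) < n" using fn r [OF i] by blast
      then show "\<sigma> i \<in> {1..n}" using i by (simp add: \<sigma>_def)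
    qed
    show "(\<lambda>i. Suc (inv f (i - 1))) \<in> {1..n} \<rightarrow> {1..n}"
    proof
      fix i assume i: "i \<in> {1..n}"
      have "inv f (i - 1) < n" using inv r [OF i] by blast
      then show "Suc (inv f (i - 1)) \<in> {1..n}" by simp
    qed
    show "Suc (inv f (\<sigma> x - 1)) = x" if "x \<in> {1..n}" for x
      using that permutes_inverses(2) [OF f(1)] by (simp add: \<sigma>_def)
    show "\<sigma> (Suc (inv f (y - 1))) = y" if "y \<in> {1..n}" for y
    proof -
      have "inv f (y - 1) < n" using inv r [OF that] by blast
      then show ?thesis using that permutes_inverses(1) [OF f(1), of "y - 1"] by (simp add: \<sigma>_def)
    qed
  qed
  then have "\<sigma> permutes {1..n}" by (rule bij_imp_permutes) (auto simp: \<sigma>_def)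
  moreover have "perm_list n \<sigma> ys = xs"
  proof (rule nth_equalityI)
    show "length (perm_list n \<sigma> ys) = length xs" using assms by (metis length_perm_list size_mset)
    fix k assume "k < length (perm_list n \<sigma> ys)"
    then have "k < n" by simp
    then show "perm_list n \<sigma> ys ! k = xs ! k"
      using permute_list_nth [OF f(1), of k] f(2) assms(2) by (simp add: perm_list_nth \<sigma>_def)
  qed
  ultimately show ?thesis using that by blast
qed

lemma ex_dec_perm:
  assumes "p \<in> P_exps n"
  obtains q \<sigma> where "q \<in> dec_exps n" "\<sigma> permutes {1..n}" "perm_list n \<sigma> q = p"
proof -
  define q where "q = rev (sort p)"
  have m: "mset p = mset q" by (simp add: q_def)
  have "q \<in> dec_exps n"
    using assms by (auto simp: dec_exps_def P_exps_def q_def sorted_wrt_rev simp flip: sum_mset_sum_list)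
  moreover have "length q = n" using assms by (simp add: q_def P_exps_def)
  ultimately show ?thesis using mset_eq_perm_list [OF m] that by blast
qed

section \<open>Alternating families and their components\<close>

lemma CE_to_Nov_type:
  assumes "p \<in> dec_exps n" shows "CE_to_Nov n F (exps_type n p) = F p"
proof -
  have "{q \<in> P_exps n. sorted_wrt (\<ge>) q \<and> exps_type n q = exps_type n p} = {p}"
    using assms exps_type_inj [of n] by (auto simp: inj_on_def dec_exps_def)
  then show ?thesis by (simp add: CE_to_Nov_def)
qed

lemma CE_to_Nov_outside:
  assumes "k \<notin> K_types n" shows "CE_to_Nov n F k = 0"
proof -
  have "{p \<in> P_exps n. sorted_wrt (\<ge>) p \<and> exps_type n p = k} = {}"
    using assms exps_type_K_types by auto
  then show ?thesis by (simp only: CE_to_Nov_def sum.empty)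
qed

lemma CE_to_Nov_eq_iff: "CE_to_Nov n F = c \<longleftrightarrow> (\<forall>k. k \<notin> K_types n \<longrightarrow> c k = 0) \<and> (\<forall>p\<in>dec_exps n. F p = c (exps_type n p))"
proof
  assume "CE_to_Nov n F = c"
  then show "(\<forall>k. k \<notin> K_types n \<longrightarrow> c k = 0) \<and> (\<forall>p\<in>dec_exps n. F p = c (exps_type n p))"
    using CE_to_Nov_type CE_to_Nov_outside by metis
next
  assume *: "(\<forall>k. k \<notin> K_types n \<longrightarrow> c k = 0) \<and> (\<forall>p\<in>dec_exps n. F p = c (exps_type n p))"
  show "CE_to_Nov n F = c"
  proof
    fix k
    show "CE_to_Nov n F k = c k"
    proof (cases "k \<in> K_types n")
      case True
      then obtain p where "p \<in> dec_exps n" "k = exps_type n p" by (rule K_types_cases)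
      then show ?thesis using * by (simp add: CE_to_Nov_type)
    qed (use * CE_to_Nov_outside in auto)
  qed
qed

lemma CE_to_Nov_add: "CE_to_Nov n (F + G) = CE_to_Nov n F + CE_to_Nov n G"
  by (simp add: CE_to_Nov_def fun_eq_iff sum.distrib sum_fun_apply)

context novikov_algebra
begin

lemma CE_to_Nov_scale: "CE_to_Nov n (scale2 c F) = scale2 c (CE_to_Nov n F)"
  by (simp add: CE_to_Nov_def fun_eq_iff sum_fun_apply scale_sum_right)

text \<open>Characteristic 0 makes 2 invertible.\<close>

lemma eq_minus_self: "v = - v \<Longrightarrow> v = (0 :: 'v)"
proof -
  assume "v = - v"
  then have "v + v = 0" by (metis add.right_inverse)
  then have "scale (1 + 1) v = 0" by (simp only: scale_left_distrib scale_one)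
  then show "v = 0" by simp
qed

lemma Hom_wedge_type_iff:
  assumes p: "p \<in> dec_exps n"
  shows "f \<in> Hom_wedge scale (exps_type n p) \<longleftrightarrow> f \<in> End_op scale n \<and>
    (\<forall>i j xs. i < j \<longrightarrow> j < n \<longrightarrow> p ! i = p ! j \<longrightarrow> length xs = n \<longrightarrow> xs ! i = xs ! j \<longrightarrow> f xs = 0)"
proof -
  have P: "p \<in> P_exps n" using p by (simp add: dec_exps_def)
  have s: "sum_list (exps_type n p) = n"
    using sum_list_take_exps_type [OF P, of n] by simp
  have j: "j < n" if "b < n" "j < sum_list (take (Suc b) (exps_type n p))" for b j
  proof -
    have "card {i. i < n \<and> n - Suc b \<le> p ! i} \<le> card {..<n}" by (intro card_mono) auto
    then show ?thesis using that sum_list_take_exps_type [OF P, of "Suc b"] by simp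
  qed
  show ?thesis
    unfolding Hom_wedge_def s length_exps_type
  proof (intro iffI CollectI conjI allI impI; elim CollectE conjE)
    fix i j and xs :: "'v list" assume "\<forall>b<n. \<forall>i j. sum_list (take b (exps_type n p)) \<le> i \<longrightarrow> i < j \<longrightarrow>
          j < sum_list (take (Suc b) (exps_type n p)) \<longrightarrow> (\<forall>xs. length xs = n \<longrightarrow> xs ! i = xs ! j \<longrightarrow> f xs = 0)"
      "i < j" "j < n" "p ! i = p ! j" "length xs = n" "xs ! i = xs ! j"
    then show "f xs = 0" using same_block_iff [OF p, of i j] by blast
  next
    fix b i j and xs :: "'v list" assume "\<forall>i j xs. i < j \<longrightarrow> j < n \<longrightarrow> p ! i = p ! j \<longrightarrow> length xs = n \<longrightarrow> xs ! i = xs ! j \<longrightarrow> f xs = 0"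
      "b < n" "sum_list (take b (exps_type n p)) \<le> i" "i < j"
      "j < sum_list (take (Suc b) (exps_type n p))" "length xs = n" "xs ! i = xs ! j"
    then show "f xs = 0" using same_block_iff [OF p, of i j] j by blast
  qed
qed

lemma CE_act: "F \<in> CE scale n \<Longrightarrow> \<sigma> permutes {1..n} \<Longrightarrow> length p = n \<Longrightarrow>
    End_act n \<sigma> (F (perm_list n (inv \<sigma>) p)) = fun_scale scale (of_int (sign \<sigma>)) (F p)"
  using Had_act_apply [of F n \<sigma> p] by (auto simp: CE_def fun_scale_def)

text \<open>Swapping two equal exponents fixes \<open>p\<close>, so \<open>F p\<close> changes sign
  under the swap of the arguments; if these are equal too, the value is its own negative.\<close>

lemma CE_Hom_wedge:
  assumes F: "F \<in> CE scale n" and p: "p \<in> dec_exps n"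
  shows "F p \<in> Hom_wedge scale (exps_type n p)"
  unfolding Hom_wedge_type_iff [OF p]
proof (intro conjI allI impI)
  show "F p \<in> End_op scale n" using F by (simp add: CE_def Had_opD)
  fix i j and xs :: "'v list"
  assume ij: "i < j" "j < n" "p ! i = p ! j" "length xs = n" "xs ! i = xs ! j"
  define \<sigma> where "\<sigma> = transpose (Suc i) (Suc j)"
  have \<sigma>: "\<sigma> permutes {1..n}" unfolding \<sigma>_def using ij by (intro permutes_swap_id) auto
  have fix_perm: "perm_list n (inv \<sigma>) ys = ys" if "length ys = n" "ys ! i = ys ! j" for ys :: "'b list"
    using that ij by (intro nth_equalityI) (auto simp: perm_list_nth \<sigma>_def transpose_def)
  have "End_act n \<sigma> (F p) xs = scale (of_int (sign \<sigma>)) (F p xs)"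
    using CE_act [OF F \<sigma>, of p] fix_perm [of p] p ij by (simp add: dec_exps_def P_exps_def fun_scale_def)
  then have "F p xs = - F p xs"
    using ij fix_perm [of xs] by (simp add: End_act_def) (simp add: \<sigma>_def sign_swap_id)
  then show "F p xs = 0" by (rule eq_minus_self)
qed

text \<open>Polarization: the value with \<open>u + v\<close> in both slots is 0, and so are the two
  diagonal terms of its expansion.\<close>

lemma Hom_wedge_transpose:
  assumes p: "p \<in> dec_exps n" and f: "f \<in> Hom_wedge scale (exps_type n p)"
    and ab: "a \<in> {1..n}" "b \<in> {1..n}" "a < b" "p ! (a - 1) = p ! (b - 1)" and xs: "length xs = n"
  shows "f (perm_list n (transpose a b) xs) = - f xs"
proof -
  have E: "f \<in> End_op scale n"
    and van: "\<And>i j xs. i < j \<Longrightarrow> j < n \<Longrightarrow> p ! i = p ! j \<Longrightarrow> length xs = n \<Longrightarrow> xs ! i = xs ! j \<Longrightarrow> f xs = 0"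
    using f by (auto simp: Hom_wedge_type_iff [OF p])
  have "f (xs[a - 1 := u, b - 1 := u]) = 0" for u
    using ab xs by (intro van [of "a - 1" "b - 1"]) auto
  moreover have "f (xs[a - 1 := u + v, b - 1 := w]) = f (xs[a - 1 := u, b - 1 := w]) + f (xs[a - 1 := v, b - 1 := w])" for u v w
  proof -
    have s: "xs[a - 1 := u, b - 1 := w] = xs[b - 1 := w, a - 1 := u]" for u
      using ab by (intro list_update_swap) auto
    show ?thesis unfolding s using E ab xs by (simp add: End_op_iff)
  qed
  moreover have "f (xs[a - 1 := w, b - 1 := u + v]) = f (xs[a - 1 := w, b - 1 := u]) + f (xs[a - 1 := w, b - 1 := v])" for u v w
    using E ab xs by (simp add: End_op_iff)
  ultimately have "f (xs[a - 1 := u, b - 1 := v]) + f (xs[a - 1 := v, b - 1 := u]) = 0" for u v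
    by (metis (no_types, lifting) add.commute add.right_neutral)
  from this [of "xs ! (b - 1)" "xs ! (a - 1)"]
  have "f (xs[a - 1 := xs ! (b - 1), b - 1 := xs ! (a - 1)]) = - f xs"
    by (simp add: eq_neg_iff_add_eq_0)
  moreover have "perm_list n (transpose a b) xs = xs[a - 1 := xs ! (b - 1), b - 1 := xs ! (a - 1)]"
    using ab xs by (intro nth_equalityI) (auto simp: perm_list_nth transpose_def nth_list_update)
  ultimately show ?thesis by simp
qed

text \<open>Induction on a set containing the support of the permutation, peeling off one
  transposition of equal exponents at a time.\<close>

lemma Hom_wedge_stabilizer:
  assumes p: "p \<in> dec_exps n" and f: "f \<in> Hom_wedge scale (exps_type n p)"
    and \<sigma>: "\<sigma> permutes {1..n}" "perm_list n \<sigma> p = p" and xs: "length xs = n"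
  shows "f (perm_list n \<sigma> xs) = scale (of_int (sign \<sigma>)) (f xs)"
proof -
  have "f (perm_list n \<sigma> xs) = scale (of_int (sign \<sigma>)) (f xs)"
    if "finite S" "\<sigma> permutes S" "S \<subseteq> {1..n}" "\<forall>k\<in>{1..n}. p ! (\<sigma> k - 1) = p ! (k - 1)" "length xs = n" for S \<sigma> xs
    using that
  proof (induction S arbitrary: \<sigma> xs rule: finite_induct)
    case empty
    then show ?case by (simp add: perm_list_id [unfolded id_def] id_def)
  next
    case (insert a S)
    \<comment> \<open>The transposition removes \<open>a\<close> from the support and exchanges
      equal exponents, so \<open>\<tau>\<close> still stabilizes \<open>p\<close>.\<close>
    define \<tau> where "\<tau> = transpose a (\<sigma> a) \<circ> \<sigma>"
    have \<tau>: "\<tau> permutes S" unfolding \<tau>_def by (rule permutes_insert_lemma [OF insert.prems(1)])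
    then have \<tau>n: "\<tau> permutes {1..n}" using insert.prems(2) permutes_subset by blast
    have \<sigma>n: "\<sigma> permutes {1..n}" using insert.prems(1,2) permutes_subset by blast
    have a: "a \<in> {1..n}" "\<sigma> a \<in> {1..n}" using insert.prems(2) permutes_in_image [OF \<sigma>n] by auto
    have \<sigma>_eq: "\<sigma> = transpose a (\<sigma> a) \<circ> \<tau>" by (simp add: \<tau>_def fun_eq_iff)
    have pa: "p ! (\<sigma> a - 1) = p ! (a - 1)" using insert.prems(3) a by blast
    have "p ! (transpose a (\<sigma> a) k - 1) = p ! (k - 1)" for k
      using pa by (simp add: transpose_def)
    then have "p ! (\<tau> k - 1) = p ! (k - 1)" if "k \<in> {1..n}" for k
      using insert.prems(3) that by (simp add: \<tau>_def)
    then have IH: "f (perm_list n \<tau> xs) = scale (of_int (sign \<tau>)) (f xs)" if "length xs = n" for xs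
      using insert.IH [OF \<tau>] insert.prems(2) that by simp
    show ?case
    proof (cases "a = \<sigma> a")
      case True
      then have "\<sigma> = \<tau>" using \<sigma>_eq by (metis comp_id transpose_same id_comp)
      then show ?thesis using IH insert.prems by simp
    next
      case False
      have tr: "f (perm_list n (transpose a (\<sigma> a)) xs) = - f xs"
      proof (cases "a < \<sigma> a")
        case True
        then show ?thesis using Hom_wedge_transpose [OF p f a] pa insert.prems by simp
      next
        case ge: False
        then show ?thesis
          using Hom_wedge_transpose [OF p f a(2,1)] pa insert.prems False by (subst transpose_commute) simp
      qed
      have "f (perm_list n \<sigma> xs) = f (perm_list n \<tau> (perm_list n (transpose a (\<sigma> a)) xs))"
        by (subst \<sigma>_eq, subst perm_list_comp [OF \<tau>n]) simp
      also have "\<dots> = scale (- of_int (sign \<tau>)) (f xs)" using IH tr by simp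
      also have "sign \<sigma> = - sign \<tau>"
        using False permutes_imp_permutation [OF finite_atLeastAtMost \<tau>n]
        by (subst \<sigma>_eq, subst sign_compose) (auto simp: sign_swap_id permutation_swap_id)
      then have "scale (- of_int (sign \<tau>)) (f xs) = scale (of_int (sign \<sigma>)) (f xs)" by simp
      finally show ?thesis .
    qed
  qed
  note * = this
  have "p ! (\<sigma> k - 1) = p ! (k - 1)" if "k \<in> {1..n}" for k
    using arg_cong [OF \<sigma>(2), of "\<lambda>r. r ! (k - 1)"] that perm_list_nth [of "k - 1" n \<sigma> p] by auto
  then show ?thesis using * [of "{1..n}" \<sigma> xs] \<sigma>(1) xs by simp
qed

text \<open>Each orbit of exponents contains a decreasing list, whose component determines the
  others through the alternation.\<close>

lemma CE_to_Nov_inj: "inj_on (CE_to_Nov n) (CE scale n)"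
proof (rule inj_onI)
  fix F G assume F: "F \<in> CE scale n" and G: "G \<in> CE scale n" and eq: "CE_to_Nov n F = CE_to_Nov n G"
  have dec: "F q = G q" if "q \<in> dec_exps n" for q
    using arg_cong [OF eq, of "\<lambda>c. c (exps_type n q)"] that by (simp add: CE_to_Nov_type)
  show "F = G"
  proof
    fix p
    show "F p = G p"
    proof (cases "p \<in> P_exps n")
      case True
      obtain q \<sigma> where q: "q \<in> dec_exps n" "\<sigma> permutes {1..n}" "perm_list n \<sigma> q = p"
        using ex_dec_perm [OF True] .
      have lp: "length p = n" "length q = n" using True q by (auto simp: P_exps_def dec_exps_def)
      have "perm_list n (inv \<sigma>) p = q" using perm_list_inv(2) [OF q(2) lp(2)] q(3) by simp
      then have "fun_scale scale (of_int (sign \<sigma>)) (F p) = fun_scale scale (of_int (sign \<sigma>)) (G p)"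
        using CE_act [OF F q(2) lp(1)] CE_act [OF G q(2) lp(1)] dec [OF q(1)] by simp
      then have "scale (of_int (sign \<sigma>)) (F p xs) = scale (of_int (sign \<sigma>)) (G p xs)" for xs
        by (simp add: fun_scale_def fun_eq_iff)
      then show ?thesis by (simp add: fun_eq_iff)
    next
      case False
      have "F p = 0" "G p = 0"
        by (rule Had_op_outside [OF _ False], use F G in \<open>simp add: CE_def\<close>)+
      then show ?thesis by simp
    qed
  qed
qed

text \<open>Acting with \<open>\<tau>\<close> reindexes the sum by composition with
  \<open>\<tau>\<close>; the sign left over is that of \<open>\<tau>\<close>.\<close>

lemma alternation_CE:
  assumes G: "G \<in> Had_op scale n"
  defines "F \<equiv> \<Sum>\<sigma> | \<sigma> permutes {1..n}. scale2 (of_int (sign \<sigma>)) (Had_act n \<sigma> G)"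
  shows "F \<in> CE scale n"
proof -
  have H: "F \<in> Had_op scale n" unfolding F_def using G by (intro Had_op_sum Had_op_scale Had_op_act) auto
  have PF: "Phi F zs = (\<Sum>\<sigma> | \<sigma> permutes {1..n}. scale (of_int (sign \<sigma>)) (Phi G (perm_list n (inv \<sigma>) zs)))"
    if "length zs = n" for zs
    unfolding F_def Phi_sum Phi_scale using that by (intro sum.cong refl) (simp add: Phi_act [OF G])
  have "Had_act n \<tau> F = scale2 (of_int (sign \<tau>)) F" if \<tau>: "\<tau> permutes {1..n}" for \<tau>
  proof (rule Phi_inj)
    fix zs :: "('k \<times> 'v) list" assume zs: "length zs = n"
    have "Phi (Had_act n \<tau> F) zs = (\<Sum>\<sigma> | \<sigma> permutes {1..n}.
        scale (of_int (sign \<sigma>)) (Phi G (perm_list n (inv \<sigma>) (perm_list n (inv \<tau>) zs))))"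
      using Phi_act [OF H \<tau> zs] PF by simp
    also have "\<dots> = (\<Sum>\<sigma> | \<sigma> permutes {1..n}.
        scale (of_int (sign \<tau>)) (scale (of_int (sign (\<sigma> \<circ> \<tau>))) (Phi G (perm_list n (inv (\<sigma> \<circ> \<tau>)) zs))))"
    proof (rule sum.cong [OF refl])
      fix \<sigma> assume "\<sigma> \<in> {\<sigma>. \<sigma> permutes {1..n}}"
      then have \<sigma>: "\<sigma> permutes {1..n}" by simp
      have perm: "permutation \<sigma>" "permutation \<tau>" using \<sigma> \<tau> permutes_imp_permutation by blast+
      have "sign \<tau> * sign (\<sigma> \<circ> \<tau>) = sign \<sigma>" using perm by (simp add: sign_compose mult.left_commute)
      then have s: "of_int (sign \<tau>) * of_int (sign (\<sigma> \<circ> \<tau>)) = (of_int (sign \<sigma>) :: 'k)" by (metis of_int_mult)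
      have "inv (\<sigma> \<circ> \<tau>) = inv \<tau> \<circ> inv \<sigma>" using permutes_bij [OF \<sigma>] permutes_bij [OF \<tau>] o_inv_distrib by blast
      then show "scale (of_int (sign \<sigma>)) (Phi G (perm_list n (inv \<sigma>) (perm_list n (inv \<tau>) zs))) =
          scale (of_int (sign \<tau>)) (scale (of_int (sign (\<sigma> \<circ> \<tau>))) (Phi G (perm_list n (inv (\<sigma> \<circ> \<tau>)) zs)))"
        using s by (simp add: perm_list_comp [OF permutes_inv [OF \<sigma>]])
    qed
    also have "\<dots> = Phi (scale2 (of_int (sign \<tau>)) F) zs"
      using sum_permutations_compose_right [OF \<tau>, of "\<lambda>\<sigma>. scale (of_int (sign \<tau>)) (scale (of_int (sign \<sigma>)) (Phi G (perm_list n (inv \<sigma>) zs)))"]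
      by (simp only: Phi_scale PF [OF zs] scale_sum_right)
    finally show "Phi (Had_act n \<tau> F) zs = Phi (scale2 (of_int (sign \<tau>)) F) zs" .
  qed (use H \<tau> in \<open>auto intro: Had_op_act Had_op_scale\<close>)
  then show ?thesis using H by (simp add: CE_def)
qed

text \<open>Surjectivity by alternation: the components are placed on decreasing exponents, divided
  by the order of the stabilizer, and summed over all permutations with signs.\<close>

lemma CE_to_Nov_image: "CE_to_Nov n ` CE scale n = Hom_sum scale (K_types n)"
proof (intro equalityI subsetI)
  fix c assume "c \<in> CE_to_Nov n ` CE scale n"
  then obtain F where F: "F \<in> CE scale n" "c = CE_to_Nov n F" by blast
  have "c k \<in> Hom_wedge scale k" if k: "k \<in> K_types n" for k
  proof -
    obtain p where "p \<in> dec_exps n" "k = exps_type n p" using K_types_cases [OF k] .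
    then show ?thesis using CE_Hom_wedge F by (simp add: CE_to_Nov_type)
  qed
  then show "c \<in> Hom_sum scale (K_types n)"
    using F(2) CE_to_Nov_outside by (auto simp: Hom_sum_def)
next
  fix c assume c: "c \<in> Hom_sum scale (K_types n)"
  define stab where "stab p = {\<sigma>. \<sigma> permutes {1..n} \<and> perm_list n (inv \<sigma>) p = p}" for p :: "nat list"
  define G where "G p = (if p \<in> dec_exps n then fun_scale scale (1 / of_nat (card (stab p))) (c (exps_type n p)) else 0)" for p
  define F where "F = (\<Sum>\<sigma> | \<sigma> permutes {1..n}. scale2 (of_int (sign \<sigma>)) (Had_act n \<sigma> G))"
  have cw: "c (exps_type n p) \<in> Hom_wedge scale (exps_type n p)" if "p \<in> dec_exps n" for p
    using c that exps_type_dec_exps by (auto simp: Hom_sum_def)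
  have fin: "finite (stab p)" for p unfolding stab_def using finite_permutations [of "{1..n}"] by (rule rev_finite_subset) auto
  have G: "G \<in> Had_op scale n"
    using cw by (auto simp: G_def Had_op_def dec_exps_def End_op_0 Hom_wedge_type_iff intro!: End_op_scale)
  have F_CE: "F \<in> CE scale n" unfolding F_def by (rule alternation_CE [OF G])
  have Fp: "F p xs = c (exps_type n p) xs" if p: "p \<in> dec_exps n" for p xs
  proof (cases "length xs = n")
    case True
    have P: "p \<in> P_exps n" "length p = n" using p by (auto simp: dec_exps_def P_exps_def)
    have summand: "scale (of_int (sign \<sigma>)) (Had_act n \<sigma> G p xs) =
        (if \<sigma> \<in> stab p then scale (1 / of_nat (card (stab p))) (c (exps_type n p) xs) else 0)"
      if \<sigma>: "\<sigma> permutes {1..n}" for \<sigma>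
    proof -
      let ?q = "perm_list n (inv \<sigma>) p"
      have inv: "inv \<sigma> permutes {1..n}" using \<sigma> permutes_inv by blast
      have H: "Had_act n \<sigma> G p xs = G ?q (perm_list n (inv \<sigma>) xs)"
        using Had_act_apply [OF G \<sigma> P(2)] True by (simp add: End_act_def)
      show ?thesis
      proof (cases "\<sigma> \<in> stab p")
        case st: True
        then have "c (exps_type n p) (perm_list n (inv \<sigma>) xs) = scale (of_int (sign (inv \<sigma>))) (c (exps_type n p) xs)"
          using inv True by (intro Hom_wedge_stabilizer [OF p cw [OF p]]) (auto simp: stab_def)
        then show ?thesis
          using st p H sign_inv_perm [OF \<sigma>] by (simp add: stab_def G_def fun_scale_def mult.commute flip: of_int_mult)
      next
        case False
        \<comment> \<open>A rearrangement of \<open>p\<close> other than \<open>p\<close> itself is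
          not decreasing, so \<open>G\<close> vanishes there.\<close>
        then have "?q \<notin> dec_exps n"
          using dec_exps_mset_eq [OF _ p, of ?q] mset_perm_list [OF inv P(2)] \<sigma> by (auto simp: stab_def)
        then show ?thesis using False H by (simp add: G_def)
      qed
    qed
    have "id \<in> stab p" using P by (simp add: stab_def permutes_id)
    then have card: "card (stab p) \<noteq> 0" using fin by auto
    have "F p xs = (\<Sum>\<sigma> | \<sigma> permutes {1..n}. scale (of_int (sign \<sigma>)) (Had_act n \<sigma> G p xs))"
      by (simp add: F_def sum_fun_apply)
    also have "\<dots> = (\<Sum>\<sigma> | \<sigma> permutes {1..n}.
        if \<sigma> \<in> stab p then scale (1 / of_nat (card (stab p))) (c (exps_type n p) xs) else 0)"
      using summand by (intro sum.cong) auto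
    also have "\<dots> = (\<Sum>\<sigma>\<in>stab p. scale (1 / of_nat (card (stab p))) (c (exps_type n p) xs))"
      by (rule sum.mono_neutral_cong_right) (auto simp: finite_permutations stab_def)
    also have "\<dots> = c (exps_type n p) xs"
      using card by (simp add: sum_constant_scale)
    finally show ?thesis .
  next
    case False
    have "F \<in> Had_op scale n" using F_CE by (simp add: CE_def)
    then have "F p xs = 0" using End_op_length [OF Had_opD] False by blast
    moreover have "c (exps_type n p) xs = 0"
      using cw [OF p] False End_op_length unfolding Hom_wedge_type_iff [OF p] by blast
    ultimately show ?thesis by simp
  qed
  have "CE_to_Nov n F = c"
    unfolding CE_to_Nov_eq_iff using Fp c by (auto simp: Hom_sum_def)
  then show "c \<in> CE_to_Nov n ` CE scale n" using F_CE by blast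
qed

end

section \<open>Explicit components of the differential\<close>

lemma monom_eval_update:
  "j < length p \<Longrightarrow> length ls = length p \<Longrightarrow> monom_eval ls (p[j := Suc (p ! j)]) = ls ! j * monom_eval ls p"
proof (induction p arbitrary: ls j)
  case (Cons k p)
  then obtain a ls' where "ls = a # ls'" by (cases ls) auto
  then show ?case using Cons by (cases j) (auto simp: mult.left_commute)
qed simp

lemma sum_list_Suc_update: "j < length p \<Longrightarrow> sum_list (p[j := Suc (p ! j)]) = Suc (sum_list p)"
  by (simp add: sum_list_update member_le_sum_list)

lemma sum_list_pred_update:
  fixes p :: "nat list"
  shows "j < length p \<Longrightarrow> p ! j \<ge> 1 \<Longrightarrow> sum_list (p[j := p ! j - 1]) + 1 = sum_list p"
  using sum_list_Suc_update [of j "p[j := p ! j - 1]"] by simp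

context novikov_algebra
begin

abbreviation "\<omega> \<equiv> End_prod nprod"
abbreviation "\<omega>' \<equiv> End_act 2 (transpose 1 2) (End_prod nprod)"

lemma opp_in: "\<omega>' \<in> End_op scale 2"
  using End_op_act [OF End_prod_in permutes_swap_id, of 1 2] by simp

lemma End_comp_prod:
  "length ys = n \<Longrightarrow> End_comp 2 2 n \<omega> f (x # ys) = x \<diamondop> f ys"
  "length ys = n \<Longrightarrow> End_comp 2 2 n \<omega>' f (x # ys) = f ys \<diamondop> x"
  "n \<ge> 1 \<Longrightarrow> length ys = n - 1 \<Longrightarrow> End_comp n 1 2 f \<omega> (x # y # ys) = f ((x \<diamondop> y) # ys)"
  "n \<ge> 1 \<Longrightarrow> length ys = n - 1 \<Longrightarrow> End_comp n 1 2 f \<omega>' (x # y # ys) = f ((y \<diamondop> x) # ys)"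
  by (auto simp: End_comp_eq comp_args_def End_prod_def End_act_def perm_list_nth transpose_def numeral_2_eq_2)

text \<open>Coordinates of \<open>\<alpha>\<close> composed with \<open>F\<close> in the second
  slot. Either \<open>D\<close> falls on the first argument, giving exponent 1 there, or on the
  value of \<open>F\<close>, where it multiplies by the sum of the other weights and so raises one
  exponent of \<open>F\<close>.\<close>

definition left_comp :: "nat \<Rightarrow> (nat list \<Rightarrow> 'v list \<Rightarrow> 'v) \<Rightarrow> nat list \<Rightarrow> 'v list \<Rightarrow> 'v"
  where "left_comp n F r = (if r \<notin> P_exps (n + 1) then 0
    else if hd r = 1 then End_comp 2 2 n \<omega> (F (tl r))
    else if hd r = 0 then - (\<Sum>j | j < n \<and> tl r ! j \<ge> 1. End_comp 2 2 n \<omega>' (F ((tl r)[j := tl r ! j - 1])))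
    else 0)"

lemma left_comp_Had: "F \<in> Had_op scale n \<Longrightarrow> left_comp n F \<in> Had_op scale (n + 1)"
  using End_op_comp [OF End_prod_in Had_opD, of F n 2] End_op_comp [OF opp_in Had_opD, of F n 2]
  by (intro Had_opI) (auto simp: left_comp_def End_op_0 intro!: End_op_uminus End_op_sum)

lemma Phi_left_comp:
  assumes F: "F \<in> Had_op scale n" and us: "length us = n"
  shows "Phi (left_comp n F) (z # us) = act z (sum_list (map fst us)) (Phi F us)"
proof -
  obtain a x where z: "z = (a, x)" by (cases z)
  define ls where "ls = map fst us"
  define ys where "ys = map snd us"
  have ls: "length ls = n" and ys: "length ys = n" using us by (simp_all add: ls_def ys_def)
  \<comment> \<open>Tails behind a first exponent 0; their sum is \<open>n\<close>, one more than in
    \<open>P_exps n\<close>.\<close>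
  define Q where "Q = {t :: nat list. length t = n \<and> sum_list t = n}"
  have finQ: "finite Q"
    by (rule finite_subset [OF _ finite_imageI [OF finite_P_exps [of "n + 1"], of tl]])
      (auto simp: Q_def P_exps_def image_iff intro!: exI [of _ "0 # _"])
  let ?g = "\<lambda>r. scale (monom_eval (a # ls) r) (left_comp n F r (x # ys))"
  have P: "P_exps (n + 1) = (#) 1 ` P_exps n \<union> (#) 0 ` Q \<union> {r \<in> P_exps (n + 1). hd r \<ge> 2}"
  proof (intro equalityI subsetI)
    fix r assume r: "r \<in> P_exps (n + 1)"
    then obtain b t where bt: "r = b # t" by (cases r) (auto simp: P_exps_def)
    consider "b = 0" | "b = 1" | "b \<ge> 2" by linarith
    then show "r \<in> (#) 1 ` P_exps n \<union> (#) 0 ` Q \<union> {r \<in> P_exps (n + 1). hd r \<ge> 2}"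
      using r bt by cases (auto simp: P_exps_def Q_def)
  qed (auto simp: P_exps_def Q_def)
  have "Phi (left_comp n F) (z # us) = (\<Sum>r\<in>P_exps (n + 1). ?g r)"
    unfolding Phi_def using us by (simp add: z ls_def ys_def)
  also have "\<dots> = (\<Sum>r\<in>(#) 1 ` P_exps n \<union> (#) 0 ` Q. ?g r)"
    by (rule sum.mono_neutral_right) (use P in \<open>auto simp: left_comp_def\<close>)
  also have "\<dots> = (\<Sum>r\<in>(#) 1 ` P_exps n. ?g r) + (\<Sum>r\<in>(#) 0 ` Q. ?g r)"
    using finQ by (intro sum.union_disjoint) auto
  also have "(\<Sum>r\<in>(#) 1 ` P_exps n. ?g r) = scale a (x \<diamondop> Phi F us)"
  proof -
    interpret r: Vector_Spaces.linear scale scale "\<lambda>y. x \<diamondop> y" by (rule linear_right)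
    have "(\<Sum>r\<in>(#) 1 ` P_exps n. ?g r) = (\<Sum>s\<in>P_exps n. ?g (1 # s))"
      by (subst sum.reindex) (auto simp: inj_on_def)
    also have "\<dots> = (\<Sum>s\<in>P_exps n. scale (a * monom_eval ls s) (x \<diamondop> F s ys))"
      using ys by (intro sum.cong refl) (auto simp: left_comp_def End_comp_prod P_exps_def)
    also have "\<dots> = scale a (x \<diamondop> Phi F us)"
      unfolding Phi_def us r.sum r.scale by (simp add: scale_sum_right ls_def ys_def)
    finally show ?thesis .
  qed
  also have "(\<Sum>r\<in>(#) 0 ` Q. ?g r) = - scale (sum_list ls) (Phi F us \<diamondop> x)"
  proof -
    interpret l: Vector_Spaces.linear scale scale "\<lambda>y. y \<diamondop> x" by (rule linear_left)
    let ?h = "\<lambda>t j. scale (monom_eval ls t) (F (t[j := t ! j - 1]) ys \<diamondop> x)"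
    have "(\<Sum>r\<in>(#) 0 ` Q. ?g r) = (\<Sum>t\<in>Q. ?g (0 # t))"
      by (subst sum.reindex) (auto simp: inj_on_def)
    also have "\<dots> = (\<Sum>t\<in>Q. - (\<Sum>j | j < n \<and> t ! j \<ge> 1. ?h t j))"
      using ys by (intro sum.cong refl)
        (auto simp: left_comp_def End_comp_prod [unfolded One_nat_def] P_exps_def Q_def sum_fun_apply scale_sum_right)
    also have "\<dots> = - (\<Sum>(t, j)\<in>(SIGMA t:Q. {j. j < n \<and> t ! j \<ge> 1}). ?h t j)"
      using finQ by (simp add: sum.Sigma sum_negf)
    \<comment> \<open>Raising the exponent at \<open>j\<close> is multiplication of the monomial by
      the weight \<open>ls ! j\<close>; lowering it is the inverse matching.\<close>
    also have "(\<Sum>(t, j)\<in>(SIGMA t:Q. {j. j < n \<and> t ! j \<ge> 1}). ?h t j) =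
        (\<Sum>(s, j)\<in>P_exps n \<times> {..<n}. scale (ls ! j * monom_eval ls s) (F s ys \<diamondop> x))"
    proof (rule sum.reindex_bij_witness [where i = "\<lambda>(s, j). (s[j := Suc (s ! j)], j)" and j = "\<lambda>(t, j). (t[j := t ! j - 1], j)"])
      fix tj assume "tj \<in> (SIGMA t:Q. {j. j < n \<and> t ! j \<ge> 1})"
      then obtain t j where tj: "tj = (t, j)" "length t = n" "sum_list t = n" "j < n" "t ! j \<ge> 1" by (auto simp: Q_def)
      then show "(case case tj of (t, j) \<Rightarrow> (t[j := t ! j - 1], j) of (s, j) \<Rightarrow> (s[j := Suc (s ! j)], j)) = tj" by simp
      show "(case tj of (t, j) \<Rightarrow> (t[j := t ! j - 1], j)) \<in> P_exps n \<times> {..<n}"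
        using tj sum_list_pred_update [of j t] by (simp add: P_exps_def)
      have "monom_eval ls t = ls ! j * monom_eval ls (t[j := t ! j - 1])"
        using monom_eval_update [of j "t[j := t ! j - 1]" ls] tj ls by simp
      then show "(case case tj of (t, j) \<Rightarrow> (t[j := t ! j - 1], j) of
          (s, j) \<Rightarrow> scale (ls ! j * monom_eval ls s) (F s ys \<diamondop> x)) = (case tj of (t, j) \<Rightarrow> ?h t j)"
        using tj by simp
    next
      fix sj assume "sj \<in> P_exps n \<times> {..<n}"
      then obtain s j where sj: "sj = (s, j)" "length s = n" "sum_list s + 1 = n" "j < n" by (auto simp: P_exps_def)
      then show "(case case sj of (s, j) \<Rightarrow> (s[j := Suc (s ! j)], j) of (t, j) \<Rightarrow> (t[j := t ! j - 1], j)) = sj" by simp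
      show "(case sj of (s, j) \<Rightarrow> (s[j := Suc (s ! j)], j)) \<in> (SIGMA t:Q. {j. j < n \<and> t ! j \<ge> 1})"
        using sj by (simp add: Q_def sum_list_Suc_update)
    qed
    also have "\<dots> = (\<Sum>s\<in>P_exps n. \<Sum>j<n. scale (ls ! j * monom_eval ls s) (F s ys \<diamondop> x))"
      by (simp add: sum.cartesian_product)
    also have "\<dots> = (\<Sum>s\<in>P_exps n. scale (sum_list ls * monom_eval ls s) (F s ys \<diamondop> x))"
      using ls by (intro sum.cong refl) (simp add: sum_list_sum_nth atLeast0LessThan sum_distrib_right flip: scale_sum_left)
    also have "\<dots> = scale (sum_list ls) (Phi F us \<diamondop> x)"
      unfolding Phi_def us l.sum l.scale by (simp add: scale_sum_right ls_def ys_def)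
    finally show ?thesis .
  qed
  finally show ?thesis by (simp add: act_def z ls_def)
qed

text \<open>Both families have the same polynomial, so no structure constant of the operad is
  computed.\<close>

lemma Had_comp_left:
  assumes F: "F \<in> Had_op scale n"
  shows "Had_comp scale 2 2 n \<alpha> F = left_comp n F"
proof (rule Phi_inj [OF _ left_comp_Had [OF F]])
  show "Had_comp scale 2 2 n \<alpha> F \<in> Had_op scale (n + 1)"
    using Had_op_comp [OF alpha_Had F, of 2] by simp
  fix zs :: "('k \<times> 'v) list" assume "length zs = n + 1"
  then obtain z us where zs: "zs = z # us" "length us = n" by (cases zs) auto
  then have "Phi (Had_comp scale 2 2 n \<alpha> F) zs = act z (sum_list (map fst us)) (Phi F us)"
    using Phi_comp [OF alpha_Had F, of 2 zs] by (simp add: comp_args_def Phi_alpha)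
  then show "Phi (Had_comp scale 2 2 n \<alpha> F) zs = Phi (left_comp n F) zs"
    using Phi_left_comp [OF F zs(2)] zs by simp
qed

text \<open>The inserted product has weight \<open>l\<^sub>1 + l\<^sub>2\<close>, whose power
  \<open>a + b - 1\<close> is expanded by the binomial theorem; the factor \<open>l\<^sub>1\<close>
  or \<open>l\<^sub>2\<close> from \<open>\<alpha>\<close> supplies the missing degree. The tests
  for 0 exclude cases in which truncated subtraction would give a wrong coefficient.\<close>

definition right_comp :: "nat \<Rightarrow> (nat list \<Rightarrow> 'v list \<Rightarrow> 'v) \<Rightarrow> nat list \<Rightarrow> 'v list \<Rightarrow> 'v"
  where "right_comp n F r = (if r \<notin> P_exps (n + 1) then 0
    else (let a = r ! 0; b = r ! 1; s = (a + b - 1) # drop 2 r in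
      fun_scale scale (if a = 0 then 0 else of_nat (a + b - 1 choose (a - 1))) (End_comp n 1 2 (F s) \<omega>)
      + fun_scale scale (if b = 0 then 0 else - of_nat (a + b - 1 choose a)) (End_comp n 1 2 (F s) \<omega>')))"

lemma right_comp_Had: "F \<in> Had_op scale n \<Longrightarrow> n \<ge> 1 \<Longrightarrow> right_comp n F \<in> Had_op scale (n + 1)"
  using End_op_comp [OF Had_opD End_prod_in, of F n 1] End_op_comp [OF Had_opD opp_in, of F n 1]
  by (intro Had_opI) (auto simp: right_comp_def Let_def intro!: End_op_add End_op_scale)

lemma Phi_right_comp:
  assumes F: "F \<in> Had_op scale n" and n: "n \<ge> 1" and us: "length us = n - 1"
  shows "Phi (right_comp n F) (z # z' # us) = Phi F (brk z z' # us)"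
proof -
  obtain a x where z: "z = (a, x)" by (cases z)
  obtain b y where z': "z' = (b, y)" by (cases z')
  define ls where "ls = map fst us"
  define ys where "ys = map snd us"
  have ls: "length ls = n - 1" and ys: "length ys = n - 1" using us by (simp_all add: ls_def ys_def)
  let ?u = "\<lambda>s. F s ((x \<diamondop> y) # ys)" and ?v = "\<lambda>s. F s ((y \<diamondop> x) # ys)"
  let ?s = "\<lambda>r. (r ! 0 + r ! 1 - 1) # drop 2 r"
  have decomp: "\<exists>i j t. r = i # j # t \<and> length t = n - 1 \<and> i + j + sum_list t = n" if r: "r \<in> P_exps (n + 1)" for r
  proof -
    obtain i r' where r': "r = i # r'" using r by (cases r) (auto simp: P_exps_def)
    then obtain j t where "r' = j # t" using r n by (cases r') (auto simp: P_exps_def)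
    then show ?thesis using r' r n by (auto simp: P_exps_def)
  qed
  have decomp': "\<exists>k t. s = k # t \<and> length t = n - 1 \<and> k + sum_list t + 1 = n" if "s \<in> P_exps n" for s
    using that by (cases s) (auto simp: P_exps_def)
  let ?M = "\<lambda>r. monom_eval (a # b # ls) r"
  \<comment> \<open>The summand \<open>i\<close> of the binomial expansion of the power
    \<open>hd s\<close>, multiplied by the weight \<open>a\<close>, has exponent
    \<open>Suc i\<close> in the first argument.\<close>
  have reindex1: "(\<Sum>r | r \<in> P_exps (n + 1) \<and> r ! 0 \<noteq> 0. scale (?M r * of_nat (r ! 0 + r ! 1 - 1 choose (r ! 0 - 1))) (?u (?s r))) =
    (\<Sum>(s, i)\<in>(SIGMA s:P_exps n. {..hd s}). scale (of_nat (hd s choose i) * a ^ Suc i * b ^ (hd s - i) * monom_eval ls (tl s)) (?u s))"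
  proof (rule sum.reindex_bij_witness [where i = "\<lambda>(s, i). Suc i # (hd s - i) # tl s" and j = "\<lambda>r. (?s r, r ! 0 - 1)"])
    fix r assume "r \<in> {r \<in> P_exps (n + 1). r ! 0 \<noteq> 0}"
    moreover from this obtain i j t where r: "r = i # j # t" "length t = n - 1" "i + j + sum_list t = n" using decomp by blast
    ultimately obtain i' where i: "i = Suc i'" by (cases i) auto
    show "(case (?s r, r ! 0 - 1) of (s, i) \<Rightarrow> Suc i # (hd s - i) # tl s) = r" using r i by simp
    show "(?s r, r ! 0 - 1) \<in> (SIGMA s:P_exps n. {..hd s})" using r i n by (auto simp: P_exps_def)
    show "(case (?s r, r ! 0 - 1) of (s, i) \<Rightarrow>
        scale (of_nat (hd s choose i) * a ^ Suc i * b ^ (hd s - i) * monom_eval ls (tl s)) (?u s)) =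
      scale (?M r * of_nat (r ! 0 + r ! 1 - 1 choose (r ! 0 - 1))) (?u (?s r))"
      using r i by (simp add: mult_ac)
  next
    fix si assume "si \<in> (SIGMA s:P_exps n. {..hd s})"
    then obtain s i where "si = (s, i)" "s \<in> P_exps n" "i \<le> hd s" by auto
    moreover from this obtain k t where "s = k # t" "length t = n - 1" "k + sum_list t + 1 = n" using decomp' by blast
    ultimately have s: "si = (k # t, i)" "length t = n - 1" "k + sum_list t + 1 = n" "i \<le> k" by auto
    show "(?s (case si of (s, i) \<Rightarrow> Suc i # (hd s - i) # tl s), (case si of (s, i) \<Rightarrow> Suc i # (hd s - i) # tl s) ! 0 - 1) = si"
      using s by simp
    show "(case si of (s, i) \<Rightarrow> Suc i # (hd s - i) # tl s) \<in> {r \<in> P_exps (n + 1). r ! 0 \<noteq> 0}"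
      using s n by (auto simp: P_exps_def)
  qed
  have reindex2: "(\<Sum>r | r \<in> P_exps (n + 1) \<and> r ! 1 \<noteq> 0. scale (?M r * of_nat (r ! 0 + r ! 1 - 1 choose (r ! 0))) (?v (?s r))) =
    (\<Sum>(s, i)\<in>(SIGMA s:P_exps n. {..hd s}). scale (of_nat (hd s choose i) * a ^ i * b ^ Suc (hd s - i) * monom_eval ls (tl s)) (?v s))"
  proof (rule sum.reindex_bij_witness [where i = "\<lambda>(s, i). i # Suc (hd s - i) # tl s" and j = "\<lambda>r. (?s r, r ! 0)"])
    fix r assume "r \<in> {r \<in> P_exps (n + 1). r ! 1 \<noteq> 0}"
    moreover from this obtain i j t where r: "r = i # j # t" "length t = n - 1" "i + j + sum_list t = n" using decomp by blast
    ultimately obtain j' where j: "j = Suc j'" by (cases j) auto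
    show "(case (?s r, r ! 0) of (s, i) \<Rightarrow> i # Suc (hd s - i) # tl s) = r" using r j by simp
    show "(?s r, r ! 0) \<in> (SIGMA s:P_exps n. {..hd s})" using r j n by (auto simp: P_exps_def)
    show "(case (?s r, r ! 0) of (s, i) \<Rightarrow>
        scale (of_nat (hd s choose i) * a ^ i * b ^ Suc (hd s - i) * monom_eval ls (tl s)) (?v s)) =
      scale (?M r * of_nat (r ! 0 + r ! 1 - 1 choose (r ! 0))) (?v (?s r))"
      using r j by (simp add: mult_ac)
  next
    fix si assume "si \<in> (SIGMA s:P_exps n. {..hd s})"
    then obtain s i where "si = (s, i)" "s \<in> P_exps n" "i \<le> hd s" by auto
    moreover from this obtain k t where "s = k # t" "length t = n - 1" "k + sum_list t + 1 = n" using decomp' by blast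
    ultimately have s: "si = (k # t, i)" "length t = n - 1" "k + sum_list t + 1 = n" "i \<le> k" by auto
    show "(?s (case si of (s, i) \<Rightarrow> i # Suc (hd s - i) # tl s), (case si of (s, i) \<Rightarrow> i # Suc (hd s - i) # tl s) ! 0) = si"
      using s by simp
    show "(case si of (s, i) \<Rightarrow> i # Suc (hd s - i) # tl s) \<in> {r \<in> P_exps (n + 1). r ! 1 \<noteq> 0}"
      using s n by (auto simp: P_exps_def)
  qed
  have "Phi (right_comp n F) (z # z' # us) = (\<Sum>r\<in>P_exps (n + 1). scale (?M r) (right_comp n F r (x # y # ys)))"
    unfolding Phi_def using us n by (simp add: z z' ls_def ys_def)
  also have "\<dots> = (\<Sum>r\<in>P_exps (n + 1).
      (if r ! 0 \<noteq> 0 then scale (?M r * of_nat (r ! 0 + r ! 1 - 1 choose (r ! 0 - 1))) (?u (?s r)) else 0)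
      - (if r ! 1 \<noteq> 0 then scale (?M r * of_nat (r ! 0 + r ! 1 - 1 choose (r ! 0))) (?v (?s r)) else 0))"
    using n ys by (intro sum.cong refl)
      (simp add: right_comp_def Let_def fun_scale_def End_comp_prod [unfolded One_nat_def] scale_right_distrib)
  also have "\<dots> = (\<Sum>r | r \<in> P_exps (n + 1) \<and> r ! 0 \<noteq> 0. scale (?M r * of_nat (r ! 0 + r ! 1 - 1 choose (r ! 0 - 1))) (?u (?s r)))
    - (\<Sum>r | r \<in> P_exps (n + 1) \<and> r ! 1 \<noteq> 0. scale (?M r * of_nat (r ! 0 + r ! 1 - 1 choose (r ! 0))) (?v (?s r)))"
    by (simp add: sum_subtractf sum.inter_filter cong: if_cong)
  also have "\<dots> = (\<Sum>s\<in>P_exps n. \<Sum>i\<le>hd s.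
      scale (of_nat (hd s choose i) * a ^ Suc i * b ^ (hd s - i) * monom_eval ls (tl s)) (?u s)
      - scale (of_nat (hd s choose i) * a ^ i * b ^ Suc (hd s - i) * monom_eval ls (tl s)) (?v s))"
    unfolding reindex1 reindex2 by (simp add: sum.Sigma sum_subtractf)
  also have "\<dots> = (\<Sum>s\<in>P_exps n. \<Sum>i\<le>hd s. scale (of_nat (hd s choose i) * a ^ i * b ^ (hd s - i) * monom_eval ls (tl s))
      (F s ((scale a (x \<diamondop> y) - scale b (y \<diamondop> x)) # ys)))"
  proof (intro sum.cong refl)
    fix s i
    interpret l: Vector_Spaces.linear scale scale "\<lambda>w. F s ([] @ w # ys)"
      by (rule End_op_slot [OF Had_opD [OF F]])
    have "F s ((scale a (x \<diamondop> y) - scale b (y \<diamondop> x)) # ys) = scale a (?u s) - scale b (?v s)"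
      using l.diff [of "scale a (x \<diamondop> y)" "scale b (y \<diamondop> x)"] l.scale by simp
    then show "scale (of_nat (hd s choose i) * a ^ Suc i * b ^ (hd s - i) * monom_eval ls (tl s)) (?u s)
      - scale (of_nat (hd s choose i) * a ^ i * b ^ Suc (hd s - i) * monom_eval ls (tl s)) (?v s) =
      scale (of_nat (hd s choose i) * a ^ i * b ^ (hd s - i) * monom_eval ls (tl s))
      (F s ((scale a (x \<diamondop> y) - scale b (y \<diamondop> x)) # ys))"
      by (simp add: scale_right_diff_distrib mult_ac)
  qed
  also have "\<dots> = (\<Sum>s\<in>P_exps n. scale (monom_eval ((a + b) # ls) s) (F s ((scale a (x \<diamondop> y) - scale b (y \<diamondop> x)) # ys)))"
  proof (rule sum.cong [OF refl])
    fix s assume "s \<in> P_exps n"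
    then obtain k t where s: "s = k # t" using decomp' by blast
    show "(\<Sum>i\<le>hd s. scale (of_nat (hd s choose i) * a ^ i * b ^ (hd s - i) * monom_eval ls (tl s))
        (F s ((scale a (x \<diamondop> y) - scale b (y \<diamondop> x)) # ys))) =
      scale (monom_eval ((a + b) # ls) s) (F s ((scale a (x \<diamondop> y) - scale b (y \<diamondop> x)) # ys))"
      unfolding s by (simp add: binomial_ring sum_distrib_right flip: scale_sum_left)
  qed
  also have "\<dots> = Phi F (brk z z' # us)"
    unfolding Phi_def using us n by (simp add: z z' brk_def act_def ls_def ys_def)
  finally show ?thesis .
qed

lemma Had_comp_right:
  assumes F: "F \<in> Had_op scale n" and n: "n \<ge> 1"
  shows "Had_comp scale n 1 2 F \<alpha> = right_comp n F"
proof (rule Phi_inj [OF _ right_comp_Had [OF F n]])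
  show "Had_comp scale n 1 2 F \<alpha> \<in> Had_op scale (n + 1)"
    using Had_op_comp [OF F alpha_Had, of 1] n by simp
  fix zs :: "('k \<times> 'v) list" assume "length zs = n + 1"
  then obtain z z' us where zs: "zs = z # z' # us" "length us = n - 1"
    using n by (cases zs; cases "tl zs") auto
  then have "Phi (Had_comp scale n 1 2 F \<alpha>) zs = Phi F (brk z z' # us)"
    using Phi_comp [OF F alpha_Had, of 1 zs] n by (simp add: comp_args_def Phi_alpha brk_def)
  then show "Phi (Had_comp scale n 1 2 F \<alpha>) zs = Phi (right_comp n F) zs"
    using Phi_right_comp [OF F n zs(2)] zs by simp
qed

lemma CE_diff_apply:
  assumes F: "F \<in> Had_op scale n" and n: "n \<ge> 1" and r: "length r = n + 1" and xs: "length xs = n + 1"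
  shows "CE_diff scale nprod n F r xs =
    (\<Sum>i\<le>n. scale ((-1) ^ i) (left_comp n F (r ! i # delete i r) (xs ! i # delete i xs))) +
    (\<Sum>j\<le>n. \<Sum>i<j. scale ((-1) ^ (i + j)) (right_comp n F (r ! i # r ! j # delete i (delete j r))
      (xs ! i # xs ! j # delete i (delete j xs))))"
proof -
  note H = left_comp_Had [OF F] and K = right_comp_Had [OF F n]
  have 1: "scale (of_int (sign (inv (cyc i)))) (Had_act (n + 1) (inv (cyc i)) (left_comp n F) r xs) =
      scale ((-1) ^ i) (left_comp n F (r ! i # delete i r) (xs ! i # delete i xs))" if "i \<in> {..n}" for i
    using Had_act_apply [OF H inv_cyc(1) r, of i] inv_cyc(2,3) [of i n] xs r that
    by (simp add: End_act_def perm_list_cyc)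
  have 2: "scale (of_int (sign (inv (cyc2 j i)))) (Had_act (n + 1) (inv (cyc2 j i)) (right_comp n F) r xs) =
      - scale ((-1) ^ (i + j)) (right_comp n F (r ! i # r ! j # delete i (delete j r))
      (xs ! i # xs ! j # delete i (delete j xs)))" if "j \<in> {..n}" "i \<in> {..<j}" for i j
    using Had_act_apply [OF K inv_cyc2(1) r, of i j] inv_cyc2(2,3) [of i j n] xs r that
    by (simp add: End_act_def perm_list_cyc2)
  show ?thesis
    unfolding CE_diff_def Had_comp_left [OF F] Had_comp_right [OF F n] sum_shuffles_1 sum_shuffles_2 [OF n]
      sum_fun_apply minus_apply scale2_apply
    by (rule trans [OF arg_cong2 [where f = minus, OF sum.cong [OF refl 1] sum.cong [OF refl sum.cong [OF refl 2]]]])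
      (simp_all add: sum_negf)
qed

lemma CE_swap:
  assumes F: "F \<in> CE scale n" and l: "length as = length us" "length bs = length vs"
  shows "F (as @ a # b # bs) (us @ x # y # vs) = - F (as @ b # a # bs) (us @ y # x # vs)"
proof (cases "length as + length bs + 2 = n")
  case True
  define \<sigma> where "\<sigma> = transpose (Suc (length us)) (Suc (Suc (length us)))"
  have \<sigma>: "\<sigma> permutes {1..n}" unfolding \<sigma>_def using True l by (intro permutes_swap_id) auto
  have p: "perm_list n (inv \<sigma>) (cs @ c # d # ds) = cs @ d # c # ds"
    if "length cs = length us" "length ds = length vs" for cs ds :: "'b list" and c d
    using that True l by (intro nth_equalityI) (auto simp: \<sigma>_def perm_list_nth transpose_def nth_append nth_Cons')
  have "End_act n \<sigma> (F (perm_list n (inv \<sigma>) (as @ b # a # bs))) (us @ y # x # vs) =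
      scale (of_int (sign \<sigma>)) (F (as @ b # a # bs) (us @ y # x # vs))"
    using CE_act [OF F \<sigma>, of "as @ b # a # bs"] True by (simp add: fun_scale_def)
  then show ?thesis
    using True l by (simp add: p End_act_def) (simp add: \<sigma>_def sign_swap_id)
next
  case False
  then have "F (as @ a # b # bs) = 0" "F (as @ b # a # bs) = 0"
    using F by (auto simp: CE_def Had_op_def P_exps_def)
  then show ?thesis by simp
qed

text \<open>Moving an entry together with its exponent past \<open>cs\<close> costs one sign per
  step. Applied to an entry of exponent 0, this restores the decreasing form
  \<open>pLie_exps\<close>.\<close>

lemma CE_move_last:
  assumes F: "F \<in> CE scale n"
  shows "length as = length us \<Longrightarrow> length cs = length vs \<Longrightarrow>
    F (as @ a # cs) (us @ x # vs) = scale ((-1) ^ length cs) (F (as @ cs @ [a]) (us @ vs @ [x]))"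
proof (induction cs arbitrary: as us vs)
  case (Cons c cs)
  then obtain v vs' where vs: "vs = v # vs'" "length cs = length vs'" by (cases vs) auto
  have "F (as @ a # c # cs) (us @ x # v # vs') = - F ((as @ [c]) @ a # cs) ((us @ [v]) @ x # vs')"
    using CE_swap [OF F Cons.prems(1) vs(2), of a c x v] by simp
  also have "\<dots> = - scale ((-1) ^ length cs) (F ((as @ [c]) @ cs @ [a]) ((us @ [v]) @ vs' @ [x]))"
    using Cons.IH [of "as @ [c]" "us @ [v]" vs'] Cons.prems(1) vs(2) by simp
  finally show ?case using vs by simp
qed simp

end

section \<open>The exponent lists of the pre-Lie summand and of the target of the connecting
  map\<close>

definition pLie_exps :: "nat \<Rightarrow> nat list"
  where "pLie_exps n = replicate (n - 1) 1 @ [0]"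

definition conn_exps :: "nat \<Rightarrow> nat list"
  where "conn_exps n = 2 # replicate (n - 2) 1 @ [0, 0]"

lemma exps_type_count: "length p = n \<Longrightarrow> exps_type n p = map (count (mset p)) (rev [0..<n])"
  by (simp add: exps_type_def count_mset_nth del: count_mset)

lemma sorted_wrt_ge_replicate: "sorted_wrt (\<ge>) (replicate m (c::nat))"
  by (simp add: sorted_wrt_iff_nth_less)

lemma pLie_exps_dec: "n \<ge> 1 \<Longrightarrow> pLie_exps n \<in> dec_exps n"
  by (auto simp: dec_exps_def P_exps_def pLie_exps_def sum_list_replicate sorted_wrt_append
      sorted_wrt_ge_replicate [simplified])

lemma conn_exps_dec: "n \<ge> 2 \<Longrightarrow> conn_exps n \<in> dec_exps (n + 1)"
  by (auto simp: dec_exps_def P_exps_def conn_exps_def sum_list_replicate sorted_wrt_append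
      sorted_wrt_ge_replicate [simplified])

lemma exps_type_pLie: "n \<ge> 1 \<Longrightarrow> exps_type n (pLie_exps n) = pLie_type n"
proof (cases "n = 1")
  case True
  then show ?thesis by (simp add: exps_type_count pLie_exps_def pLie_type_def)
next
  case False
  assume "n \<ge> 1"
  then obtain m where m: "n = m + 2" using False by (metis Suc_leI add.commute le_Suc_ex le_neq_implies_less one_add_one plus_1_eq_Suc)
  have "[0..<n] = 0 # 1 # [2..<n]" by (simp add: m upt_conv_Cons numeral_2_eq_2 del: upt_Suc)
  moreover have "map (count (mset (pLie_exps n))) [2..<n] = replicate m 0"
    by (rule nth_equalityI) (simp_all add: m pLie_exps_def del: upt_Suc)
  ultimately have "rev (exps_type n (pLie_exps n)) = 1 # (m + 1) # replicate m 0"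
    by (simp add: exps_type_count pLie_exps_def m rev_map)
  then show ?thesis by (simp add: pLie_type_def m flip: rev_swap)
qed

lemma exps_type_conn: "n \<ge> 2 \<Longrightarrow> exps_type (n + 1) (conn_exps n) = conn_type n"
proof -
  assume "n \<ge> 2"
  then obtain m where m: "n = m + 2" by (metis add.commute le_Suc_ex)
  have "[0..<n + 1] = 0 # 1 # 2 # [3..<n + 1]"
    by (simp add: m upt_conv_Cons numeral_2_eq_2 numeral_3_eq_3 del: upt_Suc)
  moreover have "map (count (mset (conn_exps n))) [3..<n + 1] = replicate m 0"
    by (rule nth_equalityI) (simp_all add: m conn_exps_def del: upt_Suc)
  ultimately have "rev (exps_type (n + 1) (conn_exps n)) = 2 # m # 1 # replicate m 0"
    by (simp add: exps_type_count conn_exps_def m rev_map)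
  then show ?thesis by (simp add: conn_type_def m flip: rev_swap)
qed

section \<open>Omission of list entries, counted from 1 by \<open>omit\<close> and from 0 by
  \<open>delete\<close>\<close>

lemma omit_Nil [simp]: "omit I [] = []"
  by (simp add: omit_def)

lemma omit_Cons: "omit I (x # xs) = (if 1 \<in> I then [] else [x]) @ omit {i. Suc i \<in> I} xs"
  by (simp add: omit_def nths_Cons)

lemma omit_empty: "omit {} xs = xs"
  by (simp add: omit_def nths_all)

lemma omit_insert_0: "omit (insert 0 I) xs = omit I xs"
  by (simp add: omit_def)

lemma omit_single: "omit {Suc i} xs = delete i xs"
proof (induction xs arbitrary: i)
  case (Cons x xs)
  then show ?case by (cases i) (auto simp: omit_Cons omit_empty omit_insert_0)
qed (simp add: delete_def)

lemma omit_pair: "i < j \<Longrightarrow> omit {Suc i, Suc j} xs = delete i (delete j xs)"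
proof (induction xs arbitrary: i j)
  case (Cons x xs)
  then obtain j' where j: "j = Suc j'" by (cases j) auto
  have "{k. Suc k = Suc j} = {j}" for j by auto
  moreover have "{k. k = i \<or> k = j} = {i, j}" for i j :: nat by auto
  ultimately show ?case
    using Cons by (cases i) (auto simp: omit_Cons j omit_insert_0 omit_single omit_empty)
qed (simp add: delete_def)

lemma delete_append1: "i < length xs \<Longrightarrow> delete i (xs @ ys) = delete i xs @ ys"
  by (simp add: delete_def)

lemma delete_append2: "delete (length xs) (xs @ [y]) = xs"
  by (simp add: delete_def)

lemma delete_replicate: "i < m \<Longrightarrow> delete i (replicate m x) = replicate (m - 1) x"
  by (rule nth_equalityI) (auto simp: delete_def nth_append)

context novikov_algebra
begin

text \<open>All exponents are 1 except the last, which is 0. The four sums of the pre-Lie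
  differential arise according to whether an action or a bracket is formed and whether the last
  argument is singled out by it.\<close>

theorem pLie_component:
  assumes F: "F \<in> CE scale n" and n: "n \<ge> 1"
  shows "CE_diff scale nprod n F (pLie_exps (n + 1)) = pLie_diff scale nprod n (F (pLie_exps n))"
proof
  fix xs :: "'v list"
  have H: "F \<in> Had_op scale n" using F by (simp add: CE_def)
  let ?f = "F (pLie_exps n)"
  show "CE_diff scale nprod n F (pLie_exps (n + 1)) xs = pLie_diff scale nprod n ?f xs"
  proof (cases "length xs = n + 1")
    case False
    have "CE_diff scale nprod n F \<in> Had_op scale (n + 1)" by (rule CE_diff_Had [OF H n])
    then show ?thesis using End_op_length [OF Had_opD] False by (simp add: pLie_diff_def)
  next
    case True
    then obtain ys z where xs: "xs = ys @ [z]" and ys: "length ys = n"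
      by (cases xs rule: rev_exhaust) auto
    let ?r = "pLie_exps (n + 1)"
    have r: "?r = replicate n 1 @ [0]" "?r ! n = 0" "\<And>i. i < n \<Longrightarrow> ?r ! i = 1"
      "\<And>i. i < n \<Longrightarrow> delete i ?r = pLie_exps n" "delete n ?r = replicate n 1"
      by (simp_all add: pLie_exps_def nth_append delete_append1 delete_replicate) (simp add: delete_def)
    have PE: "1 # pLie_exps n \<in> P_exps (n + 1)" "0 # replicate n 1 \<in> P_exps (n + 1)"
      using n by (auto simp: P_exps_def pLie_exps_def sum_list_replicate)
    \<comment> \<open>Removing an argument of exponent 1 leaves \<open>pLie_exps n\<close>; this is
      the first sum.\<close>
    have A1: "left_comp n F (?r ! i # delete i ?r) (xs ! i # delete i xs) = (ys ! i) \<diamondop> ?f (delete i ys @ [z])"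
      if i: "i < n" for i
      using i PE ys by (simp add: r(2-5) xs nth_append delete_append1 left_comp_def End_comp_prod length_delete del: One_nat_def)
    \<comment> \<open>The last argument has exponent 0, so the derivation falls on \<open>F\<close>:
      one of the remaining exponents 1 comes from an exponent 0, and the argument carrying it is
      moved to the end. This is the second sum.\<close>
    have A2: "left_comp n F (?r ! n # delete n ?r) (xs ! n # delete n xs) =
       - (\<Sum>j<n. scale ((-1) ^ (n - 1 - j)) (?f (delete j ys @ [ys ! j])) \<diamondop> z)"
    proof -
      have "F ((replicate n 1)[j := 0]) ys = scale ((-1) ^ (n - 1 - j)) (?f (delete j ys @ [ys ! j]))" if j: "j < n" for j
      proof -
        have "(replicate n 1)[j := 0] = replicate j 1 @ 0 # replicate (n - 1 - j) (1::nat)"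
          using j by (simp add: upd_conv_take_nth_drop min_def)
        moreover have "ys = take j ys @ ys ! j # drop (Suc j) ys" using j ys id_take_nth_drop by blast
        moreover have "replicate j 1 @ replicate (n - 1 - j) 1 @ [0] = pLie_exps n"
          using j by (simp add: pLie_exps_def flip: replicate_add append_assoc)
        ultimately show ?thesis
          using CE_move_last [OF F, of "replicate j 1" "take j ys" "replicate (n - 1 - j) 1" "drop (Suc j) ys" 0 "ys ! j"] j ys
          by (simp add: delete_def)
      qed
      moreover have "{j. j < n \<and> replicate n 1 ! j \<ge> (1::nat)} = {..<n}" by auto
      ultimately show ?thesis
        using PE ys xs by (simp add: r(2-5) left_comp_def nth_append delete_append2 [of ys z, unfolded ys]
            sum_fun_apply End_comp_prod del: One_nat_def cong: sum.cong_simp)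
    qed
    \<comment> \<open>With both exponents 1 the two binomial coefficients are 1, and the commutator
      appears; this is the fourth sum.\<close>
    have B1: "right_comp n F (?r ! i # ?r ! j # delete i (delete j ?r)) (xs ! i # xs ! j # delete i (delete j xs)) =
        ?f ((ys ! i \<diamondop> ys ! j - ys ! j \<diamondop> ys ! i) # delete i (delete j ys) @ [z])" if ij: "i < j" "j < n" for i j
    proof -
      obtain m where m: "n = Suc (Suc m)" using ij by (metis Suc_lessE less_imp_Suc_add)
      have d: "delete i (delete j ?r) = replicate m 1 @ [0]"
      proof -
        have "delete i (replicate (Suc m) 1 @ [0 :: nat]) = delete i (replicate (Suc m) 1) @ [0]"
          by (rule delete_append1) (use ij m in simp)
        also have "\<dots> = replicate m 1 @ [0]" by (subst delete_replicate) (use ij m in simp_all)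
        finally show ?thesis using ij by (simp only: r(4)) (simp add: pLie_exps_def m)
      qed
      have P: "1 # 1 # replicate m 1 @ [0] \<in> P_exps (n + 1)" by (simp add: P_exps_def m sum_list_replicate)
      have s: "1 # replicate m 1 @ [0] = pLie_exps n" by (simp add: pLie_exps_def m)
      have x: "xs ! i = ys ! i" "xs ! j = ys ! j" "delete i (delete j xs) = delete i (delete j ys) @ [z]"
        using ij ys by (simp_all add: xs nth_append delete_append1 length_delete)
      have l: "length (delete i (delete j ys) @ [z]) = n - 1" using ij ys by (simp add: length_delete)
      interpret l: Vector_Spaces.linear scale scale "\<lambda>w. ?f ([] @ w # (delete i (delete j ys) @ [z]))"
        by (rule End_op_slot [OF Had_opD [OF H]])
      have "right_comp n F (1 # 1 # replicate m 1 @ [0]) (ys ! i # ys ! j # delete i (delete j ys) @ [z]) =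
          ?f ((ys ! i \<diamondop> ys ! j) # delete i (delete j ys) @ [z]) - ?f ((ys ! j \<diamondop> ys ! i) # delete i (delete j ys) @ [z])"
        using P s n by (simp add: right_comp_def Let_def fun_scale_def End_comp_prod(3,4) [OF n l] del: One_nat_def)
          (simp add: s [symmetric])
      also have "\<dots> = ?f ((ys ! i \<diamondop> ys ! j - ys ! j \<diamondop> ys ! i) # delete i (delete j ys) @ [z])"
        using l.diff [of "ys ! i \<diamondop> ys ! j" "ys ! j \<diamondop> ys ! i"] by simp
      finally show ?thesis unfolding d x r(3) [OF order.strict_trans [OF ij]] r(3) [OF ij(2)] .
    qed
    \<comment> \<open>With exponents 1 and 0 only the product with the last argument on the right
      survives; this is the third sum.\<close>
    have B2: "right_comp n F (?r ! i # ?r ! n # delete i (delete n ?r)) (xs ! i # xs ! n # delete i (delete n xs)) =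
        scale ((-1) ^ (n - 1)) (?f (delete i ys @ [ys ! i \<diamondop> z]))" if i: "i < n" for i
    proof -
      have P: "1 # 0 # replicate (n - 1) 1 \<in> P_exps (n + 1)" using n by (simp add: P_exps_def sum_list_replicate)
      have x: "xs ! i = ys ! i" "xs ! n = z" "delete n xs = ys"
        using i ys delete_append2 [of ys z] by (simp_all add: xs nth_append)
      have l: "length (delete i ys) = n - 1" using i ys by (simp add: length_delete)
      have "right_comp n F (1 # 0 # replicate (n - 1) 1) (ys ! i # z # delete i ys) = F (0 # replicate (n - 1) 1) ((ys ! i \<diamondop> z) # delete i ys)"
        using P by (simp add: right_comp_def Let_def fun_scale_def End_comp_prod(3,4) [OF n l] del: One_nat_def)
      also have "\<dots> = scale ((-1) ^ (n - 1)) (?f (delete i ys @ [ys ! i \<diamondop> z]))"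
        using CE_move_last [OF F, of "[]" "[]" "replicate (n - 1) 1" "delete i ys" 0 "ys ! i \<diamondop> z"] l
        by (simp add: pLie_exps_def)
      finally show ?thesis unfolding x r(2,5) r(3) [OF i] delete_replicate [OF i] .
    qed
    \<comment> \<open>The sign of position \<open>n\<close> combined with that of the rearrangement
      in \<open>A2\<close>; the minus cancels the one in \<open>left_comp\<close>.\<close>
    have sgn: "(-1) ^ n * (-1) ^ (n - 1 - j) = - ((-1) ^ j :: 'k)" if j: "j < n" for j
    proof -
      obtain m where "n = Suc (j + m)" using j less_iff_Suc_add by auto
      then show ?thesis by (simp add: power_add mult.left_commute flip: power_mult_distrib)
    qed
    have sgn': "(-1) ^ (i + n) * (-1) ^ (n - 1) = - ((-1) ^ i :: 'k)" for i
      using sgn [of 0] n by (simp add: power_add mult.assoc)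
    have "CE_diff scale nprod n F ?r xs =
      (\<Sum>i<n. scale ((-1) ^ i) (ys ! i \<diamondop> ?f (delete i ys @ [z])))
      + (\<Sum>j<n. scale ((-1) ^ j) (?f (delete j ys @ [ys ! j]) \<diamondop> z))
      + (\<Sum>i<n. scale (- ((-1) ^ i)) (?f (delete i ys @ [ys ! i \<diamondop> z])))
      + (\<Sum>j<n. \<Sum>i<j. scale ((-1) ^ (i + j)) (?f ((ys ! i \<diamondop> ys ! j - ys ! j \<diamondop> ys ! i) # delete i (delete j ys) @ [z])))"
    proof -
      have lr: "length ?r = n + 1" by (simp add: pLie_exps_def)
      have "scale ((-1) ^ n) (- (\<Sum>j<n. scale ((-1) ^ (n - 1 - j)) (?f (delete j ys @ [ys ! j])) \<diamondop> z)) =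
          (\<Sum>j<n. scale ((-1) ^ j) (?f (delete j ys @ [ys ! j]) \<diamondop> z))"
        unfolding scale_minus_right scale_sum_right sum_negf [symmetric] prod_left scale_scale
        by (intro sum.cong refl) (simp add: sgn [simplified])
      moreover have "(\<Sum>i<n. scale ((-1) ^ (i + n)) (scale ((-1) ^ (n - 1)) (?f (delete i ys @ [ys ! i \<diamondop> z])))) =
          (\<Sum>i<n. scale (- ((-1) ^ i)) (?f (delete i ys @ [ys ! i \<diamondop> z])))"
        unfolding scale_scale sgn' ..
      moreover have "(\<Sum>i<n. scale ((-1) ^ i) (left_comp n F (?r ! i # delete i ?r) (xs ! i # delete i xs))) =
          (\<Sum>i<n. scale ((-1) ^ i) (ys ! i \<diamondop> ?f (delete i ys @ [z])))"
        by (rule sum.cong [OF refl]) (simp only: A1 lessThan_iff)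
      moreover have "(\<Sum>i<n. scale ((-1) ^ (i + n)) (right_comp n F (?r ! i # ?r ! n # delete i (delete n ?r))
            (xs ! i # xs ! n # delete i (delete n xs)))) =
          (\<Sum>i<n. scale ((-1) ^ (i + n)) (scale ((-1) ^ (n - 1)) (?f (delete i ys @ [ys ! i \<diamondop> z]))))"
        by (rule sum.cong [OF refl]) (simp only: B2 lessThan_iff)
      moreover have "(\<Sum>j<n. \<Sum>i<j. scale ((-1) ^ (i + j)) (right_comp n F (?r ! i # ?r ! j # delete i (delete j ?r))
            (xs ! i # xs ! j # delete i (delete j xs)))) =
          (\<Sum>j<n. \<Sum>i<j. scale ((-1) ^ (i + j)) (?f ((ys ! i \<diamondop> ys ! j - ys ! j \<diamondop> ys ! i) # delete i (delete j ys) @ [z])))"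
        by (intro sum.cong refl) (simp only: B1 lessThan_iff)
      ultimately show ?thesis
        unfolding CE_diff_apply [OF H n lr True] lessThan_Suc_atMost [symmetric] sum.lessThan_Suc A2
        by (simp only: ac_simps)
    qed
    also have "\<dots> = pLie_diff scale nprod n ?f xs"
    proof -
      have j: "(\<Sum>i=1..<Suc j. g i) = (\<Sum>i<j. g (Suc i))" for g :: "nat \<Rightarrow> 'v" and j
        by (simp only: One_nat_def sum.shift_bounds_Suc_ivl atLeast0LessThan)
      have nth: "xs ! i = ys ! i" if "i < n" for i using that ys by (simp add: xs nth_append)
      have t: "take n xs = ys" "length xs = Suc n" using xs ys by auto
      have z: "xs ! n = z" using ys by (simp add: xs nth_append)
      show ?thesis
        unfolding pLie_diff_def Let_def One_nat_def sum.atLeast1_atMost_eq j [unfolded One_nat_def]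
        by (simp add: t omit_single omit_pair nth z cong: sum.cong_simp)
    qed
    finally show ?thesis .
  qed
qed

lemma count_in_pLie_exps: "v \<in># mset (pLie_exps n) \<Longrightarrow> v = 0 \<or> v = 1"
  by (auto simp: pLie_exps_def split: if_splits)

lemma mset_conn_exps: "n \<ge> 2 \<Longrightarrow> mset (conn_exps n) = add_mset 2 (add_mset 0 (mset (pLie_exps n) - {#1#}))"
  by (cases n; cases "n - 1") (auto simp: conn_exps_def pLie_exps_def numeral_2_eq_2)

text \<open>An action term adjoins an exponent 1, or adjoins a 0 and raises another exponent; a
  bracket term splits an exponent \<open>k\<close> into two of sum \<open>k + 1\<close>. Starting
  from ones and a single 0, a 2 appears only together with a second 0 and the loss of a 1.\<close>

lemma CE_diff_support:
  assumes F: "F \<in> CE scale n" and n: "n \<ge> 2"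
    and supp: "\<And>s. F s \<noteq> 0 \<Longrightarrow> mset s = mset (pLie_exps n)"
    and r: "r \<in> P_exps (n + 1)" "CE_diff scale nprod n F r \<noteq> 0"
  shows "mset r = mset (pLie_exps (n + 1)) \<or> mset r = mset (conn_exps n)"
proof -
  have H: "F \<in> Had_op scale n" using F by (simp add: CE_def)
  let ?P = "mset (pLie_exps n)" and ?Q = "\<lambda>r. mset r = mset (pLie_exps (n + 1)) \<or> mset r = mset (conn_exps n)"
  have P1: "mset (pLie_exps (n + 1)) = add_mset 1 ?P"
    using n by (cases n) (auto simp: pLie_exps_def)
  have one: "1 \<in># ?P" and zero: "0 \<in># ?P" using n by (auto simp: pLie_exps_def)
  have conn: "mset (conn_exps n) = add_mset 2 (add_mset 0 (?P - {#1#}))" by (rule mset_conn_exps [OF n])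
  have pl: "mset (pLie_exps (n + 1)) = add_mset 0 (add_mset 1 (?P - {#0#}))"
    unfolding P1 using zero by (simp add: add_mset_commute)
  have L: "?Q (a # t)" if nz: "left_comp n F (a # t) \<noteq> 0" for a t
  proof -
    have P: "a # t \<in> P_exps (n + 1)" using nz by (auto simp: left_comp_def split: if_splits)
    have zc: "End_comp 2 2 n \<omega> 0 = 0" "End_comp 2 2 n \<omega>' 0 = 0"
      by (auto simp: fun_eq_iff End_comp_eq comp_args_def End_prod_def End_act_def perm_list_nth transpose_def
          numeral_2_eq_2 prod_left prod_right nth_append)
    consider "a = 1" "F t \<noteq> 0" | j where "a = 0" "j < n" "t ! j \<ge> 1" "F (t[j := t ! j - 1]) \<noteq> 0"
    proof -
      have "a = 1 \<and> F t \<noteq> 0 \<or> a = 0 \<and> (\<exists>j<n. t ! j \<ge> 1 \<and> F (t[j := t ! j - 1]) \<noteq> 0)"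
      proof (rule ccontr)
        assume "\<not> ?thesis"
        then have "left_comp n F (a # t) = 0"
          using P by (auto simp: left_comp_def zc zc [unfolded One_nat_def] intro!: sum.neutral)
        then show False using nz by simp
      qed
      then show ?thesis using that by blast
    qed
    then show ?thesis
    proof cases
      case 1
      then show ?thesis using supp P1 by auto
    next
      case (2 j)
      have lt: "j < length t" using 2 P by (simp add: P_exps_def)
      have m: "add_mset (t ! j - 1) (mset t - {#t ! j#}) = ?P"
        using supp [OF 2(4)] lt by (simp add: mset_update)
      then have "mset t - {#t ! j#} = ?P - {#t ! j - 1#}" by (metis add_mset_remove_trivial)
      then have t: "mset t = add_mset (t ! j) (?P - {#t ! j - 1#})"
        using lt by (metis insert_DiffM nth_mem_mset)
      have "t ! j - 1 = 0 \<or> t ! j - 1 = 1"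
        using count_in_pLie_exps [of "t ! j - 1" n] m by (metis union_single_eq_member)
      then consider "t ! j = 1" | "t ! j = 2" using 2(3) by linarith
      then show ?thesis
      proof cases
        case 1
        then show ?thesis using t \<open>a = 0\<close> pl by simp
      next
        case two: 2
        then show ?thesis using t \<open>a = 0\<close> conn by (simp add: add_mset_commute)
      qed
    qed
  qed
  have R: "?Q (a # b # t)" if nz: "right_comp n F (a # b # t) \<noteq> 0" for a b t
  proof -
    have zc: "End_comp n 1 2 0 \<omega> = 0" "End_comp n 1 2 0 \<omega>' = 0"
      by (auto simp: fun_eq_iff End_comp_eq)
    have "F ((a + b - 1) # t) \<noteq> 0 \<and> (a \<noteq> 0 \<or> b \<noteq> 0)"
    proof (rule ccontr)
      have fz: "fun_scale scale c 0 = (0 :: 'v list \<Rightarrow> 'v)" "fun_scale scale 0 f = 0"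
        for c and f :: "'v list \<Rightarrow> 'v"
        by (auto simp: fun_scale_def fun_eq_iff)
      assume "\<not> ?thesis"
      then consider "F ((a + b - 1) # t) = 0" | "a = 0" "b = 0" by blast
      then have "right_comp n F (a # b # t) = 0"
        by cases (simp_all add: right_comp_def Let_def zc fz del: One_nat_def)
      then show False using nz by simp
    qed
    then have m: "add_mset (a + b - 1) (mset t) = ?P" and ab: "a \<noteq> 0 \<or> b \<noteq> 0"
      using supp [of "(a + b - 1) # t"] by auto
    have t: "mset t = ?P - {#a + b - 1#}" using m by (metis add_mset_remove_trivial)
    \<comment> \<open>The exponent that is split is 0 or 1, so \<open>a\<close> and \<open>b\<close>
      have sum 1 or 2; the splitting of 2 into 2 and 0 is the one that leads to
      \<open>conn_exps\<close>.\<close>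
    have "a + b - 1 = 0 \<or> a + b - 1 = 1"
      using count_in_pLie_exps [of "a + b - 1" n] m by (metis union_single_eq_member)
    then have "a + b = 1 \<or> a + b = 2" using ab by auto
    then have "a = 1 \<and> b = 0 \<or> a = 0 \<and> b = 1 \<or> a = 1 \<and> b = 1 \<or> a = 2 \<and> b = 0 \<or> a = 0 \<and> b = 2"
      by presburger
    then consider "a = 1" "b = 0" | "a = 0" "b = 1" | "a = 1" "b = 1" | "a = 2" "b = 0" | "a = 0" "b = 2"
      by blast
    then show ?thesis
      using t pl conn P1 one by cases (auto simp: add_mset_commute)
  qed
  obtain xs where xs: "CE_diff scale nprod n F r xs \<noteq> 0" using r(2) by (auto simp: fun_eq_iff)
  have "CE_diff scale nprod n F \<in> Had_op scale (n + 1)" using CE_diff_Had [OF H] n by simp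
  then have lx: "length xs = n + 1" using xs End_op_length [OF Had_opD] by blast
  have lr: "length r = n + 1" using r by (simp add: P_exps_def)
  have n1: "n \<ge> 1" using n by simp
  have perm: "mset (r ! i # delete i r) = mset r" if "i \<le> n" for i
    using mset_perm_list [OF cyc_permutes, of i "n + 1" r] perm_list_cyc [of i "n + 1" r] that lr by simp
  have perm2: "mset (r ! i # r ! j # delete i (delete j r)) = mset r" if "i < j" "j \<le> n" for i j
    using mset_perm_list [OF cyc2_permutes, of i j "n + 1" r] perm_list_cyc2 [of i j "n + 1" r] that lr by simp
  have "(\<exists>i\<le>n. left_comp n F (r ! i # delete i r) \<noteq> 0) \<or>
      (\<exists>j\<le>n. \<exists>i<j. right_comp n F (r ! i # r ! j # delete i (delete j r)) \<noteq> 0)"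
  proof (rule ccontr)
    assume "\<not> ?thesis"
    then have "CE_diff scale nprod n F r xs = 0"
      unfolding CE_diff_apply [OF H n1 lr lx] by simp
    then show False using xs by simp
  qed
  then show ?thesis
  proof
    assume "\<exists>i\<le>n. left_comp n F (r ! i # delete i r) \<noteq> 0"
    then show ?thesis using L perm by metis
  next
    assume "\<exists>j\<le>n. \<exists>i<j. right_comp n F (r ! i # r ! j # delete i (delete j r)) \<noteq> 0"
    then show ?thesis using R perm2 by metis
  qed
qed

section \<open>The short exact sequence\<close>

abbreviation "CNov \<equiv> Nov_complex scale nprod"
abbreviation "Cbar \<equiv> Nov_bar_complex scale nprod"
abbreviation "CpLie \<equiv> pLie_complex scale nprod"

lemma vector_space_fun_scale: "vector_space (fun_scale scale :: 'k \<Rightarrow> ('a \<Rightarrow> 'v) \<Rightarrow> 'a \<Rightarrow> 'v)"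
  by unfold_locales (auto simp: fun_scale_def fun_eq_iff scale_right_distrib scale_left_distrib)

lemma vector_space_scale2: "vector_space (scale2 :: 'k \<Rightarrow> ('b \<Rightarrow> 'a \<Rightarrow> 'v) \<Rightarrow> 'b \<Rightarrow> 'a \<Rightarrow> 'v)"
  by unfold_locales (auto simp: fun_scale_def fun_eq_iff scale_right_distrib scale_left_distrib)

lemma Nov_lift:
  assumes "c \<in> Hom_sum scale (K_types n)"
  obtains F where "F \<in> CE scale n" "CE_to_Nov n F = c"
    "Nov_diff scale nprod n c = CE_to_Nov (n + 1) (CE_diff scale nprod n F)"
proof -
  let ?F = "inv_into (CE scale n) (CE_to_Nov n) c"
  have "c \<in> CE_to_Nov n ` CE scale n" using assms CE_to_Nov_image by simp
  then have "?F \<in> CE scale n" "CE_to_Nov n ?F = c" by (rule inv_into_into, rule f_inv_into_f)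
  then show ?thesis using that by (simp add: Nov_diff_def)
qed

lemma Nov_diff_CE_to_Nov:
  "F \<in> CE scale n \<Longrightarrow> Nov_diff scale nprod n (CE_to_Nov n F) = CE_to_Nov (n + 1) (CE_diff scale nprod n F)"
  by (simp add: Nov_diff_def inv_into_f_f [OF CE_to_Nov_inj])

lemma Nov_complex: "cochain_complex scale2 CNov"
  unfolding cochain_complex_def
proof (intro allI impI conjI ballI)
  fix n :: nat assume n: "1 \<le> n"
  interpret S: vector_space "scale2 :: 'k \<Rightarrow> (nat list \<Rightarrow> 'v list \<Rightarrow> 'v) \<Rightarrow> nat list \<Rightarrow> 'v list \<Rightarrow> 'v"
    by (rule vector_space_scale2)
  have sp: "cspace CNov m = CE_to_Nov m ` CE scale m" for m by (simp add: Nov_complex_def CE_to_Nov_image)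
  have d: "cdiff CNov m = Nov_diff scale nprod m" for m by (simp add: Nov_complex_def)
  have z: "CE_to_Nov m 0 = (0 :: nat list \<Rightarrow> 'v list \<Rightarrow> 'v)" for m by (simp add: CE_to_Nov_def fun_eq_iff sum_fun_apply)
  show "S.subspace (cspace CNov n)"
    unfolding S.subspace_def sp
    using CE_0 CE_add CE_scale z by (auto simp: CE_to_Nov_add [symmetric] CE_to_Nov_scale [symmetric] intro!: image_eqI [of 0])
  show "linear_between scale2 scale2 (cspace CNov n) (cspace CNov (Suc n)) (cdiff CNov n)"
    unfolding linear_between_def sp d
  proof (intro conjI ballI allI)
    show "Nov_diff scale nprod n ` CE_to_Nov n ` CE scale n \<subseteq> CE_to_Nov (Suc n) ` CE scale (Suc n)"
      using CE_diff_CE [OF _ n] by (auto simp: Nov_diff_CE_to_Nov)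
  next
    fix x y assume "x \<in> CE_to_Nov n ` CE scale n" "y \<in> CE_to_Nov n ` CE scale n"
    then obtain F G where FG: "F \<in> CE scale n" "x = CE_to_Nov n F" "G \<in> CE scale n" "y = CE_to_Nov n G" by blast
    have s: "F + G \<in> CE scale n" by (rule CE_add [OF FG(1,3)])
    show "Nov_diff scale nprod n (x + y) = Nov_diff scale nprod n x + Nov_diff scale nprod n y"
      unfolding FG(2,4) CE_to_Nov_add [symmetric] Nov_diff_CE_to_Nov [OF s] Nov_diff_CE_to_Nov [OF FG(1)]
        Nov_diff_CE_to_Nov [OF FG(3)] CE_diff_add [OF FG(1,3) s n] ..
  next
    fix c x assume "x \<in> CE_to_Nov n ` CE scale n"
    then obtain F where F: "F \<in> CE scale n" "x = CE_to_Nov n F" by blast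
    have s: "scale2 c F \<in> CE scale n" by (rule CE_scale [OF F(1)])
    show "Nov_diff scale nprod n (scale2 c x) = scale2 c (Nov_diff scale nprod n x)"
      unfolding F(2) CE_to_Nov_scale [symmetric] Nov_diff_CE_to_Nov [OF s] Nov_diff_CE_to_Nov [OF F(1)]
        CE_diff_scale [OF F(1) s n] ..
  qed
  fix x assume "x \<in> cspace CNov n"
  then obtain F where F: "F \<in> CE scale n" "x = CE_to_Nov n F" unfolding sp by blast
  have "Nov_diff scale nprod (Suc n) (Nov_diff scale nprod n x) =
      CE_to_Nov (Suc n + 1) (CE_diff scale nprod (n + 1) (CE_diff scale nprod n F))"
    unfolding F(2) Nov_diff_CE_to_Nov [OF F(1)]
    using Nov_diff_CE_to_Nov [OF CE_diff_CE [OF F(1) n]] by simp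
  then show "cdiff CNov (Suc n) (cdiff CNov n x) = 0"
    using CE_diff_CE_diff [OF F(1) n] z by (simp add: d)
qed

lemma pLie_type_K: "n \<ge> 1 \<Longrightarrow> pLie_type n \<in> K_types n"
  using exps_type_K_types [of "pLie_exps n" n] pLie_exps_dec [of n] exps_type_pLie [of n] by (simp add: dec_exps_def)

text \<open>Blocks of length 0 or 1 impose no condition, so both descriptions say that the first
  \<open>n - 1\<close> arguments alternate. For \<open>n = 1\<close> the types \<open>[1]\<close>
  and \<open>[0, 1]\<close> differ by an empty block.\<close>

lemma Hom_wedge_pLie: 
  assumes "n \<ge> 1" shows "Hom_wedge scale (pLie_type n) = Hom_wedge scale [n - 1, 1]"
proof -
  have blocks: "f \<in> Hom_wedge scale ks \<longleftrightarrow> f \<in> End_op scale n \<and> (\<forall>i j. i < j \<longrightarrow> j < n - 1 \<longrightarrow>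
      (\<forall>xs. length xs = n \<longrightarrow> xs ! i = xs ! j \<longrightarrow> f xs = 0))"
    if ks: "ks = replicate m 0 @ [n - 1, 1]" for f ks m
  proof -
    have s: "sum_list ks = n" using assms ks by (simp add: sum_list_replicate)
    have t: "sum_list (take b ks) = (if b \<le> m then 0 else if b = Suc m then n - 1 else n)" for b
    proof -
      consider "b \<le> m" | "b = Suc m" | "b \<ge> m + 2" by linarith
      then show ?thesis
        using assms by cases (auto simp: ks sum_list_replicate take_Cons' min_def)
    qed
    have "(\<exists>b<length ks. sum_list (take b ks) \<le> i \<and> j < sum_list (take (Suc b) ks)) \<longleftrightarrow> j < n - 1"
      if ij: "i < j" for i j
    proof
      assume "\<exists>b<length ks. sum_list (take b ks) \<le> i \<and> j < sum_list (take (Suc b) ks)"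
      then show "j < n - 1" using ij unfolding t by (auto split: if_splits)
    next
      assume "j < n - 1"
      then show "\<exists>b<length ks. sum_list (take b ks) \<le> i \<and> j < sum_list (take (Suc b) ks)"
        unfolding t by (intro exI [of _ m]) (simp add: ks)
    qed
    then show ?thesis unfolding Hom_wedge_def s by blast
  qed
  show ?thesis
  proof (cases "n = 1")
    case True
    have "f \<in> Hom_wedge scale [1] \<longleftrightarrow> f \<in> End_op scale 1" for f by (auto simp: Hom_wedge_def)
    then show ?thesis using True blocks [of "[0, 1]" 0] by (auto simp: pLie_type_def)
  next
    case False
    then show ?thesis using blocks [of "pLie_type n" "n - 2"] blocks [of "[n - 1, 1]" 0] assms
      by (auto simp: pLie_type_def)
  qed
qed

lemma Hom_wedge_0: "0 \<in> Hom_wedge scale ks"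
  by (simp add: Hom_wedge_def End_op_0)

lemma Hom_wedge_subspace: "module.subspace (fun_scale scale) (Hom_wedge scale ks)"
proof -
  interpret S: vector_space "fun_scale scale :: 'k \<Rightarrow> ('v list \<Rightarrow> 'v) \<Rightarrow> 'v list \<Rightarrow> 'v" by (rule vector_space_fun_scale)
  show ?thesis
    unfolding S.subspace_def
    by (auto simp: Hom_wedge_def End_op_0 intro!: End_op_add End_op_scale) (auto simp: fun_scale_def)
qed

lemma Nov_proj_surj:
  assumes n: "n \<ge> 1" and f: "f \<in> Hom_wedge scale [n - 1, 1]"
  shows "summand_incl (pLie_type n) f \<in> cspace CNov n" "Nov_proj n (summand_incl (pLie_type n) f) = f"
  using f Hom_wedge_pLie [OF n] pLie_type_K [OF n] Hom_wedge_0
  by (auto simp: Nov_complex_def Hom_sum_def summand_incl_def Nov_proj_def)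

lemma Nov_proj_diff:
  assumes n: "n \<ge> 1" and c: "c \<in> cspace CNov n"
  shows "Nov_proj (Suc n) (cdiff CNov n c) = cdiff CpLie n (Nov_proj n c)"
proof -
  obtain F where F: "F \<in> CE scale n" "CE_to_Nov n F = c"
      "Nov_diff scale nprod n c = CE_to_Nov (n + 1) (CE_diff scale nprod n F)"
    using Nov_lift [of c n] c by (auto simp: Nov_complex_def)
  have "Nov_proj n c = F (pLie_exps n)"
    using CE_to_Nov_type [OF pLie_exps_dec [OF n], of F] F(2) by (simp add: Nov_proj_def exps_type_pLie [OF n])
  moreover have "Nov_proj (Suc n) (cdiff CNov n c) = CE_diff scale nprod n F (pLie_exps (n + 1))"
    using CE_to_Nov_type [OF pLie_exps_dec [of "n + 1"], of "CE_diff scale nprod n F"] F(3)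
    by (simp add: Nov_complex_def Nov_proj_def exps_type_pLie)
  ultimately show ?thesis using pLie_component [OF F(1) n] by (simp add: pLie_complex_def)
qed

text \<open>In each degree the bar complex is the kernel of the projection, so the kernel lemma
  applies; it also supplies that the pre-Lie cochains form a complex.\<close>

theorem ses: "short_exact_sequence scale2 Cbar Nov_incl scale2 CNov Nov_proj (fun_scale scale) CpLie"
proof (rule short_exact_sequence_kernel [OF vector_space_scale2 vector_space_fun_scale Nov_complex])
  show "module.subspace (fun_scale scale) (cspace CpLie n)" for n
    by (simp add: pLie_complex_def Hom_wedge_subspace)
  have into: "Nov_proj n c \<in> cspace CpLie n" if "n \<ge> 1" "c \<in> cspace CNov n" for n c
    using that pLie_type_K [of n] Hom_wedge_pLie [of n]
    by (auto simp: Nov_proj_def Nov_complex_def pLie_complex_def Hom_sum_def)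
  show "cochain_map scale2 CNov (fun_scale scale) CpLie Nov_proj"
    unfolding cochain_map_def linear_between_def
    using into Nov_proj_diff by (auto simp: Nov_proj_def fun_scale_def)
  show "Nov_proj n ` cspace CNov n = cspace CpLie n" if n: "n \<ge> 1" for n
  proof
    show "cspace CpLie n \<subseteq> Nov_proj n ` cspace CNov n"
    proof
      fix f assume "f \<in> cspace CpLie n"
      then have "f \<in> Hom_wedge scale [n - 1, 1]" by (simp add: pLie_complex_def)
      then show "f \<in> Nov_proj n ` cspace CNov n"
        using Nov_proj_surj [OF n] by (metis image_eqI)
    qed
  qed (use into n in auto)
  show "cspace Cbar n = {y \<in> cspace CNov n. Nov_proj n y = 0}" if n: "n \<ge> 1" for n
    using pLie_type_K [OF n] Hom_wedge_0
    by (auto simp: Nov_bar_complex_def Nov_complex_def Hom_sum_def Nov_proj_def)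
  show "cdiff Cbar = cdiff CNov" by (simp add: Nov_bar_complex_def Nov_complex_def)
  show "Nov_incl n x = x" for n and x :: "nat list \<Rightarrow> 'v list \<Rightarrow> 'v" by (simp add: Nov_incl_def)
qed

text \<open>For \<open>n \<ge> 2\<close> the lift by zeros has a differential with at most two
  components, by \<open>CE_diff_support\<close>. The one in the pre-Lie summand is the differential
  of the cocycle \<open>f\<close> and vanishes.\<close>

lemma Nov_diff_summand:
  assumes n: "n \<ge> 1" and f: "f \<in> cocycles CpLie n"
  defines "y \<equiv> summand_incl (pLie_type n) f"
  shows "Nov_diff scale nprod n y = (if n = 1 then 0 else
    summand_incl (conn_type n) (Nov_diff_component scale nprod n (pLie_type n) (conn_type n) f))"
proof -
  have "f \<in> Hom_wedge scale [n - 1, 1]" using f by (simp add: cocycles_def pLie_complex_def)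
  then have y: "y \<in> cspace CNov n" and py: "Nov_proj n y = f"
    unfolding y_def by (rule Nov_proj_surj [OF n])+
  obtain F where F: "F \<in> CE scale n" "CE_to_Nov n F = y"
      "Nov_diff scale nprod n y = CE_to_Nov (n + 1) (CE_diff scale nprod n F)"
    using Nov_lift [of y n] y by (auto simp: Nov_complex_def)
  have d0: "Nov_diff scale nprod n y (pLie_type (n + 1)) = 0"
    using Nov_proj_diff [OF n y] py f by (simp add: cocycles_def Nov_proj_def Nov_complex_def)
  \<comment> \<open>An alternating family that vanishes on the decreasing representative of an orbit
    vanishes on the whole orbit.\<close>
  have supp: "mset s = mset (pLie_exps n)" if s: "F s \<noteq> 0" for s
  proof -
    have P: "s \<in> P_exps n" using F(1) s by (auto simp: CE_def Had_op_def)
    obtain q \<sigma> where q: "q \<in> dec_exps n" "\<sigma> permutes {1..n}" "perm_list n \<sigma> q = s" using ex_dec_perm [OF P] .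
    have l: "length q = n" "length s = n" using q P by (auto simp: dec_exps_def P_exps_def)
    have "perm_list n (inv \<sigma>) s = q" using perm_list_inv(2) [OF q(2) l(1)] q(3) by simp
    then have "End_act n \<sigma> (F q) = fun_scale scale (of_int (sign \<sigma>)) (F s)" using CE_act [OF F(1) q(2) l(2)] by simp
    moreover have "fun_scale scale (of_int (sign \<sigma>)) (F s) \<noteq> 0"
      using s by (auto simp: fun_scale_def fun_eq_iff)
    moreover have "End_act n \<sigma> 0 = (0 :: 'v list \<Rightarrow> 'v)" by (simp add: End_act_def fun_eq_iff)
    ultimately have "F q \<noteq> 0" by auto
    then have "y (exps_type n q) \<noteq> 0" using CE_to_Nov_type [OF q(1), of F] F(2) by simp
    then have "exps_type n q = pLie_type n" by (auto simp: y_def summand_incl_def split: if_splits)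
    then have "q = pLie_exps n"
      using exps_type_inj [of n] q(1) pLie_exps_dec [OF n] exps_type_pLie [OF n] by (auto simp: inj_on_def)
    then show ?thesis using mset_perm_list [OF q(2) l(1)] q(3) by simp
  qed
  have zero: "Nov_diff scale nprod n y k = 0" if k: "n = 1 \<or> k \<noteq> conn_type n" for k
  proof (cases "k \<in> K_types (n + 1)")
    case False
    then show ?thesis using CE_to_Nov_outside by (simp only: F(3))
  next
    case True
    then obtain r where r: "r \<in> dec_exps (n + 1)" "k = exps_type (n + 1) r" by (rule K_types_cases)
    have dr: "Nov_diff scale nprod n y k = CE_diff scale nprod n F r"
      unfolding F(3) r(2) by (rule CE_to_Nov_type [OF r(1)])
    show ?thesis
    proof (cases "n = 1")
      case 1: True
      \<comment> \<open>In degree 2 the only decreasing list is \<open>[1, 0]\<close>, which belongs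
        to the pre-Lie summand; hence the differential of the lift is 0.\<close>
      have n2: "n + 1 = 2" using 1 by simp
      have "r \<in> {[1, 0], [0, 1]}" and s: "sorted_wrt (\<ge>) r"
        using r(1) unfolding n2 dec_exps_def P_exps_2 by blast+
      then have "r = [1, 0]" by auto
      then have "r = pLie_exps (n + 1)" unfolding n2 by (simp add: pLie_exps_def)
      then have "k = pLie_type (n + 1)" using r(2) exps_type_pLie [of "n + 1"] by simp
      then show ?thesis using d0 by simp
    next
      case False
      then have n2: "n \<ge> 2" using n by simp
      show ?thesis
      proof (rule ccontr)
        assume nz: "Nov_diff scale nprod n y k \<noteq> 0"
        have "r \<in> P_exps (n + 1)" using r(1) by (simp add: dec_exps_def)
        then have "mset r = mset (pLie_exps (n + 1)) \<or> mset r = mset (conn_exps n)"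
          using CE_diff_support [OF F(1) n2 supp] nz dr by auto
        then have "r = pLie_exps (n + 1) \<or> r = conn_exps n"
          using dec_exps_mset_eq [OF r(1)] pLie_exps_dec [of "n + 1"] conn_exps_dec [OF n2] by auto
        then have "k = pLie_type (n + 1) \<or> k = conn_type n"
          using r(2) exps_type_pLie [of "n + 1"] exps_type_conn [OF n2] by auto
        then show False using nz d0 k False by auto
      qed
    qed
  qed
  show ?thesis
  proof (cases "n = 1")
    case True
    then show ?thesis using zero by (simp add: fun_eq_iff)
  next
    case False
    then show ?thesis
      using zero by (auto simp: fun_eq_iff summand_incl_def Nov_diff_component_def y_def)
  qed
qed

sublocale ses: cochain_ses scale2 scale2 "fun_scale scale" Cbar Nov_incl CNov Nov_proj CpLie
  using ses vector_space_scale2 vector_space_fun_scale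
  by (simp add: cochain_ses_def cochain_ses_axioms_def)

text \<open>Extension by zeros is one admissible lift in the snake lemma, and any lift computes the
  class.\<close>

lemma connecting_map_eq_class:
  assumes n: "n \<ge> 1" and f: "f \<in> cocycles CpLie n"
  shows "connecting_map Cbar Nov_incl CNov Nov_proj n (cohomology_class CpLie n f) =
    cohomology_class Cbar (Suc n) (Nov_diff scale nprod n (summand_incl (pLie_type n) f))"
proof -
  let ?y = "summand_incl (pLie_type n) f"
  have fH: "f \<in> Hom_wedge scale [n - 1, 1]" using f by (simp add: cocycles_def pLie_complex_def)
  note y = Nov_proj_surj [OF n fH]
  have dy: "cdiff CNov n ?y = Nov_diff scale nprod n ?y" by (simp add: Nov_complex_def)
  have "Nov_proj (Suc n) (cdiff CNov n ?y) = 0"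
    using Nov_proj_diff [OF n y(1)] y(2) f by (simp add: cocycles_def)
  moreover have "cdiff CNov n ?y \<in> cspace CNov (Suc n)" by (rule ses.diff_in(2) [OF n y(1)])
  ultimately have "cdiff CNov n ?y \<in> cspace Cbar (Suc n)"
    using ses.i_image [of "Suc n"] by (auto simp: Nov_incl_def)
  then show ?thesis
    unfolding cohomology_class_def dy [symmetric]
    by (intro ses.connecting_map_eq [OF n y f]) (simp_all add: Nov_incl_def)
qed

end

theorem theorem3p17:
  fixes scale :: "'k::field_char_0 \<Rightarrow> 'v::ab_group_add \<Rightarrow> 'v"
    and nprod :: "'v \<Rightarrow> 'v \<Rightarrow> 'v"
  assumes "novikov_algebra scale nprod"
  defines "sN \<equiv> fun_scale (fun_scale scale)"
    and "sL \<equiv> fun_scale scale"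
    and "Cbar \<equiv> Nov_bar_complex scale nprod"
    and "CNov \<equiv> Nov_complex scale nprod"
    and "CpLie \<equiv> pLie_complex scale nprod"
    and "\<delta> \<equiv> connecting_map (Nov_bar_complex scale nprod) Nov_incl (Nov_complex scale nprod) Nov_proj"
  shows
    "short_exact_sequence sN Cbar Nov_incl sN CNov Nov_proj sL CpLie \<and>
     induces_quotient_iso Cbar Nov_incl sN CNov Nov_proj sL CpLie \<and>
     long_exact_sequence sN Cbar Nov_incl sN CNov Nov_proj sL CpLie \<delta> \<and>
     (\<forall>f\<in>cocycles CpLie 1.
        \<delta> 1 (cohomology_class CpLie 1 f) = cohomology_class Cbar 2 0) \<and>
     (\<forall>n\<ge>2. \<forall>f\<in>cocycles CpLie n.
        \<delta> n (cohomology_class CpLie n f) =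
        cohomology_class Cbar (n + 1)
          (summand_incl (conn_type n)
            (Nov_diff_component scale nprod n (pLie_type n) (conn_type n) f)))"
proof -
  interpret novikov_algebra scale nprod by fact
  have "\<delta> 1 (cohomology_class CpLie 1 f) = cohomology_class Cbar 2 0" if f: "f \<in> cocycles CpLie 1" for f
    using connecting_map_eq_class [OF order.refl f [unfolded CpLie_def]]
      Nov_diff_summand [OF order.refl f [unfolded CpLie_def]]
    by (simp add: \<delta>_def Cbar_def CpLie_def numeral_2_eq_2)
  moreover have "\<delta> n (cohomology_class CpLie n f) =
      cohomology_class Cbar (n + 1) (summand_incl (conn_type n)
        (Nov_diff_component scale nprod n (pLie_type n) (conn_type n) f))"
    if n: "n \<ge> 2" and f: "f \<in> cocycles CpLie n" for n f
  proof -
    have n1: "n \<ge> 1" using n by simp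
    show ?thesis
      using connecting_map_eq_class [OF n1 f [unfolded CpLie_def]] Nov_diff_summand [OF n1 f [unfolded CpLie_def]] n
      by (simp add: \<delta>_def Cbar_def CpLie_def)
  qed
  ultimately show ?thesis
    unfolding sN_def sL_def Cbar_def CNov_def CpLie_def \<delta>_def
    using ses ses.quotient_iso ses.long_exact by blast
qed

end
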